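(* Let $B$ be a unital algebra over $\mathbb{C}$. Given a free-free-Boolean independent family (with amalgamation over $B$) $\Gamma=\{(A_k^\ell,A_k^r,A_k^b)\}_{k\in K}$ of triples of $B$-faces in a $B$-$B$-non-commutative probability space $(\mathcal{A},E_{\mathcal{A}},\varepsilon)$, there exists a bi-free ffb $B$-system $\{(\tilde A_k^\ell,\tilde A_k^r,C_k',D_k')\}_{k\in K}$ inside a $B$-$B$-non-commutative probability space $(\mathcal{A}',E_{\mathcal{A}'},\varepsilon')$, and for each $k\in K$ there are injective $B$-linear maps $\alpha_{\ell,k}:A_k^\ell\to\tilde A_k^\ell$, $\alpha_{r,k}:A_k^r\to\tilde A_k^r$ and $\alpha_{b,k}:A_k^b\to\mathrm{alg}(C_k'D_k')$, such that whenever $n\in\mathbb{N}$, $\chi:\{1,\ldots,n\}\to\{\ell,r,b\}$, and $Z_i\in A_k^{\chi(i)}$ for all $1\le i\le n$, we have $$E_{\mathcal{A}'}(\alpha_{\chi(1),k}(Z_1)\cdots\alpha_{\chi(n),k}(Z_n))=E_{\mathcal{A}}(Z_1\cdots Z_n).$$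
   Context: $B$ is a unital algebra over $\mathbb{C}$. For subsets $X,Y$ of an algebra, $XY=\{xy: x\in X,y\in Y\}$, and $\mathrm{alg}(\cdot)$ denotes the (not necessarily unital) subalgebra generated by the indicated set or sets. **$B$-$B$-non-commutative probability space.** A triple $(\mathcal{A},E_{\mathcal{A}},\varepsilon)$ where $\mathcal{A}$ is a unital algebra, $\varepsilon:B\otimes B^{\mathrm{op}}\to\mathcal{A}$ is a unital homomorphism whose restrictions to $B\otimes 1_B$ and $1_B\otimes B$ are injective, and $E_{\mathcal{A}}:\mathcal{A}\to B$ is linear with $E_{\mathcal{A}}(\varepsilon(b_1\otimes b_2)T)=b_1E_{\mathcal{A}}(T)b_2$ and $E_{\mathcal{A}}(T\varepsilon(b\otimes 1_B))=E_{\mathcal{A}}(T\varepsilon(1_B\otimes b))$ for all $b,b_1,b_2\in B$, $T\in\mathcal{A}$. Write $L_b=\varepsilon(b\otimes 1_B)$, $R_b=\varepsilon(1_B\otimes b)$, $\mathcal{A}_\ell=\{T: TR_b=R_bT\ \forall b\in B\}$, $\mathcal{A}_r=\{T: TL_b=L_bT\ \forall b\in B\}$. "$B$-linear" for maps between subalgebras of such spaces refers to multiplication by the copies of $B$ in the two spaces: by the elements $L_b$ for the maps $\alpha_{\ell,k},\alpha_{b,k}$ and by the elements $R_b$ for $\alpha_{r,k}$. **Bimodules.** A $B$-$B$-bimodule with a specified $B$-projection is a triple $(\mathcal{X},\mathring{\mathcal{X}},p)$ with $\mathcal{X}=B\oplus\mathring{\mathcal{X}}$ a direct sum of $B$-$B$-bimodules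 and $p:\mathcal{X}\to B$, $p(b\oplus\eta)=b$. $\mathcal{L}(\mathcal{X})$ is the algebra of $\mathbb{C}$-linear maps on $\mathcal{X}$, $E_{\mathcal{L}(\mathcal{X})}(a)=p(a(1_B\oplus 0))$; $\mathcal{L}_\ell(\mathcal{X})$ (resp. $\mathcal{L}_r(\mathcal{X})$) is the set of operators commuting with right (resp. left) multiplication by all $b\in B$. **Reduced free product.** For a family $\{(\mathcal{X}_k,\mathring{\mathcal{X}}_k,p_k)\}_{k\in K}$ it is $(\mathcal{X},\mathring{\mathcal{X}},p)$ with $\mathring{\mathcal{X}}=\bigoplus_{n\ge1}\bigoplus_{k_1\ne k_2\ne\cdots\ne k_n}\mathring{\mathcal{X}}_{k_1}\otimes_B\cdots\otimes_B\mathring{\mathcal{X}}_{k_n}$ (consecutive indices distinct). Let $\mathcal{X}_\ell(k)$ (resp. $\mathcal{X}_r(k)$) be $B$ plus the sum of those summands with $k_1\neq k$ (resp. $k_n\ne k$), with natural bimodule isomorphisms $V_k:\mathcal{X}\to\mathcal{X}_k\otimes_B\mathcal{X}_\ell(k)$, $W_k:\mathcal{X}\to\mathcal{X}_r(k)\otimes_B\mathcal{X}_k$. The left and right regular representations are $\lambda_k(a)=V_k^{-1}(a\otimes\mathrm{Id})V_k$ (for $a\in\mathcal{L}_\ell(\mathcal{X}_k)$) and $\rho_k(a)=W_k^{-1}(\mathrm{Id}\otimes a)W_k$ (for $a\in\mathcal{L}_r(\mathcal{X}_k)$). The $k$-th Boolean projection $P_k:\mathcal{X}\to\mathcal{X}$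 is the natural projection onto $B\oplus\mathring{\mathcal{X}}_k$. **Bi-freeness.** A pair of $B$-faces of $\mathcal{A}$ is a pair $(C,D)$ of unital subalgebras with $\varepsilon(B\otimes1_B)\subseteq C\subseteq\mathcal{A}_\ell$ and $\varepsilon(1_B\otimes B)\subseteq D\subseteq\mathcal{A}_r$. A family $\{(C_k,D_k)\}_{k\in K}$ of such pairs is bi-free over $B$ if there exist $(\mathcal{X}_k,\mathring{\mathcal{X}}_k,p_k)$ and unital homomorphisms $\ell_k:C_k\to\mathcal{L}_\ell(\mathcal{X}_k)$, $r_k:D_k\to\mathcal{L}_r(\mathcal{X}_k)$ such that expectations under $E_{\mathcal{A}}$ of all words in the $C_k,D_k$ equal the expectations under $E_{\mathcal{L}(\mathcal{X})}$ of the words obtained by applying $\lambda_k\circ\ell_k$ to elements of $C_k$ and $\rho_k\circ r_k$ to elements of $D_k$. **Triples and free-free-Boolean independence.** A triple of $B$-faces is a triple $(A^\ell,A^r,A^b)$ of subalgebras of $\mathcal{A}$, $A^\ell$ and $A^r$ unital, with $\varepsilon(B\otimes1_B)\subseteq A^\ell\subseteq\mathcal{A}_\ell$, $\varepsilon(1_B\otimes B)\subseteq A^r\subseteq\mathcal{A}_r$, $\varepsilon(B\otimes1_B)A^b\varepsilon(B\otimes1_B)\subseteq A^b\subseteq\mathcal{A}_\ell$. A family $\{(A^\ell_k,A^r_k,A^b_k)\}_{k\in K}$ of such triples is free-free-Boolean independent with amalgamation over $B$ if there exist $(\mathcal{X}_k,\mathring{\mathcal{X}}_k,p_k)$, unital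 homomorphisms $\ell_k:A^\ell_k\to\mathcal{L}_\ell(\mathcal{X}_k)$, $r_k:A^r_k\to\mathcal{L}_r(\mathcal{X}_k)$ and (not necessarily unital) homomorphisms $m_k:A^b_k\to\mathcal{L}_\ell(\mathcal{X}_k)$ such that for every word $Z_1\cdots Z_n$ in elements of the algebras of the family, $E_{\mathcal{A}}(Z_1\cdots Z_n)$ equals $E_{\mathcal{L}(\mathcal{X})}$ (on the reduced free product $\mathcal{X}$) of the word obtained by replacing each $Z\in A^\ell_k$, $A^r_k$, $A^b_k$ by $\lambda_k(\ell_k(Z))$, $\rho_k(r_k(Z))$, $P_k\lambda_k(m_k(Z))P_k$ respectively. **Bi-free ffb $B$-system.** Let $\{(A_k^\ell,A_k^r,C_k,D_k)\}_{k\in K}$ be quadruples of subalgebras of $\mathcal{A}$ such that each $(A_k^\ell,A_k^r)$ is a pair of $B$-faces and $\{(\mathrm{alg}(A_k^\ell,C_k),\mathrm{alg}(A_k^r,D_k))\}_{k\in K}$ is a bi-free family of pairs of $B$-faces over $B$. Let $C_k'\subseteq C_k$ and $D_k'\subseteq D_k\cap\mathcal{A}_\ell$ be subsets with $L_bC_k'\subseteq C_k'$ and $C_k'L_b\subseteq C_k'$ for all $b\in B$. With $\mathbb{A}_k=\mathrm{alg}(A_k^\ell,A_k^r)$, the family $\{(A_k^\ell,A_k^r,C_k',D_k')\}_{k\in K}$ is a bi-free ffb $B$-system if for all $n\ge0$, $k\in K$: (1) $C_k'\mathbb{A}_kC_k'=\{0\}=D_k'\mathbb{A}_kD_k'$;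 (2) $E_{\mathcal{A}}(\mathbb{A}_kC_k'\mathbb{A}_k(D_k'\mathbb{A}_kC_k')^n\mathbb{A}_k)=0$; (3) $E_{\mathcal{A}}(\mathbb{A}_kD_k'\mathbb{A}_k(C_k'\mathbb{A}_kD_k')^n\mathbb{A}_k)=0$ (each occurrence of a set in a product contributing an independently chosen element). *)

theory Defs
  imports Complex_Main "HOL-Algebra.Module" "HOL-Algebra.Coset" "HOL-Library.Poly_Mapping"
begin

section \<open>Complex algebras\<close>

definition complex_ring :: "complex ring" where
  "complex_ring = \<lparr>carrier = UNIV, mult = (*), one = 1, zero = 0, add = (+)\<rparr>"

text \<open>The locale \<^locale>\<open>algebra\<close> of the library is about commutative algebras only. The zero
  algebra is not excluded.\<close>

locale complex_algebra = ring A + module complex_ring A for A (structure) +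
  assumes smult_mult_left:
    "\<lbrakk>x \<in> carrier A; y \<in> carrier A\<rbrakk> \<Longrightarrow> c \<odot> (x \<otimes> y) = (c \<odot> x) \<otimes> y"
    and smult_mult_right:
    "\<lbrakk>x \<in> carrier A; y \<in> carrier A\<rbrakk> \<Longrightarrow> c \<odot> (x \<otimes> y) = x \<otimes> (c \<odot> y)"

definition linear_on ::
  "(complex, 'a, 'p) module_scheme \<Rightarrow> 'a set \<Rightarrow> (complex, 'c, 'q) module_scheme \<Rightarrow> ('a \<Rightarrow> 'c) \<Rightarrow> bool" where
  "linear_on M S N f \<longleftrightarrow>
     f \<in> S \<rightarrow> carrier N \<and>
     (\<forall>x\<in>S. \<forall>y\<in>S. f (x \<oplus>\<^bsub>M\<^esub> y) = f x \<oplus>\<^bsub>N\<^esub> f y) \<and>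
     (\<forall>c. \<forall>x\<in>S. f (c \<odot>\<^bsub>M\<^esub> x) = c \<odot>\<^bsub>N\<^esub> f x)"

definition alg_hom ::
  "(complex, 'a, 'p) module_scheme \<Rightarrow> (complex, 'c, 'q) module_scheme \<Rightarrow> ('a \<Rightarrow> 'c) \<Rightarrow> bool" where
  "alg_hom A C h \<longleftrightarrow>
     linear_on A (carrier A) C h \<and>
     (\<forall>x\<in>carrier A. \<forall>y\<in>carrier A. h (x \<otimes>\<^bsub>A\<^esub> y) = h x \<otimes>\<^bsub>C\<^esub> h y)"

definition unital_alg_hom ::
  "(complex, 'a, 'p) module_scheme \<Rightarrow> (complex, 'c, 'q) module_scheme \<Rightarrow> ('a \<Rightarrow> 'c) \<Rightarrow> bool" where
  "unital_alg_hom A C h \<longleftrightarrow> alg_hom A C h \<and> h \<one>\<^bsub>A\<^esub> = \<one>\<^bsub>C\<^esub>"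

definition subalg :: "(complex, 'a, 'p) module_scheme \<Rightarrow> 'a set \<Rightarrow> bool" where
  "subalg A S \<longleftrightarrow>
     S \<subseteq> carrier A \<and> \<zero>\<^bsub>A\<^esub> \<in> S \<and>
     (\<forall>x\<in>S. \<forall>y\<in>S. x \<oplus>\<^bsub>A\<^esub> y \<in> S \<and> x \<otimes>\<^bsub>A\<^esub> y \<in> S) \<and>
     (\<forall>c. \<forall>x\<in>S. c \<odot>\<^bsub>A\<^esub> x \<in> S)"

definition unital_subalg :: "(complex, 'a, 'p) module_scheme \<Rightarrow> 'a set \<Rightarrow> bool" where
  "unital_subalg A S \<longleftrightarrow> subalg A S \<and> \<one>\<^bsub>A\<^esub> \<in> S"

definition alg_gen :: "(complex, 'a, 'p) module_scheme \<Rightarrow> 'a set \<Rightarrow> 'a set" where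
  "alg_gen A S = \<Inter>{D. subalg A D \<and> S \<subseteq> D}"

definition word_prod :: "('a, 'p) monoid_scheme \<Rightarrow> 'a list \<Rightarrow> 'a" where
  "word_prod A xs = foldr (mult A) xs \<one>\<^bsub>A\<^esub>"

primrec set_pow :: "('a, 'p) monoid_scheme \<Rightarrow> 'a set \<Rightarrow> nat \<Rightarrow> 'a set" where
  "set_pow A S 0 = {\<one>\<^bsub>A\<^esub>}"
| "set_pow A S (Suc n) = S <#>\<^bsub>A\<^esub> set_pow A S n"

definition op_alg :: "(complex, 'a) module \<Rightarrow> (complex, 'a) module" where
  "op_alg A = A\<lparr>mult := (\<lambda>x y. y \<otimes>\<^bsub>A\<^esub> x)\<rparr>"


section \<open>Vector spaces given by generators and relations\<close>

text \<open>All tensor products below are quotients of a free complex vector space on a set \<open>W\<close> of words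
  (finitely supported functions whose support lies in \<open>W\<close>) by the span of a set \<open>R\<close> of relations.
  Elements of such a quotient are cosets; a map on a quotient is the union, resp. the common value,
  of its values over all representatives.\<close>

definition fscale :: "complex \<Rightarrow> ('w \<Rightarrow>\<^sub>0 complex) \<Rightarrow> ('w \<Rightarrow>\<^sub>0 complex)" where
  "fscale c = Poly_Mapping.map ((*) c)"

definition qclass :: "('w \<Rightarrow>\<^sub>0 complex) set \<Rightarrow> ('w \<Rightarrow>\<^sub>0 complex) \<Rightarrow> ('w \<Rightarrow>\<^sub>0 complex) set" where
  "qclass R f = {g. g - f \<in> Modules.module.span fscale R}"

definition gen_class :: "('w \<Rightarrow>\<^sub>0 complex) set \<Rightarrow> 'w \<Rightarrow> ('w \<Rightarrow>\<^sub>0 complex) set" where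
  "gen_class R w = qclass R (Poly_Mapping.single w 1)"

definition push :: "('w \<Rightarrow> 'v) \<Rightarrow> ('w \<Rightarrow>\<^sub>0 complex) \<Rightarrow> ('v \<Rightarrow>\<^sub>0 complex)" where
  "push \<phi> f = (\<Sum>w\<in>Poly_Mapping.keys f. Poly_Mapping.single (\<phi> w) (Poly_Mapping.lookup f w))"

text \<open>The map of quotients induced by a map of words; \<open>R\<close> are the relations of the target.\<close>

definition qmap ::
  "('v \<Rightarrow>\<^sub>0 complex) set \<Rightarrow> ('w \<Rightarrow> 'v) \<Rightarrow> ('w \<Rightarrow>\<^sub>0 complex) set \<Rightarrow> ('v \<Rightarrow>\<^sub>0 complex) set" where
  "qmap R \<phi> F = (\<Union>f\<in>F. qclass R (push \<phi> f))"

text \<open>The linear map from a quotient to a module \<open>M\<close> with prescribed values on words.\<close>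

definition qlift ::
  "(complex, 'm, 'p) module_scheme \<Rightarrow> ('w \<Rightarrow> 'm) \<Rightarrow> ('w \<Rightarrow>\<^sub>0 complex) set \<Rightarrow> 'm" where
  "qlift M \<phi> F =
     the_elem ((\<lambda>f. finsum M (\<lambda>w. Poly_Mapping.lookup f w \<odot>\<^bsub>M\<^esub> \<phi> w) (Poly_Mapping.keys f)) ` F)"

text \<open>The fields \<open>mult\<close> and \<open>one\<close> of the library's module records play no role for vector spaces.\<close>

definition presented ::
  "'w set \<Rightarrow> ('w \<Rightarrow>\<^sub>0 complex) set \<Rightarrow> (complex, ('w \<Rightarrow>\<^sub>0 complex) set) module" where
  "presented W R =
     \<lparr>carrier = qclass R ` {f. Poly_Mapping.keys f \<subseteq> W}, mult = undefined, one = undefined,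
      zero = qclass R 0,
      add = (\<lambda>F G. \<Union>f\<in>F. \<Union>g\<in>G. qclass R (f + g)),
      smult = (\<lambda>c F. \<Union>f\<in>F. qclass R (fscale c f))\<rparr>"

definition bilinear_rels ::
  "(complex, 'm, 'p) module_scheme \<Rightarrow> (complex, 'n, 'q) module_scheme \<Rightarrow> ('m \<times> 'n \<Rightarrow>\<^sub>0 complex) set" where
  "bilinear_rels M N =
     {Poly_Mapping.single (x \<oplus>\<^bsub>M\<^esub> x', y) 1 - Poly_Mapping.single (x, y) 1 - Poly_Mapping.single (x', y) 1
       | x x' y. x \<in> carrier M \<and> x' \<in> carrier M \<and> y \<in> carrier N} \<union>
     {Poly_Mapping.single (x, y \<oplus>\<^bsub>N\<^esub> y') 1 - Poly_Mapping.single (x, y) 1 - Poly_Mapping.single (x, y') 1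
       | x y y'. x \<in> carrier M \<and> y \<in> carrier N \<and> y' \<in> carrier N} \<union>
     {Poly_Mapping.single (c \<odot>\<^bsub>M\<^esub> x, y) 1 - Poly_Mapping.single (x, y) c
       | c x y. x \<in> carrier M \<and> y \<in> carrier N} \<union>
     {Poly_Mapping.single (x, c \<odot>\<^bsub>N\<^esub> y) 1 - Poly_Mapping.single (x, y) c
       | c x y. x \<in> carrier M \<and> y \<in> carrier N}"

text \<open>The tensor product over the complex numbers of two algebras.\<close>

definition alg_tensor ::
  "(complex, 'a) module \<Rightarrow> (complex, 'c) module \<Rightarrow> (complex, ('a \<times> 'c \<Rightarrow>\<^sub>0 complex) set) module" where
  "alg_tensor A C =
     (let R = bilinear_rels A C in
      (presented (carrier A \<times> carrier C) R)
        \<lparr>mult := (\<lambda>F G. \<Union>f\<in>F. \<Union>g\<in>G. qclass R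
           (\<Sum>u\<in>Poly_Mapping.keys f. \<Sum>v\<in>Poly_Mapping.keys g.
              Poly_Mapping.single (fst u \<otimes>\<^bsub>A\<^esub> fst v, snd u \<otimes>\<^bsub>C\<^esub> snd v)
                (Poly_Mapping.lookup f u * Poly_Mapping.lookup g v))),
         one := gen_class R (\<one>\<^bsub>A\<^esub>, \<one>\<^bsub>C\<^esub>)\<rparr>)"


section \<open>B-B-non-commutative probability spaces\<close>

definition btens :: "(complex, 'b) module \<Rightarrow> 'b \<Rightarrow> 'b \<Rightarrow> ('b \<times> 'b \<Rightarrow>\<^sub>0 complex) set" where
  "btens B b c = gen_class (bilinear_rels B (op_alg B)) (b, c)"

definition Lop ::
  "(complex, 'b) module \<Rightarrow> (('b \<times> 'b \<Rightarrow>\<^sub>0 complex) set \<Rightarrow> 'a) \<Rightarrow> 'b \<Rightarrow> 'a" where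
  "Lop B \<epsilon> b = \<epsilon> (btens B b \<one>\<^bsub>B\<^esub>)"

definition Rop ::
  "(complex, 'b) module \<Rightarrow> (('b \<times> 'b \<Rightarrow>\<^sub>0 complex) set \<Rightarrow> 'a) \<Rightarrow> 'b \<Rightarrow> 'a" where
  "Rop B \<epsilon> b = \<epsilon> (btens B \<one>\<^bsub>B\<^esub> b)"

definition bb_ncps ::
  "(complex, 'b) module \<Rightarrow> (complex, 'a) module \<Rightarrow> ('a \<Rightarrow> 'b) \<Rightarrow>
   (('b \<times> 'b \<Rightarrow>\<^sub>0 complex) set \<Rightarrow> 'a) \<Rightarrow> bool" where
  "bb_ncps B A E \<epsilon> \<longleftrightarrow>
     complex_algebra B \<and> complex_algebra A \<and>
     unital_alg_hom (alg_tensor B (op_alg B)) A \<epsilon> \<and>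
     inj_on \<epsilon> ((\<lambda>b. btens B b \<one>\<^bsub>B\<^esub>) ` carrier B) \<and>
     inj_on \<epsilon> ((\<lambda>b. btens B \<one>\<^bsub>B\<^esub> b) ` carrier B) \<and>
     linear_on A (carrier A) B E \<and>
     (\<forall>b\<^sub>1\<in>carrier B. \<forall>b\<^sub>2\<in>carrier B. \<forall>T\<in>carrier A.
        E (\<epsilon> (btens B b\<^sub>1 b\<^sub>2) \<otimes>\<^bsub>A\<^esub> T) = b\<^sub>1 \<otimes>\<^bsub>B\<^esub> E T \<otimes>\<^bsub>B\<^esub> b\<^sub>2) \<and>
     (\<forall>b\<in>carrier B. \<forall>T\<in>carrier A. E (T \<otimes>\<^bsub>A\<^esub> Lop B \<epsilon> b) = E (T \<otimes>\<^bsub>A\<^esub> Rop B \<epsilon> b))"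

definition left_alg ::
  "(complex, 'b) module \<Rightarrow> (complex, 'a) module \<Rightarrow> (('b \<times> 'b \<Rightarrow>\<^sub>0 complex) set \<Rightarrow> 'a) \<Rightarrow> 'a set" where
  "left_alg B A \<epsilon> =
     {T \<in> carrier A. \<forall>b\<in>carrier B. T \<otimes>\<^bsub>A\<^esub> Rop B \<epsilon> b = Rop B \<epsilon> b \<otimes>\<^bsub>A\<^esub> T}"

definition right_alg ::
  "(complex, 'b) module \<Rightarrow> (complex, 'a) module \<Rightarrow> (('b \<times> 'b \<Rightarrow>\<^sub>0 complex) set \<Rightarrow> 'a) \<Rightarrow> 'a set" where
  "right_alg B A \<epsilon> =
     {T \<in> carrier A. \<forall>b\<in>carrier B. T \<otimes>\<^bsub>A\<^esub> Lop B \<epsilon> b = Lop B \<epsilon> b \<otimes>\<^bsub>A\<^esub> T}"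

definition pair_of_faces ::
  "(complex, 'b) module \<Rightarrow> (complex, 'a) module \<Rightarrow> (('b \<times> 'b \<Rightarrow>\<^sub>0 complex) set \<Rightarrow> 'a) \<Rightarrow>
   'a set \<Rightarrow> 'a set \<Rightarrow> bool" where
  "pair_of_faces B A \<epsilon> C D \<longleftrightarrow>
     unital_subalg A C \<and> unital_subalg A D \<and>
     Lop B \<epsilon> ` carrier B \<subseteq> C \<and> C \<subseteq> left_alg B A \<epsilon> \<and>
     Rop B \<epsilon> ` carrier B \<subseteq> D \<and> D \<subseteq> right_alg B A \<epsilon>"

definition triple_of_faces ::
  "(complex, 'b) module \<Rightarrow> (complex, 'a) module \<Rightarrow> (('b \<times> 'b \<Rightarrow>\<^sub>0 complex) set \<Rightarrow> 'a) \<Rightarrow>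
   'a set \<Rightarrow> 'a set \<Rightarrow> 'a set \<Rightarrow> bool" where
  "triple_of_faces B A \<epsilon> Al Ar Ab \<longleftrightarrow>
     pair_of_faces B A \<epsilon> Al Ar \<and> subalg A Ab \<and> Ab \<subseteq> left_alg B A \<epsilon> \<and>
     (Lop B \<epsilon> ` carrier B) <#>\<^bsub>A\<^esub> Ab <#>\<^bsub>A\<^esub> (Lop B \<epsilon> ` carrier B) \<subseteq> Ab"


section \<open>Bimodules\<close>

record ('b, 'm) bimod = "(complex, 'm) module" +
  lact :: "'b \<Rightarrow> 'm \<Rightarrow> 'm"
  ract :: "'m \<Rightarrow> 'b \<Rightarrow> 'm"

definition bimodule :: "(complex, 'b) module \<Rightarrow> ('b, 'm) bimod \<Rightarrow> bool" where
  "bimodule B M \<longleftrightarrow>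
     module complex_ring M \<and>
     (\<forall>b\<in>carrier B. linear_on M (carrier M) M (lact M b)) \<and>
     (\<forall>b\<in>carrier B. linear_on M (carrier M) M (\<lambda>x. ract M x b)) \<and>
     (\<forall>x\<in>carrier M. linear_on B (carrier B) M (\<lambda>b. lact M b x)) \<and>
     (\<forall>x\<in>carrier M. linear_on B (carrier B) M (\<lambda>b. ract M x b)) \<and>
     (\<forall>x\<in>carrier M. lact M \<one>\<^bsub>B\<^esub> x = x \<and> ract M x \<one>\<^bsub>B\<^esub> = x) \<and>
     (\<forall>b\<in>carrier B. \<forall>c\<in>carrier B. \<forall>x\<in>carrier M.
        lact M (b \<otimes>\<^bsub>B\<^esub> c) x = lact M b (lact M c x) \<and>
        ract M x (b \<otimes>\<^bsub>B\<^esub> c) = ract M (ract M x b) c \<and>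
        ract M (lact M b x) c = lact M b (ract M x c))"

definition direct_sum :: "'i set \<Rightarrow> ('i \<Rightarrow> ('b, 'm) bimod) \<Rightarrow> ('b, 'i \<Rightarrow> 'm) bimod" where
  "direct_sum I M =
     \<lparr>carrier = {f. (\<forall>i\<in>I. f i \<in> carrier (M i)) \<and> (\<forall>i. i \<notin> I \<longrightarrow> f i = \<zero>\<^bsub>M i\<^esub>) \<and>
                    finite {i. f i \<noteq> \<zero>\<^bsub>M i\<^esub>}},
      mult = undefined, one = undefined,
      zero = (\<lambda>i. \<zero>\<^bsub>M i\<^esub>),
      add = (\<lambda>f g i. f i \<oplus>\<^bsub>M i\<^esub> g i),
      smult = (\<lambda>c f i. c \<odot>\<^bsub>M i\<^esub> f i),
      lact = (\<lambda>b f i. lact (M i) b (f i)),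
      ract = (\<lambda>f b i. ract (M i) (f i) b)\<rparr>"

text \<open>A bimodule with a specified \<open>B\<close>-projection is \<open>B \<oplus> X\<close> for a bimodule \<open>X\<close>, the projection \<open>p\<close>
  being \<^const>\<open>fst\<close>. So \<open>X\<close> alone is the datum, and \<open>with_proj B X\<close> is \<open>B \<oplus> X\<close>.\<close>

definition with_proj :: "(complex, 'b) module \<Rightarrow> ('b, 'm) bimod \<Rightarrow> ('b, 'b \<times> 'm) bimod" where
  "with_proj B X =
     \<lparr>carrier = carrier B \<times> carrier X, mult = undefined, one = undefined,
      zero = (\<zero>\<^bsub>B\<^esub>, \<zero>\<^bsub>X\<^esub>),
      add = (\<lambda>(b, x) (c, y). (b \<oplus>\<^bsub>B\<^esub> c, x \<oplus>\<^bsub>X\<^esub> y)),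
      smult = (\<lambda>a (b, x). (a \<odot>\<^bsub>B\<^esub> b, a \<odot>\<^bsub>X\<^esub> x)),
      lact = (\<lambda>c (b, x). (c \<otimes>\<^bsub>B\<^esub> b, lact X c x)),
      ract = (\<lambda>(b, x) c. (b \<otimes>\<^bsub>B\<^esub> c, ract X x c))\<rparr>"

text \<open>Operators on a bimodule are kept extensional, so that equality in the operator algebra is
  equality of functions.\<close>

definition lin_ops :: "('b, 'm) bimod \<Rightarrow> (complex, 'm \<Rightarrow> 'm) module" where
  "lin_ops M =
     \<lparr>carrier = {T \<in> extensional (carrier M). linear_on M (carrier M) M T},
      mult = compose (carrier M),
      one = (\<lambda>x\<in>carrier M. x),
      zero = (\<lambda>x\<in>carrier M. \<zero>\<^bsub>M\<^esub>),
      add = (\<lambda>S T. \<lambda>x\<in>carrier M. S x \<oplus>\<^bsub>M\<^esub> T x),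
      smult = (\<lambda>c T. \<lambda>x\<in>carrier M. c \<odot>\<^bsub>M\<^esub> T x)\<rparr>"

definition left_ops :: "(complex, 'b) module \<Rightarrow> ('b, 'm) bimod \<Rightarrow> (complex, 'm \<Rightarrow> 'm) module" where
  "left_ops B M = (lin_ops M)
     \<lparr>carrier := {T \<in> carrier (lin_ops M).
        \<forall>b\<in>carrier B. \<forall>x\<in>carrier M. T (ract M x b) = ract M (T x) b}\<rparr>"

definition right_ops :: "(complex, 'b) module \<Rightarrow> ('b, 'm) bimod \<Rightarrow> (complex, 'm \<Rightarrow> 'm) module" where
  "right_ops B M = (lin_ops M)
     \<lparr>carrier := {T \<in> carrier (lin_ops M).
        \<forall>b\<in>carrier B. \<forall>x\<in>carrier M. T (lact M b x) = lact M b (T x)}\<rparr>"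

definition op_exp ::
  "(complex, 'b) module \<Rightarrow> ('b, 'm) bimod \<Rightarrow> ('b \<times> 'm \<Rightarrow> 'b \<times> 'm) \<Rightarrow> 'b" where
  "op_exp B X T = fst (T (\<one>\<^bsub>B\<^esub>, \<zero>\<^bsub>X\<^esub>))"


section \<open>Tensor products over B\<close>

definition tensor_rels ::
  "(complex, 'b) module \<Rightarrow> ('b, 'm) bimod \<Rightarrow> ('b, 'n) bimod \<Rightarrow> ('m \<times> 'n \<Rightarrow>\<^sub>0 complex) set" where
  "tensor_rels B M N = bilinear_rels M N \<union>
     {Poly_Mapping.single (ract M x b, y) 1 - Poly_Mapping.single (x, lact N b y) 1
       | x b y. x \<in> carrier M \<and> b \<in> carrier B \<and> y \<in> carrier N}"

definition tensor ::
  "(complex, 'b) module \<Rightarrow> ('b, 'm) bimod \<Rightarrow> ('b, 'n) bimod \<Rightarrow>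
   ('b, ('m \<times> 'n \<Rightarrow>\<^sub>0 complex) set) bimod" where
  "tensor B M N =
     (let R = tensor_rels B M N in
      module.extend (presented (carrier M \<times> carrier N) R)
        (bimod.fields
          (\<lambda>b. qmap R (\<lambda>(x, y). (lact M b x, y)))
          (\<lambda>F b. qmap R (\<lambda>(x, y). (x, ract N y b)) F)))"

text \<open>The tensor product of a list of bimodules, for nonempty lists. Its words are the lists \<open>xs\<close> of
  elements with \<open>xs ! i\<close> in the \<open>i\<close>-th bimodule.\<close>

definition tlist_words :: "('b, 'm) bimod list \<Rightarrow> 'm list set" where
  "tlist_words Ms = {xs. list_all2 (\<lambda>M x. x \<in> carrier M) Ms xs}"

definition tlist_rels ::
  "(complex, 'b) module \<Rightarrow> ('b, 'm) bimod list \<Rightarrow> ('m list \<Rightarrow>\<^sub>0 complex) set" where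
  "tlist_rels B Ms =
     {Poly_Mapping.single (xs[i := x \<oplus>\<^bsub>Ms ! i\<^esub> y]) 1 - Poly_Mapping.single (xs[i := x]) 1
        - Poly_Mapping.single (xs[i := y]) 1
       | xs i x y. xs \<in> tlist_words Ms \<and> i < length Ms \<and>
           x \<in> carrier (Ms ! i) \<and> y \<in> carrier (Ms ! i)} \<union>
     {Poly_Mapping.single (xs[i := c \<odot>\<^bsub>Ms ! i\<^esub> x]) 1 - Poly_Mapping.single (xs[i := x]) c
       | xs i c x. xs \<in> tlist_words Ms \<and> i < length Ms \<and> x \<in> carrier (Ms ! i)} \<union>
     {Poly_Mapping.single (xs[i := ract (Ms ! i) x b, Suc i := y]) 1
        - Poly_Mapping.single (xs[i := x, Suc i := lact (Ms ! Suc i) b y]) 1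
       | xs i x y b. xs \<in> tlist_words Ms \<and> Suc i < length Ms \<and> b \<in> carrier B \<and>
           x \<in> carrier (Ms ! i) \<and> y \<in> carrier (Ms ! Suc i)}"

definition tensor_list ::
  "(complex, 'b) module \<Rightarrow> ('b, 'm) bimod list \<Rightarrow> ('b, ('m list \<Rightarrow>\<^sub>0 complex) set) bimod" where
  "tensor_list B Ms =
     (let R = tlist_rels B Ms; n = length Ms - 1 in
      module.extend (presented (tlist_words Ms) R)
        (bimod.fields
          (\<lambda>b. qmap R (\<lambda>xs. xs[0 := lact (Ms ! 0) b (xs ! 0)]))
          (\<lambda>F b. qmap R (\<lambda>xs. xs[n := ract (Ms ! n) (xs ! n) b]) F)))"


section \<open>The reduced free product\<close>

text \<open>The summand of the free product indexed by \<open>k\<^sub>1 \<noteq> \<dots> \<noteq> k\<^sub>n\<close> is the component of the direct sum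
  at the list \<open>[k\<^sub>1, \<dots>, k\<^sub>n]\<close>. Sums over smaller index sets are submodules: they consist of functions
  which vanish at the other lists.\<close>

type_synonym ('k, 'x) fp0 = "'k list \<Rightarrow> ('x list \<Rightarrow>\<^sub>0 complex) set"
type_synonym ('b, 'k, 'x) fp = "'b \<times> ('k, 'x) fp0"

definition alt_words :: "'k set \<Rightarrow> 'k list set" where
  "alt_words K = {ks. ks \<noteq> [] \<and> set ks \<subseteq> K \<and> distinct_adj ks}"

definition fp_part ::
  "(complex, 'b) module \<Rightarrow> ('k \<Rightarrow> ('b, 'x) bimod) \<Rightarrow> 'k list set \<Rightarrow> ('b, ('k, 'x) fp0) bimod" where
  "fp_part B X I = direct_sum I (\<lambda>ks. tensor_list B (map X ks))"

definition fp_mod ::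
  "(complex, 'b) module \<Rightarrow> 'k set \<Rightarrow> ('k \<Rightarrow> ('b, 'x) bimod) \<Rightarrow> ('b, ('b, 'k, 'x) fp) bimod" where
  "fp_mod B K X = with_proj B (fp_part B X (alt_words K))"

definition fp_left ::
  "(complex, 'b) module \<Rightarrow> 'k set \<Rightarrow> ('k \<Rightarrow> ('b, 'x) bimod) \<Rightarrow> 'k \<Rightarrow> ('b, ('b, 'k, 'x) fp) bimod" where
  "fp_left B K X k = with_proj B (fp_part B X {ks \<in> alt_words K. hd ks \<noteq> k})"

definition fp_right ::
  "(complex, 'b) module \<Rightarrow> 'k set \<Rightarrow> ('k \<Rightarrow> ('b, 'x) bimod) \<Rightarrow> 'k \<Rightarrow> ('b, ('b, 'k, 'x) fp) bimod" where
  "fp_right B K X k = with_proj B (fp_part B X {ks \<in> alt_words K. last ks \<noteq> k})"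

text \<open>The image of \<open>(b \<oplus> x) \<otimes> (b' \<oplus> \<xi>)\<close> in the free product under the natural isomorphism
  \<open>V\<^sub>k\<inverse>\<close> is \<open>bb' \<oplus> (b\<xi> + xb' + x \<otimes> \<xi>)\<close>, with \<open>xb'\<close> in the summand \<open>[k]\<close>. Likewise for \<open>W\<^sub>k\<inverse>\<close>.\<close>

definition left_join ::
  "(complex, 'b) module \<Rightarrow> ('k \<Rightarrow> ('b, 'x) bimod) \<Rightarrow> 'k \<Rightarrow>
   ('b \<times> 'x) \<times> ('b, 'k, 'x) fp \<Rightarrow> ('b, 'k, 'x) fp" where
  "left_join B X k = (\<lambda>((b, x), (b', \<xi>)).
     (b \<otimes>\<^bsub>B\<^esub> b',
      \<lambda>ks. let M = tensor_list B (map X ks); R = tlist_rels B (map X ks) in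
        lact M b (\<xi> ks) \<oplus>\<^bsub>M\<^esub>
        (if ks = [k] then gen_class R [ract (X k) x b']
         else if ks \<noteq> [] \<and> hd ks = k then qmap R (\<lambda>xs. x # xs) (\<xi> (tl ks))
         else \<zero>\<^bsub>M\<^esub>)))"

definition right_join ::
  "(complex, 'b) module \<Rightarrow> ('k \<Rightarrow> ('b, 'x) bimod) \<Rightarrow> 'k \<Rightarrow>
   ('b, 'k, 'x) fp \<times> ('b \<times> 'x) \<Rightarrow> ('b, 'k, 'x) fp" where
  "right_join B X k = (\<lambda>((b', \<xi>), (b, x)).
     (b' \<otimes>\<^bsub>B\<^esub> b,
      \<lambda>ks. let M = tensor_list B (map X ks); R = tlist_rels B (map X ks) in
        ract M (\<xi> ks) b \<oplus>\<^bsub>M\<^esub>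
        (if ks = [k] then gen_class R [lact (X k) b' x]
         else if ks \<noteq> [] \<and> last ks = k then qmap R (\<lambda>xs. xs @ [x]) (\<xi> (butlast ks))
         else \<zero>\<^bsub>M\<^esub>)))"

definition V_inv ::
  "(complex, 'b) module \<Rightarrow> 'k set \<Rightarrow> ('k \<Rightarrow> ('b, 'x) bimod) \<Rightarrow> 'k \<Rightarrow>
   (('b \<times> 'x) \<times> ('b, 'k, 'x) fp \<Rightarrow>\<^sub>0 complex) set \<Rightarrow> ('b, 'k, 'x) fp" where
  "V_inv B K X k = qlift (fp_mod B K X) (left_join B X k)"

definition V_iso ::
  "(complex, 'b) module \<Rightarrow> 'k set \<Rightarrow> ('k \<Rightarrow> ('b, 'x) bimod) \<Rightarrow> 'k \<Rightarrow>
   ('b, 'k, 'x) fp \<Rightarrow> (('b \<times> 'x) \<times> ('b, 'k, 'x) fp \<Rightarrow>\<^sub>0 complex) set" where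
  "V_iso B K X k = inv_into (carrier (tensor B (with_proj B (X k)) (fp_left B K X k))) (V_inv B K X k)"

definition W_inv ::
  "(complex, 'b) module \<Rightarrow> 'k set \<Rightarrow> ('k \<Rightarrow> ('b, 'x) bimod) \<Rightarrow> 'k \<Rightarrow>
   (('b, 'k, 'x) fp \<times> ('b \<times> 'x) \<Rightarrow>\<^sub>0 complex) set \<Rightarrow> ('b, 'k, 'x) fp" where
  "W_inv B K X k = qlift (fp_mod B K X) (right_join B X k)"

definition W_iso ::
  "(complex, 'b) module \<Rightarrow> 'k set \<Rightarrow> ('k \<Rightarrow> ('b, 'x) bimod) \<Rightarrow> 'k \<Rightarrow>
   ('b, 'k, 'x) fp \<Rightarrow> (('b, 'k, 'x) fp \<times> ('b \<times> 'x) \<Rightarrow>\<^sub>0 complex) set" where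
  "W_iso B K X k = inv_into (carrier (tensor B (fp_right B K X k) (with_proj B (X k)))) (W_inv B K X k)"

definition left_rep ::
  "(complex, 'b) module \<Rightarrow> 'k set \<Rightarrow> ('k \<Rightarrow> ('b, 'x) bimod) \<Rightarrow> 'k \<Rightarrow>
   ('b \<times> 'x \<Rightarrow> 'b \<times> 'x) \<Rightarrow> ('b, 'k, 'x) fp \<Rightarrow> ('b, 'k, 'x) fp" where
  "left_rep B K X k a =
     (\<lambda>v\<in>carrier (fp_mod B K X).
        V_inv B K X k
          (qmap (tensor_rels B (with_proj B (X k)) (fp_left B K X k)) (\<lambda>(x, \<xi>). (a x, \<xi>)) (V_iso B K X k v)))"

definition right_rep ::
  "(complex, 'b) module \<Rightarrow> 'k set \<Rightarrow> ('k \<Rightarrow> ('b, 'x) bimod) \<Rightarrow> 'k \<Rightarrow>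
   ('b \<times> 'x \<Rightarrow> 'b \<times> 'x) \<Rightarrow> ('b, 'k, 'x) fp \<Rightarrow> ('b, 'k, 'x) fp" where
  "right_rep B K X k a =
     (\<lambda>v\<in>carrier (fp_mod B K X).
        W_inv B K X k
          (qmap (tensor_rels B (fp_right B K X k) (with_proj B (X k))) (\<lambda>(\<xi>, x). (\<xi>, a x)) (W_iso B K X k v)))"

definition bool_proj ::
  "(complex, 'b) module \<Rightarrow> 'k set \<Rightarrow> ('k \<Rightarrow> ('b, 'x) bimod) \<Rightarrow> 'k \<Rightarrow>
   ('b, 'k, 'x) fp \<Rightarrow> ('b, 'k, 'x) fp" where
  "bool_proj B K X k =
     (\<lambda>(b, \<xi>)\<in>carrier (fp_mod B K X).
        (b, \<lambda>ks. if ks = [k] then \<xi> ks else \<zero>\<^bsub>tensor_list B (map X ks)\<^esub>))"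

definition fp_exp ::
  "(complex, 'b) module \<Rightarrow> 'k set \<Rightarrow> ('k \<Rightarrow> ('b, 'x) bimod) \<Rightarrow>
   (('b, 'k, 'x) fp \<Rightarrow> ('b, 'k, 'x) fp) \<Rightarrow> 'b" where
  "fp_exp B K X = op_exp B (fp_part B X (alt_words K))"


section \<open>Independence\<close>

datatype face = LeftFace | RightFace | BoolFace
datatype side = LeftSide | RightSide

text \<open>Higher-order logic cannot quantify over the carrier types of the bimodules inside a formula, so
  they are a parameter of the two notions of independence. Several bimodules can always be placed in
  one common type.\<close>

definition bi_free ::
  "'x itself \<Rightarrow> (complex, 'b) module \<Rightarrow> (complex, 'a) module \<Rightarrow> ('a \<Rightarrow> 'b) \<Rightarrow>
   (('b \<times> 'b \<Rightarrow>\<^sub>0 complex) set \<Rightarrow> 'a) \<Rightarrow> 'k set \<Rightarrow> ('k \<Rightarrow> 'a set) \<Rightarrow> ('k \<Rightarrow> 'a set) \<Rightarrow> bool" where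
  "bi_free TX B A E \<epsilon> K C D \<longleftrightarrow>
     (\<forall>k\<in>K. pair_of_faces B A \<epsilon> (C k) (D k)) \<and>
     (\<exists>(X :: 'k \<Rightarrow> ('b, 'x) bimod) l r.
        (\<forall>k\<in>K.
           bimodule B (X k) \<and>
           unital_alg_hom (A\<lparr>carrier := C k\<rparr>) (left_ops B (with_proj B (X k))) (l k) \<and>
           unital_alg_hom (A\<lparr>carrier := D k\<rparr>) (right_ops B (with_proj B (X k))) (r k)) \<and>
        (\<forall>w :: (side \<times> 'k \<times> 'a) list.
           (\<forall>(s, k, Z)\<in>set w. k \<in> K \<and> Z \<in> (case s of LeftSide \<Rightarrow> C k | RightSide \<Rightarrow> D k)) \<longrightarrow>
           E (word_prod A (map (\<lambda>(s, k, Z). Z) w)) =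
           fp_exp B K X (word_prod (lin_ops (fp_mod B K X))
             (map (\<lambda>(s, k, Z). case s of
                LeftSide \<Rightarrow> left_rep B K X k (l k Z)
              | RightSide \<Rightarrow> right_rep B K X k (r k Z)) w))))"

definition ffb_independent ::
  "'x itself \<Rightarrow> (complex, 'b) module \<Rightarrow> (complex, 'a) module \<Rightarrow> ('a \<Rightarrow> 'b) \<Rightarrow>
   (('b \<times> 'b \<Rightarrow>\<^sub>0 complex) set \<Rightarrow> 'a) \<Rightarrow> 'k set \<Rightarrow>
   ('k \<Rightarrow> 'a set) \<Rightarrow> ('k \<Rightarrow> 'a set) \<Rightarrow> ('k \<Rightarrow> 'a set) \<Rightarrow> bool" where
  "ffb_independent TX B A E \<epsilon> K Al Ar Ab \<longleftrightarrow>
     (\<forall>k\<in>K. triple_of_faces B A \<epsilon> (Al k) (Ar k) (Ab k)) \<and>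
     (\<exists>(X :: 'k \<Rightarrow> ('b, 'x) bimod) l r m.
        (\<forall>k\<in>K.
           bimodule B (X k) \<and>
           unital_alg_hom (A\<lparr>carrier := Al k\<rparr>) (left_ops B (with_proj B (X k))) (l k) \<and>
           unital_alg_hom (A\<lparr>carrier := Ar k\<rparr>) (right_ops B (with_proj B (X k))) (r k) \<and>
           alg_hom (A\<lparr>carrier := Ab k\<rparr>) (left_ops B (with_proj B (X k))) (m k)) \<and>
        (\<forall>w :: (face \<times> 'k \<times> 'a) list.
           (\<forall>(\<chi>, k, Z)\<in>set w.
              k \<in> K \<and> Z \<in> (case \<chi> of LeftFace \<Rightarrow> Al k | RightFace \<Rightarrow> Ar k | BoolFace \<Rightarrow> Ab k)) \<longrightarrow>
           E (word_prod A (map (\<lambda>(\<chi>, k, Z). Z) w)) =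
           fp_exp B K X (word_prod (lin_ops (fp_mod B K X))
             (map (\<lambda>(\<chi>, k, Z). case \<chi> of
                LeftFace \<Rightarrow> left_rep B K X k (l k Z)
              | RightFace \<Rightarrow> right_rep B K X k (r k Z)
              | BoolFace \<Rightarrow> word_prod (lin_ops (fp_mod B K X))
                  [bool_proj B K X k, left_rep B K X k (m k Z), bool_proj B K X k]) w))))"

definition bi_free_ffb_system ::
  "'x itself \<Rightarrow> (complex, 'b) module \<Rightarrow> (complex, 'a) module \<Rightarrow> ('a \<Rightarrow> 'b) \<Rightarrow>
   (('b \<times> 'b \<Rightarrow>\<^sub>0 complex) set \<Rightarrow> 'a) \<Rightarrow> 'k set \<Rightarrow>
   ('k \<Rightarrow> 'a set) \<Rightarrow> ('k \<Rightarrow> 'a set) \<Rightarrow> ('k \<Rightarrow> 'a set) \<Rightarrow> ('k \<Rightarrow> 'a set) \<Rightarrow> bool" where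
  "bi_free_ffb_system TX B A E \<epsilon> K Al Ar C' D' \<longleftrightarrow>
     (\<exists>C D.
        (\<forall>k\<in>K. pair_of_faces B A \<epsilon> (Al k) (Ar k) \<and> subalg A (C k) \<and> subalg A (D k) \<and>
           C' k \<subseteq> C k \<and> D' k \<subseteq> D k \<inter> left_alg B A \<epsilon> \<and>
           (\<forall>b\<in>carrier B. {Lop B \<epsilon> b} <#>\<^bsub>A\<^esub> C' k \<subseteq> C' k \<and> C' k <#>\<^bsub>A\<^esub> {Lop B \<epsilon> b} \<subseteq> C' k)) \<and>
        bi_free TX B A E \<epsilon> K (\<lambda>k. alg_gen A (Al k \<union> C k)) (\<lambda>k. alg_gen A (Ar k \<union> D k))) \<and>
     (\<forall>k\<in>K. let AA = alg_gen A (Al k \<union> Ar k) in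
        C' k <#>\<^bsub>A\<^esub> AA <#>\<^bsub>A\<^esub> C' k = {\<zero>\<^bsub>A\<^esub>} \<and> D' k <#>\<^bsub>A\<^esub> AA <#>\<^bsub>A\<^esub> D' k = {\<zero>\<^bsub>A\<^esub>} \<and>
        (\<forall>n.
          (\<forall>T \<in> AA <#>\<^bsub>A\<^esub> C' k <#>\<^bsub>A\<^esub> AA <#>\<^bsub>A\<^esub> set_pow A (D' k <#>\<^bsub>A\<^esub> AA <#>\<^bsub>A\<^esub> C' k) n <#>\<^bsub>A\<^esub> AA.
             E T = \<zero>\<^bsub>B\<^esub>) \<and>
          (\<forall>T \<in> AA <#>\<^bsub>A\<^esub> D' k <#>\<^bsub>A\<^esub> AA <#>\<^bsub>A\<^esub> set_pow A (C' k <#>\<^bsub>A\<^esub> AA <#>\<^bsub>A\<^esub> D' k) n <#>\<^bsub>A\<^esub> AA.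
             E T = \<zero>\<^bsub>B\<^esub>)))"

text \<open>Here \<open>J\<close> and \<open>J'\<close> are the copies of \<open>B\<close> in the two spaces.\<close>

definition B_linear_on ::
  "(complex, 'b) module \<Rightarrow> (complex, 'a) module \<Rightarrow> ('b \<Rightarrow> 'a) \<Rightarrow>
   (complex, 'c) module \<Rightarrow> ('b \<Rightarrow> 'c) \<Rightarrow> 'a set \<Rightarrow> ('a \<Rightarrow> 'c) \<Rightarrow> bool" where
  "B_linear_on B A J A' J' S f \<longleftrightarrow>
     linear_on A S A' f \<and>
     (\<forall>b\<in>carrier B. \<forall>Z\<in>S.
        f (J b \<otimes>\<^bsub>A\<^esub> Z) = J' b \<otimes>\<^bsub>A'\<^esub> f Z \<and> f (Z \<otimes>\<^bsub>A\<^esub> J b) = f Z \<otimes>\<^bsub>A'\<^esub> J' b)"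

text \<open>Types for the existential claim: operators on a reduced free product of bimodules with elements
  in \<open>'y\<close>, and, for an algebra on \<open>'a\<close>, a type \<open>'y\<close> with room for two copies of a quotient of the
  algebra together with the algebra itself.\<close>

type_synonym ('b, 'k, 'y) fp_ops = "('b, 'k, 'y) fp \<Rightarrow> ('b, 'k, 'y) fp"
type_synonym 'a doubled = "('a set \<times> 'a) \<times> ('a set \<times> 'a)"

end

theory Submission
  imports Defs
begin

text \<open>The claim only involves mixed moments of the three faces of one triple at a time, so of the
  independence of the family only its consequence \<open>E(1) = 1\<close> is needed.

  Let \<open>J\<close> be the largest left ideal of \<open>A\<close> contained in the kernel of \<open>E\<close>, and \<open>G = A/J \<oplus> A\<close>, on
  which \<open>A\<close> acts faithfully from the left; \<open>B\<close> acts on \<open>G\<close> through \<open>L\<^sub>b\<close> and \<open>R\<^sub>b\<close>. The class of \<open>1\<close> in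
  the first summand is a central vector, because \<open>E(S L\<^sub>b) = E(S R\<^sub>b)\<close>, and together with the
  functional \<open>E\<close> it makes \<open>Y = G \<oplus> G\<close> a bimodule with a specified \<open>B\<close>-projection. In terms of \<open>2 \<times> 2\<close>
  matrices acting on \<open>Y\<close>, send \<open>z\<close> in a left or right face to \<open>diag(z, z)\<close> and \<open>z\<close> in a Boolean face to
  the product of \<open>z e\<^sub>1\<^sub>2\<close> and \<open>e\<^sub>2\<^sub>1\<close>: the former commutes with the right action of \<open>B\<close>, the latter
  with both actions, so they may be placed in a left and in a right face. On \<open>G \<oplus> 0\<close> all of
  these act as \<open>z\<close>, which gives the moments. The strictly upper and lower triangular matrices multiply
  to zero with only diagonal matrices in between, and words with one more upper than lower corner, or
  vice versa, map the central vector into \<open>0 \<oplus> G\<close> or to zero.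

  Taking a copy of \<open>Y\<close> for every \<open>k\<close>, the operators on the reduced free product form the space
  \<open>A'\<close>. In it the images of the left and right regular representations are bi-free by
  construction, once \<open>V\<^sub>k\<close> and \<open>W\<^sub>k\<close> are known to be isomorphisms, and on the submodule formed by
  \<open>B\<close> and the words of the single letter \<open>k\<close>, a copy of \<open>Y\<close>, both representations of an operator act as
  that operator.\<close>

section \<open>Complex modules and linear maps\<close>

text \<open>A word in a left and a right face of index \<open>k\<close> is no longer a matrix once
  it acts on the free product, so patterns of zero entries cannot be used directly. The projection q
  = e_11 onto the first copy of G is therefore represented twice, as Q at the left end and as R at
  the right end of words. Both commute with everything generated by diagonal operators, since the
  two representations of commuting operators commute. Left corners satisfy Qc = c and cQ = 0, right
  corners dR = d and Rd = 0, and the conditions of the system follow from these identities: a word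
  whose last corner is from C' is annihilated by Q on the right, and Q fixes the vacuum; a word
  whose first corner is from D' is annihilated by R on the left, and R does not change the component
  in B. The other obstacle is that V_k and W_k are set-theoretic inverses on quotients of free
  spaces. Only their values on elementary tensors are ever computed; since elementary tensors span
  the free product, linear maps are compared there and no normal form for words is required.\<close>

abbreviation cmodule :: "(complex, 'm, 'p) module_scheme \<Rightarrow> bool" where
  "cmodule \<equiv> Module.module complex_ring"

abbreviation lin :: "(complex, 'a, 'p) module_scheme \<Rightarrow> (complex, 'c, 'q) module_scheme \<Rightarrow> ('a \<Rightarrow> 'c) \<Rightarrow> bool" where
  "lin M N f \<equiv> linear_on M (carrier M) N f"

lemma complex_ring_simps [simp]:
  "carrier complex_ring = UNIV" "x \<otimes>\<^bsub>complex_ring\<^esub> y = x * y" "x \<oplus>\<^bsub>complex_ring\<^esub> y = x + y"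
  "\<one>\<^bsub>complex_ring\<^esub> = 1" "\<zero>\<^bsub>complex_ring\<^esub> = 0"
  by (simp_all add: complex_ring_def)

lemma cring_complex_ring: "cring complex_ring"
proof (intro cringI abelian_groupI comm_monoidI)
  show "\<exists>y\<in>carrier complex_ring. y \<oplus>\<^bsub>complex_ring\<^esub> x = \<zero>\<^bsub>complex_ring\<^esub>" for x
    by (rule bexI[of _ "-x"]) auto
qed (auto simp: algebra_simps)

text \<open>Additive inverses are obtained rather than assumed: \<open>(-1) \<odot> x\<close> is
  one, by distributivity in the scalar and the assumptions on the scalars 1 and 0.\<close>

lemma cmoduleI:
  fixes M :: "(complex, 'm, 'p) module_scheme" (structure)
  assumes "\<And>x y. x \<in> carrier M \<Longrightarrow> y \<in> carrier M \<Longrightarrow> x \<oplus> y \<in> carrier M"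
    and "\<zero> \<in> carrier M"
    and "\<And>x y z. x \<in> carrier M \<Longrightarrow> y \<in> carrier M \<Longrightarrow> z \<in> carrier M \<Longrightarrow> x \<oplus> y \<oplus> z = x \<oplus> (y \<oplus> z)"
    and "\<And>x y. x \<in> carrier M \<Longrightarrow> y \<in> carrier M \<Longrightarrow> x \<oplus> y = y \<oplus> x"
    and "\<And>x. x \<in> carrier M \<Longrightarrow> \<zero> \<oplus> x = x"
    and smult: "\<And>c x. x \<in> carrier M \<Longrightarrow> c \<odot> x \<in> carrier M"
    and distr: "\<And>c d x. x \<in> carrier M \<Longrightarrow> (c + d) \<odot> x = c \<odot> x \<oplus> d \<odot> x"
    and "\<And>c x y. x \<in> carrier M \<Longrightarrow> y \<in> carrier M \<Longrightarrow> c \<odot> (x \<oplus> y) = c \<odot> x \<oplus> c \<odot> y"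
    and "\<And>c d x. x \<in> carrier M \<Longrightarrow> (c * d) \<odot> x = c \<odot> (d \<odot> x)"
    and one: "\<And>x. x \<in> carrier M \<Longrightarrow> 1 \<odot> x = x"
    and zero: "\<And>x. x \<in> carrier M \<Longrightarrow> 0 \<odot> x = \<zero>"
  shows "cmodule M"
proof (intro moduleI cring_complex_ring abelian_groupI)
  show "\<exists>y\<in>carrier M. y \<oplus> x = \<zero>" if "x \<in> carrier M" for x
    using that smult[of x "-1"] distr[of x "-1" 1] one[of x] zero[of x]
    by (intro bexI[of _ "(-1) \<odot> x"]) auto
qed (use assms in auto)

context
  fixes M :: "(complex, 'm, 'p) module_scheme" (structure)
  assumes M: "cmodule M"
begin

interpretation M: Module.module complex_ring M by (rule M)

lemma cmod_add_closed: "x \<in> carrier M \<Longrightarrow> y \<in> carrier M \<Longrightarrow> x \<oplus> y \<in> carrier M" by simp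
lemma cmod_zero_closed: "\<zero> \<in> carrier M" by simp
lemma cmod_smult_closed: "x \<in> carrier M \<Longrightarrow> c \<odot> x \<in> carrier M" by simp
lemma cmod_assoc: "x \<in> carrier M \<Longrightarrow> y \<in> carrier M \<Longrightarrow> z \<in> carrier M \<Longrightarrow> x \<oplus> y \<oplus> z = x \<oplus> (y \<oplus> z)"
  by (rule M.a_assoc)
lemma cmod_comm: "x \<in> carrier M \<Longrightarrow> y \<in> carrier M \<Longrightarrow> x \<oplus> y = y \<oplus> x" by (rule M.a_comm)
lemma cmod_lcomm: "x \<in> carrier M \<Longrightarrow> y \<in> carrier M \<Longrightarrow> z \<in> carrier M \<Longrightarrow> x \<oplus> (y \<oplus> z) = y \<oplus> (x \<oplus> z)"
  by (rule M.a_lcomm)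
lemma cmod_l_zero: "x \<in> carrier M \<Longrightarrow> \<zero> \<oplus> x = x" by simp
lemma cmod_r_zero: "x \<in> carrier M \<Longrightarrow> x \<oplus> \<zero> = x" by simp
lemma cmod_smult_add: "x \<in> carrier M \<Longrightarrow> (c + d) \<odot> x = c \<odot> x \<oplus> d \<odot> x"
  using M.smult_l_distr[of c d x] by simp
lemma cmod_smult_distr: "x \<in> carrier M \<Longrightarrow> y \<in> carrier M \<Longrightarrow> c \<odot> (x \<oplus> y) = c \<odot> x \<oplus> c \<odot> y"
  using M.smult_r_distr[of c x y] by simp
lemma cmod_smult_mult: "x \<in> carrier M \<Longrightarrow> (c * d) \<odot> x = c \<odot> (d \<odot> x)"
  using M.smult_assoc1[of c d x] by simp
lemma cmod_smult_one: "x \<in> carrier M \<Longrightarrow> 1 \<odot> x = x"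
  using M.smult_one[of x] by simp
lemma cmod_smult_zero: "x \<in> carrier M \<Longrightarrow> 0 \<odot> x = \<zero>"
  using M.smult_l_null[of x] by simp
lemma cmod_smult_null: "c \<odot> \<zero> = \<zero>"
  using M.smult_r_null[of c] by simp
text \<open>Differences are written with the scalar -1, the form into which \<open>flift\<close>
  turns a subtraction in the free space.\<close>

lemma cmod_diff_zero_iff:
  assumes "x \<in> carrier M" "y \<in> carrier M"
  shows "x \<oplus> (-1) \<odot> y = \<zero> \<longleftrightarrow> x = y"
proof -
  have y: "(-1) \<odot> y \<oplus> y = \<zero>"
    using cmod_smult_add[of y "-1" 1] assms by (simp add: cmod_smult_one cmod_smult_zero)
  then have "x \<oplus> (-1) \<odot> y \<oplus> y = x"
    using assms by (simp add: cmod_assoc cmod_smult_closed)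
  moreover have "y \<oplus> (-1) \<odot> y = \<zero>"
    using y assms by (simp add: cmod_comm cmod_smult_closed)
  ultimately show ?thesis using assms by auto
qed

end

lemmas cmod_closed = cmod_add_closed cmod_zero_closed cmod_smult_closed
lemmas cmod_ac = cmod_assoc cmod_comm cmod_lcomm
lemmas cmod_simps = cmod_l_zero cmod_r_zero cmod_smult_add cmod_smult_distr cmod_smult_mult
  cmod_smult_one cmod_smult_zero cmod_smult_null

lemma linD:
  assumes "lin M N f"
  shows "x \<in> carrier M \<Longrightarrow> f x \<in> carrier N"
    "x \<in> carrier M \<Longrightarrow> y \<in> carrier M \<Longrightarrow> f (x \<oplus>\<^bsub>M\<^esub> y) = f x \<oplus>\<^bsub>N\<^esub> f y"
    "x \<in> carrier M \<Longrightarrow> f (c \<odot>\<^bsub>M\<^esub> x) = c \<odot>\<^bsub>N\<^esub> f x"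
  using assms by (auto simp: linear_on_def)

lemma linI:
  assumes "\<And>x. x \<in> carrier M \<Longrightarrow> f x \<in> carrier N"
    "\<And>x y. x \<in> carrier M \<Longrightarrow> y \<in> carrier M \<Longrightarrow> f (x \<oplus>\<^bsub>M\<^esub> y) = f x \<oplus>\<^bsub>N\<^esub> f y"
    "\<And>c x. x \<in> carrier M \<Longrightarrow> f (c \<odot>\<^bsub>M\<^esub> x) = c \<odot>\<^bsub>N\<^esub> f x"
  shows "lin M N f"
  using assms by (auto simp: linear_on_def)

lemma lin_zero:
  assumes "cmodule M" "cmodule N" "lin M N f"
  shows "f \<zero>\<^bsub>M\<^esub> = \<zero>\<^bsub>N\<^esub>"
  using linD(3)[OF assms(3) cmod_zero_closed[OF assms(1)], of 0] linD(1)[OF assms(3) cmod_zero_closed[OF assms(1)]]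
  by (simp add: assms cmod_simps cmod_closed)

lemma lin_comp: "lin M N f \<Longrightarrow> lin N P g \<Longrightarrow> lin M P (\<lambda>x. g (f x))"
  by (auto simp: linear_on_def Pi_iff)

lemma lin_cong: "(\<And>x. x \<in> carrier M \<Longrightarrow> f x = g x) \<Longrightarrow> cmodule M \<Longrightarrow> lin M N f = lin M N g"
  by (auto simp: linear_on_def Pi_iff cmod_closed)

lemma lin_add:
  assumes "cmodule N" "lin M N f" "lin M N g"
  shows "lin M N (\<lambda>x. f x \<oplus>\<^bsub>N\<^esub> g x)"
  using assms by (intro linI) (simp_all add: linD cmod_closed cmod_simps cmod_ac)

lemma lin_smult:
  assumes "cmodule N" "lin M N f"
  shows "lin M N (\<lambda>x. c \<odot>\<^bsub>N\<^esub> f x)"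
  using assms by (intro linI) (simp_all add: linD cmod_closed cmod_simps flip: cmod_smult_mult, simp add: mult.commute)

text \<open>Spanning is stated as an induction principle instead of through linear combinations.
  Closure of \<open>S\<close> is demanded only at points of the carrier, so that membership is
  available in the induction steps. The main use is \<open>lin_eqI\<close>: linear maps that agree
  on generators agree.\<close>

definition spans :: "(complex, 'm, 'p) module_scheme \<Rightarrow> 'm set \<Rightarrow> bool" where
  "spans M G \<longleftrightarrow> G \<subseteq> carrier M \<and>
     (\<forall>S. G \<subseteq> S \<longrightarrow> \<zero>\<^bsub>M\<^esub> \<in> S \<longrightarrow> (\<forall>x\<in>S \<inter> carrier M. \<forall>y\<in>S \<inter> carrier M. x \<oplus>\<^bsub>M\<^esub> y \<in> S) \<longrightarrow>
        (\<forall>c. \<forall>x\<in>S \<inter> carrier M. c \<odot>\<^bsub>M\<^esub> x \<in> S) \<longrightarrow> carrier M \<subseteq> S)"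

lemma spans_induct [consumes 2, case_names gen zero add smult]:
  assumes "spans M G" "x \<in> carrier M"
    and "\<And>x. x \<in> G \<Longrightarrow> P x" "P \<zero>\<^bsub>M\<^esub>"
    and "\<And>x y. x \<in> carrier M \<Longrightarrow> y \<in> carrier M \<Longrightarrow> P x \<Longrightarrow> P y \<Longrightarrow> P (x \<oplus>\<^bsub>M\<^esub> y)"
    and "\<And>c x. x \<in> carrier M \<Longrightarrow> P x \<Longrightarrow> P (c \<odot>\<^bsub>M\<^esub> x)"
  shows "P x"
proof -
  have "carrier M \<subseteq> {x. P x}"
    using assms(1)[unfolded spans_def, THEN conjunct2, rule_format, of "{x. P x}"] assms(3-)
    by blast
  then show ?thesis using assms(2) by auto
qed

lemma spansI:
  assumes "G \<subseteq> carrier M"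
    and "\<And>P x. x \<in> carrier M \<Longrightarrow> (\<And>x. x \<in> G \<Longrightarrow> P x) \<Longrightarrow> P \<zero>\<^bsub>M\<^esub> \<Longrightarrow>
      (\<And>x y. x \<in> carrier M \<Longrightarrow> y \<in> carrier M \<Longrightarrow> P x \<Longrightarrow> P y \<Longrightarrow> P (x \<oplus>\<^bsub>M\<^esub> y)) \<Longrightarrow>
      (\<And>c x. x \<in> carrier M \<Longrightarrow> P x \<Longrightarrow> P (c \<odot>\<^bsub>M\<^esub> x)) \<Longrightarrow> P x"
  shows "spans M G"
  unfolding spans_def
proof (intro conjI allI impI subsetI)
  fix S x assume *: "G \<subseteq> S" "\<zero>\<^bsub>M\<^esub> \<in> S" "\<forall>x\<in>S \<inter> carrier M. \<forall>y\<in>S \<inter> carrier M. x \<oplus>\<^bsub>M\<^esub> y \<in> S"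
    "\<forall>c. \<forall>x\<in>S \<inter> carrier M. c \<odot>\<^bsub>M\<^esub> x \<in> S" "x \<in> carrier M"
  show "x \<in> S" by (rule assms(2)[of x "\<lambda>x. x \<in> S"]) (use * in auto)
qed (use assms(1) in auto)

lemma lin_eqI:
  assumes "spans M G" "cmodule M" "cmodule N" "lin M N f" "lin M N g"
    and "\<And>x. x \<in> G \<Longrightarrow> f x = g x" "x \<in> carrier M"
  shows "f x = g x"
  using assms(1,7)
  by (induction rule: spans_induct) (use assms in \<open>simp_all add: linD lin_zero[of M N]\<close>)

section \<open>Quotients of free vector spaces\<close>

lemma lookup_fscale [simp]: "Poly_Mapping.lookup (fscale c f) w = c * Poly_Mapping.lookup f w"
  by (cases "Poly_Mapping.lookup f w = 0") (auto simp: fscale_def Poly_Mapping.map.rep_eq)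

text \<open>Turns the span of relations in \<open>qclass\<close> into the library's
  \<open>fs.span\<close>, whose induction and closure rules then apply.\<close>

interpretation fs: vector_space fscale
  by unfold_locales (auto intro!: poly_mapping_eqI simp: lookup_add algebra_simps)

lemma fscale_single [simp]: "fscale c (Poly_Mapping.single w d) = Poly_Mapping.single w (c * d)"
  by (rule poly_mapping_eqI) (simp add: lookup_single when_def)

lemma keys_fscale: "Poly_Mapping.keys (fscale c f) \<subseteq> Poly_Mapping.keys f"
  by (auto simp: in_keys_iff)

lemma keys_add_subset:
  "Poly_Mapping.keys f \<subseteq> W \<Longrightarrow> Poly_Mapping.keys g \<subseteq> W \<Longrightarrow> Poly_Mapping.keys (f + g) \<subseteq> W"
  using Poly_Mapping.keys_add[of f g] by auto

lemma keys_fscale_subset: "Poly_Mapping.keys f \<subseteq> W \<Longrightarrow> Poly_Mapping.keys (fscale c f) \<subseteq> W"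
  by (rule order_trans[OF keys_fscale])

lemma fs_subspace_keys: "fs.subspace {f. Poly_Mapping.keys f \<subseteq> W}"
  by (simp add: fs.subspace_def keys_add_subset keys_fscale_subset)

lemma fs_free_induct [consumes 1, case_names zero add single]:
  fixes f :: "'w \<Rightarrow>\<^sub>0 'c::comm_monoid_add"
  assumes "Poly_Mapping.keys f \<subseteq> W" "P 0"
    and "\<And>f g. Poly_Mapping.keys f \<subseteq> W \<Longrightarrow> Poly_Mapping.keys g \<subseteq> W \<Longrightarrow> P f \<Longrightarrow> P g \<Longrightarrow> P (f + g)"
    and "\<And>w c. w \<in> W \<Longrightarrow> P (Poly_Mapping.single w c)"
  shows "P f"
proof -
  define S where "S = Poly_Mapping.keys f"
  have *: "f = (\<Sum>w\<in>S. Poly_Mapping.single w (Poly_Mapping.lookup f w))"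
    unfolding S_def
    by (rule poly_mapping_eqI)
       (auto simp: lookup_sum lookup_single when_def sum.delta in_keys_iff)
  have "finite S" "S \<subseteq> W" using assms(1) by (auto simp: S_def)
  then have "P (\<Sum>w\<in>S. Poly_Mapping.single w (h w)) \<and>
      Poly_Mapping.keys (\<Sum>w\<in>S. Poly_Mapping.single w (h w)) \<subseteq> W" for h
    by (induction rule: finite_induct) (use assms in \<open>simp_all add: keys_add_subset\<close>)
  then show ?thesis using * by metis
qed

lemma qclass_eq_iff: "qclass R f = qclass R g \<longleftrightarrow> f - g \<in> fs.span R"
proof
  assume "qclass R f = qclass R g"
  moreover have "f \<in> qclass R f" by (simp add: qclass_def fs.span_zero)
  ultimately show "f - g \<in> fs.span R" by (simp add: qclass_def)
next
  assume *: "f - g \<in> fs.span R"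
  have "h - f \<in> fs.span R \<longleftrightarrow> h - g \<in> fs.span R" for h
    using fs.span_add[OF _ *, of "h - f"] fs.span_diff[OF _ *, of "h - g"] by auto
  then show "qclass R f = qclass R g" by (auto simp: qclass_def)
qed

lemma qclass_self: "f \<in> qclass R f"
  by (simp add: qclass_def fs.span_zero)

lemma qclass_memD: "g \<in> qclass R f \<Longrightarrow> qclass R g = qclass R f"
  by (simp add: qclass_eq_iff) (simp add: qclass_def)

text \<open>Operations on quotients are unions over all representatives. If all representatives give
  the same class, the union is that class; it is not empty because a class contains its own
  representative.\<close>

lemma qclass_Union:
  assumes "\<And>f'. f' \<in> qclass R f \<Longrightarrow> qclass R' (h f') = qclass R' (h f)"
  shows "(\<Union>f'\<in>qclass R f. qclass R' (h f')) = qclass R' (h f)"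
  using assms qclass_self[of f R] by blast

lemma qclass_add_cong: "qclass R f = qclass R f' \<Longrightarrow> qclass R g = qclass R g' \<Longrightarrow> qclass R (f + g) = qclass R (f' + g')"
  unfolding qclass_eq_iff using fs.span_add[of "f - f'" R "g - g'"] by (simp add: algebra_simps)

lemma presented_simps:
  "carrier (presented W R) = qclass R ` {f. Poly_Mapping.keys f \<subseteq> W}"
  "\<zero>\<^bsub>presented W R\<^esub> = qclass R 0"
  "qclass R f \<oplus>\<^bsub>presented W R\<^esub> qclass R g = qclass R (f + g)"
  "c \<odot>\<^bsub>presented W R\<^esub> qclass R f = qclass R (fscale c f)"
proof -
  show "qclass R f \<oplus>\<^bsub>presented W R\<^esub> qclass R g = qclass R (f + g)"
  proof -
    have "(\<Union>g'\<in>qclass R g. qclass R (f' + g')) = qclass R (f' + g)" for f'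
      by (rule qclass_Union) (rule qclass_add_cong[OF refl], erule qclass_memD)
    moreover have "(\<Union>f'\<in>qclass R f. qclass R (f' + g)) = qclass R (f + g)"
      by (rule qclass_Union) (rule qclass_add_cong[OF _ refl], erule qclass_memD)
    ultimately show ?thesis by (simp add: presented_def)
  qed
  have "qclass R (fscale c f') = qclass R (fscale c f)" if "f' \<in> qclass R f" for f'
    using fs.span_scale[of "f' - f" R c] qclass_memD[OF that]
    by (simp add: qclass_eq_iff fs.scale_right_diff_distrib)
  then show "c \<odot>\<^bsub>presented W R\<^esub> qclass R f = qclass R (fscale c f)"
    using qclass_Union[of R f R "fscale c"] by (simp add: presented_def)
qed (simp_all add: presented_def)

lemma presentedI: "Poly_Mapping.keys f \<subseteq> W \<Longrightarrow> qclass R f \<in> carrier (presented W R)"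
  by (auto simp: presented_simps)

lemma presentedE:
  assumes "F \<in> carrier (presented W R)"
  obtains f where "Poly_Mapping.keys f \<subseteq> W" "F = qclass R f"
  using assms by (auto simp: presented_simps)

lemma cmodule_presented: "cmodule (presented W R)"
proof (rule cmoduleI)
  show "x \<oplus>\<^bsub>presented W R\<^esub> y \<in> carrier (presented W R)"
    if "x \<in> carrier (presented W R)" "y \<in> carrier (presented W R)" for x y
    using that by (elim presentedE) (simp add: presented_simps(3) presentedI keys_add_subset)
  show "c \<odot>\<^bsub>presented W R\<^esub> x \<in> carrier (presented W R)"
    if "x \<in> carrier (presented W R)" for c x
    using that by (elim presentedE) (simp add: presented_simps(4) presentedI keys_fscale_subset)
qed (auto simp: presented_simps algebra_simps fs.scale_left_distrib fs.scale_right_distrib)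

lemma gen_class_closed: "w \<in> W \<Longrightarrow> gen_class R w \<in> carrier (presented W R)"
  unfolding gen_class_def by (rule presentedI) auto

lemma spans_presented: "spans (presented W R) (gen_class R ` W)"
proof (rule spansI)
  fix P F assume F: "F \<in> carrier (presented W R)"
    and P: "\<And>x. x \<in> gen_class R ` W \<Longrightarrow> P x" "P \<zero>\<^bsub>presented W R\<^esub>"
    "\<And>x y. x \<in> carrier (presented W R) \<Longrightarrow> y \<in> carrier (presented W R) \<Longrightarrow> P x \<Longrightarrow> P y
      \<Longrightarrow> P (x \<oplus>\<^bsub>presented W R\<^esub> y)"
    "\<And>c x. x \<in> carrier (presented W R) \<Longrightarrow> P x \<Longrightarrow> P (c \<odot>\<^bsub>presented W R\<^esub> x)"
  from F obtain f where f: "Poly_Mapping.keys f \<subseteq> W" "F = qclass R f" by (auto simp: presented_simps)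
  have "P (qclass R f)" using f(1)
  proof (induction rule: fs_free_induct)
    case zero then show ?case using P(2) by (simp add: presented_simps)
  next
    case (add f g)
    then show ?case using P(3)[of "qclass R f" "qclass R g"] by (simp add: presented_simps)
  next
    case (single w c)
    have "P (gen_class R w)" using single P(1) by blast
    then show ?case using P(4)[OF gen_class_closed[OF single], of c]
      by (simp add: gen_class_def presented_simps)
  qed
  then show "P F" using f by simp
qed (auto intro: gen_class_closed)

subsection \<open>Maps out of a quotient\<close>

text \<open>The sum inside \<open>qlift\<close>, at one representative. Splitting it off allows
  linearity to be shown in the free space, before independence of the representative is
  known.\<close>

definition flift ::
  "(complex, 'm, 'p) module_scheme \<Rightarrow> ('w \<Rightarrow> 'm) \<Rightarrow> ('w \<Rightarrow>\<^sub>0 complex) \<Rightarrow> 'm" where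
  "flift M \<phi> f = finsum M (\<lambda>w. Poly_Mapping.lookup f w \<odot>\<^bsub>M\<^esub> \<phi> w) (Poly_Mapping.keys f)"

context
  fixes M :: "(complex, 'm, 'p) module_scheme" (structure) and W :: "'w set" and \<phi> :: "'w \<Rightarrow> 'm"
  assumes M: "cmodule M" and \<phi>: "\<phi> \<in> W \<rightarrow> carrier M"
begin

interpretation M: Module.module complex_ring M by (rule M)

private lemma phi: "w \<in> W \<Longrightarrow> \<phi> w \<in> carrier M"
  using \<phi> by auto

text \<open>Two elements and their sum have different supports, so additivity is proved after all
  sums have been extended to a common finite set.\<close>

lemma flift_superset:
  assumes "finite S" "Poly_Mapping.keys f \<subseteq> S" "S \<subseteq> W"
  shows "flift M \<phi> f = finsum M (\<lambda>w. Poly_Mapping.lookup f w \<odot> \<phi> w) S"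
  unfolding flift_def
  by (rule M.add.finprod_mono_neutral_cong_left)
     (use assms phi M in \<open>auto simp: in_keys_iff Pi_iff cmod_simps\<close>)

lemma flift_closed: "Poly_Mapping.keys f \<subseteq> W \<Longrightarrow> flift M \<phi> f \<in> carrier M"
  unfolding flift_def by (rule M.finsum_closed) (use phi in auto)

lemma flift_add:
  assumes "Poly_Mapping.keys f \<subseteq> W" "Poly_Mapping.keys g \<subseteq> W"
  shows "flift M \<phi> (f + g) = flift M \<phi> f \<oplus> flift M \<phi> g"
proof -
  let ?S = "Poly_Mapping.keys f \<union> Poly_Mapping.keys g"
  have S: "finite ?S" "?S \<subseteq> W" using assms by auto
  have "flift M \<phi> (f + g) = finsum M (\<lambda>w. Poly_Mapping.lookup f w \<odot> \<phi> w \<oplus> Poly_Mapping.lookup g w \<odot> \<phi> w) ?S"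
    using S phi M Poly_Mapping.keys_add[of f g]
    by (subst flift_superset[of ?S]) (auto simp: lookup_add cmod_smult_add intro!: M.add.finprod_cong')
  also have "\<dots> = flift M \<phi> f \<oplus> flift M \<phi> g"
    using S phi by (subst M.finsum_addf) (auto simp: flift_superset[of ?S] Pi_iff)
  finally show ?thesis .
qed

lemma flift_fscale:
  assumes "Poly_Mapping.keys f \<subseteq> W"
  shows "flift M \<phi> (fscale c f) = c \<odot> flift M \<phi> f"
proof -
  let ?S = "Poly_Mapping.keys f"
  have "flift M \<phi> (fscale c f) = finsum M (\<lambda>w. c \<odot> (Poly_Mapping.lookup f w \<odot> \<phi> w)) ?S"
    using assms phi M keys_fscale[of c f]
    by (subst flift_superset[of ?S]) (auto simp: cmod_smult_mult intro!: M.add.finprod_cong')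
  also have "\<dots> = c \<odot> flift M \<phi> f"
    unfolding flift_def using assms phi by (subst M.finsum_smult_ldistr) (auto simp: Pi_iff)
  finally show ?thesis .
qed

lemma flift_single: "w \<in> W \<Longrightarrow> flift M \<phi> (Poly_Mapping.single w c) = c \<odot> \<phi> w"
  using flift_superset[of "{w}" "Poly_Mapping.single w c"] \<phi> by (auto simp: Pi_iff)

lemma flift_zero: "flift M \<phi> 0 = \<zero>"
  by (simp add: flift_def)

lemma flift_diff:
  assumes "Poly_Mapping.keys f \<subseteq> W" "Poly_Mapping.keys g \<subseteq> W"
  shows "flift M \<phi> (f - g) = flift M \<phi> f \<oplus> (-1) \<odot> flift M \<phi> g"
proof -
  have "f - g = f + fscale (-1) g" by (rule poly_mapping_eqI) (simp add: lookup_add lookup_minus)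
  then show ?thesis using assms by (simp only: flift_add flift_fscale keys_fscale_subset)
qed

text \<open>Support and value are treated in one induction, since \<open>flift\<close> is known to
  be additive only on supports inside \<open>W\<close>. The statement on supports is what admits
  arbitrary representatives of a class: they differ from a given one by words in
  \<open>W\<close>.\<close>

lemma flift_span:
  assumes "f \<in> fs.span R" "\<forall>r\<in>R. Poly_Mapping.keys r \<subseteq> W" "\<forall>r\<in>R. flift M \<phi> r = \<zero>"
  shows "Poly_Mapping.keys f \<subseteq> W \<and> flift M \<phi> f = \<zero>"
  using assms(1)
proof (induction rule: fs.span_induct_alt)
  case (step c x y)
  then show ?case
    using assms(2,3) M
    by (simp add: flift_add flift_fscale cmod_simps cmod_closed keys_add_subset keys_fscale_subset)
qed (simp add: flift_zero)

context
  fixes R :: "('w \<Rightarrow>\<^sub>0 complex) set"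
  assumes keys: "\<forall>r\<in>R. Poly_Mapping.keys r \<subseteq> W" and rels: "\<forall>r\<in>R. flift M \<phi> r = \<zero>"
begin

lemma flift_qclass_eq:
  assumes "Poly_Mapping.keys f \<subseteq> W" "f' \<in> qclass R f"
  shows "flift M \<phi> f' = flift M \<phi> f"
proof -
  have *: "Poly_Mapping.keys (f' - f) \<subseteq> W \<and> flift M \<phi> (f' - f) = \<zero>"
    by (rule flift_span[OF _ keys rels]) (use assms in \<open>simp add: qclass_def\<close>)
  have "flift M \<phi> (f + (f' - f)) = flift M \<phi> f"
    using * assms M by (subst flift_add) (auto simp: cmod_simps flift_closed)
  then show ?thesis by simp
qed

lemma qlift_class: "Poly_Mapping.keys f \<subseteq> W \<Longrightarrow> qlift M \<phi> (qclass R f) = flift M \<phi> f"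
proof -
  assume f: "Poly_Mapping.keys f \<subseteq> W"
  have "flift M \<phi> ` qclass R f = {flift M \<phi> f}"
    using flift_qclass_eq[OF f] qclass_self[of f R] by blast
  then show ?thesis by (simp add: qlift_def flift_def[abs_def])
qed

lemma qlift_gen: "w \<in> W \<Longrightarrow> qlift M \<phi> (gen_class R w) = \<phi> w"
  using M \<phi> by (auto simp: gen_class_def qlift_class flift_single cmod_simps Pi_iff)

lemma qlift_lin: "lin (presented W R) M (qlift M \<phi>)"
  by (intro linI; elim presentedE)
     (simp_all add: presented_simps(3,4) qlift_class flift_closed flift_add flift_fscale
        keys_add_subset keys_fscale_subset)

end
end

lemma push_superset:
  assumes "finite S" "Poly_Mapping.keys f \<subseteq> S"
  shows "push \<phi> f = (\<Sum>w\<in>S. Poly_Mapping.single (\<phi> w) (Poly_Mapping.lookup f w))"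
  unfolding push_def by (rule sum.mono_neutral_left) (use assms in \<open>auto simp: in_keys_iff\<close>)

lemma push_add: "push \<phi> (f + g) = push \<phi> f + push \<phi> g"
proof -
  let ?S = "Poly_Mapping.keys f \<union> Poly_Mapping.keys g"
  show ?thesis
    using Poly_Mapping.keys_add[of f g]
    by (simp add: push_superset[of ?S] lookup_add single_add sum.distrib)
qed

lemma push_fscale: "push \<phi> (fscale c f) = fscale c (push \<phi> f)"
  using keys_fscale[of c f] by (simp add: push_superset[of "Poly_Mapping.keys f"] fs.scale_sum_right)

lemma push_single [simp]: "push \<phi> (Poly_Mapping.single w c) = Poly_Mapping.single (\<phi> w) c"
  by (simp add: push_superset[of "{w}"])

lemma push_zero [simp]: "push \<phi> 0 = 0"
  by (simp add: push_def)

lemma push_diff: "push \<phi> (f - g) = push \<phi> f - push \<phi> g"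
  using push_add[of \<phi> "f - g" g] by simp

lemma push_keys: "Poly_Mapping.keys f \<subseteq> W \<Longrightarrow> \<phi> ` W \<subseteq> W' \<Longrightarrow> Poly_Mapping.keys (push \<phi> f) \<subseteq> W'"
proof (induction rule: fs_free_induct)
  case (add f g)
  then show ?case by (simp add: push_add keys_add_subset)
qed auto

lemma push_span:
  assumes "f \<in> fs.span R" "\<forall>r\<in>R. push \<phi> r \<in> fs.span R'"
  shows "push \<phi> f \<in> fs.span R'"
  using assms(1)
  by (induction rule: fs.span_induct_alt) (auto simp: push_add push_fscale fs.span_zero intro!: fs.span_add fs.span_scale assms(2)[rule_format])

lemma qmap_class:
  assumes "\<forall>r\<in>R. push \<phi> r \<in> fs.span R'"
  shows "qmap R' \<phi> (qclass R f) = qclass R' (push \<phi> f)"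
  unfolding qmap_def
proof (rule qclass_Union)
  fix f' assume "f' \<in> qclass R f"
  then have "push \<phi> (f' - f) \<in> fs.span R'"
    by (intro push_span[OF _ assms]) (simp_all add: qclass_def)
  then show "qclass R' (push \<phi> f') = qclass R' (push \<phi> f)"
    by (simp add: qclass_eq_iff push_diff)
qed

lemma qmap_gen:
  assumes "\<forall>r\<in>R. push \<phi> r \<in> fs.span R'"
  shows "qmap R' \<phi> (gen_class R w) = gen_class R' (\<phi> w)"
  by (simp add: gen_class_def qmap_class[OF assms])

lemma qmap_lin:
  assumes "\<forall>r\<in>R. push \<phi> r \<in> fs.span R'" "\<phi> ` W \<subseteq> W'"
  shows "lin (presented W R) (presented W' R') (qmap R' \<phi>)"
  by (intro linI; elim presentedE)
     (simp_all add: presented_simps(3,4) qmap_class[OF assms(1)] push_add push_fscale presentedI push_keys[OF _ assms(2)])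

section \<open>Bimodules\<close>

lemma complex_algebraD:
  fixes B :: "(complex, 'b) module" (structure)
  assumes "complex_algebra B"
  shows "ring B" "cmodule B"
    "x \<in> carrier B \<Longrightarrow> y \<in> carrier B \<Longrightarrow> c \<odot> (x \<otimes> y) = (c \<odot> x) \<otimes> y"
    "x \<in> carrier B \<Longrightarrow> y \<in> carrier B \<Longrightarrow> c \<odot> (x \<otimes> y) = x \<otimes> (c \<odot> y)"
    "x \<in> carrier B \<Longrightarrow> y \<in> carrier B \<Longrightarrow> x \<otimes> y \<in> carrier B"
    "\<one> \<in> carrier B"
    "x \<in> carrier B \<Longrightarrow> \<one> \<otimes> x = x"
    "x \<in> carrier B \<Longrightarrow> x \<otimes> \<one> = x"
    "x \<in> carrier B \<Longrightarrow> y \<in> carrier B \<Longrightarrow> z \<in> carrier B \<Longrightarrow> x \<otimes> y \<otimes> z = x \<otimes> (y \<otimes> z)"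
    "x \<in> carrier B \<Longrightarrow> y \<in> carrier B \<Longrightarrow> z \<in> carrier B \<Longrightarrow> (x \<oplus> y) \<otimes> z = x \<otimes> z \<oplus> y \<otimes> z"
    "x \<in> carrier B \<Longrightarrow> y \<in> carrier B \<Longrightarrow> z \<in> carrier B \<Longrightarrow> z \<otimes> (x \<oplus> y) = z \<otimes> x \<oplus> z \<otimes> y"
    "x \<in> carrier B \<Longrightarrow> \<zero> \<otimes> x = \<zero>"
    "x \<in> carrier B \<Longrightarrow> x \<otimes> \<zero> = \<zero>"
proof -
  interpret complex_algebra B by fact
  show "x \<in> carrier B \<Longrightarrow> x \<otimes> \<one> = x" by (rule monoid.r_one[OF ring.is_monoid[OF complex_algebra.axioms(1)[OF assms]]])
  show "ring B" "cmodule B" by unfold_locales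
  show "x \<in> carrier B \<Longrightarrow> y \<in> carrier B \<Longrightarrow> c \<odot> (x \<otimes> y) = (c \<odot> x) \<otimes> y" by (rule smult_mult_left)
  show "x \<in> carrier B \<Longrightarrow> y \<in> carrier B \<Longrightarrow> c \<odot> (x \<otimes> y) = x \<otimes> (c \<odot> y)" by (rule smult_mult_right)
qed (use complex_algebra.axioms(1)[OF assms] in \<open>auto intro: ring.ring_simprules\<close>)

lemmas calg_closed = complex_algebraD(5,6)
lemmas calg_simps = complex_algebraD(7,8,10-13)

lemma bimoduleD:
  assumes "bimodule B M"
  shows "cmodule M"
    "b \<in> carrier B \<Longrightarrow> lin M M (lact M b)"
    "b \<in> carrier B \<Longrightarrow> lin M M (\<lambda>x. ract M x b)"
    "x \<in> carrier M \<Longrightarrow> lin B M (\<lambda>b. lact M b x)"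
    "x \<in> carrier M \<Longrightarrow> lin B M (\<lambda>b. ract M x b)"
  using assms by (auto simp: bimodule_def)

lemma bimodule_simps:
  assumes "bimodule B M"
  shows "b \<in> carrier B \<Longrightarrow> x \<in> carrier M \<Longrightarrow> lact M b x \<in> carrier M"
    "b \<in> carrier B \<Longrightarrow> x \<in> carrier M \<Longrightarrow> ract M x b \<in> carrier M"
    "b \<in> carrier B \<Longrightarrow> x \<in> carrier M \<Longrightarrow> y \<in> carrier M \<Longrightarrow> lact M b (x \<oplus>\<^bsub>M\<^esub> y) = lact M b x \<oplus>\<^bsub>M\<^esub> lact M b y"
    "b \<in> carrier B \<Longrightarrow> x \<in> carrier M \<Longrightarrow> y \<in> carrier M \<Longrightarrow> ract M (x \<oplus>\<^bsub>M\<^esub> y) b = ract M x b \<oplus>\<^bsub>M\<^esub> ract M y b"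
    "b \<in> carrier B \<Longrightarrow> x \<in> carrier M \<Longrightarrow> lact M b (c \<odot>\<^bsub>M\<^esub> x) = c \<odot>\<^bsub>M\<^esub> lact M b x"
    "b \<in> carrier B \<Longrightarrow> x \<in> carrier M \<Longrightarrow> ract M (c \<odot>\<^bsub>M\<^esub> x) b = c \<odot>\<^bsub>M\<^esub> ract M x b"
    "b \<in> carrier B \<Longrightarrow> b' \<in> carrier B \<Longrightarrow> x \<in> carrier M \<Longrightarrow> lact M (b \<oplus>\<^bsub>B\<^esub> b') x = lact M b x \<oplus>\<^bsub>M\<^esub> lact M b' x"
    "b \<in> carrier B \<Longrightarrow> b' \<in> carrier B \<Longrightarrow> x \<in> carrier M \<Longrightarrow> ract M x (b \<oplus>\<^bsub>B\<^esub> b') = ract M x b \<oplus>\<^bsub>M\<^esub> ract M x b'"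
    "b \<in> carrier B \<Longrightarrow> x \<in> carrier M \<Longrightarrow> lact M (c \<odot>\<^bsub>B\<^esub> b) x = c \<odot>\<^bsub>M\<^esub> lact M b x"
    "b \<in> carrier B \<Longrightarrow> x \<in> carrier M \<Longrightarrow> ract M x (c \<odot>\<^bsub>B\<^esub> b) = c \<odot>\<^bsub>M\<^esub> ract M x b"
    "x \<in> carrier M \<Longrightarrow> lact M \<one>\<^bsub>B\<^esub> x = x"
    "x \<in> carrier M \<Longrightarrow> ract M x \<one>\<^bsub>B\<^esub> = x"
    "b \<in> carrier B \<Longrightarrow> b' \<in> carrier B \<Longrightarrow> x \<in> carrier M \<Longrightarrow> lact M (b \<otimes>\<^bsub>B\<^esub> b') x = lact M b (lact M b' x)"
    "b \<in> carrier B \<Longrightarrow> b' \<in> carrier B \<Longrightarrow> x \<in> carrier M \<Longrightarrow> ract M x (b \<otimes>\<^bsub>B\<^esub> b') = ract M (ract M x b) b'"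
    "b \<in> carrier B \<Longrightarrow> b' \<in> carrier B \<Longrightarrow> x \<in> carrier M \<Longrightarrow> ract M (lact M b x) b' = lact M b (ract M x b')"
  using assms by (auto simp: bimodule_def linear_on_def Pi_iff)

lemma bimodule_zero:
  assumes "bimodule B M" "b \<in> carrier B"
  shows "lact M b \<zero>\<^bsub>M\<^esub> = \<zero>\<^bsub>M\<^esub>" "ract M \<zero>\<^bsub>M\<^esub> b = \<zero>\<^bsub>M\<^esub>"
  using bimoduleD(1,2,3)[OF assms(1)] assms(2) by (auto intro: lin_zero)

lemma bimodule_zero':
  assumes "bimodule B M" "cmodule B" "x \<in> carrier M"
  shows "lact M \<zero>\<^bsub>B\<^esub> x = \<zero>\<^bsub>M\<^esub>" "ract M x \<zero>\<^bsub>B\<^esub> = \<zero>\<^bsub>M\<^esub>"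
  using bimoduleD(1,4,5)[OF assms(1)] assms(2,3) by (auto intro: lin_zero)

lemma cmodule_transfer:
  assumes "cmodule N" "carrier M = carrier N" "add M = add N" "\<zero>\<^bsub>M\<^esub> = \<zero>\<^bsub>N\<^esub>" "Module.smult M = Module.smult N"
  shows "cmodule M"
  by (rule cmoduleI) (use assms(1) in \<open>simp_all add: assms(2-) cmod_closed cmod_simps cmod_assoc, simp add: cmod_comm\<close>)

subsection \<open>Tensor products of two bimodules\<close>

definition bilin ::
  "(complex, 'b) module \<Rightarrow> ('b, 'm) bimod \<Rightarrow> ('b, 'n) bimod \<Rightarrow> (complex, 'p, 'q) module_scheme \<Rightarrow> ('m \<times> 'n \<Rightarrow> 'p) \<Rightarrow> bool" where
  "bilin B M N P \<psi> \<longleftrightarrow>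
     (\<forall>y\<in>carrier N. lin M P (\<lambda>x. \<psi> (x, y))) \<and> (\<forall>x\<in>carrier M. lin N P (\<lambda>y. \<psi> (x, y))) \<and>
     (\<forall>x\<in>carrier M. \<forall>y\<in>carrier N. \<forall>b\<in>carrier B. \<psi> (ract M x b, y) = \<psi> (x, lact N b y))"

lemma tensor_simps:
  "carrier (tensor B M N) = carrier (presented (carrier M \<times> carrier N) (tensor_rels B M N))"
  "add (tensor B M N) = add (presented (carrier M \<times> carrier N) (tensor_rels B M N))"
  "zero (tensor B M N) = zero (presented (carrier M \<times> carrier N) (tensor_rels B M N))"
  "Module.smult (tensor B M N) = Module.smult (presented (carrier M \<times> carrier N) (tensor_rels B M N))"
  by (simp_all add: tensor_def Let_def module.defs bimod.defs)

lemma cmodule_tensor: "cmodule (tensor B M N)"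
  by (rule cmodule_transfer[OF cmodule_presented]) (rule tensor_simps)+

lemma bilinD:
  assumes "bilin B M N P \<psi>"
  shows "x \<in> carrier M \<Longrightarrow> y \<in> carrier N \<Longrightarrow> \<psi> (x, y) \<in> carrier P"
    "x \<in> carrier M \<Longrightarrow> x' \<in> carrier M \<Longrightarrow> y \<in> carrier N \<Longrightarrow> \<psi> (x \<oplus>\<^bsub>M\<^esub> x', y) = \<psi> (x, y) \<oplus>\<^bsub>P\<^esub> \<psi> (x', y)"
    "x \<in> carrier M \<Longrightarrow> y \<in> carrier N \<Longrightarrow> y' \<in> carrier N \<Longrightarrow> \<psi> (x, y \<oplus>\<^bsub>N\<^esub> y') = \<psi> (x, y) \<oplus>\<^bsub>P\<^esub> \<psi> (x, y')"
    "x \<in> carrier M \<Longrightarrow> y \<in> carrier N \<Longrightarrow> \<psi> (c \<odot>\<^bsub>M\<^esub> x, y) = c \<odot>\<^bsub>P\<^esub> \<psi> (x, y)"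
    "x \<in> carrier M \<Longrightarrow> y \<in> carrier N \<Longrightarrow> \<psi> (x, c \<odot>\<^bsub>N\<^esub> y) = c \<odot>\<^bsub>P\<^esub> \<psi> (x, y)"
    "x \<in> carrier M \<Longrightarrow> y \<in> carrier N \<Longrightarrow> b \<in> carrier B \<Longrightarrow> \<psi> (ract M x b, y) = \<psi> (x, lact N b y)"
  using assms by (auto simp: bilin_def linear_on_def Pi_iff)

lemma bilinI:
  assumes "\<And>x y. x \<in> carrier M \<Longrightarrow> y \<in> carrier N \<Longrightarrow> \<psi> (x, y) \<in> carrier P"
    "\<And>x x' y. x \<in> carrier M \<Longrightarrow> x' \<in> carrier M \<Longrightarrow> y \<in> carrier N \<Longrightarrow> \<psi> (x \<oplus>\<^bsub>M\<^esub> x', y) = \<psi> (x, y) \<oplus>\<^bsub>P\<^esub> \<psi> (x', y)"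
    "\<And>x y y'. x \<in> carrier M \<Longrightarrow> y \<in> carrier N \<Longrightarrow> y' \<in> carrier N \<Longrightarrow> \<psi> (x, y \<oplus>\<^bsub>N\<^esub> y') = \<psi> (x, y) \<oplus>\<^bsub>P\<^esub> \<psi> (x, y')"
    "\<And>x y c. x \<in> carrier M \<Longrightarrow> y \<in> carrier N \<Longrightarrow> \<psi> (c \<odot>\<^bsub>M\<^esub> x, y) = c \<odot>\<^bsub>P\<^esub> \<psi> (x, y)"
    "\<And>x y c. x \<in> carrier M \<Longrightarrow> y \<in> carrier N \<Longrightarrow> \<psi> (x, c \<odot>\<^bsub>N\<^esub> y) = c \<odot>\<^bsub>P\<^esub> \<psi> (x, y)"
    "\<And>x y b. x \<in> carrier M \<Longrightarrow> y \<in> carrier N \<Longrightarrow> b \<in> carrier B \<Longrightarrow> \<psi> (ract M x b, y) = \<psi> (x, lact N b y)"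
  shows "bilin B M N P \<psi>"
  using assms by (auto simp: bilin_def intro!: linI)

lemma keys_single_subset: "w \<in> W \<Longrightarrow> Poly_Mapping.keys (Poly_Mapping.single w c) \<subseteq> W"
  by simp

lemma keys_diff_subset:
  "Poly_Mapping.keys f \<subseteq> W \<Longrightarrow> Poly_Mapping.keys g \<subseteq> W \<Longrightarrow> Poly_Mapping.keys (f - g) \<subseteq> W"
  using Poly_Mapping.keys_diff[of f g] by (rule order_trans) simp

lemma bilinear_rels_keys:
  assumes "cmodule M" "cmodule N" "r \<in> bilinear_rels M N"
  shows "Poly_Mapping.keys r \<subseteq> carrier M \<times> carrier N"
  using assms(3)
  by (auto simp: bilinear_rels_def simp del: keys_single simp: cmod_closed[OF assms(1)] cmod_closed[OF assms(2)]
      intro!: keys_diff_subset keys_single_subset del: subsetI)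

lemma tensor_rels_keys:
  assumes "bimodule B M" "bimodule B N" "r \<in> tensor_rels B M N"
  shows "Poly_Mapping.keys r \<subseteq> carrier M \<times> carrier N"
  using assms(3) bilinear_rels_keys[OF bimoduleD(1)[OF assms(1)] bimoduleD(1)[OF assms(2)]]
  by (auto simp: tensor_rels_def simp del: keys_single
      simp: bimodule_simps[OF assms(1)] bimodule_simps[OF assms(2)]
      intro!: keys_diff_subset keys_single_subset del: subsetI)

lemma flift_bilinear_rels:
  assumes M: "cmodule M" and N: "cmodule N" and P: "cmodule P"
    and l1: "\<And>y. y \<in> carrier N \<Longrightarrow> lin M P (\<lambda>x. \<psi> (x, y))"
    and l2: "\<And>x. x \<in> carrier M \<Longrightarrow> lin N P (\<lambda>y. \<psi> (x, y))"
    and r: "r \<in> bilinear_rels M N"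
  shows "flift P \<psi> r = \<zero>\<^bsub>P\<^esub>"
proof -
  have \<psi>: "\<psi> \<in> carrier M \<times> carrier N \<rightarrow> carrier P"
    using linD(1)[OF l1] by auto
  note fl = flift_diff[OF P \<psi>] flift_single[OF P \<psi>] keys_single_subset keys_diff_subset
  have z: "x \<oplus>\<^bsub>P\<^esub> (-1) \<odot>\<^bsub>P\<^esub> x = \<zero>\<^bsub>P\<^esub>" if "x \<in> carrier P" for x
    using cmod_diff_zero_iff[OF P that that] by simp
  have z3: "(x \<oplus>\<^bsub>P\<^esub> y) \<oplus>\<^bsub>P\<^esub> (-1) \<odot>\<^bsub>P\<^esub> x \<oplus>\<^bsub>P\<^esub> (-1) \<odot>\<^bsub>P\<^esub> y = \<zero>\<^bsub>P\<^esub>" if "x \<in> carrier P" "y \<in> carrier P" for x y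
    using that P z[of "x \<oplus>\<^bsub>P\<^esub> y"] by (simp add: cmod_ac cmod_closed cmod_simps)
  from r show ?thesis
    unfolding bilinear_rels_def
  proof (elim UnE CollectE exE conjE, goal_cases)
    case (1 x x' y)
    then show ?case using P
      by (simp add: fl cmod_closed[OF M] cmod_closed[OF N] del: keys_single)
        (simp add: linD[OF l1] cmod_simps cmod_closed z3)
  next
    case (2 x y y')
    then show ?case using P
      by (simp add: fl cmod_closed[OF M] cmod_closed[OF N] del: keys_single)
        (simp add: linD[OF l2] cmod_simps cmod_closed z3)
  next
    case (3 c x y)
    then show ?case using P
      by (simp add: fl cmod_closed[OF M] cmod_closed[OF N] del: keys_single)
        (simp add: linD[OF l1] cmod_simps cmod_closed z)
  next
    case (4 c x y)
    then show ?case using P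
      by (simp add: fl cmod_closed[OF M] cmod_closed[OF N] del: keys_single)
        (simp add: linD[OF l2] cmod_simps cmod_closed z)
  qed
qed

lemma flift_tensor_rels:
  assumes "bimodule B M" "bimodule B N" "cmodule P" "bilin B M N P \<psi>" "r \<in> tensor_rels B M N"
  shows "flift P \<psi> r = \<zero>\<^bsub>P\<^esub>"
  using assms(5) unfolding tensor_rels_def
proof (elim UnE[of _ "bilinear_rels M N"] CollectE exE conjE)
  show "flift P \<psi> r = \<zero>\<^bsub>P\<^esub>" if "r \<in> bilinear_rels M N"
    using assms(4)
    by (intro flift_bilinear_rels[OF bimoduleD(1)[OF assms(1)] bimoduleD(1)[OF assms(2)] assms(3) _ _ that])
      (auto simp: bilin_def)
next
  fix x b y
  assume r: "r = Poly_Mapping.single (ract M x b, y) 1 - Poly_Mapping.single (x, lact N b y) 1"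
    and *: "x \<in> carrier M" "b \<in> carrier B" "y \<in> carrier N"
  have \<psi>: "\<psi> \<in> carrier M \<times> carrier N \<rightarrow> carrier P"
    using bilinD(1)[OF assms(4)] by auto
  note fl = flift_diff[OF assms(3) \<psi>] flift_single[OF assms(3) \<psi>] keys_single_subset keys_diff_subset
  have z: "x \<oplus>\<^bsub>P\<^esub> (-1) \<odot>\<^bsub>P\<^esub> x = \<zero>\<^bsub>P\<^esub>" if "x \<in> carrier P" for x
    using cmod_diff_zero_iff[OF assms(3) that that] by simp
  show "flift P \<psi> r = \<zero>\<^bsub>P\<^esub>"
    unfolding r using assms(3) *
    by (simp add: fl bimodule_simps(1,2)[OF assms(1)] bimodule_simps(1,2)[OF assms(2)] del: keys_single)
      (simp add: bilinD[OF assms(4)] cmod_simps cmod_closed z bimodule_simps(1,2)[OF assms(2)])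
qed

text \<open>The universal property of the tensor product over \<open>B\<close>: a balanced bilinear
  map vanishes on all relations.\<close>

lemma tensor_lift:
  assumes "bimodule B M" "bimodule B N" "cmodule P" "bilin B M N P \<psi>"
  shows "lin (tensor B M N) P (qlift P \<psi>)"
    "x \<in> carrier M \<Longrightarrow> y \<in> carrier N \<Longrightarrow> qlift P \<psi> (gen_class (tensor_rels B M N) (x, y)) = \<psi> (x, y)"
proof -
  have \<psi>: "\<psi> \<in> carrier M \<times> carrier N \<rightarrow> carrier P"
    using bilinD(1)[OF assms(4)] by auto
  have keys: "\<forall>r\<in>tensor_rels B M N. Poly_Mapping.keys r \<subseteq> carrier M \<times> carrier N"
    using tensor_rels_keys[OF assms(1,2)] by blast
  have rels: "\<forall>r\<in>tensor_rels B M N. flift P \<psi> r = \<zero>\<^bsub>P\<^esub>"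
    using flift_tensor_rels[OF assms] by blast
  show "lin (tensor B M N) P (qlift P \<psi>)"
    using qlift_lin[OF assms(3) \<psi> keys rels] by (simp add: linear_on_def tensor_simps)
  show "x \<in> carrier M \<Longrightarrow> y \<in> carrier N \<Longrightarrow> qlift P \<psi> (gen_class (tensor_rels B M N) (x, y)) = \<psi> (x, y)"
    using qlift_gen[OF assms(3) \<psi> keys rels, where w = "(x, y)"] by simp
qed

lemma flift_gen_class:
  assumes "Poly_Mapping.keys f \<subseteq> W" "\<phi> ` W \<subseteq> W'"
  shows "flift (presented W' R') (\<lambda>w. gen_class R' (\<phi> w)) f = qclass R' (push \<phi> f)"
proof -
  have \<phi>: "(\<lambda>w. gen_class R' (\<phi> w)) \<in> W \<rightarrow> carrier (presented W' R')"
    using assms(2) by (auto intro: gen_class_closed)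
  show ?thesis using assms(1)
  proof (induction rule: fs_free_induct)
    case zero then show ?case by (simp add: flift_zero[OF cmodule_presented \<phi>] presented_simps)
  next
    case (add f g)
    then show ?case by (simp add: flift_add[OF cmodule_presented \<phi>] presented_simps push_add)
  next
    case (single w c)
    show ?case unfolding flift_single[OF cmodule_presented \<phi> single]
      by (simp add: gen_class_def presented_simps)
  qed
qed

text \<open>The linear extension of \<open>w \<mapsto> gen_class R' (\<phi> w)\<close> is
  \<open>push \<phi>\<close> followed by the quotient map. So the condition for
  \<open>\<phi>\<close> to descend to quotients becomes the vanishing of a \<open>flift\<close> on
  relations, which is already established for balanced (multi)linear maps; no relation has to be
  pushed forward by hand.\<close>

lemma push_in_span:
  assumes "Poly_Mapping.keys f \<subseteq> W" "\<phi> ` W \<subseteq> W'"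
    and "flift (presented W' R') (\<lambda>w. gen_class R' (\<phi> w)) f = \<zero>\<^bsub>presented W' R'\<^esub>"
  shows "push \<phi> f \<in> fs.span R'"
  using assms by (simp add: flift_gen_class presented_simps qclass_eq_iff)

lemma gen_class_eqI: "Poly_Mapping.single w 1 - Poly_Mapping.single w' 1 \<in> R \<Longrightarrow> gen_class R w = gen_class R w'"
  by (simp add: gen_class_def qclass_eq_iff fs.span_base)

lemma gen_class_addI:
  "Poly_Mapping.single w 1 - Poly_Mapping.single w' 1 - Poly_Mapping.single w'' 1 \<in> R \<Longrightarrow>
    gen_class R w = gen_class R w' \<oplus>\<^bsub>presented W R\<^esub> gen_class R w''"
  by (simp add: gen_class_def presented_simps qclass_eq_iff fs.span_base algebra_simps)

lemma gen_class_smultI: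
  "Poly_Mapping.single w 1 - Poly_Mapping.single w' c \<in> R \<Longrightarrow>
    gen_class R w = c \<odot>\<^bsub>presented W R\<^esub> gen_class R w'"
  by (simp add: gen_class_def presented_simps qclass_eq_iff fs.span_base)

text \<open>The universal balanced map: each required identity is one of the relations that have
  been divided out.\<close>

lemma bilin_gen_class: "bilin B M N (tensor B M N) (gen_class (tensor_rels B M N))"
proof (rule bilinI)
  show "gen_class (tensor_rels B M N) (x, y) \<in> carrier (tensor B M N)"
    if "x \<in> carrier M" "y \<in> carrier N" for x y
    using that by (simp add: tensor_simps gen_class_closed)
  show "gen_class (tensor_rels B M N) (x \<oplus>\<^bsub>M\<^esub> x', y) =
      gen_class (tensor_rels B M N) (x, y) \<oplus>\<^bsub>tensor B M N\<^esub> gen_class (tensor_rels B M N) (x', y)"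
    if "x \<in> carrier M" "x' \<in> carrier M" "y \<in> carrier N" for x x' y
    unfolding tensor_simps by (rule gen_class_addI) (use that in \<open>unfold tensor_rels_def bilinear_rels_def, blast\<close>)
  show "gen_class (tensor_rels B M N) (x, y \<oplus>\<^bsub>N\<^esub> y') =
      gen_class (tensor_rels B M N) (x, y) \<oplus>\<^bsub>tensor B M N\<^esub> gen_class (tensor_rels B M N) (x, y')"
    if "x \<in> carrier M" "y \<in> carrier N" "y' \<in> carrier N" for x y y'
    unfolding tensor_simps by (rule gen_class_addI) (use that in \<open>unfold tensor_rels_def bilinear_rels_def, blast\<close>)
  show "gen_class (tensor_rels B M N) (c \<odot>\<^bsub>M\<^esub> x, y) = c \<odot>\<^bsub>tensor B M N\<^esub> gen_class (tensor_rels B M N) (x, y)"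
    if "x \<in> carrier M" "y \<in> carrier N" for x y c
    unfolding tensor_simps by (rule gen_class_smultI) (use that in \<open>unfold tensor_rels_def bilinear_rels_def, blast\<close>)
  show "gen_class (tensor_rels B M N) (x, c \<odot>\<^bsub>N\<^esub> y) = c \<odot>\<^bsub>tensor B M N\<^esub> gen_class (tensor_rels B M N) (x, y)"
    if "x \<in> carrier M" "y \<in> carrier N" for x y c
    unfolding tensor_simps by (rule gen_class_smultI) (use that in \<open>unfold tensor_rels_def bilinear_rels_def, blast\<close>)
  show "gen_class (tensor_rels B M N) (ract M x b, y) = gen_class (tensor_rels B M N) (x, lact N b y)"
    if "x \<in> carrier M" "y \<in> carrier N" "b \<in> carrier B" for x y b
    by (rule gen_class_eqI) (use that in \<open>unfold tensor_rels_def, blast\<close>)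
qed

lemma spans_tensor: "spans (tensor B M N) (gen_class (tensor_rels B M N) ` (carrier M \<times> carrier N))"
  using spans_presented[of "carrier M \<times> carrier N" "tensor_rels B M N"] by (simp add: spans_def tensor_simps)

lemma tensor_map:
  assumes "bimodule B M" "bimodule B N" "\<phi> ` (carrier M \<times> carrier N) \<subseteq> carrier M' \<times> carrier N'"
    and "bilin B M N (tensor B M' N') (\<lambda>w. gen_class (tensor_rels B M' N') (\<phi> w))"
  shows "lin (tensor B M N) (tensor B M' N') (qmap (tensor_rels B M' N') \<phi>)"
    "qmap (tensor_rels B M' N') \<phi> (gen_class (tensor_rels B M N) w) = gen_class (tensor_rels B M' N') (\<phi> w)"
proof -
  have *: "\<forall>r\<in>tensor_rels B M N. push \<phi> r \<in> fs.span (tensor_rels B M' N')"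
  proof
    fix r assume that: "r \<in> tensor_rels B M N"
    show "push \<phi> r \<in> fs.span (tensor_rels B M' N')"
  proof (rule push_in_span[OF tensor_rels_keys[OF assms(1,2) that] assms(3)])
    have "bilin B M N (presented (carrier M' \<times> carrier N') (tensor_rels B M' N')) (\<lambda>w. gen_class (tensor_rels B M' N') (\<phi> w))"
      using assms(4) by (simp add: bilin_def linear_on_def tensor_simps)
    then show "flift (presented (carrier M' \<times> carrier N') (tensor_rels B M' N')) (\<lambda>w. gen_class (tensor_rels B M' N') (\<phi> w)) r =
        \<zero>\<^bsub>presented (carrier M' \<times> carrier N') (tensor_rels B M' N')\<^esub>"
      by (rule flift_tensor_rels[OF assms(1,2) cmodule_presented _ that])
  qed
  qed
  show "lin (tensor B M N) (tensor B M' N') (qmap (tensor_rels B M' N') \<phi>)"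
    using qmap_lin[OF * assms(3)] by (simp add: linear_on_def tensor_simps)
  show "qmap (tensor_rels B M' N') \<phi> (gen_class (tensor_rels B M N) w) = gen_class (tensor_rels B M' N') (\<phi> w)"
    by (rule qmap_gen[OF *])
qed

subsection \<open>Tensor products of lists\<close>

text \<open>Entries are overwritten by list updates exactly as in \<open>tlist_rels\<close>, so that
  the linearity and balancing conditions match the relations one by one.\<close>

definition multilin ::
  "(complex, 'b) module \<Rightarrow> ('b, 'm) bimod list \<Rightarrow> (complex, 'p, 'q) module_scheme \<Rightarrow> ('m list \<Rightarrow> 'p) \<Rightarrow> bool" where
  "multilin B Ms P \<psi> \<longleftrightarrow>
     (\<forall>xs\<in>tlist_words Ms. \<psi> xs \<in> carrier P) \<and>
     (\<forall>xs\<in>tlist_words Ms. \<forall>i<length Ms. lin (Ms ! i) P (\<lambda>z. \<psi> (xs[i := z]))) \<and>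
     (\<forall>xs\<in>tlist_words Ms. \<forall>i x y b. Suc i < length Ms \<longrightarrow> b \<in> carrier B \<longrightarrow>
        x \<in> carrier (Ms ! i) \<longrightarrow> y \<in> carrier (Ms ! Suc i) \<longrightarrow>
        \<psi> (xs[i := ract (Ms ! i) x b, Suc i := y]) = \<psi> (xs[i := x, Suc i := lact (Ms ! Suc i) b y]))"

abbreviation tgen :: "(complex, 'b) module \<Rightarrow> ('b, 'm) bimod list \<Rightarrow> 'm list \<Rightarrow> ('m list \<Rightarrow>\<^sub>0 complex) set" where
  "tgen B Ms \<equiv> gen_class (tlist_rels B Ms)"

lemma tlist_words_iff: "xs \<in> tlist_words Ms \<longleftrightarrow> length xs = length Ms \<and> (\<forall>i<length Ms. xs ! i \<in> carrier (Ms ! i))"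
  by (auto simp: tlist_words_def list_all2_conv_all_nth)

lemma tlist_words_update: "xs \<in> tlist_words Ms \<Longrightarrow> (i < length Ms \<Longrightarrow> x \<in> carrier (Ms ! i)) \<Longrightarrow> xs[i := x] \<in> tlist_words Ms"
  by (cases "i < length Ms") (auto simp: tlist_words_iff nth_list_update)

lemma tlist_words_Cons [simp]: "x # xs \<in> tlist_words (M # Ms) \<longleftrightarrow> x \<in> carrier M \<and> xs \<in> tlist_words Ms"
  by (simp add: tlist_words_def)

lemma tlist_words_Nil [simp]: "xs \<in> tlist_words [] \<longleftrightarrow> xs = []"
  by (simp add: tlist_words_def)

lemma tlist_words_snoc [simp]: "xs @ [x] \<in> tlist_words (Ms @ [M]) \<longleftrightarrow> x \<in> carrier M \<and> xs \<in> tlist_words Ms"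
  using list_all2_append[of Ms xs "\<lambda>M x. x \<in> carrier M" "[M]" "[x]"] list_all2_lengthD[of "\<lambda>M x. x \<in> carrier M" "Ms @ [M]" "xs @ [x]"]
  by (auto simp: tlist_words_def dest: list_all2_lengthD)

lemma tensor_list_simps:
  "carrier (tensor_list B Ms) = carrier (presented (tlist_words Ms) (tlist_rels B Ms))"
  "add (tensor_list B Ms) = add (presented (tlist_words Ms) (tlist_rels B Ms))"
  "zero (tensor_list B Ms) = zero (presented (tlist_words Ms) (tlist_rels B Ms))"
  "Module.smult (tensor_list B Ms) = Module.smult (presented (tlist_words Ms) (tlist_rels B Ms))"
  "lact (tensor_list B Ms) b = qmap (tlist_rels B Ms) (\<lambda>xs. xs[0 := lact (Ms ! 0) b (xs ! 0)])"
  "ract (tensor_list B Ms) F b = qmap (tlist_rels B Ms)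
     (\<lambda>xs. xs[length Ms - 1 := ract (Ms ! (length Ms - 1)) (xs ! (length Ms - 1)) b]) F"
  by (simp_all add: tensor_list_def Let_def module.defs bimod.defs)

text \<open>Holds for arbitrary lists of records, the empty list included, because any quotient of a
  free space by a span is a module.\<close>

lemma cmodule_tensor_list: "cmodule (tensor_list B Ms)"
  by (rule cmodule_transfer[OF cmodule_presented]) (rule tensor_list_simps)+

lemma tlist_rels_cases [consumes 1, case_names add smult balanced]:
  assumes "r \<in> tlist_rels B Ms"
  obtains (add) xs i x y where "xs \<in> tlist_words Ms" "i < length Ms" "x \<in> carrier (Ms ! i)" "y \<in> carrier (Ms ! i)"
      "r = Poly_Mapping.single (xs[i := x \<oplus>\<^bsub>Ms ! i\<^esub> y]) 1 - Poly_Mapping.single (xs[i := x]) 1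
        - Poly_Mapping.single (xs[i := y]) 1"
  | (smult) xs i c x where "xs \<in> tlist_words Ms" "i < length Ms" "x \<in> carrier (Ms ! i)"
      "r = Poly_Mapping.single (xs[i := c \<odot>\<^bsub>Ms ! i\<^esub> x]) 1 - Poly_Mapping.single (xs[i := x]) c"
  | (balanced) xs i x y b where "xs \<in> tlist_words Ms" "Suc i < length Ms" "b \<in> carrier B"
      "x \<in> carrier (Ms ! i)" "y \<in> carrier (Ms ! Suc i)"
      "r = Poly_Mapping.single (xs[i := ract (Ms ! i) x b, Suc i := y]) 1
        - Poly_Mapping.single (xs[i := x, Suc i := lact (Ms ! Suc i) b y]) 1"
  using assms unfolding tlist_rels_def by blast

context
  fixes B :: "(complex, 'b) module" and Ms :: "('b, 'm) bimod list"
  assumes Ms: "\<And>M. M \<in> set Ms \<Longrightarrow> bimodule B M"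
begin

lemma bimodule_nth: "i < length Ms \<Longrightarrow> bimodule B (Ms ! i)"
  using Ms by simp

lemma nth_cmodule: "i < length Ms \<Longrightarrow> cmodule (Ms ! i)"
  using bimodule_nth bimoduleD(1) by blast

lemma tlist_rels_keys: "r \<in> tlist_rels B Ms \<Longrightarrow> Poly_Mapping.keys r \<subseteq> tlist_words Ms"
  by (erule tlist_rels_cases)
     (auto simp: nth_cmodule cmod_closed bimodule_simps[OF bimodule_nth] simp del: keys_single
       intro!: keys_diff_subset keys_single_subset tlist_words_update del: subsetI)

lemma flift_tlist_rels:
  assumes "cmodule P" "multilin B Ms P \<psi>" "r \<in> tlist_rels B Ms"
  shows "flift P \<psi> r = \<zero>\<^bsub>P\<^esub>"
proof -
  have \<psi>: "\<psi> \<in> tlist_words Ms \<rightarrow> carrier P"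
    using assms(2) by (auto simp: multilin_def)
  note fl = flift_diff[OF assms(1) \<psi>] flift_single[OF assms(1) \<psi>] keys_single_subset keys_diff_subset
  have lin: "lin (Ms ! i) P (\<lambda>z. \<psi> (xs[i := z]))" if "xs \<in> tlist_words Ms" "i < length Ms" for xs i
    using that assms(2) by (auto simp: multilin_def)
  have z: "x \<oplus>\<^bsub>P\<^esub> (-1) \<odot>\<^bsub>P\<^esub> x = \<zero>\<^bsub>P\<^esub>" if "x \<in> carrier P" for x
    using cmod_diff_zero_iff[OF assms(1) that that] by simp
  have z3: "(x \<oplus>\<^bsub>P\<^esub> y) \<oplus>\<^bsub>P\<^esub> (-1) \<odot>\<^bsub>P\<^esub> x \<oplus>\<^bsub>P\<^esub> (-1) \<odot>\<^bsub>P\<^esub> y = \<zero>\<^bsub>P\<^esub>" if "x \<in> carrier P" "y \<in> carrier P" for x y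
    using that assms(1) z[of "x \<oplus>\<^bsub>P\<^esub> y"] by (simp add: cmod_ac cmod_closed cmod_simps)
  from assms(3) show ?thesis
  proof (cases rule: tlist_rels_cases)
    case (add xs i x y)
    have w: "xs[i := z] \<in> tlist_words Ms" if "z \<in> carrier (Ms ! i)" for z
      using add that by (intro tlist_words_update)
    show ?thesis using add(1-4) linD[OF lin[OF add(1,2)]] assms(1) w
      unfolding add(5)
      by (simp add: fl nth_cmodule cmod_closed del: keys_single) (simp add: w \<psi> nth_cmodule cmod_closed cmod_simps z3)
  next
    case (smult xs i c x)
    have w: "xs[i := z] \<in> tlist_words Ms" if "z \<in> carrier (Ms ! i)" for z
      using smult that by (intro tlist_words_update)
    show ?thesis using smult(1-3) linD[OF lin[OF smult(1,2)]] assms(1) w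
      unfolding smult(4)
      by (simp add: fl nth_cmodule cmod_closed del: keys_single) (simp add: w \<psi> nth_cmodule cmod_closed cmod_simps z)
  next
    case (balanced xs i x y b)
    have w: "xs[i := z, Suc i := z'] \<in> tlist_words Ms" if "z \<in> carrier (Ms ! i)" "z' \<in> carrier (Ms ! Suc i)" for z z'
      using balanced that by (intro tlist_words_update)
    have eq: "\<psi> (xs[i := ract (Ms ! i) x b, Suc i := y]) = \<psi> (xs[i := x, Suc i := lact (Ms ! Suc i) b y])"
      using assms(2) balanced(1-5) by (auto simp: multilin_def)
    have i: "i < length Ms" using balanced by simp
    have w': "xs[i := ract (Ms ! i) x b, Suc i := y] \<in> tlist_words Ms"
       "xs[i := x, Suc i := lact (Ms ! Suc i) b y] \<in> tlist_words Ms"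
      using balanced i by (auto intro!: w simp: bimodule_simps[OF bimodule_nth])
    show ?thesis using assms(1) w'
      unfolding balanced(6)
      by (simp add: fl del: keys_single) (simp add: funcset_mem[OF \<psi>] eq z cmod_simps)
  qed
qed

lemma tlist_lift:
  assumes "cmodule P" "multilin B Ms P \<psi>"
  shows "lin (tensor_list B Ms) P (qlift P \<psi>)"
    "xs \<in> tlist_words Ms \<Longrightarrow> qlift P \<psi> (tgen B Ms xs) = \<psi> xs"
proof -
  have \<psi>: "\<psi> \<in> tlist_words Ms \<rightarrow> carrier P"
    using assms(2) by (auto simp: multilin_def)
  have rels: "\<forall>r\<in>tlist_rels B Ms. flift P \<psi> r = \<zero>\<^bsub>P\<^esub>"
    using flift_tlist_rels[OF assms] by blast
  have keys: "\<forall>r\<in>tlist_rels B Ms. Poly_Mapping.keys r \<subseteq> tlist_words Ms"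
    using tlist_rels_keys by blast
  show "lin (tensor_list B Ms) P (qlift P \<psi>)"
    using qlift_lin[OF assms(1) \<psi> keys rels] by (simp add: linear_on_def tensor_list_simps)
  show "xs \<in> tlist_words Ms \<Longrightarrow> qlift P \<psi> (tgen B Ms xs) = \<psi> xs"
    using qlift_gen[OF assms(1) \<psi> keys rels] by simp
qed

lemma tlist_map:
  assumes "\<phi> ` tlist_words Ms \<subseteq> tlist_words Ms'"
    and "multilin B Ms (tensor_list B Ms') (\<lambda>w. tgen B Ms' (\<phi> w))"
  shows "lin (tensor_list B Ms) (tensor_list B Ms') (qmap (tlist_rels B Ms') \<phi>)"
    "qmap (tlist_rels B Ms') \<phi> (tgen B Ms w) = tgen B Ms' (\<phi> w)"
proof -
  have *: "\<forall>r\<in>tlist_rels B Ms. push \<phi> r \<in> fs.span (tlist_rels B Ms')"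
  proof
    fix r assume that: "r \<in> tlist_rels B Ms"
    show "push \<phi> r \<in> fs.span (tlist_rels B Ms')"
  proof (rule push_in_span[OF tlist_rels_keys[OF that] assms(1)])
    have "multilin B Ms (presented (tlist_words Ms') (tlist_rels B Ms')) (\<lambda>w. tgen B Ms' (\<phi> w))"
      using assms(2) by (simp add: multilin_def linear_on_def tensor_list_simps)
    then show "flift (presented (tlist_words Ms') (tlist_rels B Ms')) (\<lambda>w. tgen B Ms' (\<phi> w)) r =
        \<zero>\<^bsub>presented (tlist_words Ms') (tlist_rels B Ms')\<^esub>"
      by (rule flift_tlist_rels[OF cmodule_presented _ that])
  qed
  qed
  show "lin (tensor_list B Ms) (tensor_list B Ms') (qmap (tlist_rels B Ms') \<phi>)"
    using qmap_lin[OF * assms(1)] by (simp add: linear_on_def tensor_list_simps)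
  show "qmap (tlist_rels B Ms') \<phi> (tgen B Ms w) = tgen B Ms' (\<phi> w)"
    by (rule qmap_gen[OF *])
qed

lemma tgen_closed: "xs \<in> tlist_words Ms \<Longrightarrow> tgen B Ms xs \<in> carrier (tensor_list B Ms)"
  by (simp add: tensor_list_simps gen_class_closed)

lemma multilin_tgen: "multilin B Ms (tensor_list B Ms) (tgen B Ms)"
  unfolding multilin_def
proof (intro conjI ballI allI impI)
  fix xs i assume "xs \<in> tlist_words Ms" "i < length Ms"
  then show "lin (Ms ! i) (tensor_list B Ms) (\<lambda>z. tgen B Ms (xs[i := z]))"
    by (intro linI)
       (auto simp: tensor_list_simps tlist_rels_def
          intro!: gen_class_closed tlist_words_update gen_class_addI gen_class_smultI)
next
  fix xs i x y b
  assume "xs \<in> tlist_words Ms" "Suc i < length Ms" "b \<in> carrier B" "x \<in> carrier (Ms ! i)" "y \<in> carrier (Ms ! Suc i)"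
  then show "tgen B Ms (xs[i := ract (Ms ! i) x b, Suc i := y]) = tgen B Ms (xs[i := x, Suc i := lact (Ms ! Suc i) b y])"
    by (auto simp: tlist_rels_def intro!: gen_class_eqI)
qed (rule tgen_closed)

lemma tgen_lin: "xs \<in> tlist_words Ms \<Longrightarrow> i < length Ms \<Longrightarrow> lin (Ms ! i) (tensor_list B Ms) (\<lambda>z. tgen B Ms (xs[i := z]))"
  using multilin_tgen by (auto simp: multilin_def)

lemma tgen_balanced:
  "xs \<in> tlist_words Ms \<Longrightarrow> Suc i < length Ms \<Longrightarrow> b \<in> carrier B \<Longrightarrow> x \<in> carrier (Ms ! i) \<Longrightarrow> y \<in> carrier (Ms ! Suc i) \<Longrightarrow>
    tgen B Ms (xs[i := ract (Ms ! i) x b, Suc i := y]) = tgen B Ms (xs[i := x, Suc i := lact (Ms ! Suc i) b y])"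
  using multilin_tgen unfolding multilin_def by blast

lemma spans_tensor_list: "spans (tensor_list B Ms) (tgen B Ms ` tlist_words Ms)"
  using spans_presented[of "tlist_words Ms" "tlist_rels B Ms"] by (simp add: spans_def tensor_list_simps)

text \<open>Changing one letter of a word. Commutation with the left action matters only if the
  letter has a left neighbour, commutation with the right action only if it has a right neighbour.
  Hence the left action on the first letter and the right action on the last one, each commuting
  with the action on the other side, induce operators on the tensor product.\<close>

lemma multilin_letter_map:
  assumes j: "j < length Ms" and f: "lin (Ms ! j) (Ms ! j) f"
    and l: "\<And>b x. 0 < j \<Longrightarrow> b \<in> carrier B \<Longrightarrow> x \<in> carrier (Ms ! j) \<Longrightarrow> f (lact (Ms ! j) b x) = lact (Ms ! j) b (f x)"
    and r: "\<And>b x. Suc j < length Ms \<Longrightarrow> b \<in> carrier B \<Longrightarrow> x \<in> carrier (Ms ! j) \<Longrightarrow> f (ract (Ms ! j) x b) = ract (Ms ! j) (f x) b"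
  shows "multilin B Ms (tensor_list B Ms) (\<lambda>xs. tgen B Ms (xs[j := f (xs ! j)]))"
    "(\<lambda>xs. xs[j := f (xs ! j)]) ` tlist_words Ms \<subseteq> tlist_words Ms"
proof -
  have w: "xs[j := f (xs ! j)] \<in> tlist_words Ms" if "xs \<in> tlist_words Ms" for xs
    using that j linD(1)[OF f] by (intro tlist_words_update) (auto simp: tlist_words_iff)
  then show "(\<lambda>xs. xs[j := f (xs ! j)]) ` tlist_words Ms \<subseteq> tlist_words Ms" by auto
  show "multilin B Ms (tensor_list B Ms) (\<lambda>xs. tgen B Ms (xs[j := f (xs ! j)]))"
    unfolding multilin_def
  proof (intro conjI ballI allI impI)
    fix xs i assume *: "xs \<in> tlist_words Ms" "i < length Ms"
    show "lin (Ms ! i) (tensor_list B Ms) (\<lambda>z. tgen B Ms (xs[i := z, j := f (xs[i := z] ! j)]))"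
    proof (cases "i = j")
      case True
      have "lin (Ms ! j) (tensor_list B Ms) (\<lambda>z. tgen B Ms (xs[j := f z]))"
        by (rule lin_comp[OF f tgen_lin[OF *(1) j]])
      then show ?thesis using True * by (simp add: tlist_words_iff)
    next
      case False
      then show ?thesis using tgen_lin[OF w[OF *(1)] *(2)] by (simp add: list_update_swap)
    qed
  next
    fix xs i x y b
    assume *: "xs \<in> tlist_words Ms" "Suc i < length Ms" "b \<in> carrier B" "x \<in> carrier (Ms ! i)" "y \<in> carrier (Ms ! Suc i)"
    then have len: "length xs = length Ms" by (simp add: tlist_words_iff)
    consider "i = j" | "Suc i = j" | "i \<noteq> j" "Suc i \<noteq> j" by auto
    then show "tgen B Ms ((xs[i := ract (Ms ! i) x b, Suc i := y])[j := f (xs[i := ract (Ms ! i) x b, Suc i := y] ! j)]) =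
      tgen B Ms ((xs[i := x, Suc i := lact (Ms ! Suc i) b y])[j := f (xs[i := x, Suc i := lact (Ms ! Suc i) b y] ! j)])"
    proof cases
      case 1
      then show ?thesis using tgen_balanced[OF *(1-3), of "f x" y] * len linD(1)[OF f] r[of b x]
        by (simp add: list_update_swap[of "Suc j" j])
    next
      case 2
      then show ?thesis using tgen_balanced[OF *(1-3), of x "f y"] * len linD(1)[OF f] l[of b y]
        by auto
    next
      case 3
      then show ?thesis using tgen_balanced[OF w[OF *(1)] *(2-)] len
        by (simp add: list_update_swap[of _ j])
    qed
  qed (use w tgen_closed in auto)
qed

context
  assumes ne: "Ms \<noteq> []"
begin

lemma tensor_list_lact:
  assumes b: "b \<in> carrier B"
  shows "lin (tensor_list B Ms) (tensor_list B Ms) (lact (tensor_list B Ms) b)"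
    "lact (tensor_list B Ms) b (tgen B Ms xs) = tgen B Ms (xs[0 := lact (Ms ! 0) b (xs ! 0)])"
  unfolding tensor_list_simps(5)
  using ne b
  by (intro tlist_map multilin_letter_map bimoduleD(2)[OF bimodule_nth]; simp add: bimodule_simps[OF bimodule_nth])+

lemma tensor_list_ract:
  assumes b: "b \<in> carrier B"
  shows "lin (tensor_list B Ms) (tensor_list B Ms) (\<lambda>F. ract (tensor_list B Ms) F b)"
    "ract (tensor_list B Ms) (tgen B Ms xs) b =
      tgen B Ms (xs[length Ms - 1 := ract (Ms ! (length Ms - 1)) (xs ! (length Ms - 1)) b])"
  unfolding tensor_list_simps(6)
  using ne b
  by (intro tlist_map multilin_letter_map bimoduleD(3)[OF bimodule_nth]; simp add: bimodule_simps[OF bimodule_nth])+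

lemma tensor_list_bimodule:
  assumes B: "complex_algebra B"
  shows "bimodule B (tensor_list B Ms)"
proof -
  let ?T = "tensor_list B Ms" and ?n = "length Ms - 1"
  note cT = cmodule_tensor_list[of B Ms] and sp = spans_tensor_list
  have n: "0 < length Ms" "?n < length Ms" using ne by auto
  note cB = complex_algebraD(2)[OF B]
  have at: "xs ! 0 \<in> carrier (Ms ! 0)" "xs ! ?n \<in> carrier (Ms ! ?n)" "length xs = length Ms"
    if "xs \<in> tlist_words Ms" for xs
    using that n by (auto simp: tlist_words_iff)
  have l: "lin B ?T (\<lambda>b. lact ?T b F)" if "F \<in> carrier ?T" for F
    using sp that
  proof (induction rule: spans_induct)
    case (gen F)
    then obtain xs where xs: "xs \<in> tlist_words Ms" "F = tgen B Ms xs" by auto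
    have "lin B ?T (\<lambda>b. tgen B Ms (xs[0 := lact (Ms ! 0) b (xs ! 0)]))"
      by (rule lin_comp[OF bimoduleD(4)[OF bimodule_nth] tgen_lin]) (use n at xs in auto)
    then show ?case
      by (rule lin_cong[OF _ cB, THEN iffD1, rotated]) (simp add: xs tensor_list_lact)
  next
    case zero
    have "lin B ?T (\<lambda>b. \<zero>\<^bsub>?T\<^esub>)" by (intro linI) (simp_all add: cT cmod_closed cmod_simps)
    then show ?case
      by (rule lin_cong[OF _ cB, THEN iffD1, rotated]) (simp add: lin_zero[OF cT cT tensor_list_lact(1)])
  next
    case (add F G)
    from lin_add[OF cT add(3,4)] show ?case
      by (rule lin_cong[OF _ cB, THEN iffD1, rotated]) (simp add: add linD[OF tensor_list_lact(1)])
  next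
    case (smult c F)
    from lin_smult[OF cT smult(2)] show ?case
      by (rule lin_cong[OF _ cB, THEN iffD1, rotated]) (simp add: smult linD[OF tensor_list_lact(1)])
  qed
  have r: "lin B ?T (\<lambda>b. ract ?T F b)" if "F \<in> carrier ?T" for F
    using sp that
  proof (induction rule: spans_induct)
    case (gen F)
    then obtain xs where xs: "xs \<in> tlist_words Ms" "F = tgen B Ms xs" by auto
    have "lin B ?T (\<lambda>b. tgen B Ms (xs[?n := ract (Ms ! ?n) (xs ! ?n) b]))"
      by (rule lin_comp[OF bimoduleD(5)[OF bimodule_nth] tgen_lin]) (use n at xs in auto)
    then show ?case
      by (rule lin_cong[OF _ cB, THEN iffD1, rotated]) (simp add: xs tensor_list_ract)
  next
    case zero
    have "lin B ?T (\<lambda>b. \<zero>\<^bsub>?T\<^esub>)" by (intro linI) (simp_all add: cT cmod_closed cmod_simps)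
    then show ?case
      by (rule lin_cong[OF _ cB, THEN iffD1, rotated]) (simp add: lin_zero[OF cT cT tensor_list_ract(1)])
  next
    case (add F G)
    from lin_add[OF cT add(3,4)] show ?case
      by (rule lin_cong[OF _ cB, THEN iffD1, rotated]) (simp add: add linD[OF tensor_list_ract(1)])
  next
    case (smult c F)
    from lin_smult[OF cT smult(2)] show ?case
      by (rule lin_cong[OF _ cB, THEN iffD1, rotated]) (simp add: smult linD[OF tensor_list_ract(1)])
  qed
  have id: "lin ?T ?T (\<lambda>F. F)" by (rule linI) simp_all
  note eq = lin_eqI[OF sp cT cT]
  note lc = lin_comp[OF tensor_list_lact(1) tensor_list_lact(1)]
    lin_comp[OF tensor_list_ract(1) tensor_list_ract(1)]
    lin_comp[OF tensor_list_ract(1) tensor_list_lact(1)]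
    lin_comp[OF tensor_list_lact(1) tensor_list_ract(1)]
  note bs = bimodule_simps[OF bimodule_nth[OF n(1)]] bimodule_simps[OF bimodule_nth[OF n(2)]]
  show ?thesis
    unfolding bimodule_def
  proof (intro conjI ballI cT l r tensor_list_lact(1) tensor_list_ract(1))
    fix F assume F: "F \<in> carrier ?T"
    show "lact ?T \<one>\<^bsub>B\<^esub> F = F"
      by (rule eq[OF tensor_list_lact(1) id _ F])
         (auto simp: tensor_list_lact bs at calg_closed[OF B])
    show "ract ?T F \<one>\<^bsub>B\<^esub> = F"
      by (rule eq[OF tensor_list_ract(1) id _ F])
         (use n in \<open>auto simp: tensor_list_ract bs at calg_closed[OF B] simp del: One_nat_def\<close>)
  next
    fix b c F assume bc: "b \<in> carrier B" "c \<in> carrier B" and F: "F \<in> carrier ?T"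
    show "lact ?T (b \<otimes>\<^bsub>B\<^esub> c) F = lact ?T b (lact ?T c F)"
      by (rule eq[OF tensor_list_lact(1) lc(1) _ F])
         (use n bc in \<open>auto simp: tensor_list_lact bs at calg_closed[OF B]\<close>)
    show "ract ?T F (b \<otimes>\<^bsub>B\<^esub> c) = ract ?T (ract ?T F b) c"
      by (rule eq[OF tensor_list_ract(1) lc(2) _ F])
         (use n bc in \<open>auto simp: tensor_list_ract bs at calg_closed[OF B] simp del: One_nat_def\<close>)
    show "ract ?T (lact ?T b F) c = lact ?T b (ract ?T F c)"
    proof (rule eq[OF lc(4) lc(3) _ F])
      fix G assume "G \<in> tgen B Ms ` tlist_words Ms"
      then obtain xs where xs: "xs \<in> tlist_words Ms" "G = tgen B Ms xs" by auto
      show "ract ?T (lact ?T b G) c = lact ?T b (ract ?T G c)"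
      \<comment> \<open>For a single letter both actions hit the same entry and the claim is the
        compatibility in that letter; otherwise they change different entries.\<close>
      proof (cases "?n = 0")
        case True
        then show ?thesis using bc n at[OF xs(1)] unfolding xs(2)
          by (simp add: tensor_list_lact tensor_list_ract bs del: One_nat_def)
      next
        case False
        then show ?thesis using bc n at[OF xs(1)] unfolding xs(2)
          by (simp add: tensor_list_lact tensor_list_ract list_update_swap[of 0] del: One_nat_def)
      qed
    qed (use bc in auto)
  qed
qed

end
end

subsection \<open>Direct sums\<close>

lemma direct_sum_simps:
  "\<zero>\<^bsub>direct_sum I M\<^esub> = (\<lambda>i. \<zero>\<^bsub>M i\<^esub>)"
  "f \<oplus>\<^bsub>direct_sum I M\<^esub> g = (\<lambda>i. f i \<oplus>\<^bsub>M i\<^esub> g i)"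
  "c \<odot>\<^bsub>direct_sum I M\<^esub> f = (\<lambda>i. c \<odot>\<^bsub>M i\<^esub> f i)"
  "lact (direct_sum I M) b f = (\<lambda>i. lact (M i) b (f i))"
  "ract (direct_sum I M) f b = (\<lambda>i. ract (M i) (f i) b)"
  by (simp_all add: direct_sum_def)

lemma direct_sum_carrier:
  "f \<in> carrier (direct_sum I M) \<longleftrightarrow> (\<forall>i\<in>I. f i \<in> carrier (M i)) \<and> (\<forall>i. i \<notin> I \<longrightarrow> f i = \<zero>\<^bsub>M i\<^esub>) \<and>
     finite {i. f i \<noteq> \<zero>\<^bsub>M i\<^esub>}"
  by (simp add: direct_sum_def)

definition dsingle :: "('i \<Rightarrow> ('b, 'm) bimod) \<Rightarrow> 'i \<Rightarrow> 'm \<Rightarrow> 'i \<Rightarrow> 'm" where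
  "dsingle M i t = (\<lambda>j. if j = i then t else \<zero>\<^bsub>M j\<^esub>)"

context
  fixes M :: "'i \<Rightarrow> ('b, 'm) bimod"
  assumes M: "\<And>i. cmodule (M i)"
begin

lemma direct_sum_nth: "f \<in> carrier (direct_sum I M) \<Longrightarrow> f i \<in> carrier (M i)"
  by (cases "i \<in> I") (auto simp: direct_sum_carrier cmod_closed[OF M])

lemma direct_sumI:
  assumes "\<And>i. i \<in> I \<Longrightarrow> f i \<in> carrier (M i)" "\<And>i. i \<notin> I \<Longrightarrow> f i = \<zero>\<^bsub>M i\<^esub>"
    "{i. f i \<noteq> \<zero>\<^bsub>M i\<^esub>} \<subseteq> S" "finite S"
  shows "f \<in> carrier (direct_sum I M)"
  using assms by (auto simp: direct_sum_carrier intro: finite_subset)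

lemma direct_sum_finite: "f \<in> carrier (direct_sum I M) \<Longrightarrow> finite {i. f i \<noteq> \<zero>\<^bsub>M i\<^esub>}"
  by (simp add: direct_sum_carrier)

lemma cmodule_direct_sum: "cmodule (direct_sum I M)"
proof (rule cmoduleI)
  fix f g assume f: "f \<in> carrier (direct_sum I M)" and g: "g \<in> carrier (direct_sum I M)"
  show "f \<oplus>\<^bsub>direct_sum I M\<^esub> g \<in> carrier (direct_sum I M)"
    by (rule direct_sumI[where S = "{i. f i \<noteq> \<zero>\<^bsub>M i\<^esub>} \<union> {i. g i \<noteq> \<zero>\<^bsub>M i\<^esub>}"])
       (use f g in \<open>auto simp: direct_sum_carrier direct_sum_simps cmod_closed[OF M] cmod_simps[OF M]\<close>)
next
  fix f c assume f: "f \<in> carrier (direct_sum I M)"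
  show "c \<odot>\<^bsub>direct_sum I M\<^esub> f \<in> carrier (direct_sum I M)"
    by (rule direct_sumI[where S = "{i. f i \<noteq> \<zero>\<^bsub>M i\<^esub>}"])
       (use f in \<open>auto simp: direct_sum_carrier direct_sum_simps cmod_closed[OF M] cmod_simps[OF M]\<close>)
next
  show "f \<oplus>\<^bsub>direct_sum I M\<^esub> g = g \<oplus>\<^bsub>direct_sum I M\<^esub> f"
    if "f \<in> carrier (direct_sum I M)" "g \<in> carrier (direct_sum I M)" for f g
    using that by (simp add: direct_sum_simps direct_sum_nth cmod_comm[OF M])
qed (simp_all add: direct_sum_simps direct_sum_nth cmod_simps[OF M] cmod_assoc[OF M],
     simp add: direct_sum_carrier cmod_closed[OF M])

text \<open>Outside \<open>I\<close> only zero vectors occur, so there the actions merely have to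
  fix zero. In the free product the empty list is such an index.\<close>

lemma bimodule_direct_sum:
  assumes act: "\<And>i b. b \<in> carrier B \<Longrightarrow> lact (M i) b \<zero>\<^bsub>M i\<^esub> = \<zero>\<^bsub>M i\<^esub>" "\<And>i b. b \<in> carrier B \<Longrightarrow> ract (M i) \<zero>\<^bsub>M i\<^esub> b = \<zero>\<^bsub>M i\<^esub>"
    and MB: "\<And>i. i \<in> I \<Longrightarrow> bimodule B (M i)" and B: "complex_algebra B"
  shows "bimodule B (direct_sum I M)"
proof -
  let ?D = "direct_sum I M"
  have l: "lact ?D b f \<in> carrier ?D" if "b \<in> carrier B" "f \<in> carrier ?D" for b f
    by (rule direct_sumI[where S = "{i. f i \<noteq> \<zero>\<^bsub>M i\<^esub>}"])
       (use that in \<open>auto simp: direct_sum_carrier direct_sum_simps act bimodule_simps[OF MB]\<close>)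
  have r: "ract ?D f b \<in> carrier ?D" if "b \<in> carrier B" "f \<in> carrier ?D" for b f
    by (rule direct_sumI[where S = "{i. f i \<noteq> \<zero>\<^bsub>M i\<^esub>}"])
       (use that in \<open>auto simp: direct_sum_carrier direct_sum_simps act bimodule_simps[OF MB]\<close>)
  have *: "P i (f i)" if "f \<in> carrier ?D" "\<And>x. i \<in> I \<Longrightarrow> x \<in> carrier (M i) \<Longrightarrow> P i x" "i \<notin> I \<Longrightarrow> P i \<zero>\<^bsub>M i\<^esub>" for P i f
    using that by (cases "i \<in> I") (auto simp: direct_sum_carrier)
  have **: "P i (f i) (g i)" if "f \<in> carrier ?D" "g \<in> carrier ?D"
    "\<And>x y. i \<in> I \<Longrightarrow> x \<in> carrier (M i) \<Longrightarrow> y \<in> carrier (M i) \<Longrightarrow> P i x y" "i \<notin> I \<Longrightarrow> P i \<zero>\<^bsub>M i\<^esub> \<zero>\<^bsub>M i\<^esub>" for P i f g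
    using that by (cases "i \<in> I") (auto simp: direct_sum_carrier)
  note s = bimodule_simps[OF MB] act cmod_simps[OF M] cmod_closed[OF M]
    cmod_closed[OF complex_algebraD(2)[OF B]] calg_closed[OF B]
  show ?thesis
    unfolding bimodule_def
  proof (intro conjI ballI linI cmodule_direct_sum l r, simp_all add: direct_sum_simps fun_eq_iff, safe)
  qed ((erule * **, simp_all add: s)+)
qed

lemma dsingle_lin: "i \<in> I \<Longrightarrow> lin (M i) (direct_sum I M) (dsingle M i)"
  by (intro linI direct_sumI[where S = "{i}"])
     (auto simp: dsingle_def direct_sum_simps cmod_simps[OF M] cmod_closed[OF M] fun_eq_iff)

text \<open>Induction over a finite set containing the support: one component at a time is replaced
  by zero and restored as a \<open>dsingle\<close>.\<close>

lemma spans_direct_sum: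
  assumes G: "\<And>i. i \<in> I \<Longrightarrow> spans (M i) (G i)"
  shows "spans (direct_sum I M) (\<Union>i\<in>I. dsingle M i ` G i)"
proof (rule spansI)
  let ?D = "direct_sum I M"
  show "(\<Union>i\<in>I. dsingle M i ` G i) \<subseteq> carrier ?D"
    using G dsingle_lin by (fastforce simp: spans_def linear_on_def)
  fix P f assume f: "f \<in> carrier ?D"
    and P: "\<And>x. x \<in> (\<Union>i\<in>I. dsingle M i ` G i) \<Longrightarrow> P x" "P \<zero>\<^bsub>?D\<^esub>"
      "\<And>x y. x \<in> carrier ?D \<Longrightarrow> y \<in> carrier ?D \<Longrightarrow> P x \<Longrightarrow> P y \<Longrightarrow> P (x \<oplus>\<^bsub>?D\<^esub> y)"
      "\<And>c x. x \<in> carrier ?D \<Longrightarrow> P x \<Longrightarrow> P (c \<odot>\<^bsub>?D\<^esub> x)"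
  have single: "P (dsingle M i t)" if i: "i \<in> I" and t: "t \<in> carrier (M i)" for i t
    using G[OF i] t
  proof (induction rule: spans_induct)
    case zero then show ?case using lin_zero[OF M cmodule_direct_sum dsingle_lin[OF i]] P(2) by simp
  qed (use P i linD[OF dsingle_lin[OF i]] in auto)
  have "finite S \<Longrightarrow> f \<in> carrier ?D \<Longrightarrow> {i. f i \<noteq> \<zero>\<^bsub>M i\<^esub>} \<subseteq> S \<Longrightarrow> P f" for S f
  proof (induction S arbitrary: f rule: finite_induct)
    case empty
    then have "f = \<zero>\<^bsub>?D\<^esub>" by (auto simp: direct_sum_simps)
    then show ?case using P(2) by simp
  next
    case (insert i S f)
    let ?g = "f(i := \<zero>\<^bsub>M i\<^esub>)"
    have g: "?g \<in> carrier ?D"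
      by (rule direct_sumI[where S = "{i. f i \<noteq> \<zero>\<^bsub>M i\<^esub>}"])
         (use insert.prems(1) in \<open>auto simp: direct_sum_carrier cmod_closed[OF M]\<close>)
    have Pg: "P ?g" by (rule insert.IH[OF g]) (use insert.prems in auto)
    show ?case
    proof (cases "i \<in> I")
      case True
      have "f = dsingle M i (f i) \<oplus>\<^bsub>?D\<^esub> ?g"
        using direct_sum_nth[OF insert.prems(1)]
        by (auto simp: direct_sum_simps dsingle_def fun_eq_iff cmod_simps[OF M] cmod_closed[OF M])
      then show ?thesis
        using P(3)[OF linD(1)[OF dsingle_lin[OF True]] g single[OF True] Pg, of "f i"] direct_sum_nth[OF insert.prems(1)]
        by metis
    next
      case False
      then have "?g = f" using insert.prems(1) by (auto simp: direct_sum_carrier)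
      then show ?thesis using Pg by simp
    qed
  qed
  then show "P f" using f direct_sum_finite[OF f] by blast
qed

text \<open>The universal property of the direct sum. The sum runs over the support, which varies
  with the vector, so the proofs pass to larger finite sets of indices.\<close>

definition dlift :: "(complex, 'p, 'q) module_scheme \<Rightarrow> ('i \<Rightarrow> 'm \<Rightarrow> 'p) \<Rightarrow> ('i \<Rightarrow> 'm) \<Rightarrow> 'p" where
  "dlift N \<theta> f = finsum N (\<lambda>i. \<theta> i (f i)) {i. f i \<noteq> \<zero>\<^bsub>M i\<^esub>}"

lemma dlift_lin:
  assumes N: "cmodule N" and \<theta>: "\<And>i. i \<in> I \<Longrightarrow> lin (M i) N (\<theta> i)"
  shows "lin (direct_sum I M) N (dlift N \<theta>)"
    "i \<in> I \<Longrightarrow> t \<in> carrier (M i) \<Longrightarrow> dlift N \<theta> (dsingle M i t) = \<theta> i t"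
proof -
  interpret N: Module.module complex_ring N by (rule N)
  let ?D = "direct_sum I M"
  have cl: "\<theta> i (f i) \<in> carrier N" if "f \<in> carrier ?D" "i \<in> I" for f i
    using linD(1)[OF \<theta>[OF that(2)]] direct_sum_nth[OF that(1)] by blast
  have z: "\<theta> i \<zero>\<^bsub>M i\<^esub> = \<zero>\<^bsub>N\<^esub>" if "i \<in> I" for i
    by (rule lin_zero[OF M N \<theta>[OF that]])
  have sup: "{i. f i \<noteq> \<zero>\<^bsub>M i\<^esub>} \<subseteq> I" if "f \<in> carrier ?D" for f
    using that by (auto simp: direct_sum_carrier)
  have ext: "dlift N \<theta> f = finsum N (\<lambda>i. \<theta> i (f i)) S"
    if "f \<in> carrier ?D" "finite S" "{i. f i \<noteq> \<zero>\<^bsub>M i\<^esub>} \<subseteq> S" "S \<subseteq> I" for f S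
    unfolding dlift_def
    by (rule N.add.finprod_mono_neutral_cong_left) (use that cl[OF that(1)] z in auto)
  show "lin ?D N (dlift N \<theta>)"
  proof (rule linI)
    fix f assume f: "f \<in> carrier ?D"
    show "dlift N \<theta> f \<in> carrier N"
      unfolding dlift_def using cl[OF f] sup[OF f] by (intro N.finsum_closed) auto
    fix c
    let ?S = "{i. f i \<noteq> \<zero>\<^bsub>M i\<^esub>}"
    have "dlift N \<theta> (c \<odot>\<^bsub>?D\<^esub> f) = finsum N (\<lambda>i. c \<odot>\<^bsub>N\<^esub> \<theta> i (f i)) ?S"
    proof -
      have "dlift N \<theta> (c \<odot>\<^bsub>?D\<^esub> f) = finsum N (\<lambda>i. \<theta> i ((c \<odot>\<^bsub>?D\<^esub> f) i)) ?S"
        using f sup[OF f] direct_sum_finite[OF f]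
        by (intro ext cmod_closed(3)[OF cmodule_direct_sum]) (auto simp: direct_sum_simps cmod_simps[OF M])
      also have "\<dots> = finsum N (\<lambda>i. c \<odot>\<^bsub>N\<^esub> \<theta> i (f i)) ?S"
        by (rule N.add.finprod_cong') (use f sup[OF f] cl[OF f] in \<open>auto simp: direct_sum_simps linD[OF \<theta>] direct_sum_nth\<close>)
      finally show ?thesis .
    qed
    also have "\<dots> = c \<odot>\<^bsub>N\<^esub> dlift N \<theta> f"
      unfolding dlift_def using cl[OF f] sup[OF f] direct_sum_finite[OF f]
      by (subst N.finsum_smult_ldistr) auto
    finally show "dlift N \<theta> (c \<odot>\<^bsub>?D\<^esub> f) = c \<odot>\<^bsub>N\<^esub> dlift N \<theta> f" .
  next
    fix f g assume f: "f \<in> carrier ?D" and g: "g \<in> carrier ?D"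
    let ?S = "{i. f i \<noteq> \<zero>\<^bsub>M i\<^esub>} \<union> {i. g i \<noteq> \<zero>\<^bsub>M i\<^esub>}"
    have S: "finite ?S" "?S \<subseteq> I" using sup[OF f] sup[OF g] direct_sum_finite[OF f] direct_sum_finite[OF g] by auto
    have "dlift N \<theta> (f \<oplus>\<^bsub>?D\<^esub> g) = finsum N (\<lambda>i. \<theta> i (f i) \<oplus>\<^bsub>N\<^esub> \<theta> i (g i)) ?S"
    proof -
      have "dlift N \<theta> (f \<oplus>\<^bsub>?D\<^esub> g) = finsum N (\<lambda>i. \<theta> i ((f \<oplus>\<^bsub>?D\<^esub> g) i)) ?S"
        using f g S
        by (intro ext cmod_closed(1)[OF cmodule_direct_sum]) (auto simp: direct_sum_simps cmod_simps[OF M] cmod_closed[OF M])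
      also have "\<dots> = finsum N (\<lambda>i. \<theta> i (f i) \<oplus>\<^bsub>N\<^esub> \<theta> i (g i)) ?S"
        using subsetD[OF S(2)] cl[OF f] cl[OF g] linD(2)[OF \<theta>] direct_sum_nth[OF f] direct_sum_nth[OF g]
        by (intro N.add.finprod_cong') (auto simp: direct_sum_simps)
      finally show ?thesis .
    qed
    also have "\<dots> = dlift N \<theta> f \<oplus>\<^bsub>N\<^esub> dlift N \<theta> g"
      using f g S cl[OF f] cl[OF g]
      by (subst N.finsum_addf) (auto simp: ext[of _ ?S])
    finally show "dlift N \<theta> (f \<oplus>\<^bsub>?D\<^esub> g) = dlift N \<theta> f \<oplus>\<^bsub>N\<^esub> dlift N \<theta> g" .
  qed
  show "dlift N \<theta> (dsingle M i t) = \<theta> i t" if "i \<in> I" "t \<in> carrier (M i)"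
    using that linD(1)[OF dsingle_lin[OF that(1)] that(2)] linD(1)[OF \<theta>]
    by (subst ext[of _ "{i}"]) (auto simp: dsingle_def)
qed

end

subsection \<open>Bimodules with a projection onto \<open>B\<close>\<close>

lemma with_proj_simps:
  "carrier (with_proj B X) = carrier B \<times> carrier X"
  "\<zero>\<^bsub>with_proj B X\<^esub> = (\<zero>\<^bsub>B\<^esub>, \<zero>\<^bsub>X\<^esub>)"
  "(b, x) \<oplus>\<^bsub>with_proj B X\<^esub> (c, y) = (b \<oplus>\<^bsub>B\<^esub> c, x \<oplus>\<^bsub>X\<^esub> y)"
  "a \<odot>\<^bsub>with_proj B X\<^esub> (b, x) = (a \<odot>\<^bsub>B\<^esub> b, a \<odot>\<^bsub>X\<^esub> x)"
  "lact (with_proj B X) c (b, x) = (c \<otimes>\<^bsub>B\<^esub> b, lact X c x)"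
  "ract (with_proj B X) (b, x) c = (b \<otimes>\<^bsub>B\<^esub> c, ract X x c)"
  by (simp_all add: with_proj_def)

context
  fixes B :: "(complex, 'b) module" and X :: "('b, 'm) bimod"
  assumes B: "complex_algebra B" and X: "bimodule B X"
begin

lemma cmodule_with_proj: "cmodule (with_proj B X)"
  by (rule cmoduleI)
     (auto simp: with_proj_simps cmod_closed cmod_simps cmod_assoc complex_algebraD(2)[OF B] bimoduleD(1)[OF X]
       intro: cmod_comm[OF complex_algebraD(2)[OF B]] cmod_comm[OF bimoduleD(1)[OF X]])

lemma bimodule_with_proj: "bimodule B (with_proj B X)"
  unfolding bimodule_def
  by (intro conjI ballI linI cmodule_with_proj)
     (auto simp: with_proj_simps calg_closed[OF B] calg_simps[OF B] complex_algebraD(9)[OF B]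
       cmod_closed[OF complex_algebraD(2)[OF B]] bimodule_simps[OF X]
       complex_algebraD(3)[OF B, symmetric] complex_algebraD(4)[OF B, symmetric])

lemma with_proj_lin:
  "lin B (with_proj B X) (\<lambda>b. (b, \<zero>\<^bsub>X\<^esub>))"
  "lin X (with_proj B X) (Pair \<zero>\<^bsub>B\<^esub>)"
  "lin (with_proj B X) B fst"
  "lin (with_proj B X) X snd"
  by (intro linI;
      auto simp: with_proj_simps cmod_closed cmod_simps complex_algebraD(2)[OF B] bimoduleD(1)[OF X])+

lemma with_proj_split:
  "b \<in> carrier B \<Longrightarrow> x \<in> carrier X \<Longrightarrow> (b, x) = (b, \<zero>\<^bsub>X\<^esub>) \<oplus>\<^bsub>with_proj B X\<^esub> (\<zero>\<^bsub>B\<^esub>, x)"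
  by (simp add: with_proj_simps cmod_simps complex_algebraD(2)[OF B] bimoduleD(1)[OF X])

lemma spans_with_proj:
  assumes G: "spans X G"
  shows "spans (with_proj B X) ((\<lambda>b. (b, \<zero>\<^bsub>X\<^esub>)) ` carrier B \<union> Pair \<zero>\<^bsub>B\<^esub> ` G)"
proof (rule spansI)
  let ?D = "with_proj B X"
  note cB = complex_algebraD(2)[OF B] and cX = bimoduleD(1)[OF X]
  show "(\<lambda>b. (b, \<zero>\<^bsub>X\<^esub>)) ` carrier B \<union> Pair \<zero>\<^bsub>B\<^esub> ` G \<subseteq> carrier ?D"
    using G by (auto simp: spans_def with_proj_simps cmod_closed cB cX)
  fix P f assume f: "f \<in> carrier ?D"
    and P: "\<And>x. x \<in> (\<lambda>b. (b, \<zero>\<^bsub>X\<^esub>)) ` carrier B \<union> Pair \<zero>\<^bsub>B\<^esub> ` G \<Longrightarrow> P x" "P \<zero>\<^bsub>?D\<^esub>"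
      "\<And>x y. x \<in> carrier ?D \<Longrightarrow> y \<in> carrier ?D \<Longrightarrow> P x \<Longrightarrow> P y \<Longrightarrow> P (x \<oplus>\<^bsub>?D\<^esub> y)"
      "\<And>c x. x \<in> carrier ?D \<Longrightarrow> P x \<Longrightarrow> P (c \<odot>\<^bsub>?D\<^esub> x)"
  obtain b x where bx: "f = (b, x)" "b \<in> carrier B" "x \<in> carrier X" using f by (auto simp: with_proj_simps)
  have "P (\<zero>\<^bsub>B\<^esub>, x)" using G bx(3)
  proof (induction rule: spans_induct)
    case zero then show ?case using P(2) by (simp add: with_proj_simps)
  next
    case (add x y)
    then show ?case using P(3)[of "(\<zero>\<^bsub>B\<^esub>, x)" "(\<zero>\<^bsub>B\<^esub>, y)"] by (simp add: with_proj_simps cB cmod_closed cmod_simps)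
  next
    case (smult c x)
    then show ?case using P(4)[of "(\<zero>\<^bsub>B\<^esub>, x)" c] by (simp add: with_proj_simps cB cmod_closed cmod_simps)
  qed (use P in auto)
  moreover have "P (b, \<zero>\<^bsub>X\<^esub>)" using P(1) bx by auto
  ultimately show "P f"
    using P(3)[of "(b, \<zero>\<^bsub>X\<^esub>)" "(\<zero>\<^bsub>B\<^esub>, x)"] bx
    by (simp add: with_proj_simps cB cX cmod_closed cmod_simps)
qed

end

section \<open>The reduced free product\<close>

lemma Nil_tlist_words [simp]: "[] \<notin> tlist_words (M # Ms)"
  by (simp add: tlist_words_def)

text \<open>All \<open>X k\<close> are bimodules, also for \<open>k\<close> outside
  \<open>K\<close>, so that statements about single words carry no membership conditions.\<close>

locale bimodule_family =
  fixes B :: "(complex, 'b) module" and K :: "'k set" and X :: "'k \<Rightarrow> ('b, 'x) bimod"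
  assumes B: "complex_algebra B" and X: "\<And>k. bimodule B (X k)"
begin

abbreviation "T ks \<equiv> tensor_list B (map X ks)"
abbreviation "tg ks xs \<equiv> tgen B (map X ks) xs"
abbreviation "wds ks \<equiv> tlist_words (map X ks)"
abbreviation "Y k \<equiv> with_proj B (X k)"
abbreviation "FP I \<equiv> with_proj B (fp_part B X I)"
abbreviation "FM \<equiv> fp_mod B K X"
abbreviation "single ks t \<equiv> (\<zero>\<^bsub>B\<^esub>, dsingle T ks t)"
abbreviation "unit \<equiv> (\<one>\<^bsub>B\<^esub>, \<lambda>ks. \<zero>\<^bsub>T ks\<^esub>)"
abbreviation "unitY k \<equiv> (\<one>\<^bsub>B\<^esub>, \<zero>\<^bsub>X k\<^esub>)"
abbreviation "altl k \<equiv> {ks \<in> alt_words K. hd ks \<noteq> k}"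
abbreviation "altr k \<equiv> {ks \<in> alt_words K. last ks \<noteq> k}"

lemmas cB = complex_algebraD(2)[OF B]
lemmas cX = bimoduleD(1)[OF X]
lemmas sX = bimodule_simps[OF X]
lemmas cT = cmodule_tensor_list

lemma Ms: "M \<in> set (map X ks) \<Longrightarrow> bimodule B M"
  using X by auto

lemma bT: "ks \<noteq> [] \<Longrightarrow> bimodule B (T ks)"
  by (rule tensor_list_bimodule[OF Ms _ B]) auto

text \<open>Vectors of the free product are functions on all lists, hence the empty list has to be
  covered although \<open>bT\<close> excludes it. It has no relations, so the induced maps are
  computed at once on the zero class.\<close>

lemma T_act_zero:
  assumes "b \<in> carrier B"
  shows "lact (T ks) b \<zero>\<^bsub>T ks\<^esub> = \<zero>\<^bsub>T ks\<^esub>" "ract (T ks) \<zero>\<^bsub>T ks\<^esub> b = \<zero>\<^bsub>T ks\<^esub>"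
proof -
  have "lact (T ks) b \<zero>\<^bsub>T ks\<^esub> = \<zero>\<^bsub>T ks\<^esub> \<and> ract (T ks) \<zero>\<^bsub>T ks\<^esub> b = \<zero>\<^bsub>T ks\<^esub>"
  proof (cases "ks = []")
    case True
    then have "tlist_rels B (map X ks) = {}" by (auto simp: tlist_rels_def)
    then show ?thesis by (simp add: tensor_list_simps presented_simps qmap_class)
  next
    case False
    then show ?thesis using bimodule_zero[OF bT assms] by simp
  qed
  then show "lact (T ks) b \<zero>\<^bsub>T ks\<^esub> = \<zero>\<^bsub>T ks\<^esub>" "ract (T ks) \<zero>\<^bsub>T ks\<^esub> b = \<zero>\<^bsub>T ks\<^esub>" by auto
qed

lemmas bY = bimodule_with_proj[OF B X]
lemmas cY = bimoduleD(1)[OF bY]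

lemma tg_closed: "xs \<in> wds ks \<Longrightarrow> tg ks xs \<in> carrier (T ks)"
  by (rule tgen_closed[OF Ms]) auto

lemma spans_T: "spans (T ks) (tg ks ` wds ks)"
  by (rule spans_tensor_list[OF Ms])

lemma wds_iff: "xs \<in> wds ks \<longleftrightarrow> length xs = length ks \<and> (\<forall>i<length ks. xs ! i \<in> carrier (X (ks ! i)))"
  by (auto simp: tlist_words_iff)

lemma tg_lin: "xs \<in> wds ks \<Longrightarrow> i < length ks \<Longrightarrow> lin (X (ks ! i)) (T ks) (\<lambda>z. tg ks (xs[i := z]))"
  using tgen_lin[of "map X ks" B xs i] X by auto

lemma tg_balanced:
  "xs \<in> wds ks \<Longrightarrow> Suc i < length ks \<Longrightarrow> b \<in> carrier B \<Longrightarrow> x \<in> carrier (X (ks ! i)) \<Longrightarrow> y \<in> carrier (X (ks ! Suc i)) \<Longrightarrow>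
    tg ks (xs[i := ract (X (ks ! i)) x b, Suc i := y]) = tg ks (xs[i := x, Suc i := lact (X (ks ! Suc i)) b y])"
  using tgen_balanced[of "map X ks" B xs i b x y] X by auto

lemma multilin_TI:
  assumes "\<And>xs. xs \<in> wds ks \<Longrightarrow> \<psi> xs \<in> carrier P"
    and "\<And>xs i. xs \<in> wds ks \<Longrightarrow> i < length ks \<Longrightarrow> lin (X (ks ! i)) P (\<lambda>z. \<psi> (xs[i := z]))"
    and "\<And>xs i x y b. xs \<in> wds ks \<Longrightarrow> Suc i < length ks \<Longrightarrow> b \<in> carrier B \<Longrightarrow> x \<in> carrier (X (ks ! i)) \<Longrightarrow>
      y \<in> carrier (X (ks ! Suc i)) \<Longrightarrow>
      \<psi> (xs[i := ract (X (ks ! i)) x b, Suc i := y]) = \<psi> (xs[i := x, Suc i := lact (X (ks ! Suc i)) b y])"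
  shows "multilin B (map X ks) P \<psi>"
  using assms by (auto simp: multilin_def)

lemma T_lact: 
  assumes "ks \<noteq> []" "b \<in> carrier B" "xs \<in> wds ks"
  shows "lact (T ks) b (tg ks xs) = tg ks (xs[0 := lact (X (hd ks)) b (hd xs)])"
proof -
  have "xs \<noteq> []" using assms by (auto simp: wds_iff)
  then show ?thesis
    using assms by (subst tensor_list_lact(2)[OF Ms]) (auto simp: hd_conv_nth)
qed

lemma T_ract:
  assumes "ks \<noteq> []" "b \<in> carrier B" "xs \<in> wds ks"
  shows "ract (T ks) (tg ks xs) b = tg ks (xs[length ks - 1 := ract (X (last ks)) (last xs) b])"
proof -
  have "xs \<noteq> []" "length xs = length ks" using assms by (auto simp: wds_iff)
  then show ?thesis
    using assms by (subst tensor_list_ract(2)[OF Ms]) (auto simp: last_conv_nth)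
qed

lemma tg_single_lin: "lin (X k) (T [k]) (\<lambda>x. tg [k] [x])"
  using tg_lin[of "[\<zero>\<^bsub>X k\<^esub>]" "[k]" 0] cmod_zero_closed[OF cX] by simp

subsection \<open>Splitting off the first letter\<close>

abbreviation "cons k ks x \<equiv> qmap (tlist_rels B (map X (k # ks))) ((#) x)"

lemma multilin_cons:
  assumes x: "x \<in> carrier (X k)"
  shows "multilin B (map X ks) (T (k # ks)) (\<lambda>xs. tg (k # ks) (x # xs))"
proof (rule multilin_TI)
  fix xs i assume "xs \<in> wds ks" "i < length ks"
  then show "lin (X (ks ! i)) (T (k # ks)) (\<lambda>z. tg (k # ks) (x # xs[i := z]))"
    using tg_lin[of "x # xs" "k # ks" "Suc i"] x by simp
next
  fix xs i y z b
  assume "xs \<in> wds ks" "Suc i < length ks" "b \<in> carrier B" "y \<in> carrier (X (ks ! i))" "z \<in> carrier (X (ks ! Suc i))"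
  then show "tg (k # ks) (x # xs[i := ract (X (ks ! i)) y b, Suc i := z]) =
      tg (k # ks) (x # xs[i := y, Suc i := lact (X (ks ! Suc i)) b z])"
    using tg_balanced[of "x # xs" "k # ks" "Suc i" b y z] x by simp
qed (use x tg_closed[of "x # xs" "k # ks" for xs] in simp)

lemma cons_lin: "x \<in> carrier (X k) \<Longrightarrow> lin (T ks) (T (k # ks)) (cons k ks x)"
  and cons_tg: "x \<in> carrier (X k) \<Longrightarrow> cons k ks x (tg ks xs) = tg (k # ks) (x # xs)"
proof -
  assume x: "x \<in> carrier (X k)"
  have "(#) x ` wds ks \<subseteq> wds (k # ks)" using x by auto
  note * = tlist_map[OF Ms this multilin_cons[OF x]]
  show "lin (T ks) (T (k # ks)) (cons k ks x)" by (rule *)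
  show "cons k ks x (tg ks xs) = tg (k # ks) (x # xs)" by (rule *)
qed

lemma cons_closed: "x \<in> carrier (X k) \<Longrightarrow> t \<in> carrier (T ks) \<Longrightarrow> cons k ks x t \<in> carrier (T (k # ks))"
  by (rule linD(1)[OF cons_lin])

lemma cons_zero: "x \<in> carrier (X k) \<Longrightarrow> cons k ks x \<zero>\<^bsub>T ks\<^esub> = \<zero>\<^bsub>T (k # ks)\<^esub>"
  by (rule lin_zero[OF cT cT cons_lin])

text \<open>For a generator \<open>t\<close> this is linearity of a tensor in its first entry; the
  property passes to linear combinations of such \<open>t\<close>.\<close>

lemma cons_lin2:
  assumes "t \<in> carrier (T ks)"
  shows "lin (X k) (T (k # ks)) (\<lambda>x. cons k ks x t)"
  using spans_T assms
proof (induction rule: spans_induct)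
  case (gen t)
  then obtain xs where xs: "xs \<in> wds ks" "t = tg ks xs" by auto
  have "lin (X k) (T (k # ks)) (\<lambda>z. tg (k # ks) (z # xs))"
    using tg_lin[of "\<zero>\<^bsub>X k\<^esub> # xs" "k # ks" 0] xs cmod_zero_closed[OF cX] by simp
  then show ?case by (rule lin_cong[OF _ cX, THEN iffD1, rotated]) (simp only: cons_tg xs)
next
  case zero
  have "lin (X k) (T (k # ks)) (\<lambda>x. \<zero>\<^bsub>T (k # ks)\<^esub>)" by (intro linI) (simp_all add: cT cmod_closed cmod_simps)
  then show ?case by (rule lin_cong[OF _ cX, THEN iffD1, rotated]) (simp only: cons_zero)
next
  case (add t u)
  from lin_add[OF cT add(3,4)] show ?case
    by (rule lin_cong[OF _ cX, THEN iffD1, rotated]) (simp only: add linD[OF cons_lin])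
next
  case (smult c t)
  from lin_smult[OF cT smult(2)] show ?case
    by (rule lin_cong[OF _ cX, THEN iffD1, rotated]) (simp only: smult linD[OF cons_lin])
qed

lemma T_lact_lin: "ks \<noteq> [] \<Longrightarrow> b \<in> carrier B \<Longrightarrow> lin (T ks) (T ks) (lact (T ks) b)"
  by (rule bimoduleD(2)[OF bT])

lemma T_ract_lin: "ks \<noteq> [] \<Longrightarrow> b \<in> carrier B \<Longrightarrow> lin (T ks) (T ks) (\<lambda>t. ract (T ks) t b)"
  by (rule bimoduleD(3)[OF bT])

text \<open>On generators this is the relation between the first two entries of the longer
  word.\<close>

lemma cons_balanced:
  assumes "ks \<noteq> []" "x \<in> carrier (X k)" "b \<in> carrier B" "t \<in> carrier (T ks)"
  shows "cons k ks (ract (X k) x b) t = cons k ks x (lact (T ks) b t)"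
proof (rule lin_eqI[OF spans_T cT cT _ _ _ assms(4)])
  have xb: "ract (X k) x b \<in> carrier (X k)" using assms by (simp add: sX)
  show "lin (T ks) (T (k # ks)) (cons k ks (ract (X k) x b))" by (rule cons_lin[OF xb])
  show "lin (T ks) (T (k # ks)) (\<lambda>t. cons k ks x (lact (T ks) b t))"
    by (rule lin_comp[OF T_lact_lin cons_lin]) (use assms in auto)
  fix t assume "t \<in> tg ks ` wds ks"
  then obtain xs where xs: "xs \<in> wds ks" "t = tg ks xs" by auto
  obtain k' ks' y ys where [simp]: "ks = k' # ks'" "xs = y # ys" and y: "y \<in> carrier (X k')" "ys \<in> wds ks'"
    using assms(1) xs(1) by (cases ks; cases xs) auto
  show "cons k ks (ract (X k) x b) t = cons k ks x (lact (T ks) b t)"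
    using tg_balanced[of "x # y # ys" "k # k' # ks'" 0 b x y] assms(2-3) y
    unfolding xs(2) T_lact[OF assms(1,3) xs(1)] cons_tg[OF xb] cons_tg[OF assms(2)] by simp
qed

lemma cons_lact:
  assumes "x \<in> carrier (X k)" "b \<in> carrier B" "t \<in> carrier (T ks)"
  shows "lact (T (k # ks)) b (cons k ks x t) = cons k ks (lact (X k) b x) t"
proof (rule lin_eqI[OF spans_T cT cT _ _ _ assms(3)])
  have bx: "lact (X k) b x \<in> carrier (X k)" using assms by (simp add: sX)
  show "lin (T ks) (T (k # ks)) (cons k ks (lact (X k) b x))" by (rule cons_lin[OF bx])
  show "lin (T ks) (T (k # ks)) (\<lambda>t. lact (T (k # ks)) b (cons k ks x t))"
    by (rule lin_comp[OF cons_lin T_lact_lin]) (use assms in auto)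
  fix t assume "t \<in> tg ks ` wds ks"
  then obtain xs where xs: "xs \<in> wds ks" "t = tg ks xs" by auto
  then show "lact (T (k # ks)) b (cons k ks x t) = cons k ks (lact (X k) b x) t"
    unfolding xs(2) cons_tg[OF assms(1)] cons_tg[OF bx]
    using T_lact[of "k # ks" b "x # xs"] assms by simp
qed

text \<open>The right action concerns the last letter, which for nonempty \<open>ks\<close> is not
  the letter that is put in front.\<close>

lemma cons_ract:
  assumes "ks \<noteq> []" "x \<in> carrier (X k)" "b \<in> carrier B" "t \<in> carrier (T ks)"
  shows "ract (T (k # ks)) (cons k ks x t) b = cons k ks x (ract (T ks) t b)"
proof (rule lin_eqI[OF spans_T cT cT _ _ _ assms(4)])
  show "lin (T ks) (T (k # ks)) (\<lambda>t. cons k ks x (ract (T ks) t b))"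
    by (rule lin_comp[OF T_ract_lin cons_lin]) (use assms in auto)
  show "lin (T ks) (T (k # ks)) (\<lambda>t. ract (T (k # ks)) (cons k ks x t) b)"
    by (rule lin_comp[OF cons_lin T_ract_lin]) (use assms in auto)
  fix t assume "t \<in> tg ks ` wds ks"
  then obtain xs where xs: "xs \<in> wds ks" "t = tg ks xs" by auto
  have "xs \<noteq> []" using assms(1) xs(1) by (auto simp: wds_iff)
  then show "ract (T (k # ks)) (cons k ks x t) b = cons k ks x (ract (T ks) t b)"
    unfolding xs(2) cons_tg[OF assms(2)] T_ract[OF assms(1,3) xs(1)]
    using T_ract[of "k # ks" b "x # xs"] assms xs by (cases ks) simp_all
qed

lemma wds_Cons [simp]: "x # xs \<in> wds (k # ks) \<longleftrightarrow> x \<in> carrier (X k) \<and> xs \<in> wds ks"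
  and wds_snoc [simp]: "xs @ [x] \<in> wds (ks @ [k]) \<longleftrightarrow> x \<in> carrier (X k) \<and> xs \<in> wds ks"
  and wds_Nil [simp]: "xs \<in> wds [] \<longleftrightarrow> xs = []"
  by simp_all

text \<open>Keeps \<open>map X (k # ks)\<close> folded, so that the terms \<open>T (k # ks)\<close>
  still match the lemmas about them.\<close>

declare list.map [simp del] map_append [simp del]

subsection \<open>Bimodule structure and generators\<close>

lemma alt_words_nonempty [simp]: "[] \<notin> alt_words K"
  by (simp add: alt_words_def)

lemma bimodule_fp_part: "[] \<notin> I \<Longrightarrow> bimodule B (fp_part B X I)"
  unfolding fp_part_def
  by (rule bimodule_direct_sum[OF cT T_act_zero bT B]) auto

lemma bFP: "[] \<notin> I \<Longrightarrow> bimodule B (FP I)"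
  by (rule bimodule_with_proj[OF B bimodule_fp_part])

lemma bFM: "bimodule B FM"
  unfolding fp_mod_def by (rule bFP) simp

lemmas cFM = bimoduleD(1)[OF bFM]

lemma fp_part_simps:
  "\<zero>\<^bsub>fp_part B X I\<^esub> = (\<lambda>ks. \<zero>\<^bsub>T ks\<^esub>)"
  "f \<oplus>\<^bsub>fp_part B X I\<^esub> g = (\<lambda>ks. f ks \<oplus>\<^bsub>T ks\<^esub> g ks)"
  "c \<odot>\<^bsub>fp_part B X I\<^esub> f = (\<lambda>ks. c \<odot>\<^bsub>T ks\<^esub> f ks)"
  "lact (fp_part B X I) b f = (\<lambda>ks. lact (T ks) b (f ks))"
  "ract (fp_part B X I) f b = (\<lambda>ks. ract (T ks) (f ks) b)"
  by (simp_all add: fp_part_def direct_sum_simps)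

lemma fp_part_nth: "f \<in> carrier (fp_part B X I) \<Longrightarrow> f ks \<in> carrier (T ks)"
  unfolding fp_part_def by (rule direct_sum_nth[OF cT])

lemma fp_part_zero: "f \<in> carrier (fp_part B X I) \<Longrightarrow> ks \<notin> I \<Longrightarrow> f ks = \<zero>\<^bsub>T ks\<^esub>"
  by (auto simp: fp_part_def direct_sum_carrier)

lemma fp_part_finite: "f \<in> carrier (fp_part B X I) \<Longrightarrow> finite {ks. f ks \<noteq> \<zero>\<^bsub>T ks\<^esub>}"
  by (auto simp: fp_part_def direct_sum_carrier)

lemma fp_partI:
  "(\<And>ks. ks \<in> I \<Longrightarrow> f ks \<in> carrier (T ks)) \<Longrightarrow> (\<And>ks. ks \<notin> I \<Longrightarrow> f ks = \<zero>\<^bsub>T ks\<^esub>) \<Longrightarrow>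
   {ks. f ks \<noteq> \<zero>\<^bsub>T ks\<^esub>} \<subseteq> S \<Longrightarrow> finite S \<Longrightarrow> f \<in> carrier (fp_part B X I)"
  unfolding fp_part_def by (rule direct_sumI[OF cT])

lemmas fp_simps = with_proj_simps fp_part_simps

lemma FP_ops:
  "\<zero>\<^bsub>FP I\<^esub> = \<zero>\<^bsub>FM\<^esub>" "u \<oplus>\<^bsub>FP I\<^esub> v = u \<oplus>\<^bsub>FM\<^esub> v" "c \<odot>\<^bsub>FP I\<^esub> u = c \<odot>\<^bsub>FM\<^esub> u"
  "lact (FP I) b u = lact FM b u" "ract (FP I) u b = ract FM u b"
  unfolding fp_mod_def by (cases u; cases v; simp add: fp_simps)+

lemma spans_FP:
  assumes "[] \<notin> I"
  shows "spans (FP I) ((\<lambda>b. (b, \<lambda>ks. \<zero>\<^bsub>T ks\<^esub>)) ` carrier B \<union> (\<Union>ks\<in>I. (\<lambda>xs. single ks (tg ks xs)) ` wds ks))"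
proof -
  have "spans (fp_part B X I) (\<Union>ks\<in>I. dsingle T ks ` tg ks ` wds ks)"
    unfolding fp_part_def by (rule spans_direct_sum[OF cT spans_T])
  from spans_with_proj[OF B bimodule_fp_part[OF assms] this] show ?thesis
    by (simp add: fp_part_simps image_UN image_image)
qed

lemma single_lin: "ks \<in> I \<Longrightarrow> [] \<notin> I \<Longrightarrow> lin (T ks) (FP I) (single ks)"
  using lin_comp[OF dsingle_lin[OF cT, of ks I] with_proj_lin(2)[OF B bimodule_fp_part, unfolded fp_part_def]]
  by (simp add: fp_part_def)

lemma base_closed: "[] \<notin> I \<Longrightarrow> b \<in> carrier B \<Longrightarrow> (b, \<lambda>ks. \<zero>\<^bsub>T ks\<^esub>) \<in> carrier (FP I)"
  using cmod_zero_closed[OF bimoduleD(1)[OF bimodule_fp_part[of I]]] by (simp add: fp_simps)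

lemma lact_single: "b \<in> carrier B \<Longrightarrow> lact FM b (single ks t) = single ks (lact (T ks) b t)"
  by (auto simp: fun_eq_iff fp_mod_def fp_simps dsingle_def T_act_zero complex_algebraD(13)[OF B])

lemma ract_single: "b \<in> carrier B \<Longrightarrow> ract FM (single ks t) b = single ks (ract (T ks) t b)"
  by (auto simp: fun_eq_iff fp_mod_def fp_simps dsingle_def T_act_zero complex_algebraD(12)[OF B])

lemma lact_base: "b \<in> carrier B \<Longrightarrow> c \<in> carrier B \<Longrightarrow> lact FM b (c, \<lambda>ks. \<zero>\<^bsub>T ks\<^esub>) = (b \<otimes>\<^bsub>B\<^esub> c, \<lambda>ks. \<zero>\<^bsub>T ks\<^esub>)"
  by (auto simp: fp_mod_def fp_simps T_act_zero)

lemma ract_base: "b \<in> carrier B \<Longrightarrow> c \<in> carrier B \<Longrightarrow> ract FM (c, \<lambda>ks. \<zero>\<^bsub>T ks\<^esub>) b = (c \<otimes>\<^bsub>B\<^esub> b, \<lambda>ks. \<zero>\<^bsub>T ks\<^esub>)"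
  by (auto simp: fp_mod_def fp_simps T_act_zero)

subsection \<open>The left regular representation\<close>

text \<open>The summand \<open>x \<otimes> (b \<oplus> \<xi>)\<close> of \<open>left_join\<close>:
  \<open>x b\<close> goes to the one-letter word \<open>[k]\<close>, and \<open>x\<close> is put in
  front of the words of \<open>\<xi>\<close>.\<close>

definition lpart :: "'k \<Rightarrow> 'x \<Rightarrow> 'b \<Rightarrow> ('k, 'x) fp0 \<Rightarrow> ('k, 'x) fp0" where
  "lpart k x b \<xi> = (\<lambda>ks. if ks = [k] then tg [k] [ract (X k) x b]
     else if ks \<noteq> [] \<and> hd ks = k then qmap (tlist_rels B (map X ks)) ((#) x) (\<xi> (tl ks)) else \<zero>\<^bsub>T ks\<^esub>)"

lemma left_join_eq:
  "left_join B X k ((b, x), (b', \<xi>)) = (b \<otimes>\<^bsub>B\<^esub> b', \<lambda>ks. lact (T ks) b (\<xi> ks) \<oplus>\<^bsub>T ks\<^esub> lpart k x b' \<xi> ks)"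
  by (simp add: left_join_def Let_def lpart_def fun_eq_iff list.map)

lemma lpart_cases [case_names single cons other]:
  obtains "ks = [k]" | ks' where "ks = k # ks'" "ks' \<noteq> []" | "ks \<noteq> [k]" "\<And>ks'. ks \<noteq> k # ks'"
proof (cases "\<exists>ks'. ks = k # ks'")
  case True
  then obtain ks' where "ks = k # ks'" by auto
  then show ?thesis using that(1,2) by (cases "ks' = []") auto
qed (use that(3) in auto)

lemma lpart_single: "lpart k x b \<xi> [k] = tg [k] [ract (X k) x b]"
  by (simp add: lpart_def)

lemma lpart_cons: "ks \<noteq> [] \<Longrightarrow> lpart k x b \<xi> (k # ks) = cons k ks x (\<xi> ks)"
  by (simp add: lpart_def)

lemma lpart_other: "ks \<noteq> [k] \<Longrightarrow> (\<And>ks'. ks \<noteq> k # ks') \<Longrightarrow> lpart k x b \<xi> ks = \<zero>\<^bsub>T ks\<^esub>"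
  by (cases ks) (auto simp: lpart_def)

lemmas lpart_simps = lpart_single lpart_cons lpart_other

lemma lpart_lin:
  assumes "\<And>ks. \<xi> ks \<in> carrier (T ks)" "b \<in> carrier B"
  shows "lin (X k) (T ks) (\<lambda>x. lpart k x b \<xi> ks)"
proof (cases rule: lpart_cases[of ks k])
  case single
  show ?thesis unfolding single lpart_single
    by (rule lin_comp[OF bimoduleD(3)[OF X assms(2)] tg_single_lin])
next
  case (cons ks')
  then show ?thesis using cons_lin2[OF assms(1), of k ks'] by (simp add: lpart_cons)
next
  case other
  then show ?thesis by (intro linI) (simp_all add: lpart_other cT cmod_closed cmod_simps)
qed

lemma lpart_add:
  assumes "\<And>ks. \<xi> ks \<in> carrier (T ks)" "b \<in> carrier B" "\<And>ks. \<xi>' ks \<in> carrier (T ks)" "b' \<in> carrier B" "x \<in> carrier (X k)"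
  shows "lpart k x (b \<oplus>\<^bsub>B\<^esub> b') (\<lambda>ks. \<xi> ks \<oplus>\<^bsub>T ks\<^esub> \<xi>' ks) ks = lpart k x b \<xi> ks \<oplus>\<^bsub>T ks\<^esub> lpart k x b' \<xi>' ks"
  by (cases rule: lpart_cases[of ks k])
     (use assms in \<open>simp_all add: lpart_simps sX linD[OF tg_single_lin] linD[OF cons_lin] cT cmod_closed cmod_simps\<close>)

lemma lpart_smult:
  assumes "\<And>ks. \<xi> ks \<in> carrier (T ks)" "b \<in> carrier B" "x \<in> carrier (X k)"
  shows "lpart k x (c \<odot>\<^bsub>B\<^esub> b) (\<lambda>ks. c \<odot>\<^bsub>T ks\<^esub> \<xi> ks) ks = c \<odot>\<^bsub>T ks\<^esub> lpart k x b \<xi> ks"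
  by (cases rule: lpart_cases[of ks k])
     (use assms in \<open>simp_all add: lpart_simps sX linD[OF tg_single_lin] linD[OF cons_lin] cT cmod_closed cmod_simps\<close>)

lemma lpart_balanced:
  assumes "\<And>ks. \<xi> ks \<in> carrier (T ks)" "b \<in> carrier B" "x \<in> carrier (X k)" "c \<in> carrier B"
  shows "lpart k (ract (X k) x c) b \<xi> ks = lpart k x (c \<otimes>\<^bsub>B\<^esub> b) (\<lambda>ks. lact (T ks) c (\<xi> ks)) ks"
  by (cases rule: lpart_cases[of ks k])
     (use assms in \<open>simp_all add: lpart_simps sX cons_balanced\<close>)

lemma lpart_lact:
  assumes "\<And>ks. \<xi> ks \<in> carrier (T ks)" "b \<in> carrier B" "x \<in> carrier (X k)" "c \<in> carrier B"
  shows "lact (T ks) c (lpart k x b \<xi> ks) = lpart k (lact (X k) c x) b \<xi> ks"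
  by (cases rule: lpart_cases[of ks k])
     (use assms in \<open>simp_all add: lpart_simps sX cons_lact T_act_zero T_lact\<close>)

lemma lpart_ract:
  assumes "\<And>ks. \<xi> ks \<in> carrier (T ks)" "b \<in> carrier B" "x \<in> carrier (X k)" "c \<in> carrier B"
  shows "ract (T ks) (lpart k x b \<xi> ks) c = lpart k x (b \<otimes>\<^bsub>B\<^esub> c) (\<lambda>ks. ract (T ks) (\<xi> ks) c) ks"
  by (cases rule: lpart_cases[of ks k])
     (use assms in \<open>simp_all add: lpart_simps sX cons_ract T_act_zero T_ract\<close>)

lemma Cons_alt_words: "k \<in> K \<Longrightarrow> ks \<in> altl k \<Longrightarrow> k # ks \<in> alt_words K"
  by (cases ks) (auto simp: alt_words_def)

lemma Cons_alt_wordsD: "k # ks \<in> alt_words K \<Longrightarrow> ks \<noteq> [] \<Longrightarrow> ks \<in> altl k"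
  by (cases ks) (auto simp: alt_words_def)

lemma single_alt_words: "k \<in> K \<Longrightarrow> [k] \<in> alt_words K"
  by (auto simp: alt_words_def)

lemma carrier_FPE:
  assumes "u \<in> carrier (FP I)"
  obtains b \<xi> where "u = (b, \<xi>)" "b \<in> carrier B" "\<xi> \<in> carrier (fp_part B X I)"
  using assms by (auto simp: with_proj_simps)

lemma carrier_YE:
  assumes "p \<in> carrier (Y k)"
  obtains b x where "p = (b, x)" "b \<in> carrier B" "x \<in> carrier (X k)"
  using assms by (auto simp: with_proj_simps)

section \<open>Elementary tensors in the free product, factored at the left end\<close>

abbreviation "lj k \<equiv> left_join B X k"
abbreviation "FL k \<equiv> fp_left B K X k"

lemma FL_def: "FL k = FP (altl k)"
  by (simp add: fp_left_def)

lemma bFL: "bimodule B (FL k)"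
  unfolding FL_def by (rule bFP) simp

lemma FL_ops:
  "\<zero>\<^bsub>FL k\<^esub> = \<zero>\<^bsub>FM\<^esub>" "u \<oplus>\<^bsub>FL k\<^esub> v = u \<oplus>\<^bsub>FM\<^esub> v" "c \<odot>\<^bsub>FL k\<^esub> u = c \<odot>\<^bsub>FM\<^esub> u"
  "lact (FL k) b u = lact FM b u" "ract (FL k) u b = ract FM u b"
  unfolding FL_def by (rule FP_ops)+

context
  fixes k assumes k: "k \<in> K"
begin

text \<open>Words in \<open>FL k\<close> do not begin with \<open>k\<close>, so putting
  \<open>k\<close> in front of them gives words with distinct neighbours. The support stays finite:
  it lies in the union of the old support, its shift by \<open>k\<close>, and the word
  \<open>[k]\<close>.\<close>

lemma lj_closed:
  assumes "p \<in> carrier (Y k)" "u \<in> carrier (FL k)"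
  shows "lj k (p, u) \<in> carrier FM"
proof -
  obtain b x where p: "p = (b, x)" "b \<in> carrier B" "x \<in> carrier (X k)" using assms(1) by (rule carrier_YE)
  obtain b' \<xi> where u: "u = (b', \<xi>)" "b' \<in> carrier B" "\<xi> \<in> carrier (fp_part B X (altl k))"
    using assms(2) unfolding FL_def by (rule carrier_FPE)
  note nth = fp_part_nth[OF u(3)] and zero = fp_part_zero[OF u(3)]
  let ?f = "\<lambda>ks. lact (T ks) b (\<xi> ks) \<oplus>\<^bsub>T ks\<^esub> lpart k x b' \<xi> ks"
  have "?f \<in> carrier (fp_part B X (alt_words K))"
  proof (rule fp_partI)
    fix ks assume "ks \<in> alt_words K"
    then have "ks \<noteq> []" by auto
    then show "?f ks \<in> carrier (T ks)"
      using bimodule_simps(1)[OF bT p(2) nth] linD(1)[OF lpart_lin[OF nth u(2)] p(3)]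
      by (auto intro!: cmod_closed[OF cT])
  next
    fix ks assume ks: "ks \<notin> alt_words K"
    have "lpart k x b' \<xi> ks = \<zero>\<^bsub>T ks\<^esub>"
    proof (cases rule: lpart_cases[of ks k])
      case (cons ks')
      then have "\<xi> ks' = \<zero>\<^bsub>T ks'\<^esub>" using ks Cons_alt_words[OF k] zero by blast
      then show ?thesis using cons p(3) by (simp add: lpart_cons cons_zero)
    qed (use ks single_alt_words[OF k] in \<open>auto simp: lpart_other\<close>)
    then show "?f ks = \<zero>\<^bsub>T ks\<^esub>"
      using zero[of ks] ks p(2) by (simp add: T_act_zero cmod_simps[OF cT] cmod_closed[OF cT])
  next
    let ?S = "{ks. \<xi> ks \<noteq> \<zero>\<^bsub>T ks\<^esub>}"
    show "finite (?S \<union> insert [k] ((#) k ` ?S))" using fp_part_finite[OF u(3)] by simp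
    show "{ks. ?f ks \<noteq> \<zero>\<^bsub>T ks\<^esub>} \<subseteq> ?S \<union> insert [k] ((#) k ` ?S)"
    proof (rule subsetI, rule ccontr)
      fix ks assume *: "ks \<in> {ks. ?f ks \<noteq> \<zero>\<^bsub>T ks\<^esub>}" "ks \<notin> ?S \<union> insert [k] ((#) k ` ?S)"
      have "lpart k x b' \<xi> ks = \<zero>\<^bsub>T ks\<^esub>"
        by (cases rule: lpart_cases[of ks k]) (use *(2) p(3) in \<open>auto simp: lpart_simps cons_zero\<close>)
      then show False using * p(2) by (simp add: T_act_zero cmod_simps[OF cT] cmod_closed[OF cT])
    qed
  qed
  then show ?thesis
    using p u calg_closed[OF B] by (simp add: left_join_eq fp_mod_def with_proj_simps)
qed

text \<open>Left linearity in the first factor, right linearity in the second, and the balancing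
  identity, checked component by component. The empty list is split off: all terms vanish there, and
  its tensor product is not covered by \<open>bT\<close>.\<close>

lemma lj_act:
  assumes "p \<in> carrier (Y k)" "u \<in> carrier (FL k)" "c \<in> carrier B"
  shows "lact FM c (lj k (p, u)) = (lj k) (lact (Y k) c p, u)"
    "ract FM (lj k (p, u)) c = lj k (p, ract FM u c)"
    "(lj k) (ract (Y k) p c, u) = lj k (p, lact FM c u)"
proof -
  obtain b x where p: "p = (b, x)" "b \<in> carrier B" "x \<in> carrier (X k)" using assms(1) by (rule carrier_YE)
  obtain b' \<xi> where u: "u = (b', \<xi>)" "b' \<in> carrier B" "\<xi> \<in> carrier (fp_part B X (altl k))"
    using assms(2) unfolding FL_def by (rule carrier_FPE)
  note nth = fp_part_nth[OF u(3)] and zero = fp_part_zero[OF u(3)]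
  have lcl: "lpart k x b' \<xi> ks \<in> carrier (T ks)" for ks by (rule linD(1)[OF lpart_lin[OF nth u(2)] p(3)])
  have 0: "\<xi> [] = \<zero>\<^bsub>T []\<^esub>" by (rule zero) simp
  have 1: "lpart k y c' \<eta> [] = \<zero>\<^bsub>T []\<^esub>" for y c' \<eta> by (simp add: lpart_other)
  note simps = left_join_eq fp_mod_def fp_simps u p complex_algebraD(9)[OF B] assms(3) calg_closed[OF B]
  have "lact (T ks) c (lact (T ks) b (\<xi> ks) \<oplus>\<^bsub>T ks\<^esub> lpart k x b' \<xi> ks) =
      lact (T ks) (c \<otimes>\<^bsub>B\<^esub> b) (\<xi> ks) \<oplus>\<^bsub>T ks\<^esub> lpart k (lact (X k) c x) b' \<xi> ks" for ks
    using p u assms(3) nth[of ks] lcl[of ks]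
    by (cases "ks = []") (simp_all add: 0 1 T_act_zero cmod_simps[OF cT] cmod_closed[OF cT] calg_closed[OF B]
         bimodule_simps[OF bT] lpart_lact[OF nth])
  then show "lact FM c (lj k (p, u)) = (lj k) (lact (Y k) c p, u)" by (simp add: simps)
  have "ract (T ks) (lact (T ks) b (\<xi> ks) \<oplus>\<^bsub>T ks\<^esub> lpart k x b' \<xi> ks) c =
      lact (T ks) b (ract (T ks) (\<xi> ks) c) \<oplus>\<^bsub>T ks\<^esub> lpart k x (b' \<otimes>\<^bsub>B\<^esub> c) (\<lambda>ks. ract (T ks) (\<xi> ks) c) ks" for ks
    using p u assms(3) nth[of ks] lcl[of ks]
    by (cases "ks = []") (simp_all add: 0 1 T_act_zero cmod_simps[OF cT] cmod_closed[OF cT] calg_closed[OF B]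
         bimodule_simps[OF bT] lpart_ract[OF nth])
  then show "ract FM (lj k (p, u)) c = lj k (p, ract FM u c)" by (simp add: simps)
  have "lact (T ks) (b \<otimes>\<^bsub>B\<^esub> c) (\<xi> ks) \<oplus>\<^bsub>T ks\<^esub> lpart k (ract (X k) x c) b' \<xi> ks =
      lact (T ks) b (lact (T ks) c (\<xi> ks)) \<oplus>\<^bsub>T ks\<^esub> lpart k x (c \<otimes>\<^bsub>B\<^esub> b') (\<lambda>ks. lact (T ks) c (\<xi> ks)) ks" for ks
    using p u assms(3) nth[of ks] lcl[of ks]
    by (cases "ks = []") (simp_all add: 0 1 T_act_zero cmod_simps[OF cT] cmod_closed[OF cT] calg_closed[OF B]
         bimodule_simps[OF bT] lpart_balanced[OF nth])
  then show "(lj k) (ract (Y k) p c, u) = lj k (p, lact FM c u)" by (simp add: simps)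
qed

lemma lj_bilin: "bilin B (Y k) (FL k) FM (lj k)"
proof (rule bilinI)
  fix p u assume *: "p \<in> carrier (Y k)" "u \<in> carrier (FL k)"
  show "lj k (p, u) \<in> carrier FM" by (rule lj_closed[OF *])
  show "(lj k) (ract (Y k) p b, u) = lj k (p, lact (FL k) b u)" if "b \<in> carrier B" for b
    using lj_act(3)[OF * that] by (simp add: FL_ops)
next
  fix p p' u assume "p \<in> carrier (Y k)" "p' \<in> carrier (Y k)" "u \<in> carrier (FL k)"
  then obtain b x b' x' c \<xi> where p: "p = (b, x)" "b \<in> carrier B" "x \<in> carrier (X k)"
    and p': "p' = (b', x')" "b' \<in> carrier B" "x' \<in> carrier (X k)"
    and u: "u = (c, \<xi>)" "c \<in> carrier B" "\<xi> \<in> carrier (fp_part B X (altl k))"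
    unfolding FL_def by (elim carrier_YE carrier_FPE)
  note nth = fp_part_nth[OF u(3)]
  have 0: "\<xi> [] = \<zero>\<^bsub>T []\<^esub>" by (rule fp_part_zero[OF u(3)]) simp
  have lcl: "lpart k y c \<xi> ks \<in> carrier (T ks)" if "y \<in> carrier (X k)" for ks y by (rule linD(1)[OF lpart_lin[OF nth u(2)] that])
  have "lact (T ks) (b \<oplus>\<^bsub>B\<^esub> b') (\<xi> ks) \<oplus>\<^bsub>T ks\<^esub> lpart k (x \<oplus>\<^bsub>X k\<^esub> x') c \<xi> ks =
     lact (T ks) b (\<xi> ks) \<oplus>\<^bsub>T ks\<^esub> lpart k x c \<xi> ks \<oplus>\<^bsub>T ks\<^esub> (lact (T ks) b' (\<xi> ks) \<oplus>\<^bsub>T ks\<^esub> lpart k x' c \<xi> ks)" for ks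
    using p p' u nth[of ks] lcl
    by (cases "ks = []") (simp_all add: 0 T_act_zero cmod_simps[OF cT] cmod_closed[OF cT] cmod_closed[OF cB]
         bimodule_simps[OF bT] linD[OF lpart_lin[OF nth]] cmod_ac[OF cT])
  then show "lj k (p \<oplus>\<^bsub>Y k\<^esub> p', u) = lj k (p, u) \<oplus>\<^bsub>FM\<^esub> lj k (p', u)"
    by (simp add: left_join_eq fp_mod_def fp_simps p p' u complex_algebraD(10)[OF B])
next
  fix p u u' assume "p \<in> carrier (Y k)" "u \<in> carrier (FL k)" "u' \<in> carrier (FL k)"
  then obtain b x c \<xi> c' \<xi>' where p: "p = (b, x)" "b \<in> carrier B" "x \<in> carrier (X k)"
    and u: "u = (c, \<xi>)" "c \<in> carrier B" "\<xi> \<in> carrier (fp_part B X (altl k))"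
    and u': "u' = (c', \<xi>')" "c' \<in> carrier B" "\<xi>' \<in> carrier (fp_part B X (altl k))"
    unfolding FL_def by (elim carrier_YE carrier_FPE)
  note nth = fp_part_nth[OF u(3)] and nth' = fp_part_nth[OF u'(3)]
  have 0: "\<xi> [] = \<zero>\<^bsub>T []\<^esub>" by (rule fp_part_zero[OF u(3)]) simp
  have z': "\<xi>' [] = \<zero>\<^bsub>T []\<^esub>" by (rule fp_part_zero[OF u'(3)]) simp
  have lcl: "lpart k x c \<xi> ks \<in> carrier (T ks)" "lpart k x c' \<xi>' ks \<in> carrier (T ks)" for ks
    using linD(1)[OF lpart_lin[OF nth u(2)] p(3)] linD(1)[OF lpart_lin[OF nth' u'(2)] p(3)] by auto
  have "lact (T ks) b (\<xi> ks \<oplus>\<^bsub>T ks\<^esub> \<xi>' ks) \<oplus>\<^bsub>T ks\<^esub> lpart k x (c \<oplus>\<^bsub>B\<^esub> c') (\<lambda>ks. \<xi> ks \<oplus>\<^bsub>T ks\<^esub> \<xi>' ks) ks =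
     lact (T ks) b (\<xi> ks) \<oplus>\<^bsub>T ks\<^esub> lpart k x c \<xi> ks \<oplus>\<^bsub>T ks\<^esub> (lact (T ks) b (\<xi>' ks) \<oplus>\<^bsub>T ks\<^esub> lpart k x c' \<xi>' ks)" for ks
    unfolding lpart_add[OF nth u(2) nth' u'(2) p(3)]
    using p u u' nth[of ks] nth'[of ks] lcl
    by (cases "ks = []") (simp_all add: 0 z' T_act_zero cmod_simps[OF cT] cmod_closed[OF cT] cmod_closed[OF cB]
         bimodule_simps[OF bT] cmod_ac[OF cT])
  then show "lj k (p, u \<oplus>\<^bsub>FL k\<^esub> u') = lj k (p, u) \<oplus>\<^bsub>FM\<^esub> lj k (p, u')"
    by (simp add: FL_ops left_join_eq fp_mod_def fp_simps p u u' complex_algebraD(11)[OF B])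
next
  fix p u a assume "p \<in> carrier (Y k)" "u \<in> carrier (FL k)"
  then obtain b x c \<xi> where p: "p = (b, x)" "b \<in> carrier B" "x \<in> carrier (X k)"
    and u: "u = (c, \<xi>)" "c \<in> carrier B" "\<xi> \<in> carrier (fp_part B X (altl k))"
    unfolding FL_def by (elim carrier_YE carrier_FPE)
  note nth = fp_part_nth[OF u(3)]
  have 0: "\<xi> [] = \<zero>\<^bsub>T []\<^esub>" by (rule fp_part_zero[OF u(3)]) simp
  have lcl: "lpart k x c \<xi> ks \<in> carrier (T ks)" for ks by (rule linD(1)[OF lpart_lin[OF nth u(2)] p(3)])
  have "lact (T ks) (a \<odot>\<^bsub>B\<^esub> b) (\<xi> ks) \<oplus>\<^bsub>T ks\<^esub> lpart k (a \<odot>\<^bsub>X k\<^esub> x) c \<xi> ks =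
     a \<odot>\<^bsub>T ks\<^esub> (lact (T ks) b (\<xi> ks) \<oplus>\<^bsub>T ks\<^esub> lpart k x c \<xi> ks)" for ks
    using p u nth[of ks] lcl[of ks]
    by (cases "ks = []") (simp_all add: 0 T_act_zero cmod_simps[OF cT] cmod_closed[OF cT] cmod_closed[OF cB]
         bimodule_simps[OF bT] linD[OF lpart_lin[OF nth]])
  then show "(lj k) (a \<odot>\<^bsub>Y k\<^esub> p, u) = a \<odot>\<^bsub>FM\<^esub> lj k (p, u)"
    by (simp add: left_join_eq fp_mod_def fp_simps p u complex_algebraD(3)[OF B])
  have "lact (T ks) b (a \<odot>\<^bsub>T ks\<^esub> \<xi> ks) \<oplus>\<^bsub>T ks\<^esub> lpart k x (a \<odot>\<^bsub>B\<^esub> c) (\<lambda>ks. a \<odot>\<^bsub>T ks\<^esub> \<xi> ks) ks =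
     a \<odot>\<^bsub>T ks\<^esub> (lact (T ks) b (\<xi> ks) \<oplus>\<^bsub>T ks\<^esub> lpart k x c \<xi> ks)" for ks
    unfolding lpart_smult[OF nth u(2) p(3)]
    using p u nth[of ks] lcl[of ks]
    by (cases "ks = []") (simp_all add: 0 T_act_zero cmod_simps[OF cT] cmod_closed[OF cT] cmod_closed[OF cB]
         bimodule_simps[OF bT])
  then show "lj k (p, a \<odot>\<^bsub>FL k\<^esub> u) = a \<odot>\<^bsub>FM\<^esub> lj k (p, u)"
    by (simp add: FL_ops left_join_eq fp_mod_def fp_simps p u complex_algebraD(4)[OF B])
qed

lemma lj_base:
  assumes "b \<in> carrier B" "x \<in> carrier (X k)" "b' \<in> carrier B"
  shows "(lj k) ((b, x), (b', \<lambda>ks. \<zero>\<^bsub>T ks\<^esub>)) = (b \<otimes>\<^bsub>B\<^esub> b', dsingle T [k] (tg [k] [ract (X k) x b']))"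
proof -
  have "lact (T ks) b \<zero>\<^bsub>T ks\<^esub> \<oplus>\<^bsub>T ks\<^esub> lpart k x b' (\<lambda>ks. \<zero>\<^bsub>T ks\<^esub>) ks = dsingle T [k] (tg [k] [ract (X k) x b']) ks" for ks
    by (cases rule: lpart_cases[of ks k])
       (use assms in \<open>simp_all add: lpart_simps cons_zero T_act_zero dsingle_def cmod_closed[OF cT] cmod_simps[OF cT] tg_closed sX\<close>)
  then show ?thesis by (simp add: left_join_eq)
qed

text \<open>The two terms belong to different summands: \<open>b\<close> acts within the word
  \<open>ks\<close>, whereas \<open>x\<close> lengthens it.\<close>

lemma lj_single:
  assumes "b \<in> carrier B" "x \<in> carrier (X k)" "t \<in> carrier (T ks)" "ks \<noteq> []"
  shows "(lj k) ((b, x), single ks t) = single ks (lact (T ks) b t) \<oplus>\<^bsub>FM\<^esub> single (k # ks) (cons k ks x t)"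
proof -
  have "lact (T ks') b (dsingle T ks t ks') \<oplus>\<^bsub>T ks'\<^esub> lpart k x \<zero>\<^bsub>B\<^esub> (dsingle T ks t) ks' =
     dsingle T ks (lact (T ks) b t) ks' \<oplus>\<^bsub>T ks'\<^esub> dsingle T (k # ks) (cons k ks x t) ks'" for ks'
  proof -
    have "lact (T ks') b (dsingle T ks t ks') = dsingle T ks (lact (T ks) b t) ks'"
      using assms by (auto simp: dsingle_def T_act_zero)
    moreover have "lpart k x \<zero>\<^bsub>B\<^esub> (dsingle T ks t) ks' = dsingle T (k # ks) (cons k ks x t) ks'"
      by (cases rule: lpart_cases[of ks' k])
         (use assms lin_zero[OF cX cT tg_single_lin] in \<open>auto simp: lpart_simps dsingle_def cons_zero bimodule_zero'[OF X cB]\<close>)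
    ultimately show ?thesis by simp
  qed
  then show ?thesis
    using assms by (simp add: left_join_eq fp_mod_def fp_simps complex_algebraD(13)[OF B] cmod_simps[OF cB] cmod_closed[OF cB])
qed

end

end

lemma spans_mono: "spans M G \<Longrightarrow> G \<subseteq> H \<Longrightarrow> H \<subseteq> carrier M \<Longrightarrow> spans M H"
  unfolding spans_def by (meson order_trans)

text \<open>A left inverse on generators suffices: \<open>\<Theta> V = id\<close> then holds
  everywhere, and since the vectors \<open>V x\<close> span \<open>N\<close>, also
  \<open>V \<Theta> = id\<close>. So the function given by \<open>inv_into\<close> is linear and
  known.\<close>

lemma lin_inverse:
  assumes M: "cmodule M" and N: "cmodule N" and V: "lin M N V" and \<Theta>: "lin N M \<Theta>"
    and G: "spans M G" "spans N (V ` G)" and \<Theta>V: "\<And>x. x \<in> G \<Longrightarrow> \<Theta> (V x) = x" and v: "v \<in> carrier N"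
  shows "inv_into (carrier M) V v = \<Theta> v"
proof -
  have 1: "\<Theta> (V x) = x" if "x \<in> carrier M" for x
    by (rule lin_eqI[OF G(1) M M lin_comp[OF V \<Theta>] _ _ that]) (auto intro: linI \<Theta>V)
  have 2: "V (\<Theta> v) = v"
    by (rule lin_eqI[OF G(2) N N lin_comp[OF \<Theta> V] _ _ v]) (use \<Theta>V in \<open>auto intro: linI\<close>)
  show ?thesis
    by (rule inv_into_f_eq[OF inj_on_inverseI[of _ \<Theta>]]) (use 1 2 v linD(1)[OF \<Theta>] in auto)
qed

lemma lin_ops_simps:
  "S \<in> carrier (lin_ops M) \<longleftrightarrow> S \<in> extensional (carrier M) \<and> lin M M S"
  "mult (lin_ops M) = compose (carrier M)"
  "\<one>\<^bsub>lin_ops M\<^esub> = (\<lambda>x\<in>carrier M. x)"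
  "\<zero>\<^bsub>lin_ops M\<^esub> = (\<lambda>x\<in>carrier M. \<zero>\<^bsub>M\<^esub>)"
  "S \<oplus>\<^bsub>lin_ops M\<^esub> S' = (\<lambda>x\<in>carrier M. S x \<oplus>\<^bsub>M\<^esub> S' x)"
  "c \<odot>\<^bsub>lin_ops M\<^esub> S = (\<lambda>x\<in>carrier M. c \<odot>\<^bsub>M\<^esub> S x)"
  by (auto simp: lin_ops_def)

lemma left_ops_simps:
  "S \<in> carrier (left_ops B M) \<longleftrightarrow> S \<in> carrier (lin_ops M) \<and> (\<forall>b\<in>carrier B. \<forall>x\<in>carrier M. S (ract M x b) = ract M (S x) b)"
  "mult (left_ops B M) = mult (lin_ops M)" "\<one>\<^bsub>left_ops B M\<^esub> = \<one>\<^bsub>lin_ops M\<^esub>" "\<zero>\<^bsub>left_ops B M\<^esub> = \<zero>\<^bsub>lin_ops M\<^esub>"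
  "add (left_ops B M) = add (lin_ops M)" "Module.smult (left_ops B M) = Module.smult (lin_ops M)"
  by (auto simp: left_ops_def)

lemma right_ops_simps:
  "S \<in> carrier (right_ops B M) \<longleftrightarrow> S \<in> carrier (lin_ops M) \<and> (\<forall>b\<in>carrier B. \<forall>x\<in>carrier M. S (lact M b x) = lact M b (S x))"
  "mult (right_ops B M) = mult (lin_ops M)" "\<one>\<^bsub>right_ops B M\<^esub> = \<one>\<^bsub>lin_ops M\<^esub>" "\<zero>\<^bsub>right_ops B M\<^esub> = \<zero>\<^bsub>lin_ops M\<^esub>"
  "add (right_ops B M) = add (lin_ops M)" "Module.smult (right_ops B M) = Module.smult (lin_ops M)"
  by (auto simp: right_ops_def)

lemma lin_opsD: "S \<in> carrier (lin_ops M) \<Longrightarrow> lin M M S"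
  by (simp add: lin_ops_simps)

lemma lin_ops_eqI:
  "S \<in> carrier (lin_ops M) \<Longrightarrow> S' \<in> carrier (lin_ops M) \<Longrightarrow> (\<And>x. x \<in> carrier M \<Longrightarrow> S x = S' x) \<Longrightarrow> S = S'"
  by (auto simp: lin_ops_simps intro: extensionalityI)

context bimodule_family
begin

lemma spans_FM: "spans FM ((\<lambda>b. (b, \<lambda>ks. \<zero>\<^bsub>T ks\<^esub>)) ` carrier B \<union> (\<Union>ks\<in>alt_words K. (\<lambda>xs. single ks (tg ks xs)) ` wds ks))"
  unfolding fp_mod_def by (rule spans_FP) simp

lemma base_FM: "b \<in> carrier B \<Longrightarrow> (b, \<lambda>ks. \<zero>\<^bsub>T ks\<^esub>) \<in> carrier FM"
  unfolding fp_mod_def by (rule base_closed) simp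

lemma single_FM: "ks \<in> alt_words K \<Longrightarrow> lin (T ks) FM (single ks)"
  unfolding fp_mod_def by (rule single_lin) simp_all

lemma T_lift:
  assumes "cmodule P" "multilin B (map X ks) P \<psi>"
  shows "lin (T ks) P (qlift P \<psi>)" "xs \<in> wds ks \<Longrightarrow> qlift P \<psi> (tg ks xs) = \<psi> xs"
  by (rule tlist_lift[OF Ms assms]; simp)+

lemma base_split:
  "b \<in> carrier B \<Longrightarrow> \<xi> \<in> carrier (fp_part B X I) \<Longrightarrow> [] \<notin> I \<Longrightarrow> (b, \<xi>) = (b, \<lambda>ks. \<zero>\<^bsub>T ks\<^esub>) \<oplus>\<^bsub>FM\<^esub> (\<zero>\<^bsub>B\<^esub>, \<xi>)"
  using fp_part_nth[of \<xi> I] by (simp add: fp_mod_def fp_simps cmod_simps[OF cB] cmod_simps[OF cT])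

lemma Y_split: "b \<in> carrier B \<Longrightarrow> x \<in> carrier (X k) \<Longrightarrow> (b, x) = (b, \<zero>\<^bsub>X k\<^esub>) \<oplus>\<^bsub>Y k\<^esub> (\<zero>\<^bsub>B\<^esub>, x)"
  by (rule with_proj_split[OF B X])

lemma Y_closed: "b \<in> carrier B \<Longrightarrow> x \<in> carrier (X k) \<Longrightarrow> (b, x) \<in> carrier (Y k)"
  by (simp add: with_proj_simps)

lemmas z_closed = cmod_zero_closed[OF cB] cmod_zero_closed[OF cX]

section \<open>The isomorphism V_k and its values on elementary tensors\<close>

abbreviation "TL k \<equiv> tensor B (Y k) (FL k)"
abbreviation "gl k p u \<equiv> gen_class (tensor_rels B (Y k) (FL k)) (p, u)"

context
  fixes k assumes k: "k \<in> K"
begin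

lemma gl_lin1: "u \<in> carrier (FL k) \<Longrightarrow> lin (Y k) (TL k) (\<lambda>p. gl k p u)"
  and gl_lin2: "p \<in> carrier (Y k) \<Longrightarrow> lin (FL k) (TL k) (\<lambda>u. gl k p u)"
  and gl_balanced: "p \<in> carrier (Y k) \<Longrightarrow> u \<in> carrier (FL k) \<Longrightarrow> b \<in> carrier B \<Longrightarrow> gl k (ract (Y k) p b) u = gl k p (lact (FL k) b u)"
  using bilin_gen_class[of B "Y k" "FL k"] by (auto simp: bilin_def)

lemma single_FL: "ks \<in> altl k \<Longrightarrow> lin (T ks) (FL k) (single ks)"
  unfolding FL_def by (rule single_lin) simp_all

lemma base_FL: "b \<in> carrier B \<Longrightarrow> (b, \<lambda>ks. \<zero>\<^bsub>T ks\<^esub>) \<in> carrier (FL k)"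
  unfolding FL_def by (rule base_closed) simp_all

lemma multilin_gl_single:
  "multilin B (map X [k]) (TL k) (\<lambda>xs. gl k (\<zero>\<^bsub>B\<^esub>, hd xs) unit)"
proof (rule multilin_TI)
  have l: "lin (X k) (TL k) (\<lambda>x. gl k (\<zero>\<^bsub>B\<^esub>, x) unit)"
    by (rule lin_comp[OF with_proj_lin(2)[OF B X] gl_lin1[OF base_FL]]) (simp add: calg_closed[OF B])
  fix xs assume "xs \<in> wds [k]"
  then obtain x where xs: "xs = [x]" "x \<in> carrier (X k)" by (cases xs) (auto simp: list.map)
  then show "gl k (\<zero>\<^bsub>B\<^esub>, hd xs) unit \<in> carrier (TL k)" using linD(1)[OF l] by simp
  fix i assume "i < length [k]"
  then show "lin (X ([k] ! i)) (TL k) (\<lambda>z. gl k (\<zero>\<^bsub>B\<^esub>, hd (xs[i := z])) unit)" using l xs by simp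
qed auto

text \<open>A word beginning with \<open>k\<close> is sent to its first letter tensored with the
  rest. Relations inside the rest already hold in \<open>T ks\<close>; the only new one links the
  first two letters.\<close>

lemma multilin_gl_cons:
  assumes ks: "ks \<in> altl k"
  shows "multilin B (map X (k # ks)) (TL k) (\<lambda>xs. gl k (\<zero>\<^bsub>B\<^esub>, hd xs) (single ks (tg ks (tl xs))))"
proof (rule multilin_TI)
  have l1: "lin (X k) (TL k) (\<lambda>x. gl k (\<zero>\<^bsub>B\<^esub>, x) (single ks (tg ks ys)))" if "ys \<in> wds ks" for ys
    by (rule lin_comp[OF with_proj_lin(2)[OF B X] gl_lin1[OF linD(1)[OF single_FL[OF ks] tg_closed[OF that]]]])
  have zx: "(\<zero>\<^bsub>B\<^esub>, x) \<in> carrier (Y k)" if "x \<in> carrier (X k)" for x using that by (simp add: with_proj_simps z_closed)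
  fix xs assume "xs \<in> wds (k # ks)"
  then obtain x ys where xs: "xs = x # ys" "x \<in> carrier (X k)" "ys \<in> wds ks" by (cases xs) (auto simp: list.map)
  then show "gl k (\<zero>\<^bsub>B\<^esub>, hd xs) (single ks (tg ks (tl xs))) \<in> carrier (TL k)" using linD(1)[OF l1] by simp
  fix i
  { assume i: "i < length (k # ks)"
    show "lin (X ((k # ks) ! i)) (TL k) (\<lambda>z. gl k (\<zero>\<^bsub>B\<^esub>, hd (xs[i := z])) (single ks (tg ks (tl (xs[i := z])))))"
    proof (cases i)
      case 0
      then show ?thesis using l1 xs by simp
    next
      case (Suc j)
      have "lin (X (ks ! j)) (TL k) (\<lambda>z. gl k (\<zero>\<^bsub>B\<^esub>, x) (single ks (tg ks (ys[j := z]))))"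
        by (rule lin_comp[OF tg_lin lin_comp[OF single_FL[OF ks] gl_lin2[OF zx]]]) (use xs i Suc in auto)
      then show ?thesis using xs Suc by simp
    qed }
  fix y z b assume *: "Suc i < length (k # ks)" "b \<in> carrier B" "y \<in> carrier (X ((k # ks) ! i))" "z \<in> carrier (X ((k # ks) ! Suc i))"
  show "gl k (\<zero>\<^bsub>B\<^esub>, hd (xs[i := ract (X ((k # ks) ! i)) y b, Suc i := z])) (single ks (tg ks (tl (xs[i := ract (X ((k # ks) ! i)) y b, Suc i := z])))) =
     gl k (\<zero>\<^bsub>B\<^esub>, hd (xs[i := y, Suc i := lact (X ((k # ks) ! Suc i)) b z])) (single ks (tg ks (tl (xs[i := y, Suc i := lact (X ((k # ks) ! Suc i)) b z]))))"
  proof (cases i)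
    case (Suc j)
    then show ?thesis using tg_balanced[of ys ks j b y z] * xs by simp
  next
    \<comment> \<open>The relation between the first letter and the rest becomes the balancing of
      \<open>TL k\<close>, by way of the left action on the rest.\<close>
    case 0
    have ne: "ks \<noteq> []" using ks by auto
    have ys: "ys[0 := z] \<in> wds ks" "ys \<noteq> []" using xs(3) * 0 by (auto simp: tlist_words_iff nth_list_update)
    have "gl k (\<zero>\<^bsub>B\<^esub>, ract (X k) y b) (single ks (tg ks (ys[0 := z]))) = gl k (ract (Y k) (\<zero>\<^bsub>B\<^esub>, y) b) (single ks (tg ks (ys[0 := z])))"
      using * by (simp add: with_proj_simps complex_algebraD(12)[OF B])
    also have "\<dots> = gl k (\<zero>\<^bsub>B\<^esub>, y) (lact (FL k) b (single ks (tg ks (ys[0 := z]))))"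
      by (rule gl_balanced) (use * 0 zx linD(1)[OF single_FL[OF ks] tg_closed[OF ys(1)]] in auto)
    also have "lact (FL k) b (single ks (tg ks (ys[0 := z]))) = single ks (tg ks (ys[0 := lact (X (ks ! 0)) b z]))"
      using * 0 xs(3) ys ne by (simp add: FL_ops lact_single T_lact hd_conv_nth)
    finally show ?thesis using 0 xs ys by simp
  qed
qed

text \<open>An explicit candidate for V_k, assembled from the summands: a vector of \<open>B\<close>
  or of a word not beginning with \<open>k\<close> goes to 1 tensored with it, \<open>[x]\<close>
  goes to \<open>x\<close> tensored with 1, and \<open>x # ys\<close> to \<open>x\<close> tensored
  with \<open>ys\<close>. That it undoes \<open>lj\<close> is checked for generators
  \<open>u\<close>, after splitting \<open>p\<close> into its part in \<open>B\<close> and its part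
  in \<open>X k\<close>.\<close>

lemma lj_coordinates:
  obtains \<Theta> where "lin FM (TL k) \<Theta>" "\<And>p u. p \<in> carrier (Y k) \<Longrightarrow> u \<in> carrier (FL k) \<Longrightarrow> \<Theta> (lj k (p, u)) = gl k p u"
proof -
  define \<theta> where "\<theta> ks = (if hd ks \<noteq> k then (\<lambda>t. gl k (unitY k) (single ks t))
     else if ks = [k] then qlift (TL k) (\<lambda>xs. gl k (\<zero>\<^bsub>B\<^esub>, hd xs) unit)
     else qlift (TL k) (\<lambda>xs. gl k (\<zero>\<^bsub>B\<^esub>, hd xs) (single (tl ks) (tg (tl ks) (tl xs)))))" for ks
  have cTL: "cmodule (TL k)" by (rule cmodule_tensor)
  have uY: "unitY k \<in> carrier (Y k)" by (simp add: with_proj_simps calg_closed[OF B] z_closed)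
  have \<theta>: "lin (T ks) (TL k) (\<theta> ks)" if ks: "ks \<in> alt_words K" for ks
  proof -
    consider "hd ks \<noteq> k" | "ks = [k]" | ks' where "ks = k # ks'" "ks' \<noteq> []"
      using ks by (cases ks) (auto simp: alt_words_def)
    then show ?thesis
    proof cases
      case 1
      then have "ks \<in> altl k" using ks by simp
      then show ?thesis using 1 lin_comp[OF single_FL gl_lin2[OF uY]] by (simp add: \<theta>_def)
    next
      case 2
      then show ?thesis using T_lift(1)[OF cTL multilin_gl_single] by (simp add: \<theta>_def)
    next
      case 3
      then have "ks' \<in> altl k" using ks Cons_alt_wordsD by blast
      then show ?thesis using 3 T_lift(1)[OF cTL multilin_gl_cons] by (simp add: \<theta>_def)
    qed
  qed
  let ?F = "fp_part B X (alt_words K)"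
  have d: "lin ?F (TL k) (dlift T (TL k) \<theta>)" "\<And>ks t. ks \<in> alt_words K \<Longrightarrow> t \<in> carrier (T ks) \<Longrightarrow> dlift T (TL k) \<theta> (dsingle T ks t) = \<theta> ks t"
    using dlift_lin[OF cT cTL \<theta>, where I = "alt_words K"] by (simp_all add: fp_part_def)
  have bF: "bimodule B ?F" by (rule bimodule_fp_part) simp
  define \<Theta> where "\<Theta> u = gl k (unitY k) (fst u, \<lambda>ks. \<zero>\<^bsub>T ks\<^esub>) \<oplus>\<^bsub>(TL k)\<^esub> dlift T (TL k) \<theta> (snd u)" for u
  have lb: "lin B (FL k) (\<lambda>b. (b, \<lambda>ks. \<zero>\<^bsub>T ks\<^esub>))"
    using with_proj_lin(1)[OF B bimodule_fp_part[of "altl k"]] by (simp add: FL_def fp_part_simps)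
  have \<Theta>: "lin FM (TL k) \<Theta>"
    unfolding \<Theta>_def fp_mod_def
    by (rule lin_add[OF cTL lin_comp[OF lin_comp[OF with_proj_lin(3)[OF B bF] lb] gl_lin2[OF uY]] lin_comp[OF with_proj_lin(4)[OF B bF] d(1)]])
  have \<Theta>b: "\<Theta> (b, \<lambda>ks. \<zero>\<^bsub>T ks\<^esub>) = gl k (unitY k) (b, \<lambda>ks. \<zero>\<^bsub>T ks\<^esub>)" if "b \<in> carrier B" for b
    using lin_zero[OF bimoduleD(1)[OF bF] cTL d(1)] linD(1)[OF gl_lin2[OF uY] base_FL[OF that]]
    by (simp add: \<Theta>_def fp_part_simps cmod_simps[OF cTL])
  have zFL: "\<zero>\<^bsub>FL k\<^esub> = (\<zero>\<^bsub>B\<^esub>, \<lambda>ks. \<zero>\<^bsub>T ks\<^esub>)" by (simp add: FL_def fp_simps)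
  have \<Theta>s: "\<Theta> (single ks t) = \<theta> ks t" if "ks \<in> alt_words K" "t \<in> carrier (T ks)" for ks t
    using lin_zero[OF bimoduleD(1)[OF bFL] cTL gl_lin2[OF uY]] linD(1)[OF \<theta>[OF that(1)] that(2)] d(2)[OF that]
    by (simp add: \<Theta>_def cmod_simps[OF cTL] zFL)
  have \<Theta>lj: "\<Theta> (lj k (p, u)) = gl k p u" if p: "p \<in> carrier (Y k)" and u: "u \<in> carrier (FL k)" for p u
  proof -
    obtain b x where bx: "p = (b, x)" "b \<in> carrier B" "x \<in> carrier (X k)" using p by (rule carrier_YE)
    have b0: "(b, \<zero>\<^bsub>X k\<^esub>) \<in> carrier (Y k)" and x0: "(\<zero>\<^bsub>B\<^esub>, x) \<in> carrier (Y k)"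
      using bx by (auto simp: with_proj_simps z_closed)
    \<comment> \<open>\<open>b\<close> is \<open>1 b\<close>, and the factor \<open>b\<close> is
      carried across the tensor sign to \<open>v\<close>.\<close>
    have split: "gl k p v = gl k (unitY k) (lact FM b v) \<oplus>\<^bsub>(TL k)\<^esub> gl k (\<zero>\<^bsub>B\<^esub>, x) v" if v: "v \<in> carrier (FL k)" for v
    proof -
      have "(b, \<zero>\<^bsub>X k\<^esub>) = ract (Y k) (unitY k) b"
        using bx by (simp add: with_proj_simps calg_simps[OF B] bimodule_zero[OF X])
      then have "gl k (b, \<zero>\<^bsub>X k\<^esub>) v = gl k (unitY k) (lact FM b v)"
        using gl_balanced[OF uY v bx(2)] by (simp add: FL_ops)
      then show ?thesis
        using linD(2)[OF gl_lin1[OF v] b0 x0] Y_split[OF bx(2,3)] bx(1) by simp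
    qed
    have l1: "lin (FL k) FM (\<lambda>u. lj k (p, u))" using lj_bilin[OF k] p by (simp add: bilin_def)
    show ?thesis
    proof (rule lin_eqI[OF spans_FP[of "altl k", folded FL_def] bimoduleD(1)[OF bFL] cTL lin_comp[OF l1 \<Theta>] gl_lin2[OF p] _ u])
      fix v assume "v \<in> (\<lambda>b. (b, \<lambda>ks. \<zero>\<^bsub>T ks\<^esub>)) ` carrier B \<union> (\<Union>ks\<in>altl k. (\<lambda>xs. single ks (tg ks xs)) ` wds ks)"
      then show "\<Theta> (lj k (p, v)) = gl k p v"
      proof (elim UnE imageE UN_E)
        fix b' assume v: "v = (b', \<lambda>ks. \<zero>\<^bsub>T ks\<^esub>)" and b': "b' \<in> carrier B"
        have xb: "ract (X k) x b' \<in> carrier (X k)" using bx b' by (simp add: sX)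
        have kk: "[k] \<in> alt_words K" by (rule single_alt_words[OF k])
        have t: "tg [k] [ract (X k) x b'] \<in> carrier (T [k])" by (rule tg_closed) (simp add: xb)
        have bb: "b \<otimes>\<^bsub>B\<^esub> b' \<in> carrier B" using bx b' by (simp add: calg_closed[OF B])
        have "lj k (p, v) = (b \<otimes>\<^bsub>B\<^esub> b', \<lambda>ks. \<zero>\<^bsub>T ks\<^esub>) \<oplus>\<^bsub>FM\<^esub> single [k] (tg [k] [ract (X k) x b'])"
          unfolding bx(1) v lj_base[OF k bx(2,3) b']
          by (rule base_split[OF bb, of _ "alt_words K"]) (use linD(1)[OF single_FM[OF kk] t] in \<open>auto simp: fp_mod_def with_proj_simps\<close>)
        then have "\<Theta> (lj k (p, v)) = gl k (unitY k) (b \<otimes>\<^bsub>B\<^esub> b', \<lambda>ks. \<zero>\<^bsub>T ks\<^esub>) \<oplus>\<^bsub>(TL k)\<^esub> gl k (\<zero>\<^bsub>B\<^esub>, ract (X k) x b') unit"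
          using linD(2)[OF \<Theta> base_FM[OF bb] linD(1)[OF single_FM[OF kk] t]] \<Theta>b[OF bb] \<Theta>s[OF kk t]
            T_lift(2)[OF cTL multilin_gl_single, of "[ract (X k) x b']"] xb
          by (simp add: \<theta>_def)
        moreover have "gl k (\<zero>\<^bsub>B\<^esub>, ract (X k) x b') unit = gl k (\<zero>\<^bsub>B\<^esub>, x) v"
          using gl_balanced[OF x0 base_FL[OF calg_closed(2)[OF B]] b'] b'
          by (simp add: v with_proj_simps FL_ops lact_base calg_closed[OF B] calg_simps[OF B])
        ultimately show ?thesis
          using split[of v] base_FL[OF b'] bx b' by (simp add: v lact_base)
      next
        fix ks xs assume ks: "ks \<in> altl k" and xs: "xs \<in> wds ks" and v: "v = single ks (tg ks xs)"
        have ne: "ks \<noteq> []" using ks by (auto simp: alt_words_def)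
        have ka: "ks \<in> alt_words K" "k # ks \<in> alt_words K" "hd ks \<noteq> k" using ks Cons_alt_words[OF k ks] by auto
        have t: "lact (T ks) b (tg ks xs) \<in> carrier (T ks)" using bimodule_simps(1)[OF bT[OF ne] bx(2) tg_closed[OF xs]] .
        have t': "tg (k # ks) (x # xs) \<in> carrier (T (k # ks))" by (rule tg_closed) (simp add: bx xs)
        have "lj k (p, v) = single ks (lact (T ks) b (tg ks xs)) \<oplus>\<^bsub>FM\<^esub> single (k # ks) (tg (k # ks) (x # xs))"
          unfolding bx(1) v using lj_single[OF k bx(2,3) tg_closed[OF xs] ne] by (simp add: cons_tg[OF bx(3)])
        then have "\<Theta> (lj k (p, v)) = gl k (unitY k) (single ks (lact (T ks) b (tg ks xs))) \<oplus>\<^bsub>(TL k)\<^esub> gl k (\<zero>\<^bsub>B\<^esub>, x) v"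
          using linD(2)[OF \<Theta> linD(1)[OF single_FM[OF ka(1)] t] linD(1)[OF single_FM[OF ka(2)] t']]
            \<Theta>s[OF ka(1) t] \<Theta>s[OF ka(2) t'] T_lift(2)[OF cTL multilin_gl_cons[OF ks], of "x # xs"] xs bx ne ka
          by (simp add: \<theta>_def v)
        then show ?thesis
          using split[of v] linD(1)[OF single_FL[OF ks] tg_closed[OF xs]] bx
          by (simp add: v lact_single)
      qed
    qed simp
  qed
  show thesis by (rule that[OF \<Theta> \<Theta>lj])
qed

text \<open>Exhibits every vector of \<open>FL k\<close> as an elementary tensor, which yields most
  of the spanning set of the free product.\<close>

lemma lj_unit:
  assumes "u \<in> carrier (FL k)"
  shows "(lj k) (unitY k, u) = u"
proof -
  obtain b \<xi> where u: "u = (b, \<xi>)" "b \<in> carrier B" "\<xi> \<in> carrier (fp_part B X (altl k))"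
    using assms unfolding FL_def by (rule carrier_FPE)
  note nth = fp_part_nth[OF u(3)]
  have "lact (T ks) \<one>\<^bsub>B\<^esub> (\<xi> ks) \<oplus>\<^bsub>T ks\<^esub> lpart k \<zero>\<^bsub>X k\<^esub> b \<xi> ks = \<xi> ks" for ks
    using nth[of ks] lin_zero[OF cX cT lpart_lin[OF nth u(2), of k ks]] fp_part_zero[OF u(3), of "[]"]
    by (cases "ks = []") (auto simp: cmod_simps[OF cT] bimodule_simps[OF bT] T_act_zero calg_closed[OF B])
  then show ?thesis using u by (simp add: left_join_eq calg_simps[OF B])
qed

text \<open>Each generator of the free product is one elementary tensor: 1 tensored with it, or, if
  its word begins with \<open>k\<close>, its first letter tensored with the rest.\<close>

lemma spans_lj: "spans FM ((lj k) ` (carrier (Y k) \<times> carrier (FL k)))"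
proof (rule spans_mono[OF spans_FM])
  show "(lj k) ` (carrier (Y k) \<times> carrier (FL k)) \<subseteq> carrier FM"
    using lj_closed[OF k] by auto
  have uY: "unitY k \<in> carrier (Y k)" by (simp add: with_proj_simps calg_closed[OF B] z_closed)
  have mem: "v \<in> (lj k) ` (carrier (Y k) \<times> carrier (FL k))"
    if "lj k (p, u) = v" "p \<in> carrier (Y k)" "u \<in> carrier (FL k)" for p u v
    by (rule image_eqI[of _ _ "(p, u)"]) (use that in auto)
  have memFL: "u \<in> (lj k) ` (carrier (Y k) \<times> carrier (FL k))" if "u \<in> carrier (FL k)" for u
    by (rule mem[OF lj_unit[OF that] uY that])
  have s: "single ks (tg ks xs) \<in> (lj k) ` (carrier (Y k) \<times> carrier (FL k))" if ks: "ks \<in> alt_words K" and xs: "xs \<in> wds ks" for ks xs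
  proof (cases "hd ks = k")
    case False
    then show ?thesis using memFL linD(1)[OF single_FL tg_closed[OF xs]] ks by simp
  next
    case True
    then obtain ks' where ks': "ks = k # ks'" using ks by (cases ks) auto
    then obtain x ys where xys: "xs = x # ys" "x \<in> carrier (X k)" "ys \<in> wds ks'" using xs by (cases xs) (auto simp: list.map)
    have x0: "(\<zero>\<^bsub>B\<^esub>, x) \<in> carrier (Y k)" using xys by (simp add: with_proj_simps z_closed)
    show ?thesis
    proof (cases "ks' = []")
      case True
      have "(lj k) ((\<zero>\<^bsub>B\<^esub>, x), unit) = single ks (tg ks xs)"
        using lj_base[OF k z_closed(1) xys(2) calg_closed(2)[OF B]] True ks' xys by (simp add: calg_simps[OF B] calg_closed[OF B] sX)
      then show ?thesis by (rule mem[OF _ x0 base_FL[OF calg_closed(2)[OF B]]])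
    next
      case False
      then have a: "ks' \<in> altl k" using ks ks' Cons_alt_wordsD by blast
      have ka: "ks' \<in> alt_words K" using a by simp
      have "(lj k) ((\<zero>\<^bsub>B\<^esub>, x), single ks' (tg ks' ys)) = single ks' \<zero>\<^bsub>T ks'\<^esub> \<oplus>\<^bsub>FM\<^esub> single ks (tg ks xs)"
        using lj_single[OF k z_closed(1) xys(2) tg_closed[OF xys(3)] False] xys ks'
        by (simp add: cons_tg bimodule_zero'[OF bT[OF False] cB tg_closed[OF xys(3)]])
      also have "\<dots> = single ks (tg ks xs)"
        using lin_zero[OF cT cFM single_FM[OF ka]] linD(1)[OF single_FM[OF ks] tg_closed[OF xs]] by (simp add: cmod_simps[OF cFM])
      finally show ?thesis by (rule mem[OF _ x0 linD(1)[OF single_FL[OF a] tg_closed[OF xys(3)]]])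
    qed
  qed
  show "(\<lambda>b. (b, \<lambda>ks. \<zero>\<^bsub>T ks\<^esub>)) ` carrier B \<union> (\<Union>ks\<in>alt_words K. (\<lambda>xs. single ks (tg ks xs)) ` wds ks)
    \<subseteq> (lj k) ` (carrier (Y k) \<times> carrier (FL k))"
    using memFL base_FL s by auto
qed

lemma V_inv_gl: "lin (TL k) FM (V_inv B K X k)"
  "p \<in> carrier (Y k) \<Longrightarrow> u \<in> carrier (FL k) \<Longrightarrow> V_inv B K X k (gl k p u) = lj k (p, u)"
  unfolding V_inv_def by (rule tensor_lift[OF bY bFL cFM lj_bilin[OF k]]; assumption)+

text \<open>\<open>lin_inverse\<close> identifies the \<open>inv_into\<close> in
  \<open>V_iso\<close> with the map of \<open>lj_coordinates\<close>. From here on only its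
  linearity and its values on elementary tensors are used.\<close>

lemma V_iso_lj: "lin FM (TL k) (V_iso B K X k)"
  "p \<in> carrier (Y k) \<Longrightarrow> u \<in> carrier (FL k) \<Longrightarrow> V_iso B K X k (lj k (p, u)) = gl k p u"
proof -
  obtain \<Theta> where \<Theta>: "lin FM (TL k) \<Theta>" "\<And>p u. p \<in> carrier (Y k) \<Longrightarrow> u \<in> carrier (FL k) \<Longrightarrow> \<Theta> (lj k (p, u)) = gl k p u"
    using lj_coordinates by blast
  let ?G = "gen_class (tensor_rels B (Y k) (FL k)) ` (carrier (Y k) \<times> carrier (FL k))"
  have im: "V_inv B K X k ` ?G = (lj k) ` (carrier (Y k) \<times> carrier (FL k))"
    unfolding image_image by (rule image_cong) (auto simp: V_inv_gl)
  have eq: "V_iso B K X k v = \<Theta> v" if "v \<in> carrier FM" for v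
    unfolding V_iso_def
    by (rule lin_inverse[OF cmodule_tensor cFM V_inv_gl(1) \<Theta>(1) spans_tensor _ _ that])
       (use im spans_lj V_inv_gl(2) \<Theta>(2) in auto)
  show "lin FM (TL k) (V_iso B K X k)"
    by (rule lin_cong[OF eq cFM, THEN iffD2]) (use \<Theta>(1) in auto)
  show "p \<in> carrier (Y k) \<Longrightarrow> u \<in> carrier (FL k) \<Longrightarrow> V_iso B K X k (lj k (p, u)) = gl k p u"
    using eq[OF lj_closed[OF k]] \<Theta>(2) by simp
qed

section \<open>The operator a (x) Id and its transport to the free product\<close>

context
  fixes a assumes a: "a \<in> carrier (left_ops B (Y k))"
begin

lemma left_rep_tensor: "lin (TL k) (TL k) (qmap (tensor_rels B (Y k) (FL k)) (\<lambda>(x, \<xi>). (a x, \<xi>)))"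
  "qmap (tensor_rels B (Y k) (FL k)) (\<lambda>(x, \<xi>). (a x, \<xi>)) (gl k p u) = gl k (a p) u"
proof -
  have la: "lin (Y k) (Y k) a" using a by (simp add: left_ops_simps lin_opsD)
  have ra: "a (ract (Y k) p b) = ract (Y k) (a p) b" if "p \<in> carrier (Y k)" "b \<in> carrier B" for p b
    using a that by (simp add: left_ops_simps)
  have bl: "bilin B (Y k) (FL k) (TL k) (\<lambda>w. gen_class (tensor_rels B (Y k) (FL k)) ((\<lambda>(x, \<xi>). (a x, \<xi>)) w))"
    unfolding bilin_def
    using lin_comp[OF la gl_lin1] gl_lin2[OF linD(1)[OF la]] gl_balanced[OF linD(1)[OF la]] ra by simp
  have im: "(\<lambda>(x, \<xi>). (a x, \<xi>)) ` (carrier (Y k) \<times> carrier (FL k)) \<subseteq> carrier (Y k) \<times> carrier (FL k)"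
    using linD(1)[OF la] by auto
  show "lin (TL k) (TL k) (qmap (tensor_rels B (Y k) (FL k)) (\<lambda>(x, \<xi>). (a x, \<xi>)))"
    by (rule tensor_map(1)[OF bY bFL im bl])
  show "qmap (tensor_rels B (Y k) (FL k)) (\<lambda>(x, \<xi>). (a x, \<xi>)) (gl k p u) = gl k (a p) u"
    using tensor_map(2)[OF bY bFL im bl, of "(p, u)"] by simp
qed

lemma left_rep_closed: "left_rep B K X k a \<in> carrier (lin_ops FM)"
  using lin_comp[OF lin_comp[OF V_iso_lj(1) left_rep_tensor(1)] V_inv_gl(1)]
  by (auto simp: lin_ops_simps left_rep_def linear_on_def Pi_iff cmod_closed[OF cFM])

text \<open>The working description of the left regular representation: the operator acts on the
  first tensor factor. Right linearity of \<open>a\<close> is what lets it pass to the tensor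
  product over \<open>B\<close>.\<close>

lemma left_rep_lj:
  assumes "p \<in> carrier (Y k)" "u \<in> carrier (FL k)"
  shows "left_rep B K X k a (lj k (p, u)) = (lj k) (a p, u)"
proof -
  have "a p \<in> carrier (Y k)" using a assms(1) linD(1) by (auto simp: left_ops_simps lin_ops_simps)
  then show ?thesis
    using assms lj_closed[OF k assms] by (simp add: left_rep_def V_iso_lj(2) left_rep_tensor(2) V_inv_gl(2))
qed

end
end
end

context bimodule_family
begin

subsection \<open>The right regular representation\<close>

abbreviation "snoc k ks x \<equiv> qmap (tlist_rels B (map X (ks @ [k]))) (\<lambda>xs. xs @ [x])"

lemma multilin_snoc:
  assumes x: "x \<in> carrier (X k)"
  shows "multilin B (map X ks) (T (ks @ [k])) (\<lambda>xs. tg (ks @ [k]) (xs @ [x]))"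
proof (rule multilin_TI)
  fix xs i assume "xs \<in> wds ks" "i < length ks"
  then show "lin (X (ks ! i)) (T (ks @ [k])) (\<lambda>z. tg (ks @ [k]) (xs[i := z] @ [x]))"
    using tg_lin[of "xs @ [x]" "ks @ [k]" i] x by (simp add: wds_iff list_update_append nth_append)
next
  fix xs i y z b
  assume "xs \<in> wds ks" "Suc i < length ks" "b \<in> carrier B" "y \<in> carrier (X (ks ! i))" "z \<in> carrier (X (ks ! Suc i))"
  then show "tg (ks @ [k]) (xs[i := ract (X (ks ! i)) y b, Suc i := z] @ [x]) =
      tg (ks @ [k]) (xs[i := y, Suc i := lact (X (ks ! Suc i)) b z] @ [x])"
    using tg_balanced[of "xs @ [x]" "ks @ [k]" i b y z] x by (simp add: wds_iff list_update_append nth_append)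
qed (use x tg_closed[of "xs @ [x]" "ks @ [k]" for xs] in simp)

lemma snoc_lin: "x \<in> carrier (X k) \<Longrightarrow> lin (T ks) (T (ks @ [k])) (snoc k ks x)"
  and snoc_tg: "x \<in> carrier (X k) \<Longrightarrow> snoc k ks x (tg ks xs) = tg (ks @ [k]) (xs @ [x])"
proof -
  assume x: "x \<in> carrier (X k)"
  have "(\<lambda>xs. xs @ [x]) ` wds ks \<subseteq> wds (ks @ [k])" using x by auto
  note * = tlist_map[OF Ms this multilin_snoc[OF x]]
  show "lin (T ks) (T (ks @ [k])) (snoc k ks x)" by (rule *)
  show "snoc k ks x (tg ks xs) = tg (ks @ [k]) (xs @ [x])" by (rule *)
qed

lemma snoc_closed: "x \<in> carrier (X k) \<Longrightarrow> t \<in> carrier (T ks) \<Longrightarrow> snoc k ks x t \<in> carrier (T (ks @ [k]))"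
  by (rule linD(1)[OF snoc_lin])

lemma snoc_zero: "x \<in> carrier (X k) \<Longrightarrow> snoc k ks x \<zero>\<^bsub>T ks\<^esub> = \<zero>\<^bsub>T (ks @ [k])\<^esub>"
  by (rule lin_zero[OF cT cT snoc_lin])

lemma snoc_lin2:
  assumes "t \<in> carrier (T ks)"
  shows "lin (X k) (T (ks @ [k])) (\<lambda>x. snoc k ks x t)"
  using spans_T assms
proof (induction rule: spans_induct)
  case (gen t)
  then obtain xs where xs: "xs \<in> wds ks" "t = tg ks xs" by auto
  then have len: "length xs = length ks" by (simp add: wds_iff)
  have "lin (X k) (T (ks @ [k])) (\<lambda>z. tg (ks @ [k]) (xs @ [z]))"
    using tg_lin[of "xs @ [\<zero>\<^bsub>X k\<^esub>]" "ks @ [k]" "length xs"] xs len cmod_zero_closed[OF cX]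
    by (simp add: list_update_append)
  then show ?case by (rule lin_cong[OF _ cX, THEN iffD1, rotated]) (simp only: snoc_tg xs)
next
  case zero
  have "lin (X k) (T (ks @ [k])) (\<lambda>x. \<zero>\<^bsub>T (ks @ [k])\<^esub>)" by (intro linI) (simp_all add: cT cmod_closed cmod_simps)
  then show ?case by (rule lin_cong[OF _ cX, THEN iffD1, rotated]) (simp only: snoc_zero)
next
  case (add t u)
  from lin_add[OF cT add(3,4)] show ?case
    by (rule lin_cong[OF _ cX, THEN iffD1, rotated]) (simp only: add linD[OF snoc_lin])
next
  case (smult c t)
  from lin_smult[OF cT smult(2)] show ?case
    by (rule lin_cong[OF _ cX, THEN iffD1, rotated]) (simp only: smult linD[OF snoc_lin])
qed

lemma wds_snocE:
  assumes "xs \<in> wds (ks @ [k])"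
  obtains ys x where "xs = ys @ [x]" "x \<in> carrier (X k)" "ys \<in> wds ks"
proof (cases xs rule: rev_cases)
  case Nil
  then show ?thesis using assms by (simp add: wds_iff)
next
  case (snoc ys y)
  then show ?thesis using that assms by simp
qed

lemma T_ract_snoc:
  "b \<in> carrier B \<Longrightarrow> x \<in> carrier (X k) \<Longrightarrow> xs \<in> wds ks \<Longrightarrow>
    ract (T (ks @ [k])) (tg (ks @ [k]) (xs @ [x])) b = tg (ks @ [k]) (xs @ [ract (X k) x b])"
  using T_ract[of "ks @ [k]" b "xs @ [x]"] by (simp del: wds_iff) (simp add: wds_iff list_update_append)

text \<open>Mirror of \<open>cons_balanced\<close>: the relation between the last two entries. With
  \<open>ks\<close> split as \<open>ks' @ [k']\<close>, it sits at position
  \<open>length ks'\<close>.\<close>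

lemma snoc_balanced:
  assumes "ks \<noteq> []" "x \<in> carrier (X k)" "b \<in> carrier B" "t \<in> carrier (T ks)"
  shows "snoc k ks (lact (X k) b x) t = snoc k ks x (ract (T ks) t b)"
proof (rule lin_eqI[OF spans_T cT cT _ _ _ assms(4)])
  have bx: "lact (X k) b x \<in> carrier (X k)" using assms by (simp add: sX)
  show "lin (T ks) (T (ks @ [k])) (snoc k ks (lact (X k) b x))" by (rule snoc_lin[OF bx])
  show "lin (T ks) (T (ks @ [k])) (\<lambda>t. snoc k ks x (ract (T ks) t b))"
    by (rule lin_comp[OF T_ract_lin snoc_lin]) (use assms in auto)
  fix t assume "t \<in> tg ks ` wds ks"
  then obtain xs where xs: "xs \<in> wds ks" "t = tg ks xs" by auto
  have "length xs = length ks" using xs by (simp add: wds_iff)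
  obtain ks' k' where ks: "ks = ks' @ [k']" using assms(1) by (cases ks rule: rev_cases) auto
  obtain ys y where xs': "xs = ys @ [y]"
    using \<open>length xs = length ks\<close> assms(1) by (cases xs rule: rev_cases) auto
  have y: "y \<in> carrier (X k')" "ys \<in> wds ks'" using xs(1) unfolding ks xs' by auto
  then have len: "length ys = length ks'" by (simp add: wds_iff)
  have xb: "ract (X k') y b \<in> carrier (X k')" using y assms(3) by (simp add: sX)
  show "snoc k ks (lact (X k) b x) t = snoc k ks x (ract (T ks) t b)"
    using tg_balanced[of "ys @ [y, x]" "ks' @ [k', k]" "length ks'" b y x] assms(2-3) y wds_snoc[of "ys @ [y]" x "ks' @ [k']" k]
    unfolding xs(2) snoc_tg[OF bx] unfolding ks xs' T_ract_snoc[OF assms(3) y] snoc_tg[OF assms(2)]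
    by (simp add: len[symmetric]) (simp add: len nth_append list_update_append)
qed

lemma snoc_ract:
  assumes "x \<in> carrier (X k)" "b \<in> carrier B" "t \<in> carrier (T ks)"
  shows "ract (T (ks @ [k])) (snoc k ks x t) b = snoc k ks (ract (X k) x b) t"
proof (rule lin_eqI[OF spans_T cT cT _ _ _ assms(3)])
  have xb: "ract (X k) x b \<in> carrier (X k)" using assms by (simp add: sX)
  show "lin (T ks) (T (ks @ [k])) (snoc k ks (ract (X k) x b))" by (rule snoc_lin[OF xb])
  show "lin (T ks) (T (ks @ [k])) (\<lambda>t. ract (T (ks @ [k])) (snoc k ks x t) b)"
    by (rule lin_comp[OF snoc_lin T_ract_lin]) (use assms in auto)
  fix t assume "t \<in> tg ks ` wds ks"
  then obtain xs where xs: "xs \<in> wds ks" "t = tg ks xs" by auto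
  then show "ract (T (ks @ [k])) (snoc k ks x t) b = snoc k ks (ract (X k) x b) t"
    unfolding xs(2) snoc_tg[OF assms(1)] snoc_tg[OF xb]
    using T_ract_snoc[OF assms(2,1)] by simp
qed

lemma snoc_lact:
  assumes "ks \<noteq> []" "x \<in> carrier (X k)" "b \<in> carrier B" "t \<in> carrier (T ks)"
  shows "lact (T (ks @ [k])) b (snoc k ks x t) = snoc k ks x (lact (T ks) b t)"
proof (rule lin_eqI[OF spans_T cT cT _ _ _ assms(4)])
  show "lin (T ks) (T (ks @ [k])) (\<lambda>t. snoc k ks x (lact (T ks) b t))"
    by (rule lin_comp[OF T_lact_lin snoc_lin]) (use assms in auto)
  show "lin (T ks) (T (ks @ [k])) (\<lambda>t. lact (T (ks @ [k])) b (snoc k ks x t))"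
    by (rule lin_comp[OF snoc_lin T_lact_lin]) (use assms in auto)
  fix t assume "t \<in> tg ks ` wds ks"
  then obtain xs where xs: "xs \<in> wds ks" "t = tg ks xs" by auto
  have "xs \<noteq> []" using assms(1) xs(1) by (auto simp: wds_iff)
  then show "lact (T (ks @ [k])) b (snoc k ks x t) = snoc k ks x (lact (T ks) b t)"
    unfolding xs(2) snoc_tg[OF assms(2)] T_lact[OF assms(1,3) xs(1)]
    using T_lact[of "ks @ [k]" b "xs @ [x]"] wds_snoc[of xs x ks k] assms xs by (cases xs) simp_all
qed

text \<open>The summand \<open>(b \<oplus> \<xi>) \<otimes> x\<close> of \<open>right_join\<close>,
  with \<open>b x\<close> in the word \<open>[k]\<close> and \<open>x\<close> appended to the words
  of \<open>\<xi>\<close>.\<close>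

definition rpart :: "'k \<Rightarrow> 'x \<Rightarrow> 'b \<Rightarrow> ('k, 'x) fp0 \<Rightarrow> ('k, 'x) fp0" where
  "rpart k x b \<xi> = (\<lambda>ks. if ks = [k] then tg [k] [lact (X k) b x]
     else if ks \<noteq> [] \<and> last ks = k then qmap (tlist_rels B (map X ks)) (\<lambda>xs. xs @ [x]) (\<xi> (butlast ks)) else \<zero>\<^bsub>T ks\<^esub>)"

lemma right_join_eq:
  "right_join B X k ((b', \<xi>), (b, x)) = (b' \<otimes>\<^bsub>B\<^esub> b, \<lambda>ks. ract (T ks) (\<xi> ks) b \<oplus>\<^bsub>T ks\<^esub> rpart k x b' \<xi> ks)"
  by (simp add: right_join_def Let_def rpart_def fun_eq_iff list.map)

lemma rpart_cases [case_names single cons other]: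
  obtains "ks = [k]" | ks' where "ks = ks' @ [k]" "ks' \<noteq> []" | "ks \<noteq> [k]" "\<And>ks'. ks \<noteq> ks' @ [k]"
proof (cases "\<exists>ks'. ks = ks' @ [k]")
  case True
  then obtain ks' where "ks = ks' @ [k]" by auto
  then show ?thesis using that(1,2) by (cases "ks' = []") auto
qed (use that(3) in auto)

lemma rpart_single: "rpart k x b \<xi> [k] = tg [k] [lact (X k) b x]"
  by (simp add: rpart_def)

lemma rpart_snoc: "ks \<noteq> [] \<Longrightarrow> rpart k x b \<xi> (ks @ [k]) = snoc k ks x (\<xi> ks)"
  by (simp add: rpart_def)

lemma rpart_other: "ks \<noteq> [k] \<Longrightarrow> (\<And>ks'. ks \<noteq> ks' @ [k]) \<Longrightarrow> rpart k x b \<xi> ks = \<zero>\<^bsub>T ks\<^esub>"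
  by (cases ks rule: rev_cases) (auto simp: rpart_def)

lemmas rpart_simps = rpart_single rpart_snoc rpart_other

lemma rpart_lin:
  assumes "\<And>ks. \<xi> ks \<in> carrier (T ks)" "b \<in> carrier B"
  shows "lin (X k) (T ks) (\<lambda>x. rpart k x b \<xi> ks)"
proof (cases rule: rpart_cases[of ks k])
  case single
  show ?thesis unfolding single rpart_single
    by (rule lin_comp[OF bimoduleD(2)[OF X assms(2)] tg_single_lin])
next
  case (cons ks')
  then show ?thesis using snoc_lin2[OF assms(1), of k ks'] by (simp add: rpart_snoc)
next
  case other
  then show ?thesis by (intro linI) (simp_all add: rpart_other cT cmod_closed cmod_simps)
qed

lemma rpart_add:
  assumes "\<And>ks. \<xi> ks \<in> carrier (T ks)" "b \<in> carrier B" "\<And>ks. \<xi>' ks \<in> carrier (T ks)" "b' \<in> carrier B" "x \<in> carrier (X k)"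
  shows "rpart k x (b \<oplus>\<^bsub>B\<^esub> b') (\<lambda>ks. \<xi> ks \<oplus>\<^bsub>T ks\<^esub> \<xi>' ks) ks = rpart k x b \<xi> ks \<oplus>\<^bsub>T ks\<^esub> rpart k x b' \<xi>' ks"
  by (cases rule: rpart_cases[of ks k])
     (use assms in \<open>simp_all add: rpart_simps sX linD[OF tg_single_lin] linD[OF snoc_lin] cT cmod_closed cmod_simps\<close>)

lemma rpart_smult:
  assumes "\<And>ks. \<xi> ks \<in> carrier (T ks)" "b \<in> carrier B" "x \<in> carrier (X k)"
  shows "rpart k x (c \<odot>\<^bsub>B\<^esub> b) (\<lambda>ks. c \<odot>\<^bsub>T ks\<^esub> \<xi> ks) ks = c \<odot>\<^bsub>T ks\<^esub> rpart k x b \<xi> ks"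
  by (cases rule: rpart_cases[of ks k])
     (use assms in \<open>simp_all add: rpart_simps sX linD[OF tg_single_lin] linD[OF snoc_lin] cT cmod_closed cmod_simps\<close>)

lemma rpart_balanced:
  assumes "\<And>ks. \<xi> ks \<in> carrier (T ks)" "b \<in> carrier B" "x \<in> carrier (X k)" "c \<in> carrier B"
  shows "rpart k (lact (X k) c x) b \<xi> ks = rpart k x (b \<otimes>\<^bsub>B\<^esub> c) (\<lambda>ks. ract (T ks) (\<xi> ks) c) ks"
  by (cases rule: rpart_cases[of ks k])
     (use assms in \<open>simp_all add: rpart_simps sX snoc_balanced\<close>)

lemma rpart_ract:
  assumes "\<And>ks. \<xi> ks \<in> carrier (T ks)" "b \<in> carrier B" "x \<in> carrier (X k)" "c \<in> carrier B"
  shows "ract (T ks) (rpart k x b \<xi> ks) c = rpart k (ract (X k) x c) b \<xi> ks"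
  by (cases rule: rpart_cases[of ks k])
     (use assms in \<open>simp_all add: rpart_simps sX snoc_ract T_act_zero T_ract\<close>)

lemma rpart_lact:
  assumes "\<And>ks. \<xi> ks \<in> carrier (T ks)" "b \<in> carrier B" "x \<in> carrier (X k)" "c \<in> carrier B"
  shows "lact (T ks) c (rpart k x b \<xi> ks) = rpart k x (c \<otimes>\<^bsub>B\<^esub> b) (\<lambda>ks. lact (T ks) c (\<xi> ks)) ks"
  by (cases rule: rpart_cases[of ks k])
     (use assms in \<open>simp_all add: rpart_simps sX snoc_lact T_act_zero T_lact\<close>)

lemma snoc_alt_words: "k \<in> K \<Longrightarrow> ks \<in> altr k \<Longrightarrow> ks @ [k] \<in> alt_words K"
  by (cases ks rule: rev_cases) (auto simp: alt_words_def distinct_adj_append_iff)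

lemma snoc_alt_wordsD: "ks @ [k] \<in> alt_words K \<Longrightarrow> ks \<noteq> [] \<Longrightarrow> ks \<in> altr k"
  by (cases ks rule: rev_cases) (auto simp: alt_words_def distinct_adj_append_iff)

section \<open>Elementary tensors in the free product, factored at the right end\<close>

abbreviation "rj k \<equiv> right_join B X k"
abbreviation "FR k \<equiv> fp_right B K X k"

lemma FR_def: "FR k = FP (altr k)"
  by (simp add: fp_right_def)

lemma bFR: "bimodule B (FR k)"
  unfolding FR_def by (rule bFP) simp

lemma FR_ops:
  "\<zero>\<^bsub>FR k\<^esub> = \<zero>\<^bsub>FM\<^esub>" "u \<oplus>\<^bsub>FR k\<^esub> v = u \<oplus>\<^bsub>FM\<^esub> v" "c \<odot>\<^bsub>FR k\<^esub> u = c \<odot>\<^bsub>FM\<^esub> u"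
  "ract (FR k) u b = ract FM u b" "lact (FR k) b u = lact FM b u"
  unfolding FR_def by (rule FP_ops)+

context
  fixes k assumes k: "k \<in> K"
begin

lemma rj_closed:
  assumes "p \<in> carrier (Y k)" "u \<in> carrier (FR k)"
  shows "rj k (u, p) \<in> carrier FM"
proof -
  obtain b x where p: "p = (b, x)" "b \<in> carrier B" "x \<in> carrier (X k)" using assms(1) by (rule carrier_YE)
  obtain b' \<xi> where u: "u = (b', \<xi>)" "b' \<in> carrier B" "\<xi> \<in> carrier (fp_part B X (altr k))"
    using assms(2) unfolding FR_def by (rule carrier_FPE)
  note nth = fp_part_nth[OF u(3)] and zero = fp_part_zero[OF u(3)]
  let ?f = "\<lambda>ks. ract (T ks) (\<xi> ks) b \<oplus>\<^bsub>T ks\<^esub> rpart k x b' \<xi> ks"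
  have "?f \<in> carrier (fp_part B X (alt_words K))"
  proof (rule fp_partI)
    fix ks assume "ks \<in> alt_words K"
    then have "ks \<noteq> []" by auto
    then show "?f ks \<in> carrier (T ks)"
      using bimodule_simps(2)[OF bT p(2) nth] linD(1)[OF rpart_lin[OF nth u(2)] p(3)]
      by (auto intro!: cmod_closed[OF cT])
  next
    fix ks assume ks: "ks \<notin> alt_words K"
    have "rpart k x b' \<xi> ks = \<zero>\<^bsub>T ks\<^esub>"
    proof (cases rule: rpart_cases[of ks k])
      case (cons ks')
      then have "\<xi> ks' = \<zero>\<^bsub>T ks'\<^esub>" using ks snoc_alt_words[OF k] zero by blast
      then show ?thesis using cons p(3) by (simp add: rpart_snoc snoc_zero)
    qed (use ks single_alt_words[OF k] in \<open>auto simp: rpart_other\<close>)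
    then show "?f ks = \<zero>\<^bsub>T ks\<^esub>"
      using zero[of ks] ks p(2) by (simp add: T_act_zero cmod_simps[OF cT] cmod_closed[OF cT])
  next
    let ?S = "{ks. \<xi> ks \<noteq> \<zero>\<^bsub>T ks\<^esub>}"
    show "finite (?S \<union> insert [k] ((\<lambda>ks. ks @ [k]) ` ?S))" using fp_part_finite[OF u(3)] by simp
    show "{ks. ?f ks \<noteq> \<zero>\<^bsub>T ks\<^esub>} \<subseteq> ?S \<union> insert [k] ((\<lambda>ks. ks @ [k]) ` ?S)"
    proof (rule subsetI, rule ccontr)
      fix ks assume *: "ks \<in> {ks. ?f ks \<noteq> \<zero>\<^bsub>T ks\<^esub>}" "ks \<notin> ?S \<union> insert [k] ((\<lambda>ks. ks @ [k]) ` ?S)"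
      have "rpart k x b' \<xi> ks = \<zero>\<^bsub>T ks\<^esub>"
        by (cases rule: rpart_cases[of ks k]) (use *(2) p(3) in \<open>auto simp: rpart_simps snoc_zero\<close>)
      then show False using * p(2) by (simp add: T_act_zero cmod_simps[OF cT] cmod_closed[OF cT])
    qed
  qed
  then show ?thesis
    using p u calg_closed[OF B] by (simp add: right_join_eq fp_mod_def with_proj_simps)
qed

lemma rj_act:
  assumes "p \<in> carrier (Y k)" "u \<in> carrier (FR k)" "c \<in> carrier B"
  shows "ract FM (rj k (u, p)) c = rj k (u, ract (Y k) p c)"
    "lact FM c (rj k (u, p)) = rj k (lact FM c u, p)"
    "rj k (u, lact (Y k) c p) = rj k (ract FM u c, p)"
proof -
  obtain b x where p: "p = (b, x)" "b \<in> carrier B" "x \<in> carrier (X k)" using assms(1) by (rule carrier_YE)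
  obtain b' \<xi> where u: "u = (b', \<xi>)" "b' \<in> carrier B" "\<xi> \<in> carrier (fp_part B X (altr k))"
    using assms(2) unfolding FR_def by (rule carrier_FPE)
  note nth = fp_part_nth[OF u(3)] and zero = fp_part_zero[OF u(3)]
  have lcl: "rpart k x b' \<xi> ks \<in> carrier (T ks)" for ks by (rule linD(1)[OF rpart_lin[OF nth u(2)] p(3)])
  have 0: "\<xi> [] = \<zero>\<^bsub>T []\<^esub>" by (rule zero) simp
  have 1: "rpart k y c' \<eta> [] = \<zero>\<^bsub>T []\<^esub>" for y c' \<eta> by (simp add: rpart_other)
  note simps = right_join_eq fp_mod_def fp_simps u p complex_algebraD(9)[OF B] assms(3) calg_closed[OF B]
  have "ract (T ks) (ract (T ks) (\<xi> ks) b \<oplus>\<^bsub>T ks\<^esub> rpart k x b' \<xi> ks) c =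
      ract (T ks) (\<xi> ks) (b \<otimes>\<^bsub>B\<^esub> c) \<oplus>\<^bsub>T ks\<^esub> rpart k (ract (X k) x c) b' \<xi> ks" for ks
    using p u assms(3) nth[of ks] lcl[of ks]
    by (cases "ks = []") (simp_all add: 0 1 T_act_zero cmod_simps[OF cT] cmod_closed[OF cT] calg_closed[OF B]
         bimodule_simps[OF bT] rpart_ract[OF nth])
  then show "ract FM (rj k (u, p)) c = rj k (u, ract (Y k) p c)" by (simp add: simps)
  have "lact (T ks) c (ract (T ks) (\<xi> ks) b \<oplus>\<^bsub>T ks\<^esub> rpart k x b' \<xi> ks) =
      ract (T ks) (lact (T ks) c (\<xi> ks)) b \<oplus>\<^bsub>T ks\<^esub> rpart k x (c \<otimes>\<^bsub>B\<^esub> b') (\<lambda>ks. lact (T ks) c (\<xi> ks)) ks" for ks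
    using p u assms(3) nth[of ks] lcl[of ks]
    by (cases "ks = []") (simp_all add: 0 1 T_act_zero cmod_simps[OF cT] cmod_closed[OF cT] calg_closed[OF B]
         bimodule_simps[OF bT] rpart_lact[OF nth])
  then show "lact FM c (rj k (u, p)) = rj k (lact FM c u, p)" by (simp add: simps)
  have "ract (T ks) (\<xi> ks) (c \<otimes>\<^bsub>B\<^esub> b) \<oplus>\<^bsub>T ks\<^esub> rpart k (lact (X k) c x) b' \<xi> ks =
      ract (T ks) (ract (T ks) (\<xi> ks) c) b \<oplus>\<^bsub>T ks\<^esub> rpart k x (b' \<otimes>\<^bsub>B\<^esub> c) (\<lambda>ks. ract (T ks) (\<xi> ks) c) ks" for ks
    using p u assms(3) nth[of ks] lcl[of ks]
    by (cases "ks = []") (simp_all add: 0 1 T_act_zero cmod_simps[OF cT] cmod_closed[OF cT] calg_closed[OF B]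
         bimodule_simps[OF bT] rpart_balanced[OF nth])
  then show "rj k (u, lact (Y k) c p) = rj k (ract FM u c, p)" by (simp add: simps)
qed

lemma rj_bilin: "bilin B (FR k) (Y k) FM (rj k)"
proof (rule bilinI)
  fix u p assume "u \<in> carrier (FR k)" "p \<in> carrier (Y k)"
  then have *: "p \<in> carrier (Y k)" "u \<in> carrier (FR k)" by auto
  show "rj k (u, p) \<in> carrier FM" by (rule rj_closed[OF *])
  show "rj k (ract (FR k) u b, p) = rj k (u, lact (Y k) b p)" if "b \<in> carrier B" for b
    using rj_act(3)[OF * that] by (simp add: FR_ops)
next
  fix p p' u assume "p \<in> carrier (Y k)" "p' \<in> carrier (Y k)" "u \<in> carrier (FR k)"
  then obtain b x b' x' c \<xi> where p: "p = (b, x)" "b \<in> carrier B" "x \<in> carrier (X k)"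
    and p': "p' = (b', x')" "b' \<in> carrier B" "x' \<in> carrier (X k)"
    and u: "u = (c, \<xi>)" "c \<in> carrier B" "\<xi> \<in> carrier (fp_part B X (altr k))"
    unfolding FR_def by (elim carrier_YE carrier_FPE)
  note nth = fp_part_nth[OF u(3)]
  have 0: "\<xi> [] = \<zero>\<^bsub>T []\<^esub>" by (rule fp_part_zero[OF u(3)]) simp
  have lcl: "rpart k y c \<xi> ks \<in> carrier (T ks)" if "y \<in> carrier (X k)" for ks y by (rule linD(1)[OF rpart_lin[OF nth u(2)] that])
  have "ract (T ks) (\<xi> ks) (b \<oplus>\<^bsub>B\<^esub> b') \<oplus>\<^bsub>T ks\<^esub> rpart k (x \<oplus>\<^bsub>X k\<^esub> x') c \<xi> ks =
     ract (T ks) (\<xi> ks) b \<oplus>\<^bsub>T ks\<^esub> rpart k x c \<xi> ks \<oplus>\<^bsub>T ks\<^esub> (ract (T ks) (\<xi> ks) b' \<oplus>\<^bsub>T ks\<^esub> rpart k x' c \<xi> ks)" for ks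
    using p p' u nth[of ks] lcl
    by (cases "ks = []") (simp_all add: 0 T_act_zero cmod_simps[OF cT] cmod_closed[OF cT] cmod_closed[OF cB]
         bimodule_simps[OF bT] linD[OF rpart_lin[OF nth]] cmod_ac[OF cT])
  then show "rj k (u, p \<oplus>\<^bsub>Y k\<^esub> p') = rj k (u, p) \<oplus>\<^bsub>FM\<^esub> rj k (u, p')"
    by (simp add: right_join_eq fp_mod_def fp_simps p p' u complex_algebraD(11)[OF B])
next
  fix p u u' assume "p \<in> carrier (Y k)" "u \<in> carrier (FR k)" "u' \<in> carrier (FR k)"
  then obtain b x c \<xi> c' \<xi>' where p: "p = (b, x)" "b \<in> carrier B" "x \<in> carrier (X k)"
    and u: "u = (c, \<xi>)" "c \<in> carrier B" "\<xi> \<in> carrier (fp_part B X (altr k))"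
    and u': "u' = (c', \<xi>')" "c' \<in> carrier B" "\<xi>' \<in> carrier (fp_part B X (altr k))"
    unfolding FR_def by (elim carrier_YE carrier_FPE)
  note nth = fp_part_nth[OF u(3)] and nth' = fp_part_nth[OF u'(3)]
  have 0: "\<xi> [] = \<zero>\<^bsub>T []\<^esub>" by (rule fp_part_zero[OF u(3)]) simp
  have z': "\<xi>' [] = \<zero>\<^bsub>T []\<^esub>" by (rule fp_part_zero[OF u'(3)]) simp
  have lcl: "rpart k x c \<xi> ks \<in> carrier (T ks)" "rpart k x c' \<xi>' ks \<in> carrier (T ks)" for ks
    using linD(1)[OF rpart_lin[OF nth u(2)] p(3)] linD(1)[OF rpart_lin[OF nth' u'(2)] p(3)] by auto
  have "ract (T ks) (\<xi> ks \<oplus>\<^bsub>T ks\<^esub> \<xi>' ks) b \<oplus>\<^bsub>T ks\<^esub> rpart k x (c \<oplus>\<^bsub>B\<^esub> c') (\<lambda>ks. \<xi> ks \<oplus>\<^bsub>T ks\<^esub> \<xi>' ks) ks =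
     ract (T ks) (\<xi> ks) b \<oplus>\<^bsub>T ks\<^esub> rpart k x c \<xi> ks \<oplus>\<^bsub>T ks\<^esub> (ract (T ks) (\<xi>' ks) b \<oplus>\<^bsub>T ks\<^esub> rpart k x c' \<xi>' ks)" for ks
    unfolding rpart_add[OF nth u(2) nth' u'(2) p(3)]
    using p u u' nth[of ks] nth'[of ks] lcl
    by (cases "ks = []") (simp_all add: 0 z' T_act_zero cmod_simps[OF cT] cmod_closed[OF cT] cmod_closed[OF cB]
         bimodule_simps[OF bT] cmod_ac[OF cT])
  then show "rj k (u \<oplus>\<^bsub>FR k\<^esub> u', p) = rj k (u, p) \<oplus>\<^bsub>FM\<^esub> rj k (u', p)"
    by (simp add: FR_ops right_join_eq fp_mod_def fp_simps p u u' complex_algebraD(10)[OF B])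
next
  fix p u a assume "p \<in> carrier (Y k)" "u \<in> carrier (FR k)"
  then obtain b x c \<xi> where p: "p = (b, x)" "b \<in> carrier B" "x \<in> carrier (X k)"
    and u: "u = (c, \<xi>)" "c \<in> carrier B" "\<xi> \<in> carrier (fp_part B X (altr k))"
    unfolding FR_def by (elim carrier_YE carrier_FPE)
  note nth = fp_part_nth[OF u(3)]
  have 0: "\<xi> [] = \<zero>\<^bsub>T []\<^esub>" by (rule fp_part_zero[OF u(3)]) simp
  have lcl: "rpart k x c \<xi> ks \<in> carrier (T ks)" for ks by (rule linD(1)[OF rpart_lin[OF nth u(2)] p(3)])
  have "ract (T ks) (\<xi> ks) (a \<odot>\<^bsub>B\<^esub> b) \<oplus>\<^bsub>T ks\<^esub> rpart k (a \<odot>\<^bsub>X k\<^esub> x) c \<xi> ks =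
     a \<odot>\<^bsub>T ks\<^esub> (ract (T ks) (\<xi> ks) b \<oplus>\<^bsub>T ks\<^esub> rpart k x c \<xi> ks)" for ks
    using p u nth[of ks] lcl[of ks]
    by (cases "ks = []") (simp_all add: 0 T_act_zero cmod_simps[OF cT] cmod_closed[OF cT] cmod_closed[OF cB]
         bimodule_simps[OF bT] linD[OF rpart_lin[OF nth]])
  then show "rj k (u, a \<odot>\<^bsub>Y k\<^esub> p) = a \<odot>\<^bsub>FM\<^esub> rj k (u, p)"
    by (simp add: right_join_eq fp_mod_def fp_simps p u complex_algebraD(4)[OF B])
  have "ract (T ks) (a \<odot>\<^bsub>T ks\<^esub> \<xi> ks) b \<oplus>\<^bsub>T ks\<^esub> rpart k x (a \<odot>\<^bsub>B\<^esub> c) (\<lambda>ks. a \<odot>\<^bsub>T ks\<^esub> \<xi> ks) ks =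
     a \<odot>\<^bsub>T ks\<^esub> (ract (T ks) (\<xi> ks) b \<oplus>\<^bsub>T ks\<^esub> rpart k x c \<xi> ks)" for ks
    unfolding rpart_smult[OF nth u(2) p(3)]
    using p u nth[of ks] lcl[of ks]
    by (cases "ks = []") (simp_all add: 0 T_act_zero cmod_simps[OF cT] cmod_closed[OF cT] cmod_closed[OF cB]
         bimodule_simps[OF bT])
  then show "rj k (a \<odot>\<^bsub>FR k\<^esub> u, p) = a \<odot>\<^bsub>FM\<^esub> rj k (u, p)"
    by (simp add: FR_ops right_join_eq fp_mod_def fp_simps p u complex_algebraD(3)[OF B])
qed

lemma rj_base:
  assumes "b \<in> carrier B" "x \<in> carrier (X k)" "b' \<in> carrier B"
  shows "rj k ((b', \<lambda>ks. \<zero>\<^bsub>T ks\<^esub>), (b, x)) = (b' \<otimes>\<^bsub>B\<^esub> b, dsingle T [k] (tg [k] [lact (X k) b' x]))"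
proof -
  have "ract (T ks) \<zero>\<^bsub>T ks\<^esub> b \<oplus>\<^bsub>T ks\<^esub> rpart k x b' (\<lambda>ks. \<zero>\<^bsub>T ks\<^esub>) ks = dsingle T [k] (tg [k] [lact (X k) b' x]) ks" for ks
    by (cases rule: rpart_cases[of ks k])
       (use assms in \<open>simp_all add: rpart_simps snoc_zero T_act_zero dsingle_def cmod_closed[OF cT] cmod_simps[OF cT] tg_closed sX\<close>)
  then show ?thesis by (simp add: right_join_eq)
qed

lemma rj_single:
  assumes "b \<in> carrier B" "x \<in> carrier (X k)" "t \<in> carrier (T ks)" "ks \<noteq> []"
  shows "rj k (single ks t, (b, x)) = single ks (ract (T ks) t b) \<oplus>\<^bsub>FM\<^esub> single (ks @ [k]) (snoc k ks x t)"
proof -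
  have "ract (T ks') (dsingle T ks t ks') b \<oplus>\<^bsub>T ks'\<^esub> rpart k x \<zero>\<^bsub>B\<^esub> (dsingle T ks t) ks' =
     dsingle T ks (ract (T ks) t b) ks' \<oplus>\<^bsub>T ks'\<^esub> dsingle T (ks @ [k]) (snoc k ks x t) ks'" for ks'
  proof -
    have "ract (T ks') (dsingle T ks t ks') b = dsingle T ks (ract (T ks) t b) ks'"
      using assms by (auto simp: dsingle_def T_act_zero)
    moreover have "rpart k x \<zero>\<^bsub>B\<^esub> (dsingle T ks t) ks' = dsingle T (ks @ [k]) (snoc k ks x t) ks'"
      by (cases rule: rpart_cases[of ks' k])
         (use assms lin_zero[OF cX cT tg_single_lin] in \<open>auto simp: rpart_simps dsingle_def snoc_zero bimodule_zero'[OF X cB]\<close>)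
    ultimately show ?thesis by simp
  qed
  then show ?thesis
    using assms by (simp add: right_join_eq fp_mod_def fp_simps complex_algebraD(12)[OF B] cmod_simps[OF cB] cmod_closed[OF cB])
qed
end

section \<open>The isomorphism W_k and its values on elementary tensors\<close>

abbreviation "TR k \<equiv> tensor B (FR k) (Y k)"
abbreviation "gr k u p \<equiv> gen_class (tensor_rels B (FR k) (Y k)) (u, p)"

context
  fixes k assumes k: "k \<in> K"
begin

lemma gr_lin1: "u \<in> carrier (FR k) \<Longrightarrow> lin (Y k) (TR k) (\<lambda>p. gr k u p)"
  and gr_lin2: "p \<in> carrier (Y k) \<Longrightarrow> lin (FR k) (TR k) (\<lambda>u. gr k u p)"
  and gr_balanced: "p \<in> carrier (Y k) \<Longrightarrow> u \<in> carrier (FR k) \<Longrightarrow> b \<in> carrier B \<Longrightarrow> gr k u (lact (Y k) b p) = gr k (ract (FR k) u b) p"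
  using bilin_gen_class[of B "FR k" "Y k"] unfolding bilin_def by (fast, fast, metis)

lemma single_FR: "ks \<in> altr k \<Longrightarrow> lin (T ks) (FR k) (single ks)"
  unfolding FR_def by (rule single_lin) simp_all

lemma base_FR: "b \<in> carrier B \<Longrightarrow> (b, \<lambda>ks. \<zero>\<^bsub>T ks\<^esub>) \<in> carrier (FR k)"
  unfolding FR_def by (rule base_closed) simp_all

lemma multilin_gr_single:
  "multilin B (map X [k]) (TR k) (\<lambda>xs. gr k unit (\<zero>\<^bsub>B\<^esub>, last xs))"
proof (rule multilin_TI)
  have l: "lin (X k) (TR k) (\<lambda>x. gr k unit (\<zero>\<^bsub>B\<^esub>, x))"
    by (rule lin_comp[OF with_proj_lin(2)[OF B X] gr_lin1[OF base_FR]]) (simp add: calg_closed[OF B])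
  fix xs assume "xs \<in> wds [k]"
  then obtain x where xs: "xs = [x]" "x \<in> carrier (X k)" by (cases xs) (auto simp: list.map)
  then show "gr k unit (\<zero>\<^bsub>B\<^esub>, last xs) \<in> carrier (TR k)" using linD(1)[OF l] by simp
  fix i assume "i < length [k]"
  then show "lin (X ([k] ! i)) (TR k) (\<lambda>z. gr k unit (\<zero>\<^bsub>B\<^esub>, last (xs[i := z])))" using l xs by simp
qed auto

lemma multilin_gr_snoc:
  assumes ks: "ks \<in> altr k"
  shows "multilin B (map X (ks @ [k])) (TR k) (\<lambda>xs. gr k (single ks (tg ks (butlast xs))) (\<zero>\<^bsub>B\<^esub>, last xs))"
proof (rule multilin_TI)
  have l1: "lin (X k) (TR k) (\<lambda>x. gr k (single ks (tg ks ys)) (\<zero>\<^bsub>B\<^esub>, x))" if "ys \<in> wds ks" for ys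
    by (rule lin_comp[OF with_proj_lin(2)[OF B X] gr_lin1[OF linD(1)[OF single_FR[OF ks] tg_closed[OF that]]]])
  have zx: "(\<zero>\<^bsub>B\<^esub>, x) \<in> carrier (Y k)" if "x \<in> carrier (X k)" for x using that by (simp add: with_proj_simps z_closed)
  have ne: "ks \<noteq> []" using ks by auto
  fix xs assume "xs \<in> wds (ks @ [k])"
  then obtain x ys where xs: "xs = ys @ [x]" "x \<in> carrier (X k)" "ys \<in> wds ks"
    by (rule wds_snocE)
  then have len: "length ys = length ks" by (simp add: wds_iff)
  show "gr k (single ks (tg ks (butlast xs))) (\<zero>\<^bsub>B\<^esub>, last xs) \<in> carrier (TR k)" using linD(1)[OF l1] xs by simp
  fix i
  { assume i: "i < length (ks @ [k])"
    show "lin (X ((ks @ [k]) ! i)) (TR k) (\<lambda>z. gr k (single ks (tg ks (butlast (xs[i := z])))) (\<zero>\<^bsub>B\<^esub>, last (xs[i := z])))"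
    proof (cases "i = length ks")
      case True
      then show ?thesis using l1 xs len by (simp add: list_update_append)
    next
      case False
      then have i': "i < length ks" using i by simp
      have "lin (X (ks ! i)) (TR k) (\<lambda>z. gr k (single ks (tg ks (ys[i := z]))) (\<zero>\<^bsub>B\<^esub>, x))"
        by (rule lin_comp[OF tg_lin lin_comp[OF single_FR[OF ks] gr_lin2[OF zx]]]) (use xs i' in auto)
      then show ?thesis using xs i' len by (simp add: list_update_append nth_append)
    qed }
  fix y z b assume *: "Suc i < length (ks @ [k])" "b \<in> carrier B" "y \<in> carrier (X ((ks @ [k]) ! i))" "z \<in> carrier (X ((ks @ [k]) ! Suc i))"
  let ?xs = "xs[i := ract (X ((ks @ [k]) ! i)) y b, Suc i := z]"
  let ?xs' = "xs[i := y, Suc i := lact (X ((ks @ [k]) ! Suc i)) b z]"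
  show "gr k (single ks (tg ks (butlast ?xs))) (\<zero>\<^bsub>B\<^esub>, last ?xs) = gr k (single ks (tg ks (butlast ?xs'))) (\<zero>\<^bsub>B\<^esub>, last ?xs')"
  proof (cases "Suc i = length ks")
    case False
    then have "Suc i < length ks" using * by simp
    then show ?thesis using tg_balanced[of ys ks i b y z] * xs len by (simp add: list_update_append nth_append)
  next
    \<comment> \<open>The relation involving the appended letter is the only one not internal to
      \<open>ks\<close>; it becomes the balancing of \<open>TR k\<close>, by way of the right action
      on the letter of index \<open>last ks\<close>.\<close>
    case True
    then have i: "i = length ks - 1" by simp
    have y: "y \<in> carrier (X (last ks))" and z: "z \<in> carrier (X k)"
      using * True i ne by (auto simp: nth_append last_conv_nth)
    have ys: "ys[i := y] \<in> wds ks" using xs(3) y ne i by (auto simp: wds_iff nth_list_update last_conv_nth)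
    have "ys \<noteq> []" using ne len by auto
    then have last: "last (ys[i := y]) = y" using len i by (simp add: last_list_update)
    have "gr k (single ks (tg ks (ys[i := y]))) (\<zero>\<^bsub>B\<^esub>, lact (X k) b z) = gr k (single ks (tg ks (ys[i := y]))) (lact (Y k) b (\<zero>\<^bsub>B\<^esub>, z))"
      using * by (simp add: with_proj_simps complex_algebraD(13)[OF B])
    also have "\<dots> = gr k (ract (FR k) (single ks (tg ks (ys[i := y]))) b) (\<zero>\<^bsub>B\<^esub>, z)"
      by (rule gr_balanced[OF zx[OF z] linD(1)[OF single_FR[OF ks] tg_closed[OF ys]] *(2)])
    also have "ract (FR k) (single ks (tg ks (ys[i := y]))) b = single ks (tg ks (ys[i := ract (X (last ks)) y b]))"
      using T_ract[OF ne *(2) ys] unfolding last by (simp add: FR_ops ract_single[OF *(2)] i)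
    finally show ?thesis
      using True xs len ne by (simp add: list_update_append nth_append i last_conv_nth)
  qed
qed

text \<open>The mirror image for W_k: a final letter of index \<open>k\<close> is split off, and the
  part of \<open>p\<close> in \<open>B\<close> is carried across the tensor sign to the
  left.\<close>

lemma rj_coordinates:
  obtains \<Theta> where "lin FM (TR k) \<Theta>" "\<And>p u. p \<in> carrier (Y k) \<Longrightarrow> u \<in> carrier (FR k) \<Longrightarrow> \<Theta> (rj k (u, p)) = gr k u p"
proof -
  define \<theta> where "\<theta> ks = (if last ks \<noteq> k then (\<lambda>t. gr k (single ks t) (unitY k))
     else if ks = [k] then qlift (TR k) (\<lambda>xs. gr k unit (\<zero>\<^bsub>B\<^esub>, last xs))
     else qlift (TR k) (\<lambda>xs. gr k (single (butlast ks) (tg (butlast ks) (butlast xs))) (\<zero>\<^bsub>B\<^esub>, last xs)))" for ks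
  have cTR: "cmodule (TR k)" by (rule cmodule_tensor)
  have uY: "unitY k \<in> carrier (Y k)" by (simp add: with_proj_simps calg_closed[OF B] z_closed)
  have \<theta>: "lin (T ks) (TR k) (\<theta> ks)" if ks: "ks \<in> alt_words K" for ks
  proof -
    consider "last ks \<noteq> k" | "ks = [k]" | ks' where "ks = ks' @ [k]" "ks' \<noteq> []"
      using ks by (cases ks rule: rev_cases) (auto simp: alt_words_def)
    then show ?thesis
    proof cases
      case 1
      then have "ks \<in> altr k" using ks by simp
      then show ?thesis using 1 lin_comp[OF single_FR gr_lin2[OF uY]] by (simp add: \<theta>_def)
    next
      case 2
      then show ?thesis using T_lift(1)[OF cTR multilin_gr_single] by (simp add: \<theta>_def)
    next
      case 3
      then have "ks' \<in> altr k" using ks snoc_alt_wordsD by blast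
      then show ?thesis using 3 T_lift(1)[OF cTR multilin_gr_snoc] by (simp add: \<theta>_def)
    qed
  qed
  let ?F = "fp_part B X (alt_words K)"
  have d: "lin ?F (TR k) (dlift T (TR k) \<theta>)" "\<And>ks t. ks \<in> alt_words K \<Longrightarrow> t \<in> carrier (T ks) \<Longrightarrow> dlift T (TR k) \<theta> (dsingle T ks t) = \<theta> ks t"
    using dlift_lin[OF cT cTR \<theta>, where I = "alt_words K"] by (simp_all add: fp_part_def)
  have bF: "bimodule B ?F" by (rule bimodule_fp_part) simp
  define \<Theta> where "\<Theta> u = gr k (fst u, \<lambda>ks. \<zero>\<^bsub>T ks\<^esub>) (unitY k) \<oplus>\<^bsub>(TR k)\<^esub> dlift T (TR k) \<theta> (snd u)" for u
  have lb: "lin B (FR k) (\<lambda>b. (b, \<lambda>ks. \<zero>\<^bsub>T ks\<^esub>))"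
    using with_proj_lin(1)[OF B bimodule_fp_part[of "altr k"]] by (simp add: FR_def fp_part_simps)
  have \<Theta>: "lin FM (TR k) \<Theta>"
    unfolding \<Theta>_def fp_mod_def
    by (rule lin_add[OF cTR lin_comp[OF lin_comp[OF with_proj_lin(3)[OF B bF] lb] gr_lin2[OF uY]] lin_comp[OF with_proj_lin(4)[OF B bF] d(1)]])
  have \<Theta>b: "\<Theta> (b, \<lambda>ks. \<zero>\<^bsub>T ks\<^esub>) = gr k (b, \<lambda>ks. \<zero>\<^bsub>T ks\<^esub>) (unitY k)" if "b \<in> carrier B" for b
    using lin_zero[OF bimoduleD(1)[OF bF] cTR d(1)] linD(1)[OF gr_lin2[OF uY] base_FR[OF that]]
    by (simp add: \<Theta>_def fp_part_simps cmod_simps[OF cTR])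
  have zFR: "\<zero>\<^bsub>FR k\<^esub> = (\<zero>\<^bsub>B\<^esub>, \<lambda>ks. \<zero>\<^bsub>T ks\<^esub>)" by (simp add: FR_def fp_simps)
  have \<Theta>s: "\<Theta> (single ks t) = \<theta> ks t" if "ks \<in> alt_words K" "t \<in> carrier (T ks)" for ks t
    using lin_zero[OF bimoduleD(1)[OF bFR] cTR gr_lin2[OF uY]] linD(1)[OF \<theta>[OF that(1)] that(2)] d(2)[OF that]
    by (simp add: \<Theta>_def cmod_simps[OF cTR] zFR)
  have \<Theta>rj: "\<Theta> (rj k (u, p)) = gr k u p" if p: "p \<in> carrier (Y k)" and u: "u \<in> carrier (FR k)" for p u
  proof -
    obtain b x where bx: "p = (b, x)" "b \<in> carrier B" "x \<in> carrier (X k)" using p by (rule carrier_YE)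
    have b0: "(b, \<zero>\<^bsub>X k\<^esub>) \<in> carrier (Y k)" and x0: "(\<zero>\<^bsub>B\<^esub>, x) \<in> carrier (Y k)"
      using bx by (auto simp: with_proj_simps z_closed)
    have split: "gr k v p = gr k (ract FM v b) (unitY k) \<oplus>\<^bsub>(TR k)\<^esub> gr k v (\<zero>\<^bsub>B\<^esub>, x)" if v: "v \<in> carrier (FR k)" for v
    proof -
      have "(b, \<zero>\<^bsub>X k\<^esub>) = lact (Y k) b (unitY k)"
        using bx by (simp add: with_proj_simps calg_simps[OF B] bimodule_zero[OF X])
      then have "gr k v (b, \<zero>\<^bsub>X k\<^esub>) = gr k (ract FM v b) (unitY k)"
        using gr_balanced[OF uY v bx(2)] by (simp add: FR_ops)
      then show ?thesis
        using linD(2)[OF gr_lin1[OF v] b0 x0] Y_split[OF bx(2,3)] bx(1) by simp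
    qed
    have l1: "lin (FR k) FM (\<lambda>u. rj k (u, p))" using rj_bilin[OF k] p by (simp add: bilin_def)
    show ?thesis
    proof (rule lin_eqI[OF spans_FP[of "altr k", folded FR_def] bimoduleD(1)[OF bFR] cTR lin_comp[OF l1 \<Theta>] gr_lin2[OF p] _ u])
      fix v assume "v \<in> (\<lambda>b. (b, \<lambda>ks. \<zero>\<^bsub>T ks\<^esub>)) ` carrier B \<union> (\<Union>ks\<in>altr k. (\<lambda>xs. single ks (tg ks xs)) ` wds ks)"
      then show "\<Theta> (rj k (v, p)) = gr k v p"
      proof (elim UnE imageE UN_E)
        fix b' assume v: "v = (b', \<lambda>ks. \<zero>\<^bsub>T ks\<^esub>)" and b': "b' \<in> carrier B"
        have xb: "lact (X k) b' x \<in> carrier (X k)" using bx b' by (simp add: sX)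
        have kk: "[k] \<in> alt_words K" by (rule single_alt_words[OF k])
        have t: "tg [k] [lact (X k) b' x] \<in> carrier (T [k])" by (rule tg_closed) (simp add: xb)
        have bb: "b' \<otimes>\<^bsub>B\<^esub> b \<in> carrier B" using bx b' by (simp add: calg_closed[OF B])
        have "rj k (v, p) = (b' \<otimes>\<^bsub>B\<^esub> b, \<lambda>ks. \<zero>\<^bsub>T ks\<^esub>) \<oplus>\<^bsub>FM\<^esub> single [k] (tg [k] [lact (X k) b' x])"
          unfolding bx(1) v rj_base[OF k bx(2,3) b']
          by (rule base_split[OF bb, of _ "alt_words K"]) (use linD(1)[OF single_FM[OF kk] t] in \<open>auto simp: fp_mod_def with_proj_simps\<close>)
        then have "\<Theta> (rj k (v, p)) = gr k (b' \<otimes>\<^bsub>B\<^esub> b, \<lambda>ks. \<zero>\<^bsub>T ks\<^esub>) (unitY k) \<oplus>\<^bsub>(TR k)\<^esub> gr k unit (\<zero>\<^bsub>B\<^esub>, lact (X k) b' x)"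
          using linD(2)[OF \<Theta> base_FM[OF bb] linD(1)[OF single_FM[OF kk] t]] \<Theta>b[OF bb] \<Theta>s[OF kk t]
            T_lift(2)[OF cTR multilin_gr_single, of "[lact (X k) b' x]"] xb
          by (simp add: \<theta>_def)
        moreover have "gr k unit (\<zero>\<^bsub>B\<^esub>, lact (X k) b' x) = gr k v (\<zero>\<^bsub>B\<^esub>, x)"
          using gr_balanced[OF x0 base_FR[OF calg_closed(2)[OF B]] b'] b'
          by (simp add: v with_proj_simps FR_ops ract_base calg_closed[OF B] calg_simps[OF B])
        ultimately show ?thesis
          using split[of v] base_FR[OF b'] bx b' by (simp add: v ract_base)
      next
        fix ks xs assume ks: "ks \<in> altr k" and xs: "xs \<in> wds ks" and v: "v = single ks (tg ks xs)"
        have ne: "ks \<noteq> []" using ks by (auto simp: alt_words_def)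
        have ka: "ks \<in> alt_words K" "ks @ [k] \<in> alt_words K" "last ks \<noteq> k" using ks snoc_alt_words[OF k ks] by auto
        have t: "ract (T ks) (tg ks xs) b \<in> carrier (T ks)" using bimodule_simps(2)[OF bT[OF ne] bx(2) tg_closed[OF xs]] .
        have t': "tg (ks @ [k]) (xs @ [x]) \<in> carrier (T (ks @ [k]))" by (rule tg_closed) (simp add: bx xs)
        have "rj k (v, p) = single ks (ract (T ks) (tg ks xs) b) \<oplus>\<^bsub>FM\<^esub> single (ks @ [k]) (tg (ks @ [k]) (xs @ [x]))"
          unfolding bx(1) v using rj_single[OF k bx(2,3) tg_closed[OF xs] ne] by (simp add: snoc_tg[OF bx(3)])
        then have "\<Theta> (rj k (v, p)) = gr k (single ks (ract (T ks) (tg ks xs) b)) (unitY k) \<oplus>\<^bsub>(TR k)\<^esub> gr k v (\<zero>\<^bsub>B\<^esub>, x)"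
          using linD(2)[OF \<Theta> linD(1)[OF single_FM[OF ka(1)] t] linD(1)[OF single_FM[OF ka(2)] t']]
            \<Theta>s[OF ka(1) t] \<Theta>s[OF ka(2) t'] T_lift(2)[OF cTR multilin_gr_snoc[OF ks], of "xs @ [x]"] xs bx ne ka
          by (simp add: \<theta>_def v)
        then show ?thesis
          using split[of v] linD(1)[OF single_FR[OF ks] tg_closed[OF xs]] bx
          by (simp add: v ract_single)
      qed
    qed simp
  qed
  show thesis by (rule that[OF \<Theta> \<Theta>rj])
qed

lemma rj_unit:
  assumes "u \<in> carrier (FR k)"
  shows "rj k (u, unitY k) = u"
proof -
  obtain b \<xi> where u: "u = (b, \<xi>)" "b \<in> carrier B" "\<xi> \<in> carrier (fp_part B X (altr k))"
    using assms unfolding FR_def by (rule carrier_FPE)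
  note nth = fp_part_nth[OF u(3)]
  have "ract (T ks) (\<xi> ks) \<one>\<^bsub>B\<^esub> \<oplus>\<^bsub>T ks\<^esub> rpart k \<zero>\<^bsub>X k\<^esub> b \<xi> ks = \<xi> ks" for ks
    using nth[of ks] lin_zero[OF cX cT rpart_lin[OF nth u(2), of k ks]] fp_part_zero[OF u(3), of "[]"]
    by (cases "ks = []") (auto simp: cmod_simps[OF cT] bimodule_simps[OF bT] T_act_zero calg_closed[OF B])
  then show ?thesis using u by (simp add: right_join_eq calg_simps[OF B])
qed

lemma spans_rj: "spans FM ((rj k) ` (carrier (FR k) \<times> carrier (Y k)))"
proof (rule spans_mono[OF spans_FM])
  show "(rj k) ` (carrier (FR k) \<times> carrier (Y k)) \<subseteq> carrier FM"
    using rj_closed[OF k] by auto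
  have uY: "unitY k \<in> carrier (Y k)" by (simp add: with_proj_simps calg_closed[OF B] z_closed)
  have mem: "v \<in> (rj k) ` (carrier (FR k) \<times> carrier (Y k))"
    if "rj k (u, p) = v" "p \<in> carrier (Y k)" "u \<in> carrier (FR k)" for p u v
    by (rule image_eqI[of _ _ "(u, p)"]) (use that in auto)
  have memFR: "u \<in> (rj k) ` (carrier (FR k) \<times> carrier (Y k))" if "u \<in> carrier (FR k)" for u
    by (rule mem[OF rj_unit[OF that] uY that])
  have s: "single ks (tg ks xs) \<in> (rj k) ` (carrier (FR k) \<times> carrier (Y k))" if ks: "ks \<in> alt_words K" and xs: "xs \<in> wds ks" for ks xs
  proof (cases "last ks = k")
    case False
    then show ?thesis using memFR linD(1)[OF single_FR tg_closed[OF xs]] ks by simp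
  next
    case True
    then obtain ks' where ks': "ks = ks' @ [k]" using ks by (cases ks rule: rev_cases) auto
    obtain x ys where xys: "xs = ys @ [x]" "x \<in> carrier (X k)" "ys \<in> wds ks'" using xs unfolding ks' by (rule wds_snocE)
    have x0: "(\<zero>\<^bsub>B\<^esub>, x) \<in> carrier (Y k)" using xys by (simp add: with_proj_simps z_closed)
    show ?thesis
    proof (cases "ks' = []")
      case True
      have "rj k (unit, (\<zero>\<^bsub>B\<^esub>, x)) = single ks (tg ks xs)"
        using rj_base[OF k z_closed(1) xys(2) calg_closed(2)[OF B]] True ks' xys by (simp add: calg_simps[OF B] calg_closed[OF B] sX)
      then show ?thesis by (rule mem[OF _ x0 base_FR[OF calg_closed(2)[OF B]]])
    next
      case False
      then have a: "ks' \<in> altr k" using ks ks' snoc_alt_wordsD by blast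
      have ka: "ks' \<in> alt_words K" using a by simp
      have "rj k (single ks' (tg ks' ys), (\<zero>\<^bsub>B\<^esub>, x)) = single ks' \<zero>\<^bsub>T ks'\<^esub> \<oplus>\<^bsub>FM\<^esub> single ks (tg ks xs)"
        using rj_single[OF k z_closed(1) xys(2) tg_closed[OF xys(3)] False] xys ks'
        by (simp add: snoc_tg bimodule_zero'[OF bT[OF False] cB tg_closed[OF xys(3)]])
      also have "\<dots> = single ks (tg ks xs)"
        using lin_zero[OF cT cFM single_FM[OF ka]] linD(1)[OF single_FM[OF ks] tg_closed[OF xs]] by (simp add: cmod_simps[OF cFM])
      finally show ?thesis by (rule mem[OF _ x0 linD(1)[OF single_FR[OF a] tg_closed[OF xys(3)]]])
    qed
  qed
  show "(\<lambda>b. (b, \<lambda>ks. \<zero>\<^bsub>T ks\<^esub>)) ` carrier B \<union> (\<Union>ks\<in>alt_words K. (\<lambda>xs. single ks (tg ks xs)) ` wds ks)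
    \<subseteq> (rj k) ` (carrier (FR k) \<times> carrier (Y k))"
    using memFR base_FR s by auto
qed

lemma W_inv_gr: "lin (TR k) FM (W_inv B K X k)"
  "p \<in> carrier (Y k) \<Longrightarrow> u \<in> carrier (FR k) \<Longrightarrow> W_inv B K X k (gr k u p) = rj k (u, p)"
  unfolding W_inv_def by (rule tensor_lift[OF bFR bY cFM rj_bilin[OF k]]; assumption)+

lemma W_iso_rj: "lin FM (TR k) (W_iso B K X k)"
  "p \<in> carrier (Y k) \<Longrightarrow> u \<in> carrier (FR k) \<Longrightarrow> W_iso B K X k (rj k (u, p)) = gr k u p"
proof -
  obtain \<Theta> where \<Theta>: "lin FM (TR k) \<Theta>" "\<And>p u. p \<in> carrier (Y k) \<Longrightarrow> u \<in> carrier (FR k) \<Longrightarrow> \<Theta> (rj k (u, p)) = gr k u p"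
    using rj_coordinates by blast
  let ?G = "gen_class (tensor_rels B (FR k) (Y k)) ` (carrier (FR k) \<times> carrier (Y k))"
  have im: "W_inv B K X k ` ?G = (rj k) ` (carrier (FR k) \<times> carrier (Y k))"
    unfolding image_image by (rule image_cong) (auto simp: W_inv_gr)
  have eq: "W_iso B K X k v = \<Theta> v" if "v \<in> carrier FM" for v
    unfolding W_iso_def
    by (rule lin_inverse[OF cmodule_tensor cFM W_inv_gr(1) \<Theta>(1) spans_tensor _ _ that])
       (use im spans_rj W_inv_gr(2) \<Theta>(2) in auto)
  show "lin FM (TR k) (W_iso B K X k)"
    by (rule lin_cong[OF eq cFM, THEN iffD2]) (use \<Theta>(1) in auto)
  show "p \<in> carrier (Y k) \<Longrightarrow> u \<in> carrier (FR k) \<Longrightarrow> W_iso B K X k (rj k (u, p)) = gr k u p"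
    using eq[OF rj_closed[OF k]] \<Theta>(2) by simp
qed

section \<open>The operator Id (x) a and its transport to the free product\<close>

context
  fixes a assumes a: "a \<in> carrier (right_ops B (Y k))"
begin

lemma right_rep_tensor: "lin (TR k) (TR k) (qmap (tensor_rels B (FR k) (Y k)) (\<lambda>(\<xi>, x). (\<xi>, a x)))"
  "qmap (tensor_rels B (FR k) (Y k)) (\<lambda>(\<xi>, x). (\<xi>, a x)) (gr k u p) = gr k u (a p)"
proof -
  have la: "lin (Y k) (Y k) a" using a by (simp add: right_ops_simps lin_opsD)
  have ra: "a (lact (Y k) b p) = lact (Y k) b (a p)" if "p \<in> carrier (Y k)" "b \<in> carrier B" for p b
    using a that by (simp add: right_ops_simps)
  have bl: "bilin B (FR k) (Y k) (TR k) (\<lambda>w. gen_class (tensor_rels B (FR k) (Y k)) ((\<lambda>(\<xi>, x). (\<xi>, a x)) w))"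
    unfolding bilin_def
    using lin_comp[OF la gr_lin1] gr_lin2[OF linD(1)[OF la]] gr_balanced[OF linD(1)[OF la]] ra by simp
  have im: "(\<lambda>(\<xi>, x). (\<xi>, a x)) ` (carrier (FR k) \<times> carrier (Y k)) \<subseteq> carrier (FR k) \<times> carrier (Y k)"
    using linD(1)[OF la] by auto
  show "lin (TR k) (TR k) (qmap (tensor_rels B (FR k) (Y k)) (\<lambda>(\<xi>, x). (\<xi>, a x)))"
    by (rule tensor_map(1)[OF bFR bY im bl])
  show "qmap (tensor_rels B (FR k) (Y k)) (\<lambda>(\<xi>, x). (\<xi>, a x)) (gr k u p) = gr k u (a p)"
    using tensor_map(2)[OF bFR bY im bl, of "(u, p)"] by simp
qed

lemma right_rep_closed: "right_rep B K X k a \<in> carrier (lin_ops FM)"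
  using lin_comp[OF lin_comp[OF W_iso_rj(1) right_rep_tensor(1)] W_inv_gr(1)]
  by (auto simp: lin_ops_simps right_rep_def linear_on_def Pi_iff cmod_closed[OF cFM])

lemma right_rep_rj:
  assumes "p \<in> carrier (Y k)" "u \<in> carrier (FR k)"
  shows "right_rep B K X k a (rj k (u, p)) = rj k (u, a p)"
proof -
  have "a p \<in> carrier (Y k)" using a assms(1) linD(1) by (auto simp: right_ops_simps lin_ops_simps)
  then show ?thesis
    using assms rj_closed[OF k assms] by (simp add: right_rep_def W_iso_rj(2) right_rep_tensor(2) W_inv_gr(2))
qed

end
end
end

section \<open>Operators on a bimodule with a projection\<close>

lemma lin_opsI: "lin M M f \<Longrightarrow> cmodule M \<Longrightarrow> (\<lambda>x\<in>carrier M. f x) \<in> carrier (lin_ops M)"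
  by (auto simp: lin_ops_simps linear_on_def Pi_iff cmod_closed)

context
  fixes M :: "('b, 'm) bimod"
  assumes M: "cmodule M"
begin

lemma lin_ops_compose: "S \<in> carrier (lin_ops M) \<Longrightarrow> S' \<in> carrier (lin_ops M) \<Longrightarrow> compose (carrier M) S S' \<in> carrier (lin_ops M)"
  unfolding compose_def by (rule lin_opsI[OF lin_comp M]) (auto dest: lin_opsD)

lemma lin_ops_apply:
  "S \<in> carrier (lin_ops M) \<Longrightarrow> x \<in> carrier M \<Longrightarrow> S x \<in> carrier M"
  by (auto dest: lin_opsD linD(1))

lemma lin_ops_closed:
  "\<one>\<^bsub>lin_ops M\<^esub> \<in> carrier (lin_ops M)" "\<zero>\<^bsub>lin_ops M\<^esub> \<in> carrier (lin_ops M)"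
  "S \<in> carrier (lin_ops M) \<Longrightarrow> S' \<in> carrier (lin_ops M) \<Longrightarrow> S \<oplus>\<^bsub>lin_ops M\<^esub> S' \<in> carrier (lin_ops M)"
  "S \<in> carrier (lin_ops M) \<Longrightarrow> c \<odot>\<^bsub>lin_ops M\<^esub> S \<in> carrier (lin_ops M)"
  unfolding lin_ops_simps(3-6)
  by (rule lin_opsI[OF _ M];
      (intro lin_add[OF M] lin_smult[OF M] linI lin_opsD)?; simp add: M cmod_closed cmod_simps)+

lemma lin_ops_eval:
  "x \<in> carrier M \<Longrightarrow> \<one>\<^bsub>lin_ops M\<^esub> x = x" "x \<in> carrier M \<Longrightarrow> \<zero>\<^bsub>lin_ops M\<^esub> x = \<zero>\<^bsub>M\<^esub>"
  "x \<in> carrier M \<Longrightarrow> (S \<oplus>\<^bsub>lin_ops M\<^esub> S') x = S x \<oplus>\<^bsub>M\<^esub> S' x"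
  "x \<in> carrier M \<Longrightarrow> (c \<odot>\<^bsub>lin_ops M\<^esub> S) x = c \<odot>\<^bsub>M\<^esub> S x"
  "x \<in> carrier M \<Longrightarrow> (S \<otimes>\<^bsub>lin_ops M\<^esub> S') x = S (S' x)"
  by (simp_all add: lin_ops_simps compose_def)

lemma lin_ops_mult_closed: "S \<in> carrier (lin_ops M) \<Longrightarrow> S' \<in> carrier (lin_ops M) \<Longrightarrow> S \<otimes>\<^bsub>lin_ops M\<^esub> S' \<in> carrier (lin_ops M)"
  by (simp add: lin_ops_simps(2) lin_ops_compose)

lemma cmodule_lin_ops: "cmodule (lin_ops M)"
  by (rule cmoduleI; (rule lin_ops_eqI[of _ M])?)
     (simp_all add: lin_ops_closed lin_ops_eval lin_ops_apply M cmod_simps cmod_assoc,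
      rule cmod_comm[OF M], simp_all add: lin_ops_apply)

lemma complex_algebra_lin_ops: "complex_algebra (lin_ops M)"
proof -
  have m: "Group.monoid (lin_ops M)"
    by (rule Group.monoidI; (rule lin_ops_eqI[of _ M])?)
       (simp_all add: lin_ops_mult_closed lin_ops_closed lin_ops_eval lin_ops_apply)
  have r: "ring (lin_ops M)"
  proof (rule ringI[OF module.axioms(2)[OF cmodule_lin_ops] m])
    fix S S' S'' assume *: "S \<in> carrier (lin_ops M)" "S' \<in> carrier (lin_ops M)" "S'' \<in> carrier (lin_ops M)"
    show "(S \<oplus>\<^bsub>lin_ops M\<^esub> S') \<otimes>\<^bsub>lin_ops M\<^esub> S'' = S \<otimes>\<^bsub>lin_ops M\<^esub> S'' \<oplus>\<^bsub>lin_ops M\<^esub> S' \<otimes>\<^bsub>lin_ops M\<^esub> S''"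
      by (rule lin_ops_eqI[of _ M]) (use * in \<open>simp_all add: lin_ops_mult_closed lin_ops_closed lin_ops_eval lin_ops_apply\<close>)
    show "S'' \<otimes>\<^bsub>lin_ops M\<^esub> (S \<oplus>\<^bsub>lin_ops M\<^esub> S') = S'' \<otimes>\<^bsub>lin_ops M\<^esub> S \<oplus>\<^bsub>lin_ops M\<^esub> S'' \<otimes>\<^bsub>lin_ops M\<^esub> S'"
      by (rule lin_ops_eqI[of _ M]) (use * in \<open>simp_all add: lin_ops_mult_closed lin_ops_closed lin_ops_eval lin_ops_apply linD(2)[OF lin_opsD]\<close>)
  qed
  show ?thesis
  proof (intro complex_algebra.intro complex_algebra_axioms.intro r cmodule_lin_ops)
    fix S S' c assume *: "S \<in> carrier (lin_ops M)" "S' \<in> carrier (lin_ops M)"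
    show "c \<odot>\<^bsub>lin_ops M\<^esub> (S \<otimes>\<^bsub>lin_ops M\<^esub> S') = c \<odot>\<^bsub>lin_ops M\<^esub> S \<otimes>\<^bsub>lin_ops M\<^esub> S'"
      by (rule lin_ops_eqI[of _ M]) (use * in \<open>simp_all add: lin_ops_mult_closed lin_ops_closed lin_ops_eval lin_ops_apply\<close>)
    show "c \<odot>\<^bsub>lin_ops M\<^esub> (S \<otimes>\<^bsub>lin_ops M\<^esub> S') = S \<otimes>\<^bsub>lin_ops M\<^esub> (c \<odot>\<^bsub>lin_ops M\<^esub> S')"
      by (rule lin_ops_eqI[of _ M]) (use * in \<open>simp_all add: lin_ops_mult_closed lin_ops_closed lin_ops_eval lin_ops_apply linD(3)[OF lin_opsD]\<close>)
  qed
qed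

end

section \<open>The canonical map from B (x) B^op to the operators on a bimodule\<close>

definition lact_op :: "('b, 'm) bimod \<Rightarrow> 'b \<Rightarrow> 'm \<Rightarrow> 'm" where
  "lact_op M b = (\<lambda>v\<in>carrier M. lact M b v)"

definition ract_op :: "('b, 'm) bimod \<Rightarrow> 'b \<Rightarrow> 'm \<Rightarrow> 'm" where
  "ract_op M b = (\<lambda>v\<in>carrier M. ract M v b)"

text \<open>The homomorphism sending \<open>b \<otimes> c\<close> to
  \<open>v \<mapsto> b v c\<close>; it takes the part of \<epsilon> for operator algebras. The
  restriction to the carrier makes the operators extensional.\<close>

definition bimod_eps :: "('b, 'm) bimod \<Rightarrow> ('b \<times> 'b \<Rightarrow>\<^sub>0 complex) set \<Rightarrow> 'm \<Rightarrow> 'm" where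
  "bimod_eps M = qlift (lin_ops M) (\<lambda>(b, c). \<lambda>v\<in>carrier M. lact M b (ract M v c))"

lemma op_alg_simps [simp]:
  "carrier (op_alg B) = carrier B" "add (op_alg B) = add B" "\<zero>\<^bsub>op_alg B\<^esub> = \<zero>\<^bsub>B\<^esub>"
  "Module.smult (op_alg B) = Module.smult B" "\<one>\<^bsub>op_alg B\<^esub> = \<one>\<^bsub>B\<^esub>" "x \<otimes>\<^bsub>op_alg B\<^esub> y = y \<otimes>\<^bsub>B\<^esub> x"
  by (simp_all add: op_alg_def)

lemma cmodule_op_alg: "cmodule B \<Longrightarrow> cmodule (op_alg B)"
  by (rule cmodule_transfer) simp_all

text \<open>The multiplication of \<^const>\<open>alg_tensor\<close> on representatives.\<close>

definition tmult :: "('a \<Rightarrow> 'c \<Rightarrow> 'e) \<Rightarrow> ('a \<Rightarrow>\<^sub>0 complex) \<Rightarrow> ('c \<Rightarrow>\<^sub>0 complex) \<Rightarrow> ('e \<Rightarrow>\<^sub>0 complex)" where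
  "tmult m f g = (\<Sum>u\<in>Poly_Mapping.keys f. \<Sum>v\<in>Poly_Mapping.keys g.
     Poly_Mapping.single (m u v) (Poly_Mapping.lookup f u * Poly_Mapping.lookup g v))"

text \<open>Multiplication by one word on the left is a \<open>push\<close>, so facts about products
  follow from facts about pushed elements.\<close>

lemma tmult_eq: "tmult m f g = (\<Sum>u\<in>Poly_Mapping.keys f. fscale (Poly_Mapping.lookup f u) (push (m u) g))"
  by (simp add: tmult_def push_def fs.scale_sum_right)

lemma tmult_zero: "tmult m 0 g = 0"
  by (simp add: tmult_eq)

lemma tmult_single: "tmult m (Poly_Mapping.single u c) g = fscale c (push (m u) g)"
  by (simp add: tmult_eq)

lemma tmult_add: "tmult m (f + f') g = tmult m f g + tmult m f' g"
proof -
  let ?S = "Poly_Mapping.keys f \<union> Poly_Mapping.keys f'"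
  have *: "tmult m h g = (\<Sum>u\<in>?S. fscale (Poly_Mapping.lookup h u) (push (m u) g))"
    if "Poly_Mapping.keys h \<subseteq> ?S" for h
    unfolding tmult_eq by (rule sum.mono_neutral_left) (use that in \<open>auto simp: in_keys_iff\<close>)
  show ?thesis
    using Poly_Mapping.keys_add[of f f'] by (simp add: * lookup_add fs.scale_left_distrib sum.distrib)
qed

text \<open>A map that is multiplicative on words extends to one that is multiplicative for the
  product induced by \<open>m\<close>: bilinearity reduces the claim to words, one factor after the
  other.\<close>

lemma flift_tmult:
  fixes A :: "(complex, 'a) module"
  assumes A: "complex_algebra A" and \<phi>: "\<phi> \<in> W \<rightarrow> carrier A"
    and m: "\<And>u v. u \<in> W \<Longrightarrow> v \<in> W \<Longrightarrow> m u v \<in> W \<and> \<phi> (m u v) = \<phi> u \<otimes>\<^bsub>A\<^esub> \<phi> v"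
    and f: "Poly_Mapping.keys f \<subseteq> W" and g: "Poly_Mapping.keys g \<subseteq> W"
  shows "Poly_Mapping.keys (tmult m f g) \<subseteq> W \<and> flift A \<phi> (tmult m f g) = flift A \<phi> f \<otimes>\<^bsub>A\<^esub> flift A \<phi> g"
  using f
proof (induction rule: fs_free_induct)
  note cA = complex_algebraD(2)[OF A]
  note fl = flift_closed[OF cA \<phi>] flift_add[OF cA \<phi>] flift_fscale[OF cA \<phi>] flift_single[OF cA \<phi>] flift_zero[OF cA \<phi>]
  {
    case zero
    then show ?case using g by (simp add: tmult_zero fl calg_simps[OF A])
  next
    case (add f f')
    then show ?case using g by (simp add: tmult_add fl calg_simps[OF A] keys_add_subset)
  next
    case (single u c)
    then have u: "\<phi> u \<in> carrier A" using \<phi> by auto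
    have p: "Poly_Mapping.keys (push (m u) g) \<subseteq> W" if "Poly_Mapping.keys g \<subseteq> W" for g
      by (rule push_keys[OF that]) (use m single in auto)
    have "flift A \<phi> (push (m u) g) = \<phi> u \<otimes>\<^bsub>A\<^esub> flift A \<phi> g"
      using g
    proof (induction rule: fs_free_induct)
      case zero
      then show ?case using u by (simp add: fl calg_simps[OF A])
    next
      case (add g g')
      then show ?case using u by (simp add: push_add fl calg_simps[OF A] p)
    next
      case (single v d)
      then have "\<phi> v \<in> carrier A" "m u v \<in> W" "\<phi> (m u v) = \<phi> u \<otimes>\<^bsub>A\<^esub> \<phi> v" using \<phi> m \<open>u \<in> W\<close> by auto
      then show ?case using single u by (simp add: fl complex_algebraD(4)[OF A])
    qed
    then show ?case
      using single g p[OF g] fl(1)[OF g] u by (simp add: tmult_single fl keys_fscale_subset complex_algebraD(3)[OF A])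
  }
qed

context
  fixes B :: "(complex, 'b) module" and M :: "('b, 'm) bimod"
  assumes B: "complex_algebra B" and M: "bimodule B M"
begin

abbreviation (input) "act2 \<equiv> \<lambda>(b, c). \<lambda>v\<in>carrier M. lact M b (ract M v c)"

lemma act2_closed: "b \<in> carrier B \<Longrightarrow> c \<in> carrier B \<Longrightarrow> act2 (b, c) \<in> carrier (lin_ops M)"
  unfolding prod.case by (rule lin_opsI[OF lin_comp[OF bimoduleD(3)[OF M] bimoduleD(2)[OF M]] bimoduleD(1)[OF M]])

lemma act2_fun: "act2 \<in> carrier B \<times> carrier (op_alg B) \<rightarrow> carrier (lin_ops M)"
  using act2_closed by auto

lemma act2_keys: "\<forall>r\<in>bilinear_rels B (op_alg B). Poly_Mapping.keys r \<subseteq> carrier B \<times> carrier (op_alg B)"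
  using bilinear_rels_keys[OF complex_algebraD(2)[OF B] cmodule_op_alg[OF complex_algebraD(2)[OF B]]] by blast

lemma act2_rels: "\<forall>r\<in>bilinear_rels B (op_alg B). flift (lin_ops M) act2 r = \<zero>\<^bsub>lin_ops M\<^esub>"
proof
  note cM = bimoduleD(1)[OF M] and cB = complex_algebraD(2)[OF B]
  note s = lin_ops_eval[OF cM] lin_ops_closed[OF cM] bimodule_simps[OF M] cmod_closed[OF cB]
  fix r assume r: "r \<in> bilinear_rels B (op_alg B)"
  show "flift (lin_ops M) act2 r = \<zero>\<^bsub>lin_ops M\<^esub>"
  proof (rule flift_bilinear_rels[OF cB cmodule_op_alg[OF cB] cmodule_lin_ops[OF cM] _ _ r])
    fix c assume "c \<in> carrier (op_alg B)"
    then have c: "c \<in> carrier B" by simp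
    show "lin B (lin_ops M) (\<lambda>b. act2 (b, c))"
      by (rule linI; (rule lin_ops_eqI[of _ M])?) (use c in \<open>auto simp: s act2_closed[unfolded prod.case]\<close>)
  next
    fix b assume b: "b \<in> carrier B"
    show "lin (op_alg B) (lin_ops M) (\<lambda>c. act2 (b, c))"
      by (rule linI; (rule lin_ops_eqI[of _ M])?) (use b in \<open>auto simp: s act2_closed[unfolded prod.case]\<close>)
  qed
qed

lemmas act2_lin_ops = cmodule_lin_ops[OF bimoduleD(1)[OF M]]

lemma bimod_eps_class:
  "Poly_Mapping.keys f \<subseteq> carrier B \<times> carrier B \<Longrightarrow> bimod_eps M (qclass (bilinear_rels B (op_alg B)) f) = flift (lin_ops M) act2 f"
  unfolding bimod_eps_def using qlift_class[OF act2_lin_ops act2_fun act2_keys act2_rels] by simp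

lemma bimod_eps_btens:
  "b \<in> carrier B \<Longrightarrow> c \<in> carrier B \<Longrightarrow> bimod_eps M (btens B b c) = (\<lambda>v\<in>carrier M. lact M b (ract M v c))"
  unfolding bimod_eps_def btens_def using qlift_gen[OF act2_lin_ops act2_fun act2_keys act2_rels, of "(b, c)"] by simp

lemma Lop_bimod_eps: "b \<in> carrier B \<Longrightarrow> Lop B (bimod_eps M) b = lact_op M b"
  by (auto simp: Lop_def bimod_eps_btens calg_closed[OF B] lact_op_def bimodule_simps[OF M])

lemma Rop_bimod_eps: "b \<in> carrier B \<Longrightarrow> Rop B (bimod_eps M) b = ract_op M b"
  by (auto simp: Rop_def bimod_eps_btens calg_closed[OF B] ract_op_def bimodule_simps[OF M])

text \<open>The product of two classes is a union over all pairs of representatives, and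
  \<open>bimod_eps\<close> takes the common value of \<open>flift\<close> on such a set. So it is
  enough that \<open>flift\<close> has the expected value at every element of the union.\<close>

lemma unital_alg_hom_bimod_eps: "unital_alg_hom (alg_tensor B (op_alg B)) (lin_ops M) (bimod_eps M)"
proof -
  let ?R = "bilinear_rels B (op_alg B)" and ?W = "carrier B \<times> carrier (op_alg B)"
  note cM = bimoduleD(1)[OF M]
  note A = complex_algebra_lin_ops[OF cM]
  let ?m = "\<lambda>u v. (fst u \<otimes>\<^bsub>B\<^esub> fst v, snd u \<otimes>\<^bsub>op_alg B\<^esub> snd v)"
  have m: "?m u v \<in> ?W \<and> act2 (?m u v) = act2 u \<otimes>\<^bsub>lin_ops M\<^esub> act2 v" if uv: "u \<in> ?W" "v \<in> ?W" for u v
  proof -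
    obtain b c where u: "u = (b, c)" "b \<in> carrier B" "c \<in> carrier B" using uv by auto
    obtain b' c' where v: "v = (b', c')" "b' \<in> carrier B" "c' \<in> carrier B" using uv by auto
    have "act2 (b \<otimes>\<^bsub>B\<^esub> b', c' \<otimes>\<^bsub>B\<^esub> c) = act2 (b, c) \<otimes>\<^bsub>lin_ops M\<^esub> act2 (b', c')"
      by (rule lin_ops_eqI[OF act2_closed])
         (use u v in \<open>simp_all add: act2_closed[unfolded prod.case] lin_ops_simps(2) lin_ops_compose[OF cM] compose_eq bimodule_simps[OF M] calg_closed[OF B]\<close>)
    then show ?thesis using u v by (simp add: calg_closed[OF B])
  qed
  have lin: "linear_on (alg_tensor B (op_alg B)) (carrier (alg_tensor B (op_alg B))) (lin_ops M) (bimod_eps M)"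
    using qlift_lin[OF act2_lin_ops act2_fun act2_keys act2_rels]
    by (simp add: linear_on_def alg_tensor_def Let_def bimod_eps_def)
  have mult: "bimod_eps M (F \<otimes>\<^bsub>alg_tensor B (op_alg B)\<^esub> G) = bimod_eps M F \<otimes>\<^bsub>lin_ops M\<^esub> bimod_eps M G"
    if "F \<in> carrier (alg_tensor B (op_alg B))" "G \<in> carrier (alg_tensor B (op_alg B))" for F G
  proof -
    from that have "F \<in> carrier (presented ?W ?R)" "G \<in> carrier (presented ?W ?R)"
      by (simp_all add: alg_tensor_def Let_def)
    then obtain f g where f: "Poly_Mapping.keys f \<subseteq> ?W" "F = qclass ?R f" and g: "Poly_Mapping.keys g \<subseteq> ?W" "G = qclass ?R g"
      by (metis presentedE)
    have FG: "F \<otimes>\<^bsub>alg_tensor B (op_alg B)\<^esub> G = (\<Union>f'\<in>F. \<Union>g'\<in>G. qclass ?R (tmult ?m f' g'))"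
      by (simp add: alg_tensor_def Let_def tmult_def)
    have im: "h ` S = {c}" if "\<And>x. x \<in> S \<Longrightarrow> h x = c" "y \<in> S" for h :: "('b \<times> 'b \<Rightarrow>\<^sub>0 complex) \<Rightarrow> 'm \<Rightarrow> 'm" and S c y
      using that by auto
    define fl where "fl = flift (lin_ops M) act2"
    \<comment> \<open>Arbitrary representatives stay supported on pairs from \<open>B\<close>,
      because the relations are, and they have the same value.\<close>
    have rep: "Poly_Mapping.keys f' \<subseteq> ?W \<and> fl f' = fl f"
      if "Poly_Mapping.keys f \<subseteq> ?W" "f' \<in> qclass ?R f" for f f'
    proof -
      have "Poly_Mapping.keys (f' - f) \<subseteq> ?W"
        using flift_span[OF act2_lin_ops act2_fun _ act2_keys act2_rels, of "f' - f"] that by (simp add: qclass_def)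
      then have "Poly_Mapping.keys (f' - f + f) \<subseteq> ?W" using that by (intro keys_add_subset)
      then show ?thesis using flift_qclass_eq[OF act2_lin_ops act2_fun act2_keys act2_rels that] by (simp add: fl_def)
    qed
    have "fl h = fl f \<otimes>\<^bsub>lin_ops M\<^esub> fl g"
      if h: "h \<in> F \<otimes>\<^bsub>alg_tensor B (op_alg B)\<^esub> G" for h
    proof -
      from h obtain f' g' where *: "f' \<in> qclass ?R f" "g' \<in> qclass ?R g" "h \<in> qclass ?R (tmult ?m f' g')"
        unfolding FG unfolding f(2) g(2) by blast
      note f' = rep[OF f(1) *(1)] and g' = rep[OF g(1) *(2)]
      show ?thesis
        using flift_tmult[OF A act2_fun m, of f' g', folded fl_def] f' g' rep[OF _ *(3)] by simp
    qed
    moreover have "tmult ?m f g \<in> F \<otimes>\<^bsub>alg_tensor B (op_alg B)\<^esub> G"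
      unfolding FG unfolding f(2) g(2) using qclass_self by blast
    ultimately have "fl ` (F \<otimes>\<^bsub>alg_tensor B (op_alg B)\<^esub> G) = {fl f \<otimes>\<^bsub>lin_ops M\<^esub> fl g}"
      by (rule im)
    then have "bimod_eps M (F \<otimes>\<^bsub>alg_tensor B (op_alg B)\<^esub> G) = fl f \<otimes>\<^bsub>lin_ops M\<^esub> fl g"
      by (simp add: bimod_eps_def qlift_def fl_def flift_def[abs_def])
    then show ?thesis using f g by (simp add: bimod_eps_class fl_def)
  qed
  have one: "bimod_eps M \<one>\<^bsub>alg_tensor B (op_alg B)\<^esub> = \<one>\<^bsub>lin_ops M\<^esub>"
    using bimod_eps_btens[of "\<one>\<^bsub>B\<^esub>" "\<one>\<^bsub>B\<^esub>"]
    by (auto simp: alg_tensor_def Let_def btens_def calg_closed[OF B] lin_ops_simps bimodule_simps[OF M])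
  show ?thesis
    using lin mult one by (simp add: unital_alg_hom_def alg_hom_def)
qed

end

text \<open>The vector \<open>1 \<oplus> 0\<close> serves three times: it defines the expectation;
  it recovers \<open>b\<close> from \<open>L\<^sub>b\<close> and from \<open>R\<^sub>b\<close>,
  which gives injectivity; and, being central, it gives
  \<open>E(T L\<^sub>b) = E(T R\<^sub>b)\<close>.\<close>

lemma bb_ncps_lin_ops:
  assumes B: "complex_algebra B" and X: "bimodule B X"
  shows "bb_ncps B (lin_ops (with_proj B X)) (op_exp B X) (bimod_eps (with_proj B X))"
proof -
  let ?M = "with_proj B X"
  note bM = bimodule_with_proj[OF B X] and cM = cmodule_with_proj[OF B X]
  have u: "(\<one>\<^bsub>B\<^esub>, \<zero>\<^bsub>X\<^esub>) \<in> carrier ?M"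
    using calg_closed[OF B] cmod_zero_closed[OF bimoduleD(1)[OF X]] by (simp add: with_proj_simps)
  have l: "lact ?M b (\<one>\<^bsub>B\<^esub>, \<zero>\<^bsub>X\<^esub>) = (b, \<zero>\<^bsub>X\<^esub>)" "ract ?M (\<one>\<^bsub>B\<^esub>, \<zero>\<^bsub>X\<^esub>) b = (b, \<zero>\<^bsub>X\<^esub>)" if "b \<in> carrier B" for b
    using that by (simp_all add: with_proj_simps calg_simps[OF B] bimodule_zero[OF X])
  have fst: "fst (lact ?M b (ract ?M v c)) = b \<otimes>\<^bsub>B\<^esub> fst v \<otimes>\<^bsub>B\<^esub> c" if "b \<in> carrier B" "c \<in> carrier B" "v \<in> carrier ?M" for b c v
    using that by (cases v) (simp add: with_proj_simps complex_algebraD(9)[OF B])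
  note L = Lop_bimod_eps[OF B bM] and R = Rop_bimod_eps[OF B bM]
  have ev: "(T \<otimes>\<^bsub>lin_ops ?M\<^esub> S) v = T (S v)" if "v \<in> carrier ?M" for T S v
    using that by (simp add: lin_ops_simps compose_eq)
  show ?thesis
    unfolding bb_ncps_def
  proof (intro conjI B complex_algebra_lin_ops[OF cM] unital_alg_hom_bimod_eps[OF B bM] ballI)
    show "inj_on (bimod_eps ?M) ((\<lambda>b. btens B b \<one>\<^bsub>B\<^esub>) ` carrier B)"
    proof (intro inj_onI, clarify)
      fix b c assume bc: "b \<in> carrier B" "c \<in> carrier B"
        and eq: "bimod_eps ?M (btens B b \<one>\<^bsub>B\<^esub>) = bimod_eps ?M (btens B c \<one>\<^bsub>B\<^esub>)"
      then have "lact_op ?M b = lact_op ?M c" using L by (simp add: Lop_def)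
      then have "b = c" using u l bc by (metis lact_op_def restrict_apply' prod.inject)
      then show "btens B b \<one>\<^bsub>B\<^esub> = btens B c \<one>\<^bsub>B\<^esub>" by simp
    qed
    show "inj_on (bimod_eps ?M) ((\<lambda>b. btens B \<one>\<^bsub>B\<^esub> b) ` carrier B)"
    proof (intro inj_onI, clarify)
      fix b c assume bc: "b \<in> carrier B" "c \<in> carrier B"
        and eq: "bimod_eps ?M (btens B \<one>\<^bsub>B\<^esub> b) = bimod_eps ?M (btens B \<one>\<^bsub>B\<^esub> c)"
      then have "ract_op ?M b = ract_op ?M c" using R by (simp add: Rop_def)
      then have "b = c" using u l bc by (metis ract_op_def restrict_apply' prod.inject)
      then show "btens B \<one>\<^bsub>B\<^esub> b = btens B \<one>\<^bsub>B\<^esub> c" by simp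
    qed
    show "lin (lin_ops ?M) B (op_exp B X)"
      using u lin_ops_apply[OF cM _ u] linD[OF with_proj_lin(3)[OF B X]]
      by (intro linI) (auto simp: op_exp_def lin_ops_eval[OF cM])
    show "op_exp B X (bimod_eps ?M (btens B b c) \<otimes>\<^bsub>lin_ops ?M\<^esub> T) = b \<otimes>\<^bsub>B\<^esub> op_exp B X T \<otimes>\<^bsub>B\<^esub> c"
      if "b \<in> carrier B" "c \<in> carrier B" "T \<in> carrier (lin_ops ?M)" for b c T
      using that lin_ops_apply[OF cM that(3) u] by (simp add: op_exp_def ev[OF u] bimod_eps_btens[OF B bM] fst)
    show "op_exp B X (T \<otimes>\<^bsub>lin_ops ?M\<^esub> Lop B (bimod_eps ?M) b) = op_exp B X (T \<otimes>\<^bsub>lin_ops ?M\<^esub> Rop B (bimod_eps ?M) b)"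
      if "b \<in> carrier B" "T \<in> carrier (lin_ops ?M)" for b T
      using that u l by (simp add: op_exp_def ev L R lact_op_def ract_op_def)
  qed
qed

section \<open>The regular representations\<close>

lemma left_ops_subalg: "bimodule B M \<Longrightarrow> unital_subalg (lin_ops M) (carrier (left_ops B M))"
  using lin_ops_closed[OF bimoduleD(1), of B M] lin_ops_mult_closed[OF bimoduleD(1), of B M]
    lin_ops_eval[OF bimoduleD(1), of B M] lin_ops_apply[OF bimoduleD(1), of B M]
  by (auto simp: unital_subalg_def subalg_def left_ops_simps bimodule_simps bimodule_zero)

lemma right_ops_subalg: "bimodule B M \<Longrightarrow> unital_subalg (lin_ops M) (carrier (right_ops B M))"
  using lin_ops_closed[OF bimoduleD(1), of B M] lin_ops_mult_closed[OF bimoduleD(1), of B M]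
    lin_ops_eval[OF bimoduleD(1), of B M] lin_ops_apply[OF bimoduleD(1), of B M]
  by (auto simp: unital_subalg_def subalg_def right_ops_simps bimodule_simps bimodule_zero)

lemma lact_op_left: "bimodule B M \<Longrightarrow> b \<in> carrier B \<Longrightarrow> lact_op M b \<in> carrier (left_ops B M)"
  unfolding left_ops_simps lact_op_def
  by (auto intro!: lin_opsI bimoduleD simp: bimodule_simps)

lemma ract_op_right: "bimodule B M \<Longrightarrow> b \<in> carrier B \<Longrightarrow> ract_op M b \<in> carrier (right_ops B M)"
  unfolding right_ops_simps ract_op_def
  by (auto intro!: lin_opsI bimoduleD simp: bimodule_simps)

lemma lin_on_spans_eq:
  assumes "bilin B M N P \<psi>" "spans P (\<psi> ` (carrier M \<times> carrier N))" "cmodule P"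
    and "S \<in> carrier (lin_ops P)" "S' \<in> carrier (lin_ops P)"
    and "\<And>x y. x \<in> carrier M \<Longrightarrow> y \<in> carrier N \<Longrightarrow> S (\<psi> (x, y)) = S' (\<psi> (x, y))"
  shows "S = S'"
  by (rule lin_ops_eqI[OF assms(4,5)], rule lin_eqI[OF assms(2,3,3) lin_opsD[OF assms(4)] lin_opsD[OF assms(5)]])
    (use assms(6) in auto)

context bimodule_family
begin

text \<open>The copy of \<open>Y k\<close> inside the free product, formed by \<open>B\<close> and
  the one-letter word \<open>[k]\<close>. It equals both \<open>v \<otimes> 1\<close> and
  \<open>1 \<otimes> v\<close>, so that both representations of an operator act on it as the
  operator itself.\<close>

definition iota :: "'k \<Rightarrow> 'b \<times> 'x \<Rightarrow> ('b, 'k, 'x) fp" where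
  "iota k v = (fst v, dsingle T [k] (tg [k] [snd v]))"

lemma unit_FM: "unit \<in> carrier FM"
  by (rule base_FM) (simp add: calg_closed[OF B])

lemma unitY: "unitY k \<in> carrier (Y k)"
  by (rule Y_closed) (simp_all add: calg_closed[OF B] z_closed)

lemma lact_FM: "b \<in> carrier B \<Longrightarrow> lin FM FM (lact FM b)"
  and ract_FM: "b \<in> carrier B \<Longrightarrow> lin FM FM (\<lambda>v. ract FM v b)"
  using bimoduleD(2,3)[OF bFM] by auto

context
  fixes k assumes k: "k \<in> K"
begin

lemmas lj_eq = lin_on_spans_eq[OF lj_bilin[OF k] spans_lj[OF k] cFM]
lemmas rj_eq = lin_on_spans_eq[OF rj_bilin[OF k] spans_rj[OF k] cFM]
lemmas lin_ops_FM = lin_ops_closed[OF cFM] lin_ops_mult_closed[OF cFM]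
lemmas ev_FM = lin_ops_eval[OF cFM]
lemmas ev_Y = lin_ops_eval[OF cY]

lemma left_ops_apply: "a \<in> carrier (left_ops B (Y k)) \<Longrightarrow> p \<in> carrier (Y k) \<Longrightarrow> a p \<in> carrier (Y k)"
  and right_ops_apply: "a \<in> carrier (right_ops B (Y k)) \<Longrightarrow> p \<in> carrier (Y k) \<Longrightarrow> a p \<in> carrier (Y k)"
  by (auto simp: left_ops_simps right_ops_simps intro: lin_ops_apply[OF cY])

lemmas left_sub = left_ops_subalg[OF bY, of k, unfolded unital_subalg_def subalg_def]
lemmas right_sub = right_ops_subalg[OF bY, of k, unfolded unital_subalg_def subalg_def]

text \<open>Operators are determined by their values on the vectors \<open>lj k (p, u)\<close>,
  where the representation acts on \<open>p\<close> alone.\<close>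

lemma left_rep_unital_hom: "unital_alg_hom (left_ops B (Y k)) (lin_ops FM) (left_rep B K X k)"
  unfolding unital_alg_hom_def alg_hom_def
proof (intro conjI ballI linI)
  note c = left_rep_closed[OF k] and e = left_rep_lj[OF k] and b = bilinD[OF lj_bilin[OF k]]
  note s = left_ops_simps(2-6)
  fix S assume S: "S \<in> carrier (left_ops B (Y k))"
  show "left_rep B K X k S \<in> carrier (lin_ops FM)" by (rule c[OF S])
  { fix a
    have "a \<odot>\<^bsub>lin_ops (Y k)\<^esub> S \<in> carrier (left_ops B (Y k))" using left_sub S by auto
    then show "left_rep B K X k (a \<odot>\<^bsub>left_ops B (Y k)\<^esub> S) = a \<odot>\<^bsub>lin_ops FM\<^esub> left_rep B K X k S"
      unfolding s using S by (intro lj_eq) (simp_all add: c lin_ops_FM e ev_FM ev_Y b left_ops_apply) }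
  fix S' assume S': "S' \<in> carrier (left_ops B (Y k))"
  have "S \<oplus>\<^bsub>lin_ops (Y k)\<^esub> S' \<in> carrier (left_ops B (Y k))" using left_sub S S' by auto
  then show "left_rep B K X k (S \<oplus>\<^bsub>left_ops B (Y k)\<^esub> S') = left_rep B K X k S \<oplus>\<^bsub>lin_ops FM\<^esub> left_rep B K X k S'"
    unfolding s using S S' by (intro lj_eq) (simp_all add: c lin_ops_FM e ev_FM ev_Y b left_ops_apply)
  have "S \<otimes>\<^bsub>lin_ops (Y k)\<^esub> S' \<in> carrier (left_ops B (Y k))" using left_sub S S' by auto
  then show "left_rep B K X k (S \<otimes>\<^bsub>left_ops B (Y k)\<^esub> S') = left_rep B K X k S \<otimes>\<^bsub>lin_ops FM\<^esub> left_rep B K X k S'"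
    unfolding s using S S' by (intro lj_eq) (simp_all add: c lin_ops_FM e ev_FM ev_Y b left_ops_apply)
next
  have "\<one>\<^bsub>lin_ops (Y k)\<^esub> \<in> carrier (left_ops B (Y k))" using left_sub by auto
  then show "left_rep B K X k \<one>\<^bsub>left_ops B (Y k)\<^esub> = \<one>\<^bsub>lin_ops FM\<^esub>"
    unfolding left_ops_simps(3)
    by (intro lj_eq) (simp_all add: left_rep_closed[OF k] lin_ops_FM left_rep_lj[OF k] ev_FM ev_Y bilinD[OF lj_bilin[OF k]])
qed

lemma right_rep_unital_hom: "unital_alg_hom (right_ops B (Y k)) (lin_ops FM) (right_rep B K X k)"
  unfolding unital_alg_hom_def alg_hom_def
proof (intro conjI ballI linI)
  note c = right_rep_closed[OF k] and e = right_rep_rj[OF k] and b = bilinD[OF rj_bilin[OF k]]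
  note s = right_ops_simps(2-6)
  fix S assume S: "S \<in> carrier (right_ops B (Y k))"
  show "right_rep B K X k S \<in> carrier (lin_ops FM)" by (rule c[OF S])
  { fix a
    have "a \<odot>\<^bsub>lin_ops (Y k)\<^esub> S \<in> carrier (right_ops B (Y k))" using right_sub S by auto
    then show "right_rep B K X k (a \<odot>\<^bsub>right_ops B (Y k)\<^esub> S) = a \<odot>\<^bsub>lin_ops FM\<^esub> right_rep B K X k S"
      unfolding s using S by (intro rj_eq) (simp_all add: c lin_ops_FM e ev_FM ev_Y b right_ops_apply) }
  fix S' assume S': "S' \<in> carrier (right_ops B (Y k))"
  have "S \<oplus>\<^bsub>lin_ops (Y k)\<^esub> S' \<in> carrier (right_ops B (Y k))" using right_sub S S' by auto
  then show "right_rep B K X k (S \<oplus>\<^bsub>right_ops B (Y k)\<^esub> S') = right_rep B K X k S \<oplus>\<^bsub>lin_ops FM\<^esub> right_rep B K X k S'"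
    unfolding s using S S' by (intro rj_eq) (simp_all add: c lin_ops_FM e ev_FM ev_Y b right_ops_apply)
  have "S \<otimes>\<^bsub>lin_ops (Y k)\<^esub> S' \<in> carrier (right_ops B (Y k))" using right_sub S S' by auto
  then show "right_rep B K X k (S \<otimes>\<^bsub>right_ops B (Y k)\<^esub> S') = right_rep B K X k S \<otimes>\<^bsub>lin_ops FM\<^esub> right_rep B K X k S'"
    unfolding s using S S' by (intro rj_eq) (simp_all add: c lin_ops_FM e ev_FM ev_Y b right_ops_apply)
next
  have "\<one>\<^bsub>lin_ops (Y k)\<^esub> \<in> carrier (right_ops B (Y k))" using right_sub by auto
  then show "right_rep B K X k \<one>\<^bsub>right_ops B (Y k)\<^esub> = \<one>\<^bsub>lin_ops FM\<^esub>"
    unfolding right_ops_simps(3)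
    by (intro rj_eq) (simp_all add: right_rep_closed[OF k] lin_ops_FM right_rep_rj[OF k] ev_FM ev_Y bilinD[OF rj_bilin[OF k]])
qed

text \<open>Left multiplication by \<open>b\<close> in the first tensor factor is left
  multiplication on the whole space. The image does not depend on \<open>k\<close>, as required of
  the copy of \<open>B\<close> that all faces share.\<close>

lemma left_rep_lact: "b \<in> carrier B \<Longrightarrow> left_rep B K X k (lact_op (Y k) b) = lact_op FM b"
  using lact_op_left[OF bY, of b k] lact_op_left[OF bFM, of b]
  by (intro lj_eq) (simp_all add: left_rep_closed[OF k] left_rep_lj[OF k] left_ops_simps bilinD[OF lj_bilin[OF k]],
     simp add: lact_op_def bilinD[OF lj_bilin[OF k]] lj_act[OF k])

lemma right_rep_ract: "b \<in> carrier B \<Longrightarrow> right_rep B K X k (ract_op (Y k) b) = ract_op FM b"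
  using ract_op_right[OF bY, of b k] ract_op_right[OF bFM, of b]
  by (intro rj_eq) (simp_all add: right_rep_closed[OF k] right_rep_rj[OF k] right_ops_simps bilinD[OF rj_bilin[OF k]],
     simp add: ract_op_def bilinD[OF rj_bilin[OF k]] rj_act[OF k])

text \<open>On \<open>lj k (p, u)\<close> the operator acts on \<open>p\<close> and right
  multiplication acts on \<open>u\<close>.\<close>

lemma left_rep_left_ops:
  assumes a: "a \<in> carrier (left_ops B (Y k))"
  shows "left_rep B K X k a \<in> carrier (left_ops B FM)"
proof -
  have "left_rep B K X k a (ract FM v b) = ract FM (left_rep B K X k a v) b" if b: "b \<in> carrier B" and v: "v \<in> carrier FM" for b v
  proof (rule lin_eqI[OF spans_lj[OF k] cFM cFM lin_comp[OF ract_FM[OF b] lin_opsD[OF left_rep_closed[OF k a]]]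
        lin_comp[OF lin_opsD[OF left_rep_closed[OF k a]] ract_FM[OF b]] _ v])
    fix w assume "w \<in> lj k ` (carrier (Y k) \<times> carrier (FL k))"
    then obtain p u where w: "w = lj k (p, u)" "p \<in> carrier (Y k)" "u \<in> carrier (FL k)" by auto
    moreover have "ract FM u b \<in> carrier (FL k)"
      using bimodule_simps(2)[OF bFL b w(3)] by (simp add: FL_ops)
    ultimately show "left_rep B K X k a (ract FM w b) = ract FM (left_rep B K X k a w) b"
      using a b by (simp add: lj_act[OF k] left_rep_lj[OF k] left_ops_apply)
  qed
  then show ?thesis using left_rep_closed[OF k a] by (simp add: left_ops_simps)
qed

lemma right_rep_right_ops:
  assumes a: "a \<in> carrier (right_ops B (Y k))"
  shows "right_rep B K X k a \<in> carrier (right_ops B FM)"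
proof -
  have "right_rep B K X k a (lact FM b v) = lact FM b (right_rep B K X k a v)" if b: "b \<in> carrier B" and v: "v \<in> carrier FM" for b v
  proof (rule lin_eqI[OF spans_rj[OF k] cFM cFM lin_comp[OF lact_FM[OF b] lin_opsD[OF right_rep_closed[OF k a]]]
        lin_comp[OF lin_opsD[OF right_rep_closed[OF k a]] lact_FM[OF b]] _ v])
    fix w assume "w \<in> rj k ` (carrier (FR k) \<times> carrier (Y k))"
    then obtain p u where w: "w = rj k (u, p)" "p \<in> carrier (Y k)" "u \<in> carrier (FR k)" by auto
    moreover have "lact FM b u \<in> carrier (FR k)"
      using bimodule_simps(1)[OF bFR b w(3)] by (simp add: FR_ops)
    ultimately show "right_rep B K X k a (lact FM b w) = lact FM b (right_rep B K X k a w)"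
      using a b by (simp add: rj_act[OF k] right_rep_rj[OF k] right_ops_apply)
  qed
  then show ?thesis using right_rep_closed[OF k a] by (simp add: right_ops_simps)
qed

text \<open>Reduces the \<open>B\<close>-component of a vector under a right representation to the
  \<open>B\<close>-component of the operator on \<open>Y k\<close>.\<close>

lemma fst_rj: "fst (rj k (u, p)) = fst u \<otimes>\<^bsub>B\<^esub> fst p"
  by (cases p; cases u) (simp add: right_join_eq)

lemma iota_lj: "v \<in> carrier (Y k) \<Longrightarrow> iota k v = lj k (v, unit)"
  by (erule carrier_YE) (simp add: iota_def lj_base[OF k] calg_closed[OF B] calg_simps[OF B] sX)

lemma iota_rj: "v \<in> carrier (Y k) \<Longrightarrow> iota k v = rj k (unit, v)"
  by (erule carrier_YE) (simp add: iota_def rj_base[OF k] calg_closed[OF B] calg_simps[OF B] sX)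

lemma unit_FL: "unit \<in> carrier (FL k)" and unit_FR: "unit \<in> carrier (FR k)"
  by (rule base_FL base_FR; simp add: k calg_closed[OF B])+

lemma iota_closed: "v \<in> carrier (Y k) \<Longrightarrow> iota k v \<in> carrier FM"
  by (simp add: iota_lj lj_closed[OF k] unit_FL)

lemma left_rep_iota: "a \<in> carrier (left_ops B (Y k)) \<Longrightarrow> v \<in> carrier (Y k) \<Longrightarrow> left_rep B K X k a (iota k v) = iota k (a v)"
  by (simp add: iota_lj left_ops_apply left_rep_lj[OF k] unit_FL)

lemma right_rep_iota: "a \<in> carrier (right_ops B (Y k)) \<Longrightarrow> v \<in> carrier (Y k) \<Longrightarrow> right_rep B K X k a (iota k v) = iota k (a v)"
  by (simp add: iota_rj right_ops_apply right_rep_rj[OF k] unit_FR)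

text \<open>The tensor product of a one-letter list is the letter's bimodule: \<open>hd\<close> is
  multilinear there, so it lifts to the quotient and recovers the letter.\<close>

lemma iota_inj:
  assumes "v \<in> carrier (Y k)" "w \<in> carrier (Y k)" "iota k v = iota k w"
  shows "v = w"
proof -
  have "multilin B (map X [k]) (X k) hd"
    by (rule multilin_TI) (auto simp: wds_iff hd_conv_nth length_Suc_conv intro: linI cmod_closed[OF cX])
  note l = T_lift(2)[OF cX this]
  obtain b x c y where *: "v = (b, x)" "w = (c, y)" "x \<in> carrier (X k)" "y \<in> carrier (X k)"
    using assms(1,2) by (elim carrier_YE)
  have "dsingle T [k] (tg [k] [x]) [k] = dsingle T [k] (tg [k] [y]) [k]" using assms(3) * by (simp add: iota_def)
  then have "tg [k] [x] = tg [k] [y]" by (simp add: dsingle_def)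
  moreover have "qlift (X k) hd (tg [k] [x]) = x" "qlift (X k) hd (tg [k] [y]) = y"
    using l[of "[x]"] l[of "[y]"] * by simp_all
  ultimately have "x = y" by metis
  then show ?thesis using assms(3) * by (simp add: iota_def)
qed

text \<open>An operator is recovered from its representation by restriction to the copy
  \<open>iota k\<close> of \<open>Y k\<close>. Injectivity lets the inverse serve as the
  homomorphism in the definition of bi-freeness.\<close>

lemma left_rep_inj: "inj_on (left_rep B K X k) (carrier (left_ops B (Y k)))"
proof (rule inj_onI)
  fix a a' assume a: "a \<in> carrier (left_ops B (Y k))" "a' \<in> carrier (left_ops B (Y k))" and eq: "left_rep B K X k a = left_rep B K X k a'"
  have "a v = a' v" if "v \<in> carrier (Y k)" for v
    using left_rep_iota[OF a(1) that] left_rep_iota[OF a(2) that] eq iota_inj left_ops_apply a that by metis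
  then show "a = a'" using a by (intro lin_ops_eqI[of _ "Y k"]) (auto simp: left_ops_simps)
qed

lemma right_rep_inj: "inj_on (right_rep B K X k) (carrier (right_ops B (Y k)))"
proof (rule inj_onI)
  fix a a' assume a: "a \<in> carrier (right_ops B (Y k))" "a' \<in> carrier (right_ops B (Y k))" and eq: "right_rep B K X k a = right_rep B K X k a'"
  have "a v = a' v" if "v \<in> carrier (Y k)" for v
    using right_rep_iota[OF a(1) that] right_rep_iota[OF a(2) that] eq iota_inj right_ops_apply a that by metis
  then show "a = a'" using a by (intro lin_ops_eqI[of _ "Y k"]) (auto simp: right_ops_simps)
qed

text \<open>For a word with \<open>k\<close> at neither end, factors can be attached at both ends in
  either order; expanded, both sides consist of the same four terms. The other two conclusions
  record that an attachment at one end leaves the other end free for \<open>k\<close>.\<close>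

lemma join_assoc:
  assumes p: "p \<in> carrier (Y k)" and s: "s \<in> carrier (Y k)" and ks: "ks \<in> altl k" "ks \<in> altr k" and xs: "xs \<in> wds ks"
  shows "lj k (p, rj k (single ks (tg ks xs), s)) = rj k (lj k (p, single ks (tg ks xs)), s)"
    "rj k (single ks (tg ks xs), s) \<in> carrier (FL k)" "lj k (p, single ks (tg ks xs)) \<in> carrier (FR k)"
proof -
  obtain b x where bx: "p = (b, x)" "b \<in> carrier B" "x \<in> carrier (X k)" using p by (rule carrier_YE)
  obtain c y where cy: "s = (c, y)" "c \<in> carrier B" "y \<in> carrier (X k)" using s by (rule carrier_YE)
  have ne: "ks \<noteq> []" using ks by auto
  let ?t = "tg ks xs"
  note t = tg_closed[OF xs]
  note bi = bimodule_simps[OF bT[OF ne]]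
  have akl: "ks @ [k] \<in> altl k" using snoc_alt_words[OF k ks(2)] ks(1) ne by (simp add: hd_append)
  have akr: "k # ks \<in> altr k" using Cons_alt_words[OF k ks(1)] ks(2) ne by simp
  have ct: "cons k ks x ?t \<in> carrier (T (k # ks))" "snoc k ks y ?t \<in> carrier (T (ks @ [k]))"
    using cons_closed[OF bx(3) t] snoc_closed[OF cy(3) t] by auto
  have rs: "rj k (single ks ?t, s) = single ks (ract (T ks) ?t c) \<oplus>\<^bsub>FL k\<^esub> single (ks @ [k]) (snoc k ks y ?t)"
    unfolding cy(1) FL_ops by (rule rj_single[OF k cy(2,3) t ne])
  have ls: "lj k (p, single ks ?t) = single ks (lact (T ks) b ?t) \<oplus>\<^bsub>FR k\<^esub> single (k # ks) (cons k ks x ?t)"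
    unfolding bx(1) FR_ops by (rule lj_single[OF k bx(2,3) t ne])
  have m: "single ks (ract (T ks) ?t c) \<in> carrier (FL k)" "single (ks @ [k]) (snoc k ks y ?t) \<in> carrier (FL k)"
    "single ks (lact (T ks) b ?t) \<in> carrier (FR k)" "single (k # ks) (cons k ks x ?t) \<in> carrier (FR k)"
    using linD(1)[OF single_FL[OF k ks(1)]] linD(1)[OF single_FL[OF k akl] ct(2)]
      linD(1)[OF single_FR[OF k ks(2)]] linD(1)[OF single_FR[OF k akr] ct(1)] bi(1,2) bx cy t by auto
  show "rj k (single ks ?t, s) \<in> carrier (FL k)" unfolding rs by (rule cmod_closed(1)[OF bimoduleD(1)[OF bFL] m(1,2)])
  show "lj k (p, single ks ?t) \<in> carrier (FR k)" unfolding ls by (rule cmod_closed(1)[OF bimoduleD(1)[OF bFR] m(3,4)])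
  have al: "ks \<in> alt_words K" "ks @ [k] \<in> alt_words K" "k # ks \<in> alt_words K" "k # ks @ [k] \<in> alt_words K"
    using ks akl akr Cons_alt_words[OF k akl] by auto
  have 1: "lj k (p, rj k (single ks ?t, s)) =
      (single ks (lact (T ks) b (ract (T ks) ?t c)) \<oplus>\<^bsub>FM\<^esub> single (k # ks) (cons k ks x (ract (T ks) ?t c))) \<oplus>\<^bsub>FM\<^esub>
      (single (ks @ [k]) (lact (T (ks @ [k])) b (snoc k ks y ?t)) \<oplus>\<^bsub>FM\<^esub> single (k # ks @ [k]) (cons k (ks @ [k]) x (snoc k ks y ?t)))"
    unfolding rs bilinD(3)[OF lj_bilin[OF k] p m(1,2)]
    unfolding bx(1) using lj_single[OF k bx(2,3) _ ne] lj_single[OF k bx(2,3) ct(2)] bi(2)[OF cy(2) t] by simp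
  have 2: "rj k (lj k (p, single ks ?t), s) =
      (single ks (ract (T ks) (lact (T ks) b ?t) c) \<oplus>\<^bsub>FM\<^esub> single (ks @ [k]) (snoc k ks y (lact (T ks) b ?t))) \<oplus>\<^bsub>FM\<^esub>
      (single (k # ks) (ract (T (k # ks)) (cons k ks x ?t) c) \<oplus>\<^bsub>FM\<^esub> single (k # ks @ [k]) (snoc k (k # ks) y (cons k ks x ?t)))"
    unfolding ls bilinD(2)[OF rj_bilin[OF k] m(3,4) s]
    unfolding cy(1) using rj_single[OF k cy(2,3) _ ne] rj_single[OF k cy(2,3) ct(1)] bi(1)[OF bx(2) t] by simp
  have 3: "cons k (ks @ [k]) x (snoc k ks y ?t) = snoc k (k # ks) y (cons k ks x ?t)"
    unfolding snoc_tg[OF cy(3)] cons_tg[OF bx(3)] snoc_tg[OF cy(3)] by simp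
  have 4: "single ks (lact (T ks) b (ract (T ks) ?t c)) \<in> carrier FM" "single (k # ks) (cons k ks x (ract (T ks) ?t c)) \<in> carrier FM"
    "single (ks @ [k]) (lact (T (ks @ [k])) b (snoc k ks y ?t)) \<in> carrier FM"
    "single (k # ks @ [k]) (cons k (ks @ [k]) x (snoc k ks y ?t)) \<in> carrier FM"
    using linD(1)[OF single_FM[OF al(1)]] linD(1)[OF single_FM[OF al(2)]] linD(1)[OF single_FM[OF al(3)]] linD(1)[OF single_FM[OF al(4)]]
      bi(1,2) bx cy t ct cons_closed[OF bx(3)] bimodule_simps(1)[OF bT[of "ks @ [k]"]] by auto
  show "lj k (p, rj k (single ks ?t, s)) = rj k (lj k (p, single ks ?t), s)"
    unfolding 1 2 using 4 bx cy t
    by (simp add: bi 3 cons_ract[OF ne] snoc_lact[OF ne] cmod_assoc[OF cFM] cmod_lcomm[OF cFM] cmod_closed[OF cFM])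
qed

text \<open>A last letter of index \<open>k\<close> is peeled off, if there is one, to reach the
  situation of \<open>join_assoc\<close>; otherwise \<open>s\<close> is the unit.\<close>

lemma FL_generators:
  assumes "ks \<in> altl k" "xs \<in> wds ks"
  obtains ks' xs' s where "ks' \<in> altl k" "ks' \<in> altr k" "xs' \<in> wds ks'" "s \<in> carrier (Y k)"
    "single ks (tg ks xs) = rj k (single ks' (tg ks' xs'), s)"
proof (cases "last ks = k")
  case False
  then have "ks \<in> altr k" using assms by simp
  then show ?thesis
    using that[OF assms(1) _ assms(2) unitY] rj_unit[OF k linD(1)[OF single_FR[OF k] tg_closed[OF assms(2)]]] by simp
next
  case True
  then obtain ks' where ks': "ks = ks' @ [k]" using assms(1) by (cases ks rule: rev_cases) auto
  have ne: "ks' \<noteq> []" using assms(1) ks' by auto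
  have a: "ks' \<in> altr k" using snoc_alt_wordsD[of ks' k] assms(1) ks' ne by simp
  then have al: "ks' \<in> altl k" using assms(1) ks' ne by simp
  obtain ys y where ys: "xs = ys @ [y]" "y \<in> carrier (X k)" "ys \<in> wds ks'" using assms(2) unfolding ks' by (rule wds_snocE)
  have "rj k (single ks' (tg ks' ys), (\<zero>\<^bsub>B\<^esub>, y)) = single ks' \<zero>\<^bsub>T ks'\<^esub> \<oplus>\<^bsub>FM\<^esub> single ks (tg ks xs)"
    using rj_single[OF k z_closed(1) ys(2) tg_closed[OF ys(3)] ne] ys ks'
    by (simp add: snoc_tg bimodule_zero'[OF bT[OF ne] cB tg_closed[OF ys(3)]])
  also have "\<dots> = single ks (tg ks xs)"
    using lin_zero[OF cT cFM single_FM, of ks'] al assms(1) linD(1)[OF single_FM tg_closed[OF assms(2)]] by (simp add: cmod_simps[OF cFM])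
  finally show ?thesis using that[OF al a ys(3) Y_closed[OF z_closed(1) ys(2)]] by simp
qed

text \<open>On words that are longer than one letter or do not involve \<open>k\<close>, the two representations act on different
  ends, so they commute. Only \<open>B\<close> and the words of length one require the operators themselves to commute.\<close>

lemma left_right_rep_commute:
  assumes a: "a \<in> carrier (left_ops B (Y k))" and r: "r \<in> carrier (right_ops B (Y k))"
    and comm: "\<And>v. v \<in> carrier (Y k) \<Longrightarrow> a (r v) = r (a v)"
  shows "left_rep B K X k a \<otimes>\<^bsub>lin_ops FM\<^esub> right_rep B K X k r = right_rep B K X k r \<otimes>\<^bsub>lin_ops FM\<^esub> left_rep B K X k a"
proof (rule lj_eq)
  let ?L = "left_rep B K X k a" and ?R = "right_rep B K X k r"
  note L = left_rep_closed[OF k a] and R = right_rep_closed[OF k r]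
  show "?L \<otimes>\<^bsub>lin_ops FM\<^esub> ?R \<in> carrier (lin_ops FM)" "?R \<otimes>\<^bsub>lin_ops FM\<^esub> ?L \<in> carrier (lin_ops FM)"
    using L R by (auto intro: lin_ops_FM)
  fix p u assume p: "p \<in> carrier (Y k)" and u: "u \<in> carrier (FL k)"
  have l: "lin (FL k) FM (\<lambda>u. lj k (p, u))" using lj_bilin[OF k] p by (simp add: bilin_def)
  have "?L (?R (lj k (p, u))) = ?R (?L (lj k (p, u)))"
  proof (rule lin_eqI[OF spans_FP[of "altl k", folded FL_def] bimoduleD(1)[OF bFL] cFM
        lin_comp[OF l lin_comp[OF lin_opsD[OF R] lin_opsD[OF L]]] lin_comp[OF l lin_comp[OF lin_opsD[OF L] lin_opsD[OF R]]] _ u])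
    fix w assume "w \<in> (\<lambda>b. (b, \<lambda>ks. \<zero>\<^bsub>T ks\<^esub>)) ` carrier B \<union> (\<Union>ks\<in>altl k. (\<lambda>xs. single ks (tg ks xs)) ` wds ks)"
    then show "?L (?R (lj k (p, w))) = ?R (?L (lj k (p, w)))"
    proof (elim UnE imageE UN_E)
      fix b assume b: "b \<in> carrier B" and w: "w = (b, \<lambda>ks. \<zero>\<^bsub>T ks\<^esub>)"
      \<comment> \<open>A vector of \<open>B\<close> is absorbed into \<open>p\<close>. What remains
        lies in the copy of \<open>Y k\<close>, where the hypothesis on \<open>a\<close> and
        \<open>r\<close> applies.\<close>
      have "lj k (p, w) = lj k (ract (Y k) p b, unit)"
        unfolding w lj_act(3)[OF k p unit_FL b] by (simp add: lact_base b calg_closed[OF B] calg_simps[OF B])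
      moreover have v: "ract (Y k) p b \<in> carrier (Y k)" by (rule bimodule_simps(2)[OF bY b p])
      ultimately have "lj k (p, w) = iota k (ract (Y k) p b)" by (simp add: iota_lj)
      then show ?thesis using v a r comm by (simp add: left_rep_iota right_rep_iota left_ops_apply right_ops_apply)
    next
      fix ks xs assume ks: "ks \<in> altl k" "xs \<in> wds ks" and w: "w = single ks (tg ks xs)"
      obtain ks' xs' s where *: "ks' \<in> altl k" "ks' \<in> altr k" "xs' \<in> wds ks'" "s \<in> carrier (Y k)"
        "w = rj k (single ks' (tg ks' xs'), s)"
        unfolding w by (rule FL_generators[OF ks])
      let ?w = "single ks' (tg ks' xs')"
      note as = join_assoc[OF _ _ *(1-3)]
      \<comment> \<open>Associativity makes the right factor outermost when \<open>r\<close> is to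
        act and the left factor outermost when \<open>a\<close> is to act.\<close>
      have "?L (?R (lj k (p, w))) = ?L (rj k (lj k (p, ?w), r s))"
        unfolding *(5) as(1)[OF p *(4)] by (simp add: right_rep_rj[OF k r *(4) as(3)[OF p *(4)]])
      also have "\<dots> = lj k (a p, rj k (?w, r s))"
        unfolding as(1)[OF p right_ops_apply[OF r *(4)], symmetric]
        by (rule left_rep_lj[OF k a p as(2)[OF p right_ops_apply[OF r *(4)]]])
      also have "\<dots> = rj k (lj k (a p, ?w), r s)"
        by (rule as(1)[OF left_ops_apply[OF a p] right_ops_apply[OF r *(4)]])
      also have "\<dots> = ?R (lj k (a p, w))"
        unfolding *(5) as(1)[OF left_ops_apply[OF a p] *(4)]
        by (simp add: right_rep_rj[OF k r *(4) as(3)[OF left_ops_apply[OF a p] *(4)]])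
      also have "\<dots> = ?R (?L (lj k (p, w)))"
        unfolding *(5) by (simp add: left_rep_lj[OF k a p as(2)[OF p *(4)]])
      finally show ?thesis .
    qed
  qed simp
  then show "(?L \<otimes>\<^bsub>lin_ops FM\<^esub> ?R) (lj k (p, u)) = (?R \<otimes>\<^bsub>lin_ops FM\<^esub> ?L) (lj k (p, u))"
    using lj_closed[OF k p u] by (simp add: ev_FM)
qed

end
end

section \<open>Subalgebras\<close>

lemma subalg_Int: "unital_subalg A S \<Longrightarrow> unital_subalg A S' \<Longrightarrow> unital_subalg A (S \<inter> S')"
  by (auto simp: unital_subalg_def subalg_def)

text \<open>Allows commutation with a fixed element to be checked on generators of an
  algebra.\<close>

lemma commutant_subalg:
  fixes A :: "(complex, 'a) module" (structure)
  assumes A: "complex_algebra A" and q: "q \<in> carrier A"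
  shows "unital_subalg A {T \<in> carrier A. T \<otimes> q = q \<otimes> T}"
  unfolding unital_subalg_def subalg_def
proof (intro conjI ballI allI subsetI; (elim CollectE conjE)?; (intro CollectI conjI)?)
  note s = calg_closed[OF A] calg_simps[OF A] cmod_closed[OF complex_algebraD(2)[OF A]] complex_algebraD(9)[OF A]
  fix x y assume xy: "x \<in> carrier A" "x \<otimes> q = q \<otimes> x" "y \<in> carrier A" "y \<otimes> q = q \<otimes> y"
  show "x \<oplus> y \<in> carrier A" "x \<otimes> y \<in> carrier A" using xy by (simp_all add: s)
  show "(x \<oplus> y) \<otimes> q = q \<otimes> (x \<oplus> y)" using xy q by (simp add: s)
  show "x \<otimes> y \<otimes> q = q \<otimes> (x \<otimes> y)" using xy q complex_algebraD(9)[OF A] by metis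
next
  fix c x assume x: "x \<in> carrier A" "x \<otimes> q = q \<otimes> x"
  show "c \<odot> x \<in> carrier A" using x by (simp add: cmod_closed[OF complex_algebraD(2)[OF A]])
  show "(c \<odot> x) \<otimes> q = q \<otimes> (c \<odot> x)"
    using x q complex_algebraD(3)[OF A, of x q c] complex_algebraD(4)[OF A, of q x c] by simp
qed (use q in \<open>auto simp: calg_closed[OF A] calg_simps[OF A] cmod_closed[OF complex_algebraD(2)[OF A]]\<close>)

text \<open>The last assumption amounts to \<open>h \<zero> = \<zero>\<close>; no module laws are
  assumed of \<open>A\<close>, from which it could be derived.\<close>

lemma subalg_image:
  assumes "unital_subalg A S" "unital_alg_hom (A\<lparr>carrier := C\<rparr>) A' h" "S \<subseteq> C" "\<And>c. h (c \<odot>\<^bsub>A\<^esub> \<zero>\<^bsub>A\<^esub>) = \<zero>\<^bsub>A'\<^esub> \<and> c \<odot>\<^bsub>A\<^esub> \<zero>\<^bsub>A\<^esub> = \<zero>\<^bsub>A\<^esub>"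
  shows "unital_subalg A' (h ` S)"
  unfolding unital_subalg_def subalg_def
proof (intro conjI ballI allI)
  have h: "\<And>x. x \<in> S \<Longrightarrow> h x \<in> carrier A'"
    "\<And>x y. x \<in> S \<Longrightarrow> y \<in> S \<Longrightarrow> h (x \<oplus>\<^bsub>A\<^esub> y) = h x \<oplus>\<^bsub>A'\<^esub> h y"
    "\<And>x y. x \<in> S \<Longrightarrow> y \<in> S \<Longrightarrow> h (x \<otimes>\<^bsub>A\<^esub> y) = h x \<otimes>\<^bsub>A'\<^esub> h y"
    "\<And>c x. x \<in> S \<Longrightarrow> h (c \<odot>\<^bsub>A\<^esub> x) = c \<odot>\<^bsub>A'\<^esub> h x" "h \<one>\<^bsub>A\<^esub> = \<one>\<^bsub>A'\<^esub>"
    using assms(2,3) by (auto simp: unital_alg_hom_def alg_hom_def linear_on_def Pi_iff subset_iff)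
  have S: "\<And>x y. x \<in> S \<Longrightarrow> y \<in> S \<Longrightarrow> x \<oplus>\<^bsub>A\<^esub> y \<in> S \<and> x \<otimes>\<^bsub>A\<^esub> y \<in> S" "\<And>c x. x \<in> S \<Longrightarrow> c \<odot>\<^bsub>A\<^esub> x \<in> S" "\<zero>\<^bsub>A\<^esub> \<in> S" "\<one>\<^bsub>A\<^esub> \<in> S"
    using assms(1) by (auto simp: unital_subalg_def subalg_def)
  show "h ` S \<subseteq> carrier A'" using h(1) by auto
  show "\<zero>\<^bsub>A'\<^esub> \<in> h ` S" using S(3) assms(4) by (metis image_eqI)
  show "\<one>\<^bsub>A'\<^esub> \<in> h ` S" using S(4) h(5) by (metis image_eqI)
  fix x y assume "x \<in> h ` S" "y \<in> h ` S"
  then obtain u v where *: "u \<in> S" "v \<in> S" "x = h u" "y = h v" by auto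
  show "x \<oplus>\<^bsub>A'\<^esub> y \<in> h ` S" using *(3,4) h(2)[OF *(1,2), symmetric] S(1)[OF *(1,2)] by auto
  show "x \<otimes>\<^bsub>A'\<^esub> y \<in> h ` S" using *(3,4) h(3)[OF *(1,2), symmetric] S(1)[OF *(1,2)] by auto
next
  fix c x assume "x \<in> h ` S"
  then obtain u where *: "u \<in> S" "x = h u" by auto
  have "h (c \<odot>\<^bsub>A\<^esub> u) = c \<odot>\<^bsub>A'\<^esub> h u" "c \<odot>\<^bsub>A\<^esub> u \<in> S"
    using * assms by (auto simp: unital_alg_hom_def alg_hom_def linear_on_def unital_subalg_def subalg_def subset_iff)
  then show "c \<odot>\<^bsub>A'\<^esub> x \<in> h ` S" using *(2) by (metis image_eqI)
qed

lemma alg_gen_least: "subalg A D \<Longrightarrow> S \<subseteq> D \<Longrightarrow> alg_gen A S \<subseteq> D"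
  by (auto simp: alg_gen_def)

lemma alg_gen_superset: "S \<subseteq> alg_gen A S"
  by (auto simp: alg_gen_def)

lemma alg_gen_subalg: "subalg A S \<Longrightarrow> alg_gen A S = S"
  by (intro equalityI alg_gen_least alg_gen_superset subset_refl)

lemma alg_gen_mult: "x \<in> S \<Longrightarrow> y \<in> S' \<Longrightarrow> x \<otimes>\<^bsub>A\<^esub> y \<in> alg_gen A (S <#>\<^bsub>A\<^esub> S')"
  using alg_gen_superset[of "S <#>\<^bsub>A\<^esub> S'" A] by (auto simp: set_mult_def)

lemma set_mult_iff: "t \<in> H <#>\<^bsub>A\<^esub> H' \<longleftrightarrow> (\<exists>h\<in>H. \<exists>h'\<in>H'. t = h \<otimes>\<^bsub>A\<^esub> h')"
  by (auto simp: set_mult_def)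

lemma set_multI: "h \<in> H \<Longrightarrow> h' \<in> H' \<Longrightarrow> h \<otimes>\<^bsub>A\<^esub> h' \<in> H <#>\<^bsub>A\<^esub> H'"
  by (auto simp: set_mult_def)

lemma unital_alg_hom_inv_into:
  assumes h: "unital_alg_hom M A h" and inj: "inj_on h (carrier M)" and M: "unital_subalg M (carrier M)"
  shows "unital_alg_hom (A\<lparr>carrier := h ` carrier M\<rparr>) M (inv_into (carrier M) h)"
proof -
  have inv: "inv_into (carrier M) h (h x) = x" if "x \<in> carrier M" for x using inj that by simp
  have hh: "h x \<oplus>\<^bsub>A\<^esub> h y = h (x \<oplus>\<^bsub>M\<^esub> y)" "h x \<otimes>\<^bsub>A\<^esub> h y = h (x \<otimes>\<^bsub>M\<^esub> y)" "c \<odot>\<^bsub>A\<^esub> h x = h (c \<odot>\<^bsub>M\<^esub> x)" "\<one>\<^bsub>A\<^esub> = h \<one>\<^bsub>M\<^esub>"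
    if "x \<in> carrier M" "y \<in> carrier M" for x y c
    using h that by (auto simp: unital_alg_hom_def alg_hom_def linear_on_def)
  have one: "\<one>\<^bsub>A\<^esub> = h \<one>\<^bsub>M\<^esub>" using h by (simp add: unital_alg_hom_def)
  have cl: "x \<oplus>\<^bsub>M\<^esub> y \<in> carrier M" "x \<otimes>\<^bsub>M\<^esub> y \<in> carrier M" "c \<odot>\<^bsub>M\<^esub> x \<in> carrier M" "\<one>\<^bsub>M\<^esub> \<in> carrier M" if "x \<in> carrier M" "y \<in> carrier M" for x y c
    using M that by (auto simp: unital_subalg_def subalg_def)
  have one': "\<one>\<^bsub>M\<^esub> \<in> carrier M" using M by (simp add: unital_subalg_def)
  show ?thesis
    by (auto simp: unital_alg_hom_def alg_hom_def linear_on_def hh(1-3) one inv cl one')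
qed

lemma bi_free_cong:
  assumes "\<And>k. k \<in> K \<Longrightarrow> C k = C' k" "\<And>k. k \<in> K \<Longrightarrow> D k = D' k"
  shows "bi_free TX B A E \<epsilon> K C D \<longleftrightarrow> bi_free TX B A E \<epsilon> K C' D'"
proof -
  have "(\<forall>(s, k, Z)\<in>set w. k \<in> K \<and> Z \<in> (case s of LeftSide \<Rightarrow> C k | RightSide \<Rightarrow> D k)) \<longleftrightarrow>
    (\<forall>(s, k, Z)\<in>set w. k \<in> K \<and> Z \<in> (case s of LeftSide \<Rightarrow> C' k | RightSide \<Rightarrow> D' k))" for w :: "(side \<times> _ \<times> _) list"
    by (intro ball_cong refl) (use assms in \<open>auto split: side.splits\<close>)
  then show ?thesis using assms unfolding bi_free_def by (simp cong: ball_cong)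
qed

section \<open>Corners and bi-free ffb-systems\<close>

context bimodule_family
begin

abbreviation "EPS \<equiv> bimod_eps FM"
abbreviation "LO \<equiv> lin_ops FM"

lemma bb_ncps_FM: "bb_ncps B LO (fp_exp B K X) EPS"
  unfolding fp_mod_def fp_exp_def by (rule bb_ncps_lin_ops[OF B bimodule_fp_part]) simp

lemmas LO_alg = complex_algebra_lin_ops[OF cFM]

text \<open>\<open>ract_op FM b\<close> is the operator \<open>R\<^sub>b\<close> of this space, so
  commuting with right multiplication is membership in \<open>left_alg\<close>.\<close>

lemma left_ops_left_alg: "carrier (left_ops B FM) \<subseteq> left_alg B LO EPS"
proof
  fix S assume S: "S \<in> carrier (left_ops B FM)"
  then have 1: "S \<in> carrier LO" by (simp add: left_ops_simps)
  moreover have "S \<otimes>\<^bsub>LO\<^esub> ract_op FM b = ract_op FM b \<otimes>\<^bsub>LO\<^esub> S" if b: "b \<in> carrier B" for b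
    by (rule lin_ops_eqI[of _ FM])
       (use S 1 b ract_op_right[OF bFM b] in \<open>simp_all add: left_ops_simps right_ops_simps lin_ops_mult_closed[OF cFM] lin_ops_eval[OF cFM] lin_ops_apply[OF cFM], simp add: ract_op_def lin_ops_apply[OF cFM] bimodule_simps[OF bFM]\<close>)
  ultimately show "S \<in> left_alg B LO EPS" by (simp add: left_alg_def Rop_bimod_eps[OF B bFM])
qed

lemma right_ops_right_alg: "carrier (right_ops B FM) \<subseteq> right_alg B LO EPS"
proof
  fix S assume S: "S \<in> carrier (right_ops B FM)"
  then have 1: "S \<in> carrier LO" by (simp add: right_ops_simps)
  moreover have "S \<otimes>\<^bsub>LO\<^esub> lact_op FM b = lact_op FM b \<otimes>\<^bsub>LO\<^esub> S" if b: "b \<in> carrier B" for b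
    by (rule lin_ops_eqI[of _ FM])
       (use S 1 b lact_op_left[OF bFM b] in \<open>simp_all add: left_ops_simps right_ops_simps lin_ops_mult_closed[OF cFM] lin_ops_eval[OF cFM] lin_ops_apply[OF cFM], simp add: lact_op_def lin_ops_apply[OF cFM] bimodule_simps[OF bFM]\<close>)
  ultimately show "S \<in> right_alg B LO EPS" by (simp add: right_alg_def Lop_bimod_eps[OF B bFM])
qed

abbreviation "lrep k \<equiv> left_rep B K X k"
abbreviation "rrep k \<equiv> right_rep B K X k"
abbreviation "YO k \<equiv> lin_ops (Y k)"
abbreviation "lops k \<equiv> carrier (left_ops B (Y k))"
abbreviation "rops k \<equiv> carrier (right_ops B (Y k))"

lemma unitY_iota: "iota k (unitY k) = unit"
proof -
  have "tg [k] [\<zero>\<^bsub>X k\<^esub>] = \<zero>\<^bsub>T [k]\<^esub>" by (rule lin_zero[OF cX cT tg_single_lin])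
  then show ?thesis by (auto simp: iota_def dsingle_def fun_eq_iff)
qed

lemmas YO_alg = complex_algebra_lin_ops[OF cY]

context
  fixes k assumes k: "k \<in> K"
begin

lemma lrep_simps:
  assumes "S \<in> lops k"
  shows "lrep k S \<in> carrier LO"
    "S' \<in> lops k \<Longrightarrow> lrep k (S \<otimes>\<^bsub>YO k\<^esub> S') = lrep k S \<otimes>\<^bsub>LO\<^esub> lrep k S'"
    "S' \<in> lops k \<Longrightarrow> lrep k (S \<oplus>\<^bsub>YO k\<^esub> S') = lrep k S \<oplus>\<^bsub>LO\<^esub> lrep k S'"
    "lrep k (c \<odot>\<^bsub>YO k\<^esub> S) = c \<odot>\<^bsub>LO\<^esub> lrep k S"
  using left_rep_unital_hom[OF k] assms
  by (auto simp: unital_alg_hom_def alg_hom_def linear_on_def left_ops_simps(2-6))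

lemma rrep_simps:
  assumes "S \<in> rops k"
  shows "rrep k S \<in> carrier LO"
    "S' \<in> rops k \<Longrightarrow> rrep k (S \<otimes>\<^bsub>YO k\<^esub> S') = rrep k S \<otimes>\<^bsub>LO\<^esub> rrep k S'"
    "S' \<in> rops k \<Longrightarrow> rrep k (S \<oplus>\<^bsub>YO k\<^esub> S') = rrep k S \<oplus>\<^bsub>LO\<^esub> rrep k S'"
    "rrep k (c \<odot>\<^bsub>YO k\<^esub> S) = c \<odot>\<^bsub>LO\<^esub> rrep k S"
  using right_rep_unital_hom[OF k] assms
  by (auto simp: unital_alg_hom_def alg_hom_def linear_on_def right_ops_simps(2-6))

lemma lops_closed:
  "\<one>\<^bsub>YO k\<^esub> \<in> lops k" "\<zero>\<^bsub>YO k\<^esub> \<in> lops k" "S \<in> lops k \<Longrightarrow> S' \<in> lops k \<Longrightarrow> S \<otimes>\<^bsub>YO k\<^esub> S' \<in> lops k"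
  "S \<in> lops k \<Longrightarrow> S' \<in> lops k \<Longrightarrow> S \<oplus>\<^bsub>YO k\<^esub> S' \<in> lops k" "S \<in> lops k \<Longrightarrow> c \<odot>\<^bsub>YO k\<^esub> S \<in> lops k" "S \<in> lops k \<Longrightarrow> S \<in> carrier (YO k)"
  using left_ops_subalg[OF bY, of k] unfolding unital_subalg_def subalg_def by blast+

lemma rops_closed:
  "\<one>\<^bsub>YO k\<^esub> \<in> rops k" "\<zero>\<^bsub>YO k\<^esub> \<in> rops k" "S \<in> rops k \<Longrightarrow> S' \<in> rops k \<Longrightarrow> S \<otimes>\<^bsub>YO k\<^esub> S' \<in> rops k"
  "S \<in> rops k \<Longrightarrow> S' \<in> rops k \<Longrightarrow> S \<oplus>\<^bsub>YO k\<^esub> S' \<in> rops k" "S \<in> rops k \<Longrightarrow> c \<odot>\<^bsub>YO k\<^esub> S \<in> rops k" "S \<in> rops k \<Longrightarrow> S \<in> carrier (YO k)"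
  using right_ops_subalg[OF bY, of k] unfolding unital_subalg_def subalg_def by blast+

lemma lrep_zero: "lrep k \<zero>\<^bsub>YO k\<^esub> = \<zero>\<^bsub>LO\<^esub>"
  using lrep_simps(4)[OF lops_closed(2), of 0] cmod_simps[OF cmodule_lin_ops[OF cY]] cmod_smult_zero[OF cmodule_lin_ops[OF cFM] lrep_simps(1)[OF lops_closed(2)]]
  by simp

lemma rrep_zero: "rrep k \<zero>\<^bsub>YO k\<^esub> = \<zero>\<^bsub>LO\<^esub>"
  using rrep_simps(4)[OF rops_closed(2), of 0] cmod_simps[OF cmodule_lin_ops[OF cY]] cmod_smult_zero[OF cmodule_lin_ops[OF cFM] rrep_simps(1)[OF rops_closed(2)]]
  by simp

lemma lrep_image_subalg:
  assumes "unital_subalg (YO k) S" "S \<subseteq> lops k"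
  shows "unital_subalg LO (lrep k ` S)"
  by (rule subalg_image[OF assms(1) _ assms(2)])
     (use left_rep_unital_hom[OF k] lrep_zero in \<open>simp_all add: left_ops_def cmod_smult_null[OF cmodule_lin_ops[OF cY]]\<close>)

lemma rrep_image_subalg:
  assumes "unital_subalg (YO k) S" "S \<subseteq> rops k"
  shows "unital_subalg LO (rrep k ` S)"
  by (rule subalg_image[OF assms(1) _ assms(2)])
     (use right_rep_unital_hom[OF k] rrep_zero in \<open>simp_all add: right_ops_def cmod_smult_null[OF cmodule_lin_ops[OF cY]]\<close>)

lemma pair_of_faces_rep:
  assumes S: "unital_subalg (YO k) S" "S \<subseteq> lops k" "lact_op (Y k) ` carrier B \<subseteq> S"
    and S': "unital_subalg (YO k) S'" "S' \<subseteq> rops k" "ract_op (Y k) ` carrier B \<subseteq> S'"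
  shows "pair_of_faces B LO EPS (lrep k ` S) (rrep k ` S')"
  unfolding pair_of_faces_def
proof (intro conjI lrep_image_subalg rrep_image_subalg S S')
  show "Lop B EPS ` carrier B \<subseteq> lrep k ` S"
    using S(3) by (intro image_subsetI) (auto simp: Lop_bimod_eps[OF B bFM] simp flip: left_rep_lact[OF k])
  show "Rop B EPS ` carrier B \<subseteq> rrep k ` S'"
    using S'(3) by (intro image_subsetI) (auto simp: Rop_bimod_eps[OF B bFM] simp flip: right_rep_ract[OF k])
  show "lrep k ` S \<subseteq> left_alg B LO EPS" using left_rep_left_ops[OF k] S(2) left_ops_left_alg by blast
  show "rrep k ` S' \<subseteq> right_alg B LO EPS" using right_rep_right_ops[OF k] S'(2) right_ops_right_alg by blast
qed

lemma lact_lops: "b \<in> carrier B \<Longrightarrow> lact_op (Y k) b \<in> lops k"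
  and ract_rops: "b \<in> carrier B \<Longrightarrow> ract_op (Y k) b \<in> rops k"
  by (rule lact_op_left[OF bY] ract_op_right[OF bY]; assumption)+

lemma pair_of_faces_full: "pair_of_faces B LO EPS (lrep k ` lops k) (rrep k ` rops k)"
  by (rule pair_of_faces_rep) (auto intro: left_ops_subalg[OF bY] right_ops_subalg[OF bY] lact_lops ract_rops)

end

text \<open>The inverses of the injective representations are the witnesses: applying a
  representation to them returns the letter, so the two words whose expectations are compared are
  literally the same.\<close>

lemma bi_free_full: "bi_free TYPE('x) B LO (fp_exp B K X) EPS K (\<lambda>k. lrep k ` lops k) (\<lambda>k. rrep k ` rops k)"
  unfolding bi_free_def
proof (intro conjI ballI pair_of_faces_full exI allI impI; assumption?)
  let ?l = "\<lambda>k. inv_into (lops k) (lrep k)" and ?r = "\<lambda>k. inv_into (rops k) (rrep k)"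
  fix k assume k: "k \<in> K"
  show "bimodule B (X k)" by (rule X)
  have 1: "unital_subalg (left_ops B (Y k)) (lops k)" "unital_subalg (right_ops B (Y k)) (rops k)"
    using left_ops_subalg[OF bY, of k] right_ops_subalg[OF bY, of k]
    by (simp_all add: unital_subalg_def subalg_def left_ops_simps(2-6) right_ops_simps(2-6))
  show "unital_alg_hom (LO\<lparr>carrier := lrep k ` lops k\<rparr>) (left_ops B (Y k)) (?l k)"
    by (rule unital_alg_hom_inv_into[OF left_rep_unital_hom[OF k] left_rep_inj[OF k] 1(1)])
  show "unital_alg_hom (LO\<lparr>carrier := rrep k ` rops k\<rparr>) (right_ops B (Y k)) (?r k)"
    by (rule unital_alg_hom_inv_into[OF right_rep_unital_hom[OF k] right_rep_inj[OF k] 1(2)])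
next
  let ?l = "\<lambda>k. inv_into (lops k) (lrep k)" and ?r = "\<lambda>k. inv_into (rops k) (rrep k)"
  fix w :: "(side \<times> 'k \<times> _) list"
  assume w: "\<forall>(s, k, Z)\<in>set w. k \<in> K \<and> Z \<in> (case s of LeftSide \<Rightarrow> lrep k ` lops k | RightSide \<Rightarrow> rrep k ` rops k)"
  have "map (\<lambda>(s, k, Z). Z) w = map (\<lambda>(s, k, Z). case s of LeftSide \<Rightarrow> lrep k (?l k Z) | RightSide \<Rightarrow> rrep k (?r k Z)) w"
  proof (rule map_cong[OF refl])
    fix z assume z: "z \<in> set w"
    obtain s k Z where [simp]: "z = (s, k, Z)" by (cases z)
    show "(case z of (s, k, Z) \<Rightarrow> Z) = (case z of (s, k, Z) \<Rightarrow> case s of LeftSide \<Rightarrow> lrep k (?l k Z) | RightSide \<Rightarrow> rrep k (?r k Z))"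
      using w z by (cases s) (auto simp: f_inv_into_f)
  qed
  from arg_cong[OF this, of "\<lambda>z. fp_exp B K X (word_prod LO z)"]
  show "fp_exp B K X (word_prod LO (map (\<lambda>(s, k, Z). Z) w)) =
    fp_exp B K X (word_prod LO (map (\<lambda>(s, k, Z). case s of LeftSide \<Rightarrow> lrep k (?l k Z) | RightSide \<Rightarrow> rrep k (?r k Z)) w))" .
qed

text \<open>In these four sets \<open>q\<close> stands for the matrix unit e_11; the diagonal
  matrices are those commuting with it.\<close>

definition diag_l :: "('b \<times> 'x \<Rightarrow> 'b \<times> 'x) \<Rightarrow> 'k \<Rightarrow> (('b, 'k, 'x) fp \<Rightarrow> ('b, 'k, 'x) fp) set" where
  "diag_l q k = lrep k ` {a \<in> lops k. a \<otimes>\<^bsub>YO k\<^esub> q = q \<otimes>\<^bsub>YO k\<^esub> a}"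

definition diag_r :: "('b \<times> 'x \<Rightarrow> 'b \<times> 'x) \<Rightarrow> 'k \<Rightarrow> (('b, 'k, 'x) fp \<Rightarrow> ('b, 'k, 'x) fp) set" where
  "diag_r q k = rrep k ` {a \<in> rops k. a \<otimes>\<^bsub>YO k\<^esub> q = q \<otimes>\<^bsub>YO k\<^esub> a}"

text \<open>For a projection \<open>q\<close>, the two equations say that \<open>c\<close> has only
  an upper right entry.\<close>

definition upper_l :: "('b \<times> 'x \<Rightarrow> 'b \<times> 'x) \<Rightarrow> 'k \<Rightarrow> (('b, 'k, 'x) fp \<Rightarrow> ('b, 'k, 'x) fp) set" where
  "upper_l q k = lrep k ` {c \<in> lops k. q \<otimes>\<^bsub>YO k\<^esub> c = c \<and> c \<otimes>\<^bsub>YO k\<^esub> q = \<zero>\<^bsub>YO k\<^esub>}"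

text \<open>Only a lower left entry. Membership in \<open>lops k\<close> in addition to
  \<open>rops k\<close> makes the images commute with the operators \<open>R\<^sub>b\<close>, since
  D' has to lie in \<open>left_alg\<close>.\<close>

definition lower_r :: "('b \<times> 'x \<Rightarrow> 'b \<times> 'x) \<Rightarrow> 'k \<Rightarrow> (('b, 'k, 'x) fp \<Rightarrow> ('b, 'k, 'x) fp) set" where
  "lower_r q k = rrep k ` {d \<in> lops k \<inter> rops k. d \<otimes>\<^bsub>YO k\<^esub> q = d \<and> q \<otimes>\<^bsub>YO k\<^esub> d = \<zero>\<^bsub>YO k\<^esub>}"

text \<open>The assumption on the unit vector makes \<open>lrep k (q k)\<close> fix the vacuum, the
  one on \<open>fst\<close> makes \<open>rrep k (q k)\<close> preserve the
  \<open>B\<close>-component. The first evaluates words from their right end, the second from their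
  left end, which matches the two kinds of vanishing moments.\<close>

lemma corner_system:
  assumes ql: "\<And>k. k \<in> K \<Longrightarrow> q k \<in> lops k" and qr: "\<And>k. k \<in> K \<Longrightarrow> q k \<in> rops k"
    and fst_q: "\<And>k v. k \<in> K \<Longrightarrow> v \<in> carrier (Y k) \<Longrightarrow> fst (q k v) = fst v"
    and q_unit: "\<And>k. k \<in> K \<Longrightarrow> q k (unitY k) = unitY k"
  shows "bi_free_ffb_system TYPE('x) B LO (fp_exp B K X) EPS K (\<lambda>k. diag_l (q k) k) (\<lambda>k. diag_r (q k) k)
    (\<lambda>k. upper_l (q k) k) (\<lambda>k. lower_r (q k) k)"
proof -
  have YO: "S \<in> lops k \<Longrightarrow> S \<in> carrier (YO k)" "S \<in> rops k \<Longrightarrow> S \<in> carrier (YO k)" for S k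
    by (simp_all add: left_ops_simps right_ops_simps)
  have comm: "unital_subalg (YO k) (lops k \<inter> {a \<in> carrier (YO k). a \<otimes>\<^bsub>YO k\<^esub> q k = q k \<otimes>\<^bsub>YO k\<^esub> a})"
    "unital_subalg (YO k) (rops k \<inter> {a \<in> carrier (YO k). a \<otimes>\<^bsub>YO k\<^esub> q k = q k \<otimes>\<^bsub>YO k\<^esub> a})" if k: "k \<in> K" for k
    by (intro subalg_Int left_ops_subalg[OF bY] right_ops_subalg[OF bY] commutant_subalg[OF YO_alg YO(1)[OF ql[OF k]]])+
  have sets: "{a \<in> lops k. a \<otimes>\<^bsub>YO k\<^esub> q k = q k \<otimes>\<^bsub>YO k\<^esub> a} = lops k \<inter> {a \<in> carrier (YO k). a \<otimes>\<^bsub>YO k\<^esub> q k = q k \<otimes>\<^bsub>YO k\<^esub> a}"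
    "{a \<in> rops k. a \<otimes>\<^bsub>YO k\<^esub> q k = q k \<otimes>\<^bsub>YO k\<^esub> a} = rops k \<inter> {a \<in> carrier (YO k). a \<otimes>\<^bsub>YO k\<^esub> q k = q k \<otimes>\<^bsub>YO k\<^esub> a}" for k
    using YO by auto
  have lr: "a \<otimes>\<^bsub>YO k\<^esub> r = r \<otimes>\<^bsub>YO k\<^esub> a" if "a \<in> carrier (YO k)" "r \<in> carrier (YO k)" "\<And>v. v \<in> carrier (Y k) \<Longrightarrow> a (r v) = r (a v)" for a r k
    using that by (intro lin_ops_eqI[of _ "Y k"]) (simp_all add: lin_ops_mult_closed[OF cY] lin_ops_eval[OF cY])
  \<comment> \<open>Left multiplication commutes with \<open>q\<close> because \<open>q\<close> lies
    in \<open>rops\<close>; the next fact uses that it also lies in \<open>lops\<close>.\<close>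
  have lq: "lact_op (Y k) b \<otimes>\<^bsub>YO k\<^esub> q k = q k \<otimes>\<^bsub>YO k\<^esub> lact_op (Y k) b" if "k \<in> K" "b \<in> carrier B" for k b
    by (rule lr[OF YO(1)[OF lact_lops[OF that(1,2)]] YO(1)[OF ql[OF that(1)]]])
      (use qr[OF that(1)] that(2) in \<open>auto simp: lact_op_def right_ops_simps lin_ops_apply[OF cY] bimodule_simps[OF bY]\<close>)
  have rq: "ract_op (Y k) b \<otimes>\<^bsub>YO k\<^esub> q k = q k \<otimes>\<^bsub>YO k\<^esub> ract_op (Y k) b" if "k \<in> K" "b \<in> carrier B" for k b
    by (rule lr[OF YO(2)[OF ract_rops[OF that(1,2)]] YO(1)[OF ql[OF that(1)]]])
      (use ql[OF that(1)] that(2) in \<open>auto simp: ract_op_def left_ops_simps lin_ops_apply[OF cY] bimodule_simps[OF bY]\<close>)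
  have pair: "pair_of_faces B LO EPS (diag_l (q k) k) (diag_r (q k) k)" if k: "k \<in> K" for k
    unfolding diag_l_def diag_r_def sets
    by (rule pair_of_faces_rep[OF k comm(1)[OF k] _ _ comm(2)[OF k]])
       (use lq[OF k] rq[OF k] lact_lops[OF k] ract_rops[OF k] YO in auto)
  have full: "subalg LO (lrep k ` lops k)" "subalg LO (rrep k ` rops k)" if k: "k \<in> K" for k
    using pair_of_faces_full[OF k] by (auto simp: pair_of_faces_def unital_subalg_def)
  have sub: "diag_l (q k) k \<subseteq> lrep k ` lops k" "diag_r (q k) k \<subseteq> rrep k ` rops k"
    "upper_l (q k) k \<subseteq> lrep k ` lops k" "lower_r (q k) k \<subseteq> rrep k ` rops k" for k
    by (auto simp: diag_l_def diag_r_def upper_l_def lower_r_def)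
  have gen: "alg_gen LO (diag_l (q k) k \<union> lrep k ` lops k) = lrep k ` lops k" "alg_gen LO (diag_r (q k) k \<union> rrep k ` rops k) = rrep k ` rops k" if k: "k \<in> K" for k
    using sub(1,2)[of k] alg_gen_subalg[OF full(1)[OF k]] alg_gen_subalg[OF full(2)[OF k]] by (simp_all add: Un_absorb1)
  note YOs = calg_closed[OF YO_alg] calg_simps[OF YO_alg] complex_algebraD(9)[OF YO_alg]
  have bf: "bi_free TYPE('x) B LO (fp_exp B K X) EPS K (\<lambda>k. alg_gen LO (diag_l (q k) k \<union> lrep k ` lops k)) (\<lambda>k. alg_gen LO (diag_r (q k) k \<union> rrep k ` rops k))"
    using bi_free_full gen by (simp cong: bi_free_cong)
  have C'_act: "{Lop B EPS b} <#>\<^bsub>LO\<^esub> upper_l (q k) k \<subseteq> upper_l (q k) k" "upper_l (q k) k <#>\<^bsub>LO\<^esub> {Lop B EPS b} \<subseteq> upper_l (q k) k"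
    if k: "k \<in> K" and b: "b \<in> carrier B" for k b
  proof -
    let ?L = "lact_op (Y k) b" and ?q = "q k"
    note L = lact_lops[OF k b]
    have "lact_op FM b \<otimes>\<^bsub>LO\<^esub> lrep k c \<in> upper_l ?q k \<and> lrep k c \<otimes>\<^bsub>LO\<^esub> lact_op FM b \<in> upper_l ?q k"
      if c: "c \<in> lops k" "?q \<otimes>\<^bsub>YO k\<^esub> c = c" "c \<otimes>\<^bsub>YO k\<^esub> ?q = \<zero>\<^bsub>YO k\<^esub>" for c
    proof
      note cl = YO(1)[OF c(1)] YO(1)[OF L] YO(1)[OF ql[OF k]]
      have "?q \<otimes>\<^bsub>YO k\<^esub> (?L \<otimes>\<^bsub>YO k\<^esub> c) = ?L \<otimes>\<^bsub>YO k\<^esub> (?q \<otimes>\<^bsub>YO k\<^esub> c)"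
        using lq[OF k b] cl by (simp flip: YOs(9))
      moreover have "(?L \<otimes>\<^bsub>YO k\<^esub> c) \<otimes>\<^bsub>YO k\<^esub> ?q = \<zero>\<^bsub>YO k\<^esub>" using cl c(3) by (simp add: YOs)
      ultimately show "lact_op FM b \<otimes>\<^bsub>LO\<^esub> lrep k c \<in> upper_l ?q k"
        unfolding left_rep_lact[OF k b, symmetric] lrep_simps(2)[OF k L c(1), symmetric] upper_l_def
        using c by (intro imageI) (simp add: lops_closed(3)[OF k L])
      have "?q \<otimes>\<^bsub>YO k\<^esub> (c \<otimes>\<^bsub>YO k\<^esub> ?L) = c \<otimes>\<^bsub>YO k\<^esub> ?L"
        using c(2) cl by (simp flip: YOs(9))
      moreover have "(c \<otimes>\<^bsub>YO k\<^esub> ?L) \<otimes>\<^bsub>YO k\<^esub> ?q = (c \<otimes>\<^bsub>YO k\<^esub> ?q) \<otimes>\<^bsub>YO k\<^esub> ?L"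
        using lq[OF k b] cl by (simp add: YOs(9))
      then have "(c \<otimes>\<^bsub>YO k\<^esub> ?L) \<otimes>\<^bsub>YO k\<^esub> ?q = \<zero>\<^bsub>YO k\<^esub>" using cl c(3) by (simp add: YOs)
      ultimately show "lrep k c \<otimes>\<^bsub>LO\<^esub> lact_op FM b \<in> upper_l ?q k"
        unfolding left_rep_lact[OF k b, symmetric] lrep_simps(2)[OF k c(1) L, symmetric] upper_l_def
        using c by (intro imageI) (simp add: lops_closed(3)[OF k _ L])
    qed
    then show "{Lop B EPS b} <#>\<^bsub>LO\<^esub> upper_l ?q k \<subseteq> upper_l ?q k" "upper_l ?q k <#>\<^bsub>LO\<^esub> {Lop B EPS b} \<subseteq> upper_l ?q k"
      unfolding Lop_bimod_eps[OF B bFM b] by (auto simp: set_mult_iff upper_l_def)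
  qed
  have D'_left: "lower_r (q k) k \<subseteq> left_alg B LO EPS" if k: "k \<in> K" for k
  proof -
    have "rrep k d \<otimes>\<^bsub>LO\<^esub> ract_op FM b = ract_op FM b \<otimes>\<^bsub>LO\<^esub> rrep k d" if d: "d \<in> lops k" "d \<in> rops k" and b: "b \<in> carrier B" for d b
    proof -
      have "d \<otimes>\<^bsub>YO k\<^esub> ract_op (Y k) b = ract_op (Y k) b \<otimes>\<^bsub>YO k\<^esub> d"
        by (rule lr[OF YO(1)[OF d(1)] YO(2)[OF ract_rops[OF k b]]])
          (use d b in \<open>auto simp: ract_op_def left_ops_simps lin_ops_apply[OF cY] bimodule_simps[OF bY]\<close>)
      then show ?thesis
        unfolding right_rep_ract[OF k b, symmetric] using d(2) ract_rops[OF k b] by (simp add: rrep_simps(2)[OF k, symmetric])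
    qed
    then show ?thesis
      using rrep_simps(1)[OF k] by (auto simp: left_alg_def lower_r_def Rop_bimod_eps[OF B bFM])
  qed
  have main: "let AA = alg_gen LO (diag_l (q k) k \<union> diag_r (q k) k); C' = upper_l (q k) k; D' = lower_r (q k) k in
      C' <#>\<^bsub>LO\<^esub> AA <#>\<^bsub>LO\<^esub> C' = {\<zero>\<^bsub>LO\<^esub>} \<and> D' <#>\<^bsub>LO\<^esub> AA <#>\<^bsub>LO\<^esub> D' = {\<zero>\<^bsub>LO\<^esub>} \<and>
      (\<forall>n. (\<forall>T \<in> AA <#>\<^bsub>LO\<^esub> C' <#>\<^bsub>LO\<^esub> AA <#>\<^bsub>LO\<^esub> set_pow LO (D' <#>\<^bsub>LO\<^esub> AA <#>\<^bsub>LO\<^esub> C') n <#>\<^bsub>LO\<^esub> AA. fp_exp B K X T = \<zero>\<^bsub>B\<^esub>) \<and>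
           (\<forall>T \<in> AA <#>\<^bsub>LO\<^esub> D' <#>\<^bsub>LO\<^esub> AA <#>\<^bsub>LO\<^esub> set_pow LO (C' <#>\<^bsub>LO\<^esub> AA <#>\<^bsub>LO\<^esub> D') n <#>\<^bsub>LO\<^esub> AA. fp_exp B K X T = \<zero>\<^bsub>B\<^esub>))"
    if k: "k \<in> K" for k
  proof -
    define AA where "AA = alg_gen LO (diag_l (q k) k \<union> diag_r (q k) k)"
    define C' where "C' = upper_l (q k) k"
    define D' where "D' = lower_r (q k) k"
    let ?z = "\<zero>\<^bsub>LO\<^esub>" and ?Q = "lrep k (q k)" and ?R = "rrep k (q k)"
    interpret LO: ring LO by (rule complex_algebraD(1)[OF LO_alg])
    have Q: "?Q \<in> carrier LO" "?R \<in> carrier LO" using lrep_simps(1)[OF k ql[OF k]] rrep_simps(1)[OF k qr[OF k]] by auto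
    \<comment> \<open>Only generators have to be tested. On the same side the representation is a
      homomorphism; on opposite sides \<open>left_right_rep_commute\<close> applies, because the
      operators commute on \<open>Y k\<close>.\<close>
    have "AA \<subseteq> {T \<in> carrier LO. T \<otimes>\<^bsub>LO\<^esub> ?Q = ?Q \<otimes>\<^bsub>LO\<^esub> T} \<inter> {T \<in> carrier LO. T \<otimes>\<^bsub>LO\<^esub> ?R = ?R \<otimes>\<^bsub>LO\<^esub> T}"
      unfolding AA_def
    proof (rule alg_gen_least)
      show "subalg LO ({T \<in> carrier LO. T \<otimes>\<^bsub>LO\<^esub> ?Q = ?Q \<otimes>\<^bsub>LO\<^esub> T} \<inter> {T \<in> carrier LO. T \<otimes>\<^bsub>LO\<^esub> ?R = ?R \<otimes>\<^bsub>LO\<^esub> T})"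
        using subalg_Int[OF commutant_subalg[OF LO_alg Q(1)] commutant_subalg[OF LO_alg Q(2)]] by (simp add: unital_subalg_def)
      have ev: "a (q k v) = q k (a v)" if "a \<otimes>\<^bsub>YO k\<^esub> q k = q k \<otimes>\<^bsub>YO k\<^esub> a" "v \<in> carrier (Y k)" for a v
        using fun_cong[OF that(1), of v] that(2) by (simp add: lin_ops_eval[OF cY])
      have 1: "lrep k a \<otimes>\<^bsub>LO\<^esub> ?Q = ?Q \<otimes>\<^bsub>LO\<^esub> lrep k a \<and> lrep k a \<otimes>\<^bsub>LO\<^esub> ?R = ?R \<otimes>\<^bsub>LO\<^esub> lrep k a"
        if a: "a \<in> lops k" "a \<otimes>\<^bsub>YO k\<^esub> q k = q k \<otimes>\<^bsub>YO k\<^esub> a" for a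
        using a ql[OF k] qr[OF k] ev[OF a(2)] by (simp add: lrep_simps(2)[OF k, symmetric] left_right_rep_commute[OF k])
      have 2: "rrep k a \<otimes>\<^bsub>LO\<^esub> ?R = ?R \<otimes>\<^bsub>LO\<^esub> rrep k a \<and> rrep k a \<otimes>\<^bsub>LO\<^esub> ?Q = ?Q \<otimes>\<^bsub>LO\<^esub> rrep k a"
        if a: "a \<in> rops k" "a \<otimes>\<^bsub>YO k\<^esub> q k = q k \<otimes>\<^bsub>YO k\<^esub> a" for a
        using a ql[OF k] qr[OF k] ev[OF a(2)] by (simp add: rrep_simps(2)[OF k, symmetric] left_right_rep_commute[OF k])
      show "diag_l (q k) k \<union> diag_r (q k) k \<subseteq> {T \<in> carrier LO. T \<otimes>\<^bsub>LO\<^esub> ?Q = ?Q \<otimes>\<^bsub>LO\<^esub> T} \<inter> {T \<in> carrier LO. T \<otimes>\<^bsub>LO\<^esub> ?R = ?R \<otimes>\<^bsub>LO\<^esub> T}"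
        using 1 2 lrep_simps(1)[OF k] rrep_simps(1)[OF k] by (auto simp: diag_l_def diag_r_def)
    qed
    then have AA: "t \<in> carrier LO" "t \<otimes>\<^bsub>LO\<^esub> ?Q = ?Q \<otimes>\<^bsub>LO\<^esub> t" "t \<otimes>\<^bsub>LO\<^esub> ?R = ?R \<otimes>\<^bsub>LO\<^esub> t" if "t \<in> AA" for t
      using that by auto
    have C': "c \<in> carrier LO" "?Q \<otimes>\<^bsub>LO\<^esub> c = c" "c \<otimes>\<^bsub>LO\<^esub> ?Q = ?z" if "c \<in> C'" for c
      using that ql[OF k] by (auto simp: C'_def upper_l_def lrep_simps(1)[OF k] lrep_simps(2)[OF k, symmetric] lrep_zero[OF k])
    have D': "d \<in> carrier LO" "d \<otimes>\<^bsub>LO\<^esub> ?R = d" "?R \<otimes>\<^bsub>LO\<^esub> d = ?z" if "d \<in> D'" for d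
      using that qr[OF k] by (auto simp: D'_def lower_r_def rrep_simps(1)[OF k] rrep_simps(2)[OF k, symmetric] rrep_zero[OF k])
    \<comment> \<open>The conditions ask for equality with the set of zero, so the products of sets
      must not be empty: zero lies in all three sets.\<close>
    have ze: "?z \<in> C'" "?z \<in> D'" "?z \<in> AA"
    proof -
      show "?z \<in> C'"
        unfolding C'_def upper_l_def using lops_closed(2)[OF k] lrep_zero[OF k] YO(1)[OF ql[OF k]]
        by (intro image_eqI[of _ _ "\<zero>\<^bsub>YO k\<^esub>"]) (simp_all add: YOs)
      show "?z \<in> D'"
        unfolding D'_def lower_r_def using lops_closed(2)[OF k] rops_closed(2)[OF k] rrep_zero[OF k] YO(1)[OF ql[OF k]]
        by (intro image_eqI[of _ _ "\<zero>\<^bsub>YO k\<^esub>"]) (simp_all add: YOs)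
      show "?z \<in> AA"
        using pair[OF k] alg_gen_superset[of "diag_l (q k) k \<union> diag_r (q k) k" LO] by (auto simp: AA_def pair_of_faces_def unital_subalg_def subalg_def)
    qed
    \<comment> \<open>Write \<open>c'\<close> as \<open>?Q \<otimes> c'\<close> and move
      \<open>?Q\<close> past \<open>t\<close>, where it meets \<open>c\<close> and gives
      zero.\<close>
    have c0: "c \<otimes>\<^bsub>LO\<^esub> t \<otimes>\<^bsub>LO\<^esub> c' = ?z" if "c \<in> C'" "t \<in> AA" "c' \<in> C'" for c t c'
    proof -
      have "c \<otimes>\<^bsub>LO\<^esub> t \<otimes>\<^bsub>LO\<^esub> c' = c \<otimes>\<^bsub>LO\<^esub> (t \<otimes>\<^bsub>LO\<^esub> ?Q) \<otimes>\<^bsub>LO\<^esub> c'"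
        using C'[OF that(1)] C'[OF that(3)] AA(1)[OF that(2)] Q by (simp add: LO.m_assoc)
      also have "\<dots> = (c \<otimes>\<^bsub>LO\<^esub> ?Q) \<otimes>\<^bsub>LO\<^esub> t \<otimes>\<^bsub>LO\<^esub> c'"
        unfolding AA(2)[OF that(2)] using C'(1)[OF that(1)] AA(1)[OF that(2)] Q by (simp add: LO.m_assoc)
      finally show ?thesis using C'[OF that(1)] C'(1)[OF that(3)] AA(1)[OF that(2)] by simp
    qed
    \<comment> \<open>Dually, write \<open>d\<close> as \<open>d \<otimes> ?R\<close> and move
      \<open>?R\<close> past \<open>t\<close>, where it annihilates \<open>d'\<close>.\<close>
    have d0: "d \<otimes>\<^bsub>LO\<^esub> t \<otimes>\<^bsub>LO\<^esub> d' = ?z" if "d \<in> D'" "t \<in> AA" "d' \<in> D'" for d t d'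
    proof -
      have "d \<otimes>\<^bsub>LO\<^esub> t \<otimes>\<^bsub>LO\<^esub> d' = (d \<otimes>\<^bsub>LO\<^esub> ?R) \<otimes>\<^bsub>LO\<^esub> t \<otimes>\<^bsub>LO\<^esub> d'" using D'[OF that(1)] by simp
      also have "\<dots> = d \<otimes>\<^bsub>LO\<^esub> (t \<otimes>\<^bsub>LO\<^esub> ?R) \<otimes>\<^bsub>LO\<^esub> d'"
        unfolding AA(3)[OF that(2)] using D'(1)[OF that(1)] AA(1)[OF that(2)] Q by (simp add: LO.m_assoc)
      also have "\<dots> = d \<otimes>\<^bsub>LO\<^esub> t \<otimes>\<^bsub>LO\<^esub> (?R \<otimes>\<^bsub>LO\<^esub> d')"
        using D'(1)[OF that(1)] D'(1)[OF that(3)] AA(1)[OF that(2)] Q by (simp add: LO.m_assoc)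
      finally show ?thesis using D'[OF that(3)] D'(1)[OF that(1)] AA(1)[OF that(2)] by simp
    qed
    have tri: "S <#>\<^bsub>LO\<^esub> AA <#>\<^bsub>LO\<^esub> S = {?z}"
      if S: "?z \<in> S" "\<And>c t c'. c \<in> S \<Longrightarrow> t \<in> AA \<Longrightarrow> c' \<in> S \<Longrightarrow> c \<otimes>\<^bsub>LO\<^esub> t \<otimes>\<^bsub>LO\<^esub> c' = ?z" for S
    proof (intro equalityI subsetI)
      fix x assume "x \<in> S <#>\<^bsub>LO\<^esub> AA <#>\<^bsub>LO\<^esub> S"
      then obtain c t c' where "c \<in> S" "t \<in> AA" "c' \<in> S" "x = c \<otimes>\<^bsub>LO\<^esub> t \<otimes>\<^bsub>LO\<^esub> c'"
        by (auto simp: set_mult_iff)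
      then show "x \<in> {?z}" using S(2) by simp
    next
      fix x assume x: "x \<in> {?z}"
      have "?z \<otimes>\<^bsub>LO\<^esub> ?z \<otimes>\<^bsub>LO\<^esub> ?z \<in> S <#>\<^bsub>LO\<^esub> AA <#>\<^bsub>LO\<^esub> S"
        by (intro set_multI S(1) ze(3))
      then show "x \<in> S <#>\<^bsub>LO\<^esub> AA <#>\<^bsub>LO\<^esub> S" using x by simp
    qed
    have zs: "C' <#>\<^bsub>LO\<^esub> AA <#>\<^bsub>LO\<^esub> C' = {?z}" "D' <#>\<^bsub>LO\<^esub> AA <#>\<^bsub>LO\<^esub> D' = {?z}"
      by (rule tri[OF ze(1) c0] tri[OF ze(2) d0]; assumption)+
    have unitQ: "?Q unit = unit"
      using left_rep_iota[OF k ql[OF k] unitY] q_unit[OF k] by (simp add: unitY_iota)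
    \<comment> \<open>Compared on the vectors \<open>rj k (u, p)\<close>: \<open>?R\<close> acts on
      \<open>p\<close>, and \<open>q\<close> does not change the \<open>B\<close>-component of
      \<open>p\<close>.\<close>
    have fstR: "fst (?R v) = fst v" if v: "v \<in> carrier FM" for v
    proof -
      have f: "lin FM B fst" unfolding fp_mod_def by (rule with_proj_lin(3)[OF B bimodule_fp_part]) simp
      show ?thesis
        by (rule lin_eqI[OF spans_rj[OF k] cFM cB lin_comp[OF lin_opsD[OF Q(2)] f] f _ v])
           (auto simp: right_rep_rj[OF k qr[OF k]] fst_rj[OF k] fst_q[OF k])
    qed
    have E0: "fp_exp B K X S = \<zero>\<^bsub>B\<^esub>" if "S \<in> carrier LO" "S \<otimes>\<^bsub>LO\<^esub> ?Q = ?z" for S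
    proof -
      have "S unit = (S \<otimes>\<^bsub>LO\<^esub> ?Q) unit" using unit_FM by (simp add: lin_ops_eval[OF cFM] unitQ)
      also have "\<dots> = \<zero>\<^bsub>FM\<^esub>" using unit_FM that(2) by (simp add: lin_ops_eval[OF cFM])
      finally show ?thesis by (simp add: fp_exp_def op_exp_def fp_mod_def fp_simps)
    qed
    have E0': "fp_exp B K X S = \<zero>\<^bsub>B\<^esub>" if "S \<in> carrier LO" "?R \<otimes>\<^bsub>LO\<^esub> S = ?z" for S
    proof -
      have "fst (S unit) = fst ((?R \<otimes>\<^bsub>LO\<^esub> S) unit)"
        using unit_FM fstR[OF lin_ops_apply[OF cFM that(1) unit_FM]] by (simp add: lin_ops_eval[OF cFM])
      also have "\<dots> = \<zero>\<^bsub>B\<^esub>" using unit_FM that(2) by (simp add: lin_ops_eval[OF cFM]) (simp add: fp_mod_def fp_simps)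
      finally show ?thesis by (simp add: fp_exp_def op_exp_def fp_simps)
    qed
    have pow: "set_pow LO S n \<subseteq> carrier LO" if "S \<subseteq> carrier LO" for S n
      using that by (induction n) (auto simp: set_mult_iff intro!: LO.m_closed)
    have SC: "D' <#>\<^bsub>LO\<^esub> AA <#>\<^bsub>LO\<^esub> C' \<subseteq> carrier LO" "C' <#>\<^bsub>LO\<^esub> AA <#>\<^bsub>LO\<^esub> D' \<subseteq> carrier LO"
      using AA(1) C'(1) D'(1) by (auto simp: set_mult_iff)
    \<comment> \<open>For a positive exponent the product ends in an element of C', followed by 1 or
      by a product that is already annihilated. For exponent 0 it is 1, which \<open>?Q\<close> need
      not annihilate; hence the alternative.\<close>
    have powQ: "s = \<one>\<^bsub>LO\<^esub> \<or> s \<otimes>\<^bsub>LO\<^esub> ?Q = ?z" if "s \<in> set_pow LO (D' <#>\<^bsub>LO\<^esub> AA <#>\<^bsub>LO\<^esub> C') n" for s n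
      using that
    proof (induction n arbitrary: s)
      case (Suc n)
      then obtain d t c s' where s: "d \<in> D'" "t \<in> AA" "c \<in> C'" "s' \<in> set_pow LO (D' <#>\<^bsub>LO\<^esub> AA <#>\<^bsub>LO\<^esub> C') n"
        "s = d \<otimes>\<^bsub>LO\<^esub> t \<otimes>\<^bsub>LO\<^esub> c \<otimes>\<^bsub>LO\<^esub> s'" by (auto simp: set_mult_iff)
      have cl: "d \<in> carrier LO" "t \<in> carrier LO" "c \<in> carrier LO" "s' \<in> carrier LO"
        using s(1-3) D'(1) AA(1) C'(1) subsetD[OF pow[OF SC(1)] s(4)] by auto
      from Suc.IH[OF s(4)] show ?case
        using cl Q C'(3)[OF s(3)] by (auto simp: s(5) LO.m_assoc)
    qed simp
    have e1: "fp_exp B K X S = \<zero>\<^bsub>B\<^esub>"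
      if S: "S \<in> AA <#>\<^bsub>LO\<^esub> C' <#>\<^bsub>LO\<^esub> AA <#>\<^bsub>LO\<^esub> set_pow LO (D' <#>\<^bsub>LO\<^esub> AA <#>\<^bsub>LO\<^esub> C') n <#>\<^bsub>LO\<^esub> AA" for S n
    proof -
      from S obtain t c t' s t'' where *: "t \<in> AA" "c \<in> C'" "t' \<in> AA" "s \<in> set_pow LO (D' <#>\<^bsub>LO\<^esub> AA <#>\<^bsub>LO\<^esub> C') n" "t'' \<in> AA"
        "S = t \<otimes>\<^bsub>LO\<^esub> c \<otimes>\<^bsub>LO\<^esub> t' \<otimes>\<^bsub>LO\<^esub> s \<otimes>\<^bsub>LO\<^esub> t''" by (auto simp: set_mult_iff)
      have cl: "t \<in> carrier LO" "c \<in> carrier LO" "t' \<in> carrier LO" "s \<in> carrier LO" "t'' \<in> carrier LO"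
        using * AA(1) C'(1) pow[OF SC(1)] by auto
      have S1: "S \<otimes>\<^bsub>LO\<^esub> ?Q = t \<otimes>\<^bsub>LO\<^esub> c \<otimes>\<^bsub>LO\<^esub> t' \<otimes>\<^bsub>LO\<^esub> (s \<otimes>\<^bsub>LO\<^esub> ?Q) \<otimes>\<^bsub>LO\<^esub> t''"
        using cl Q AA(2)[OF *(5)] by (simp add: *(6) LO.m_assoc)
      have S2: "t \<otimes>\<^bsub>LO\<^esub> c \<otimes>\<^bsub>LO\<^esub> t' \<otimes>\<^bsub>LO\<^esub> ?Q = ?z"
      proof -
        have "t \<otimes>\<^bsub>LO\<^esub> c \<otimes>\<^bsub>LO\<^esub> t' \<otimes>\<^bsub>LO\<^esub> ?Q = t \<otimes>\<^bsub>LO\<^esub> (c \<otimes>\<^bsub>LO\<^esub> ?Q) \<otimes>\<^bsub>LO\<^esub> t'"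
          using cl Q AA(2)[OF *(3)] by (simp add: LO.m_assoc)
        then show ?thesis using cl C'(3)[OF *(2)] by simp
      qed
      \<comment> \<open>If the power is 1, \<open>?Q\<close> travels further left past
        \<open>t'\<close> and annihilates \<open>c\<close>; otherwise it already annihilates the
        power.\<close>
      have "S \<otimes>\<^bsub>LO\<^esub> ?Q = ?z"
        using powQ[OF *(4)] unfolding S1 using cl Q S2 by auto
      then show ?thesis using cl *(6) by (intro E0) auto
    qed
    \<comment> \<open>Here the first corner decides: \<open>?R\<close> passes \<open>t\<close> and
      annihilates \<open>d\<close>, whatever follows.\<close>
    have e2: "fp_exp B K X S = \<zero>\<^bsub>B\<^esub>"
      if S: "S \<in> AA <#>\<^bsub>LO\<^esub> D' <#>\<^bsub>LO\<^esub> AA <#>\<^bsub>LO\<^esub> set_pow LO (C' <#>\<^bsub>LO\<^esub> AA <#>\<^bsub>LO\<^esub> D') n <#>\<^bsub>LO\<^esub> AA" for S n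
    proof -
      from S obtain t d t' s t'' where *: "t \<in> AA" "d \<in> D'" "t' \<in> AA" "s \<in> set_pow LO (C' <#>\<^bsub>LO\<^esub> AA <#>\<^bsub>LO\<^esub> D') n" "t'' \<in> AA"
        "S = t \<otimes>\<^bsub>LO\<^esub> d \<otimes>\<^bsub>LO\<^esub> t' \<otimes>\<^bsub>LO\<^esub> s \<otimes>\<^bsub>LO\<^esub> t''" by (auto simp: set_mult_iff)
      have cl: "t \<in> carrier LO" "d \<in> carrier LO" "t' \<in> carrier LO" "s \<in> carrier LO" "t'' \<in> carrier LO"
        using * AA(1) D'(1) pow[OF SC(2)] by auto
      have "?R \<otimes>\<^bsub>LO\<^esub> S = (?R \<otimes>\<^bsub>LO\<^esub> t) \<otimes>\<^bsub>LO\<^esub> d \<otimes>\<^bsub>LO\<^esub> t' \<otimes>\<^bsub>LO\<^esub> s \<otimes>\<^bsub>LO\<^esub> t''"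
        using cl Q by (simp add: *(6) LO.m_assoc)
      also have "\<dots> = t \<otimes>\<^bsub>LO\<^esub> (?R \<otimes>\<^bsub>LO\<^esub> d) \<otimes>\<^bsub>LO\<^esub> t' \<otimes>\<^bsub>LO\<^esub> s \<otimes>\<^bsub>LO\<^esub> t''"
        unfolding AA(3)[OF *(1), symmetric] using cl Q by (simp add: LO.m_assoc)
      also have "\<dots> = ?z" using cl D'(3)[OF *(2)] by simp
      finally show ?thesis using cl *(6) by (intro E0') auto
    qed
    show ?thesis
      unfolding Let_def AA_def[symmetric] C'_def[symmetric] D'_def[symmetric] using zs e1 e2 by blast
  qed
  show ?thesis
    unfolding bi_free_ffb_system_def
  proof (intro conjI)
    show "\<exists>C D. (\<forall>k\<in>K. pair_of_faces B LO EPS (diag_l (q k) k) (diag_r (q k) k) \<and> subalg LO (C k) \<and> subalg LO (D k) \<and>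
        upper_l (q k) k \<subseteq> C k \<and> lower_r (q k) k \<subseteq> D k \<inter> left_alg B LO EPS \<and>
        (\<forall>b\<in>carrier B. {Lop B EPS b} <#>\<^bsub>LO\<^esub> upper_l (q k) k \<subseteq> upper_l (q k) k \<and> upper_l (q k) k <#>\<^bsub>LO\<^esub> {Lop B EPS b} \<subseteq> upper_l (q k) k)) \<and>
        bi_free TYPE('x) B LO (fp_exp B K X) EPS K (\<lambda>k. alg_gen LO (diag_l (q k) k \<union> C k)) (\<lambda>k. alg_gen LO (diag_r (q k) k \<union> D k))"
      \<comment> \<open>Taking \<open>C\<close> and \<open>D\<close> to be the full images makes the
        generated algebras the full images too, and their bi-freeness is
        \<open>bi_free_full\<close>.\<close>
      by (rule exI[of _ "\<lambda>k. lrep k ` lops k"], rule exI[of _ "\<lambda>k. rrep k ` rops k"])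
         (use pair full sub D'_left C'_act bf in blast)
  qed (use main in \<open>auto simp: Let_def\<close>)
qed

end

section \<open>Bimodules with a central unit vector\<close>

text \<open>The data of an isomorphism of \<open>Y\<close> with \<open>B \<oplus> ker p\<close>
  taking \<open>e\<close> to \<open>1 \<oplus> 0\<close>: centrality of \<open>e\<close> makes
  \<open>b \<mapsto> b e\<close> a bimodule map, and \<open>p\<close> is a left inverse of it. As
  \<open>with_proj\<close> builds literal sums \<open>B \<oplus> X\<close>, operators on
  \<open>Y\<close> are carried over through this isomorphism.\<close>

locale pointed_bimodule =
  fixes B :: "(complex, 'b) module" and Y :: "('b, 'm) bimod" and e :: 'm and p :: "'m \<Rightarrow> 'b"
  assumes B: "complex_algebra B" and Y: "bimodule B Y" and e: "e \<in> carrier Y"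
    and e_central: "\<And>b. b \<in> carrier B \<Longrightarrow> lact Y b e = ract Y e b"
    and p: "lin Y B p"
    and p_lact: "\<And>b y. b \<in> carrier B \<Longrightarrow> y \<in> carrier Y \<Longrightarrow> p (lact Y b y) = b \<otimes>\<^bsub>B\<^esub> p y"
    and p_ract: "\<And>b y. b \<in> carrier B \<Longrightarrow> y \<in> carrier Y \<Longrightarrow> p (ract Y y b) = p y \<otimes>\<^bsub>B\<^esub> b"
    and p_e: "p e = \<one>\<^bsub>B\<^esub>"
begin

definition ker :: "('b, 'm) bimod" where
  "ker = Y\<lparr>carrier := {y \<in> carrier Y. p y = \<zero>\<^bsub>B\<^esub>}\<rparr>"

lemmas cB = complex_algebraD(2)[OF B]
lemmas cY = bimoduleD(1)[OF Y]

lemma ker_simps [simp]: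
  "y \<in> carrier ker \<longleftrightarrow> y \<in> carrier Y \<and> p y = \<zero>\<^bsub>B\<^esub>"
  "add ker = add Y" "zero ker = zero Y" "Module.smult ker = Module.smult Y" "lact ker = lact Y" "ract ker = ract Y"
  by (simp_all add: ker_def)

lemma p_zero: "p \<zero>\<^bsub>Y\<^esub> = \<zero>\<^bsub>B\<^esub>"
  by (rule lin_zero[OF cY cB p])

lemma bimodule_ker: "bimodule B ker"
proof -
  have c: "cmodule ker"
    by (rule cmoduleI)
       (simp_all add: cmod_closed[OF cY] cmod_simps[OF cY] cmod_assoc[OF cY] linD[OF p] p_zero cmod_simps[OF cB] cmod_closed[OF cB],
        simp add: cmod_comm[OF cY])
  show ?thesis
    unfolding bimodule_def
    by (intro conjI ballI linI c)
       (simp_all add: bimodule_simps[OF Y] p_lact p_ract calg_simps[OF B])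
qed

abbreviation "W \<equiv> with_proj B ker"

lemmas bW = bimodule_with_proj[OF B bimodule_ker]
lemmas cW = bimoduleD(1)[OF bW]

definition join :: "'b \<times> 'm \<Rightarrow> 'm" where
  "join v = lact Y (fst v) e \<oplus>\<^bsub>Y\<^esub> snd v"

definition split :: "'m \<Rightarrow> 'b \<times> 'm" where
  "split y = (p y, y \<oplus>\<^bsub>Y\<^esub> (-1) \<odot>\<^bsub>Y\<^esub> lact Y (p y) e)"

lemma W_E:
  assumes "v \<in> carrier W"
  obtains b y where "v = (b, y)" "b \<in> carrier B" "y \<in> carrier Y" "p y = \<zero>\<^bsub>B\<^esub>"
  using assms by (auto simp: with_proj_simps)

lemma join_lin: "lin W Y join"
  by (intro linI; elim W_E)
     (simp_all add: join_def with_proj_simps bimodule_simps[OF Y] e cmod_closed[OF cY] cmod_simps[OF cY] cmod_ac[OF cY])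

lemma p_join: "v \<in> carrier W \<Longrightarrow> p (join v) = fst v"
  by (elim W_E) (simp add: join_def linD[OF p] bimodule_simps[OF Y] e p_lact p_e calg_simps[OF B] cmod_simps[OF cB])

lemma cancel: "x \<in> carrier Y \<Longrightarrow> x \<oplus>\<^bsub>Y\<^esub> (-1) \<odot>\<^bsub>Y\<^esub> x = \<zero>\<^bsub>Y\<^esub>"
  using cmod_diff_zero_iff[OF cY] by blast

lemma split_closed: "y \<in> carrier Y \<Longrightarrow> split y \<in> carrier W"
  using cmod_diff_zero_iff[OF cB, of "p y" "p y"] linD(1)[OF p, of y]
  by (simp add: split_def with_proj_simps cmod_closed[OF cY] bimodule_simps[OF Y] e linD[OF p] p_lact p_e calg_simps[OF B])

lemma join_split: "y \<in> carrier Y \<Longrightarrow> join (split y) = y"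
proof -
  assume y: "y \<in> carrier Y"
  let ?x = "lact Y (p y) e"
  have x: "?x \<in> carrier Y" using y linD(1)[OF p y] by (simp add: bimodule_simps[OF Y] e)
  have "?x \<oplus>\<^bsub>Y\<^esub> (y \<oplus>\<^bsub>Y\<^esub> (-1) \<odot>\<^bsub>Y\<^esub> ?x) = y \<oplus>\<^bsub>Y\<^esub> (?x \<oplus>\<^bsub>Y\<^esub> (-1) \<odot>\<^bsub>Y\<^esub> ?x)"
    using x y cmod_closed(3)[OF cY x] by (simp only: cmod_lcomm[OF cY])
  then show ?thesis using y by (simp add: join_def split_def cancel[OF x] cmod_simps[OF cY])
qed

lemma split_join: "v \<in> carrier W \<Longrightarrow> split (join v) = v"
proof -
  assume v: "v \<in> carrier W"
  then obtain b y where *: "v = (b, y)" "b \<in> carrier B" "y \<in> carrier Y" by (rule W_E)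
  let ?x = "lact Y b e"
  have x: "?x \<in> carrier Y" using * by (simp add: bimodule_simps[OF Y] e)
  have "(?x \<oplus>\<^bsub>Y\<^esub> y) \<oplus>\<^bsub>Y\<^esub> (-1) \<odot>\<^bsub>Y\<^esub> ?x = y \<oplus>\<^bsub>Y\<^esub> (?x \<oplus>\<^bsub>Y\<^esub> (-1) \<odot>\<^bsub>Y\<^esub> ?x)"
    using x *(3) cmod_closed(3)[OF cY x] cmod_closed(1)[OF cY] by (simp only: cmod_ac[OF cY])
  then show ?thesis
    using p_join[OF v] * x by (simp add: split_def cancel[OF x] cmod_simps[OF cY]) (simp add: join_def)
qed

text \<open>The inverse of a linear bijection: each identity is checked after applying
  \<open>join\<close>.\<close>

lemma split_lin: "lin Y W split"
proof (rule linI)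
  have inj: "u = v" if "u \<in> carrier W" "v \<in> carrier W" "join u = join v" for u v
    using split_join[OF that(1)] split_join[OF that(2)] that(3) by metis
  fix x assume x: "x \<in> carrier Y"
  show "split x \<in> carrier W" by (rule split_closed[OF x])
  fix c show "split (c \<odot>\<^bsub>Y\<^esub> x) = c \<odot>\<^bsub>W\<^esub> split x"
    by (rule inj) (use x in \<open>simp_all add: split_closed cmod_closed[OF cY] cmod_closed[OF cW] linD[OF join_lin] join_split\<close>)
  fix y assume y: "y \<in> carrier Y"
  show "split (x \<oplus>\<^bsub>Y\<^esub> y) = split x \<oplus>\<^bsub>W\<^esub> split y"
    by (rule inj) (use x y in \<open>simp_all add: split_closed cmod_closed[OF cY] cmod_closed[OF cW] linD[OF join_lin] join_split\<close>)
qed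

lemma join_act:
  assumes "v \<in> carrier W" "c \<in> carrier B"
  shows "join (lact W c v) = lact Y c (join v)" "join (ract W v c) = ract Y (join v) c"
proof -
  obtain b y where v: "v = (b, y)" "b \<in> carrier B" "y \<in> carrier Y" by (rule W_E[OF assms(1)])
  \<comment> \<open>Centrality of \<open>e\<close> enters here:
    \<open>(b e) c = b (e c) = b (c e)\<close>.\<close>
  have "ract Y (lact Y b e) c = lact Y (b \<otimes>\<^bsub>B\<^esub> c) e"
    using v assms(2) e by (simp add: bimodule_simps[OF Y] e_central[symmetric])
  then show "join (lact W c v) = lact Y c (join v)" "join (ract W v c) = ract Y (join v) c"
    using v assms(2) e by (simp_all add: join_def with_proj_simps bimodule_simps[OF Y])
qed

lemma split_act:
  assumes "y \<in> carrier Y" "c \<in> carrier B"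
  shows "split (lact Y c y) = lact W c (split y)" "split (ract Y y c) = ract W (split y) c"
  using join_act[OF split_closed[OF assms(1)] assms(2)] split_join[of "lact W c (split y)"] split_join[of "ract W (split y) c"]
    bimodule_simps(1,2)[OF bW assms(2) split_closed[OF assms(1)]] assms
  by (simp_all add: join_split)

lemma split_e: "split e = (\<one>\<^bsub>B\<^esub>, \<zero>\<^bsub>ker\<^esub>)"
  using e by (simp add: split_def p_e bimodule_simps[OF Y] cancel)

lemma fst_split: "fst (split y) = p y"
  by (simp add: split_def)

definition hat :: "('m \<Rightarrow> 'm) \<Rightarrow> 'b \<times> 'm \<Rightarrow> 'b \<times> 'm" where
  "hat S = (\<lambda>v\<in>carrier W. split (S (join v)))"

lemma hat_cong: "(\<And>y. y \<in> carrier Y \<Longrightarrow> S y = S' y) \<Longrightarrow> hat S = hat S'"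
  by (auto simp: hat_def linD(1)[OF join_lin])

lemma hat_closed: "lin Y Y S \<Longrightarrow> hat S \<in> carrier (lin_ops W)"
  unfolding hat_def by (rule lin_opsI[OF lin_comp[OF join_lin lin_comp[OF _ split_lin]] cW])

lemma hat_split: "y \<in> carrier Y \<Longrightarrow> hat S (split y) = split (S y)"
  by (simp add: hat_def split_closed join_split)

lemma hat_left:
  assumes S: "lin Y Y S" "\<And>b y. b \<in> carrier B \<Longrightarrow> y \<in> carrier Y \<Longrightarrow> S (ract Y y b) = ract Y (S y) b"
  shows "hat S \<in> carrier (left_ops B W)"
  using hat_closed[OF S(1)]
  by (auto simp: left_ops_simps hat_def bimodule_simps[OF bW] join_act S(2) split_act linD(1)[OF join_lin] linD(1)[OF S(1)])

lemma hat_right: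
  assumes S: "lin Y Y S" "\<And>b y. b \<in> carrier B \<Longrightarrow> y \<in> carrier Y \<Longrightarrow> S (lact Y b y) = lact Y b (S y)"
  shows "hat S \<in> carrier (right_ops B W)"
  using hat_closed[OF S(1)]
  by (auto simp: right_ops_simps hat_def bimodule_simps[OF bW] join_act S(2) split_act linD(1)[OF join_lin] linD(1)[OF S(1)])

lemma hat_mult: "lin Y Y S' \<Longrightarrow> hat S \<otimes>\<^bsub>lin_ops W\<^esub> hat S' = hat (\<lambda>y. S (S' y))"
  by (auto simp: lin_ops_simps compose_def hat_def split_closed linD(1) linD(1)[OF join_lin] join_split)

lemma hat_add: "lin Y Y S \<Longrightarrow> lin Y Y S' \<Longrightarrow> hat (\<lambda>y. S y \<oplus>\<^bsub>Y\<^esub> S' y) = hat S \<oplus>\<^bsub>lin_ops W\<^esub> hat S'"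
  by (auto simp: lin_ops_simps hat_def linD(1) linD(1)[OF join_lin] linD(2)[OF split_lin])

lemma hat_smult: "lin Y Y S \<Longrightarrow> hat (\<lambda>y. c \<odot>\<^bsub>Y\<^esub> S y) = c \<odot>\<^bsub>lin_ops W\<^esub> hat S"
  by (auto simp: lin_ops_simps hat_def linD(1) linD(1)[OF join_lin] linD(3)[OF split_lin])

lemma hat_zero: "hat (\<lambda>y. \<zero>\<^bsub>Y\<^esub>) = \<zero>\<^bsub>lin_ops W\<^esub>"
  using lin_zero[OF cY cW split_lin] by (auto simp: lin_ops_simps hat_def)

lemma hat_lact: "b \<in> carrier B \<Longrightarrow> hat (lact Y b) = lact_op W b"
  by (auto simp: hat_def lact_op_def split_act linD(1)[OF join_lin] split_join)

lemma hat_ract: "b \<in> carrier B \<Longrightarrow> hat (\<lambda>y. ract Y y b) = ract_op W b"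
  by (auto simp: hat_def ract_op_def split_act linD(1)[OF join_lin] split_join)

end

definition bimod_prod :: "('b, 'm) bimod \<Rightarrow> ('b, 'n) bimod \<Rightarrow> ('b, 'm \<times> 'n) bimod" where
  "bimod_prod M N =
     \<lparr>carrier = carrier M \<times> carrier N, mult = undefined, one = undefined,
      zero = (\<zero>\<^bsub>M\<^esub>, \<zero>\<^bsub>N\<^esub>),
      add = (\<lambda>(s, t) (s', t'). (s \<oplus>\<^bsub>M\<^esub> s', t \<oplus>\<^bsub>N\<^esub> t')),
      smult = (\<lambda>c (s, t). (c \<odot>\<^bsub>M\<^esub> s, c \<odot>\<^bsub>N\<^esub> t)),
      lact = (\<lambda>b (s, t). (lact M b s, lact N b t)),
      ract = (\<lambda>(s, t) b. (ract M s b, ract N t b))\<rparr>"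

lemma bimod_prod_simps:
  "carrier (bimod_prod M N) = carrier M \<times> carrier N"
  "\<zero>\<^bsub>bimod_prod M N\<^esub> = (\<zero>\<^bsub>M\<^esub>, \<zero>\<^bsub>N\<^esub>)"
  "(s, t) \<oplus>\<^bsub>bimod_prod M N\<^esub> (s', t') = (s \<oplus>\<^bsub>M\<^esub> s', t \<oplus>\<^bsub>N\<^esub> t')"
  "c \<odot>\<^bsub>bimod_prod M N\<^esub> (s, t) = (c \<odot>\<^bsub>M\<^esub> s, c \<odot>\<^bsub>N\<^esub> t)"
  "lact (bimod_prod M N) b (s, t) = (lact M b s, lact N b t)"
  "ract (bimod_prod M N) (s, t) b = (ract M s b, ract N t b)"
  by (simp_all add: bimod_prod_def)

lemma bimodule_prod:
  assumes M: "bimodule B M" and N: "bimodule B N"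
  shows "bimodule B (bimod_prod M N)"
proof -
  note cM = bimoduleD(1)[OF M] and cN = bimoduleD(1)[OF N]
  have "cmodule (bimod_prod M N)"
    by (rule cmoduleI)
       (auto simp: bimod_prod_simps cmod_closed[OF cM] cmod_closed[OF cN] cmod_simps[OF cM] cmod_simps[OF cN] cmod_assoc[OF cM] cmod_assoc[OF cN]
         intro: cmod_comm[OF cM] cmod_comm[OF cN])
  then show ?thesis
    unfolding bimodule_def
    by (intro conjI ballI linI) (auto simp: bimod_prod_simps bimodule_simps[OF M] bimodule_simps[OF N])
qed

section \<open>The copies of \<open>B\<close> in a non-commutative probability space\<close>

text \<open>The counterpart of \<open>tmult_eq\<close> with the words of the right factor fixed;
  together they treat relations in either factor.\<close>

lemma tmult_eq': "tmult m f g = (\<Sum>v\<in>Poly_Mapping.keys g. fscale (Poly_Mapping.lookup g v) (push (\<lambda>u. m u v) f))"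
  unfolding tmult_def push_def fs.scale_sum_right
  by (subst sum.swap) (simp add: mult.commute)

lemma bilinear_relsI:
  assumes "x \<in> carrier M" "y \<in> carrier N"
  shows "Poly_Mapping.single (c \<odot>\<^bsub>M\<^esub> x, y) 1 - Poly_Mapping.single (x, y) c \<in> bilinear_rels M N"
    "Poly_Mapping.single (x, c \<odot>\<^bsub>N\<^esub> y) 1 - Poly_Mapping.single (x, y) c \<in> bilinear_rels M N"
    "x' \<in> carrier M \<Longrightarrow>
      Poly_Mapping.single (x \<oplus>\<^bsub>M\<^esub> x', y) 1 - Poly_Mapping.single (x, y) 1 - Poly_Mapping.single (x', y) 1 \<in> bilinear_rels M N"
    "y' \<in> carrier N \<Longrightarrow>
      Poly_Mapping.single (x, y \<oplus>\<^bsub>N\<^esub> y') 1 - Poly_Mapping.single (x, y) 1 - Poly_Mapping.single (x, y') 1 \<in> bilinear_rels M N"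
  using assms unfolding bilinear_rels_def by blast+

context
  fixes B :: "(complex, 'b) module"
  assumes B: "complex_algebra B"
begin

private abbreviation (input) "W \<equiv> carrier B \<times> carrier B"
private abbreviation (input) "R \<equiv> bilinear_rels B (op_alg B)"
private abbreviation (input) "m \<equiv> \<lambda>u v. (fst u \<otimes>\<^bsub>B\<^esub> fst v, snd v \<otimes>\<^bsub>B\<^esub> snd u)"

lemma bilinear_rels_op_alg: "bilinear_rels M (op_alg B) = bilinear_rels M B"
  by (simp add: bilinear_rels_def op_alg_def)

lemma alg_tensor_simps:
  "carrier (alg_tensor B (op_alg B)) = carrier (presented W (bilinear_rels B B))"
  "\<zero>\<^bsub>alg_tensor B (op_alg B)\<^esub> = \<zero>\<^bsub>presented W (bilinear_rels B B)\<^esub>"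
  "F \<oplus>\<^bsub>alg_tensor B (op_alg B)\<^esub> G = F \<oplus>\<^bsub>presented W (bilinear_rels B B)\<^esub> G"
  "c \<odot>\<^bsub>alg_tensor B (op_alg B)\<^esub> F = c \<odot>\<^bsub>presented W (bilinear_rels B B)\<^esub> F"
  "\<one>\<^bsub>alg_tensor B (op_alg B)\<^esub> = btens B \<one>\<^bsub>B\<^esub> \<one>\<^bsub>B\<^esub>"
  by (simp_all add: alg_tensor_def Let_def btens_def bilinear_rels_op_alg)

lemma btens_eq: "btens B b c = gen_class (bilinear_rels B B) (b, c)"
  by (simp add: btens_def bilinear_rels_op_alg)

lemma btens_closed: "b \<in> carrier B \<Longrightarrow> c \<in> carrier B \<Longrightarrow> btens B b c \<in> carrier (alg_tensor B (op_alg B))"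
  by (simp add: alg_tensor_simps btens_eq gen_class_closed)

lemma btens_lin1: "c \<in> carrier B \<Longrightarrow> lin B (alg_tensor B (op_alg B)) (\<lambda>b. btens B b c)"
  by (rule linI; (rule btens_closed)?; (unfold alg_tensor_simps btens_eq)?; (rule gen_class_addI gen_class_smultI)?)
     (assumption | rule bilinear_relsI)+

lemma btens_lin2: "b \<in> carrier B \<Longrightarrow> lin B (alg_tensor B (op_alg B)) (\<lambda>c. btens B b c)"
  by (rule linI; (rule btens_closed)?; (unfold alg_tensor_simps btens_eq)?; (rule gen_class_addI gen_class_smultI)?)
     (assumption | rule bilinear_relsI)+

text \<open>Multiplying words by a fixed word acts on each tensor factor by a linear map, so this
  covers the multiplications from both sides that occur in \<open>tmult\<close>.\<close>

private lemma push_rels: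
  assumes r: "r \<in> R" and f: "lin B B f" and g: "lin B B g"
  shows "push (\<lambda>v. (f (fst v), g (snd v))) r \<in> fs.span R"
proof -
  note cB = complex_algebraD(2)[OF B] and cO = cmodule_op_alg[OF complex_algebraD(2)[OF B]]
  let ?\<phi> = "\<lambda>v. (f (fst v), g (snd v))"
  have l: "lin B (presented W R) (\<lambda>b. gen_class R (b, c))" "lin B (presented W R) (\<lambda>c'. gen_class R (c, c'))" if "c \<in> carrier B" for c
    using btens_lin1[OF that] btens_lin2[OF that] by (simp_all add: linear_on_def alg_tensor_def Let_def btens_def)
  have "flift (presented W R) (\<lambda>w. gen_class R (?\<phi> w)) r = \<zero>\<^bsub>presented W R\<^esub>"
    by (rule flift_bilinear_rels[OF cB cO cmodule_presented _ _ r])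
       (use lin_comp[OF f l(1)] lin_comp[OF g l(2)] linD(1)[OF f] linD(1)[OF g] in \<open>auto simp: linear_on_def Pi_iff\<close>)
  then show ?thesis
    using bilinear_rels_keys[OF cB cO r] linD(1)[OF f] linD(1)[OF g]
    by (intro push_in_span[of r W _ W]) auto
qed

text \<open>For a given \<epsilon> the product of simple tensors has to be computed in
  \<open>alg_tensor\<close> itself. By \<open>r1\<close> and \<open>r2\<close> the span of the
  relations absorbs products on both sides, so all pairs of representatives give the same class and
  the union defining the product is that class. The second factors multiply in opposite
  order.\<close>

lemma btens_mult:
  assumes "b \<in> carrier B" "c \<in> carrier B" "b' \<in> carrier B" "c' \<in> carrier B"
  shows "btens B b c \<otimes>\<^bsub>alg_tensor B (op_alg B)\<^esub> btens B b' c' = btens B (b \<otimes>\<^bsub>B\<^esub> b') (c' \<otimes>\<^bsub>B\<^esub> c)"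
proof -
  let ?f = "Poly_Mapping.single (b, c) (1 :: complex)" and ?g = "Poly_Mapping.single (b', c') (1 :: complex)"
  have l: "lin B B (\<lambda>x. y \<otimes>\<^bsub>B\<^esub> x)" "lin B B (\<lambda>x. x \<otimes>\<^bsub>B\<^esub> y)" if "y \<in> carrier B" for y
    
    using that by (auto intro!: linI simp: calg_closed[OF B] calg_simps[OF B] complex_algebraD(3)[OF B, symmetric] complex_algebraD(4)[OF B, symmetric])
  have keys: "Poly_Mapping.keys g \<subseteq> W" if "g \<in> fs.span R" for g
    using fs.span_minimal[of R "{f. Poly_Mapping.keys f \<subseteq> W}"] fs_subspace_keys[of W]
      bilinear_rels_keys[OF complex_algebraD(2)[OF B] cmodule_op_alg[OF complex_algebraD(2)[OF B]]] that by auto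
  have r1: "tmult m f g \<in> fs.span R" if f: "f \<in> fs.span R" and g: "Poly_Mapping.keys g \<subseteq> W" for f g
    unfolding tmult_eq'
  proof (intro fs.span_sum fs.span_scale)
    fix v assume "v \<in> Poly_Mapping.keys g"
    then have "fst v \<in> carrier B" "snd v \<in> carrier B" using g by auto
    then show "push (\<lambda>u. m u v) f \<in> fs.span R"
      by (intro push_span[OF f] ballI) (auto intro!: push_rels l)
  qed
  have r2: "tmult m f g \<in> fs.span R" if g: "g \<in> fs.span R" and f: "Poly_Mapping.keys f \<subseteq> W" for f g
    unfolding tmult_eq
  proof (intro fs.span_sum fs.span_scale)
    fix u assume "u \<in> Poly_Mapping.keys f"
    then have "fst u \<in> carrier B" "snd u \<in> carrier B" using f by auto
    then show "push (m u) g \<in> fs.span R"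
      by (intro push_span[OF g] ballI) (auto intro!: push_rels l)
  qed
  have "qclass R (tmult m f g) = qclass R (Poly_Mapping.single (m (b, c) (b', c')) 1)"
    if "f \<in> qclass R ?f" "g \<in> qclass R ?g" for f g
  proof -
    have fg: "f - ?f \<in> fs.span R" "g - ?g \<in> fs.span R" using that by (auto simp: qclass_def)
    have kf: "Poly_Mapping.keys ?f \<subseteq> W" "Poly_Mapping.keys ?g \<subseteq> W" using assms by auto
    have kg: "Poly_Mapping.keys g \<subseteq> W"
      using keys_add_subset[OF keys[OF fg(2)] kf(2)] by simp
    \<comment> \<open>The two representatives are exchanged one at a time.\<close>
    have "tmult m f g = tmult m (f - ?f) g + tmult m ?f (g - ?g) + tmult m ?f ?g"
      using tmult_add[of m "f - ?f" ?f g] push_add[of "m (b, c)" "g - ?g" ?g] by (simp add: tmult_single)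
    then have "tmult m f g - tmult m ?f ?g \<in> fs.span R"
      using fs.span_add[OF r1[OF fg(1) kg] r2[OF fg(2) kf(1)]] by simp
    then show ?thesis by (simp add: qclass_eq_iff tmult_single)
  qed
  then show ?thesis
    using qclass_self[of ?f R] qclass_self[of ?g R]
    by (simp add: alg_tensor_def Let_def btens_def gen_class_def tmult_def[symmetric]) blast
qed

end

text \<open>The conditions of \<open>bb_ncps\<close> on \<open>E\<close> would also hold for
  \<open>E = 0\<close>; \<open>E(1) = 1\<close> is what normalizes the vacuum vector below.\<close>

locale bb_space =
  fixes B :: "(complex, 'b) module" and A :: "(complex, 'a) module" and E \<epsilon>
  assumes ncps: "bb_ncps B A E \<epsilon>" and E_one: "E \<one>\<^bsub>A\<^esub> = \<one>\<^bsub>B\<^esub>"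
begin

abbreviation "L \<equiv> Lop B \<epsilon>"
abbreviation "R \<equiv> Rop B \<epsilon>"

lemma B: "complex_algebra B" and A: "complex_algebra A" and E: "lin A B E"
  using ncps by (auto simp: bb_ncps_def)

lemmas cB = complex_algebraD(2)[OF B]
lemmas cA = complex_algebraD(2)[OF A]
lemmas A_closed = calg_closed[OF A] cmod_closed[OF cA]
lemmas A_simps = calg_simps[OF A] cmod_simps[OF cA]
lemmas B_closed = calg_closed[OF B] cmod_closed[OF cB]
lemmas B_simps = calg_simps[OF B] cmod_simps[OF cB]

lemma eps_lin: "lin (alg_tensor B (op_alg B)) A \<epsilon>"
  and eps_mult: "F \<in> carrier (alg_tensor B (op_alg B)) \<Longrightarrow> G \<in> carrier (alg_tensor B (op_alg B)) \<Longrightarrow>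
    \<epsilon> (F \<otimes>\<^bsub>alg_tensor B (op_alg B)\<^esub> G) = \<epsilon> F \<otimes>\<^bsub>A\<^esub> \<epsilon> G"
  and eps_one: "\<epsilon> \<one>\<^bsub>alg_tensor B (op_alg B)\<^esub> = \<one>\<^bsub>A\<^esub>"
  using ncps by (auto simp: bb_ncps_def unital_alg_hom_def alg_hom_def)

lemma L_lin: "lin B A L" and R_lin: "lin B A R"
  unfolding Lop_def Rop_def
  by (rule lin_comp[OF btens_lin1[OF B] eps_lin] lin_comp[OF btens_lin2[OF B] eps_lin]; simp add: B_closed)+

lemma LR_closed: "b \<in> carrier B \<Longrightarrow> L b \<in> carrier A" "b \<in> carrier B \<Longrightarrow> R b \<in> carrier A"
  by (rule linD(1)[OF L_lin] linD(1)[OF R_lin]; assumption)+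

lemma eps_btens_mult:
  "b \<in> carrier B \<Longrightarrow> c \<in> carrier B \<Longrightarrow> b' \<in> carrier B \<Longrightarrow> c' \<in> carrier B \<Longrightarrow>
    \<epsilon> (btens B b c) \<otimes>\<^bsub>A\<^esub> \<epsilon> (btens B b' c') = \<epsilon> (btens B (b \<otimes>\<^bsub>B\<^esub> b') (c' \<otimes>\<^bsub>B\<^esub> c))"
  by (simp add: eps_mult[symmetric] btens_closed[OF B] btens_mult[OF B])

lemma LR_one: "L \<one>\<^bsub>B\<^esub> = \<one>\<^bsub>A\<^esub>" "R \<one>\<^bsub>B\<^esub> = \<one>\<^bsub>A\<^esub>"
  using eps_one by (simp_all add: Lop_def Rop_def alg_tensor_simps(5)[OF B])

text \<open>\<open>R\<close> reverses products because the second tensor factor is the opposite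
  algebra.\<close>

lemma LR_mult:
  assumes "b \<in> carrier B" "c \<in> carrier B"
  shows "L (b \<otimes>\<^bsub>B\<^esub> c) = L b \<otimes>\<^bsub>A\<^esub> L c" "R (b \<otimes>\<^bsub>B\<^esub> c) = R c \<otimes>\<^bsub>A\<^esub> R b" "R c \<otimes>\<^bsub>A\<^esub> L b = L b \<otimes>\<^bsub>A\<^esub> R c"
  using assms by (simp_all add: Lop_def Rop_def eps_btens_mult B_closed B_simps)

lemma E_LR:
  assumes "b \<in> carrier B" "S \<in> carrier A"
  shows "E (L b \<otimes>\<^bsub>A\<^esub> S) = b \<otimes>\<^bsub>B\<^esub> E S" "E (R b \<otimes>\<^bsub>A\<^esub> S) = E S \<otimes>\<^bsub>B\<^esub> b" "E (S \<otimes>\<^bsub>A\<^esub> L b) = E (S \<otimes>\<^bsub>A\<^esub> R b)"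
proof -
  have "E (\<epsilon> (btens B b c) \<otimes>\<^bsub>A\<^esub> S) = b \<otimes>\<^bsub>B\<^esub> E S \<otimes>\<^bsub>B\<^esub> c" if "b \<in> carrier B" "c \<in> carrier B" for b c
    using ncps assms that by (auto simp: bb_ncps_def)
  from this[of b "\<one>\<^bsub>B\<^esub>"] this[of "\<one>\<^bsub>B\<^esub>" b]
  show "E (L b \<otimes>\<^bsub>A\<^esub> S) = b \<otimes>\<^bsub>B\<^esub> E S" "E (R b \<otimes>\<^bsub>A\<^esub> S) = E S \<otimes>\<^bsub>B\<^esub> b"
    using assms linD(1)[OF E] by (simp_all add: Lop_def Rop_def B_closed B_simps)
  show "E (S \<otimes>\<^bsub>A\<^esub> L b) = E (S \<otimes>\<^bsub>A\<^esub> R b)" using ncps assms by (auto simp: bb_ncps_def)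
qed

subsection \<open>The GNS quotient\<close>

text \<open>The largest left ideal in the kernel of \<open>E\<close> contains \<open>A (L\<^sub>b - R\<^sub>b)\<close>, so the image of \<open>1\<close> in the quotient
  is a central vector. The second summand \<open>A\<close> makes the representation faithful.\<close>

definition cls :: "'a \<Rightarrow> 'a set" where
  "cls x = {y \<in> carrier A. \<forall>S\<in>carrier A. E (S \<otimes>\<^bsub>A\<^esub> y) = E (S \<otimes>\<^bsub>A\<^esub> x)}"

definition rep :: "'a set \<Rightarrow> 'a" where
  "rep F = (SOME x. x \<in> F)"

definition act :: "'a \<Rightarrow> 'a set \<times> 'a \<Rightarrow> 'a set \<times> 'a" where
  "act z = (\<lambda>(F, u). (cls (z \<otimes>\<^bsub>A\<^esub> rep F), z \<otimes>\<^bsub>A\<^esub> u))"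

definition gns :: "('b, 'a set \<times> 'a) bimod" where
  "gns =
     \<lparr>carrier = cls ` carrier A \<times> carrier A, mult = undefined, one = undefined,
      zero = (cls \<zero>\<^bsub>A\<^esub>, \<zero>\<^bsub>A\<^esub>),
      add = (\<lambda>(F, u) (G, v). (cls (rep F \<oplus>\<^bsub>A\<^esub> rep G), u \<oplus>\<^bsub>A\<^esub> v)),
      smult = (\<lambda>c (F, u). (cls (c \<odot>\<^bsub>A\<^esub> rep F), c \<odot>\<^bsub>A\<^esub> u)),
      lact = (\<lambda>b. act (L b)), ract = (\<lambda>s b. act (R b) s)\<rparr>"

lemma rep_cls:
  assumes "x \<in> carrier A"
  shows "rep (cls x) \<in> carrier A" "S \<in> carrier A \<Longrightarrow> E (S \<otimes>\<^bsub>A\<^esub> rep (cls x)) = E (S \<otimes>\<^bsub>A\<^esub> x)"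
proof -
  have "x \<in> cls x" using assms by (simp add: cls_def)
  then have "rep (cls x) \<in> cls x" unfolding rep_def by (rule someI)
  then show "rep (cls x) \<in> carrier A" "S \<in> carrier A \<Longrightarrow> E (S \<otimes>\<^bsub>A\<^esub> rep (cls x)) = E (S \<otimes>\<^bsub>A\<^esub> x)"
    by (auto simp: cls_def)
qed

lemma cls_eqI: "(\<And>S. S \<in> carrier A \<Longrightarrow> E (S \<otimes>\<^bsub>A\<^esub> x) = E (S \<otimes>\<^bsub>A\<^esub> y)) \<Longrightarrow> cls x = cls y"
  by (auto simp: cls_def)

lemma E_rep: "x \<in> carrier A \<Longrightarrow> E (rep (cls x)) = E x"
  using rep_cls(2)[of x "\<one>\<^bsub>A\<^esub>"] rep_cls(1)[of x] by (simp add: A_closed A_simps)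

text \<open>Independence of the chosen representatives. For multiplication by \<open>z\<close> this
  expresses that the subspace divided out is a left ideal: \<open>z\<close> is absorbed into the
  test element \<open>S\<close>.\<close>

lemma cls_ops:
  assumes "x \<in> carrier A" "y \<in> carrier A"
  shows "cls (rep (cls x) \<oplus>\<^bsub>A\<^esub> rep (cls y)) = cls (x \<oplus>\<^bsub>A\<^esub> y)"
    "cls (c \<odot>\<^bsub>A\<^esub> rep (cls x)) = cls (c \<odot>\<^bsub>A\<^esub> x)"
    "z \<in> carrier A \<Longrightarrow> cls (z \<otimes>\<^bsub>A\<^esub> rep (cls x)) = cls (z \<otimes>\<^bsub>A\<^esub> x)"
proof -
  note r = rep_cls[OF assms(1)] rep_cls[OF assms(2)]
  show "cls (rep (cls x) \<oplus>\<^bsub>A\<^esub> rep (cls y)) = cls (x \<oplus>\<^bsub>A\<^esub> y)"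
    by (rule cls_eqI) (use assms r in \<open>simp add: A_simps A_closed linD[OF E]\<close>)
  show "cls (c \<odot>\<^bsub>A\<^esub> rep (cls x)) = cls (c \<odot>\<^bsub>A\<^esub> x)"
    by (rule cls_eqI) (use assms r in \<open>simp add: A_closed linD[OF E] complex_algebraD(4)[OF A, symmetric]\<close>)
  show "cls (z \<otimes>\<^bsub>A\<^esub> rep (cls x)) = cls (z \<otimes>\<^bsub>A\<^esub> x)" if "z \<in> carrier A"
    by (rule cls_eqI) (use assms r that in \<open>simp add: A_closed complex_algebraD(9)[OF A, symmetric]\<close>)
qed

lemma gns_simps:
  assumes "x \<in> carrier A" "u \<in> carrier A"
  shows "(cls x, u) \<in> carrier gns"
    "y \<in> carrier A \<Longrightarrow> v \<in> carrier A \<Longrightarrow> (cls x, u) \<oplus>\<^bsub>gns\<^esub> (cls y, v) = (cls (x \<oplus>\<^bsub>A\<^esub> y), u \<oplus>\<^bsub>A\<^esub> v)"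
    "c \<odot>\<^bsub>gns\<^esub> (cls x, u) = (cls (c \<odot>\<^bsub>A\<^esub> x), c \<odot>\<^bsub>A\<^esub> u)"
    "z \<in> carrier A \<Longrightarrow> act z (cls x, u) = (cls (z \<otimes>\<^bsub>A\<^esub> x), z \<otimes>\<^bsub>A\<^esub> u)"
  using assms by (auto simp: gns_def act_def cls_ops)

lemma gns_consts: "\<zero>\<^bsub>gns\<^esub> = (cls \<zero>\<^bsub>A\<^esub>, \<zero>\<^bsub>A\<^esub>)" "lact gns b = act (L b)" "ract gns s b = act (R b) s"
  by (simp_all add: gns_def)

lemma gns_E:
  assumes "s \<in> carrier gns"
  obtains x u where "s = (cls x, u)" "x \<in> carrier A" "u \<in> carrier A"
  using assms by (auto simp: gns_def)

lemma cmodule_gns: "cmodule gns"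
  by (rule cmoduleI; (elim gns_E)?)
     (simp_all add: gns_simps gns_consts A_closed A_simps cmod_assoc[OF cA], simp add: cmod_comm[OF cA])

lemma act_lin: "z \<in> carrier A \<Longrightarrow> lin gns gns (act z)"
  by (rule linI; elim gns_E) (simp_all add: gns_simps A_closed A_simps complex_algebraD(4)[OF A, symmetric])

lemma act_simps:
  assumes "z \<in> carrier A" "s \<in> carrier gns"
  shows "z' \<in> carrier A \<Longrightarrow> act (z \<otimes>\<^bsub>A\<^esub> z') s = act z (act z' s)"
    "z' \<in> carrier A \<Longrightarrow> act (z \<oplus>\<^bsub>A\<^esub> z') s = act z s \<oplus>\<^bsub>gns\<^esub> act z' s"
    "act (c \<odot>\<^bsub>A\<^esub> z) s = c \<odot>\<^bsub>gns\<^esub> act z s" "act \<one>\<^bsub>A\<^esub> s = s" "act z s \<in> carrier gns"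
  using assms
  by (auto elim!: gns_E simp: gns_simps A_closed A_simps complex_algebraD(9)[OF A] complex_algebraD(3)[OF A, symmetric])

text \<open>Right multiplication by \<open>b\<close> is left multiplication by
  \<open>R\<^sub>b\<close>. It is a right action because \<open>R\<close> reverses products, and it
  is compatible with the left action because \<open>L\<close> and \<open>R\<close> commute.\<close>

lemma bimodule_gns: "bimodule B gns"
  unfolding bimodule_def
proof (intro conjI ballI cmodule_gns)
  show "lin gns gns (lact gns b)" "lin gns gns (\<lambda>x. ract gns x b)" if "b \<in> carrier B" for b
    unfolding gns_consts using act_lin[OF LR_closed(1)[OF that]] act_lin[OF LR_closed(2)[OF that]] by simp_all
  show "lin B gns (\<lambda>b. lact gns b x)" "lin B gns (\<lambda>b. ract gns x b)" if "x \<in> carrier gns" for x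
    unfolding gns_consts using that by (intro linI; simp add: act_simps LR_closed linD[OF L_lin] linD[OF R_lin])+
qed (simp_all add: gns_consts act_simps LR_one LR_mult LR_closed flip: act_simps(1), simp_all add: LR_closed LR_mult act_simps(4)[OF A_closed(2)])

section \<open>The doubled module with its central vector and functional\<close>

abbreviation "Y \<equiv> bimod_prod gns gns"

text \<open>The summand \<open>A\<close> of the first copy carries 0 and not 1:
  \<open>L\<^sub>b\<close> and \<open>R\<^sub>b\<close> need not agree on 1 in \<open>A\<close>, so
  centrality could fail. The second copy carries 0, so that e_11 fixes the vector.\<close>

definition vac :: "('a set \<times> 'a) \<times> ('a set \<times> 'a)" where
  "vac = ((cls \<one>\<^bsub>A\<^esub>, \<zero>\<^bsub>A\<^esub>), \<zero>\<^bsub>gns\<^esub>)"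

definition expect :: "('a set \<times> 'a) \<times> ('a set \<times> 'a) \<Rightarrow> 'b" where
  "expect y = E (rep (fst (fst y)))"

lemma expect_simps: "x \<in> carrier A \<Longrightarrow> expect ((cls x, u), t) = E x"
  by (simp add: expect_def E_rep)

lemma vac_closed: "vac \<in> carrier Y"
  by (simp add: vac_def bimod_prod_simps gns_simps gns_consts A_closed)

sublocale pb: pointed_bimodule B Y vac expect
proof (rule pointed_bimodule.intro)
  show "complex_algebra B" by (rule B)
  show "bimodule B Y" by (rule bimodule_prod[OF bimodule_gns bimodule_gns])
  show "vac \<in> carrier Y" by (rule vac_closed)
  show "lin Y B expect"
    by (rule linI) (auto elim!: gns_E simp: bimod_prod_simps gns_simps expect_simps linD[OF E] A_closed)
  show "expect vac = \<one>\<^bsub>B\<^esub>" by (simp add: vac_def expect_simps A_closed E_one)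
  fix b assume b: "b \<in> carrier B"
  have "cls (L b) = cls (R b)" by (rule cls_eqI) (simp add: E_LR b)
  then show "lact Y b vac = ract Y vac b"
    using b by (simp add: vac_def bimod_prod_simps gns_consts gns_simps A_closed A_simps LR_closed)
  fix y assume "y \<in> carrier Y"
  then show "expect (lact Y b y) = b \<otimes>\<^bsub>B\<^esub> expect y" "expect (ract Y y b) = expect y \<otimes>\<^bsub>B\<^esub> b"
    using b by (auto elim!: gns_E simp: bimod_prod_simps gns_consts gns_simps expect_simps E_LR A_closed LR_closed)
qed

end

section \<open>The embedding\<close>

context bb_space
begin

text \<open>As matrices over operators on \<open>gns\<close>: \<open>diag z\<close> is diag(z, z),
  \<open>first\<close> is e_11, \<open>down\<close> is e_21 and \<open>up z\<close> is z
  e_12.\<close>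

definition diag :: "'a \<Rightarrow> 'a doubled \<Rightarrow> 'a doubled" where
  "diag z = (\<lambda>(s, t). (act z s, act z t))"

definition first :: "'a doubled \<Rightarrow> 'a doubled" where
  "first = (\<lambda>(s, t). (s, \<zero>\<^bsub>gns\<^esub>))"

definition down :: "'a doubled \<Rightarrow> 'a doubled" where
  "down = (\<lambda>(s, t). (\<zero>\<^bsub>gns\<^esub>, s))"

definition up :: "'a \<Rightarrow> 'a doubled \<Rightarrow> 'a doubled" where
  "up z = (\<lambda>(s, t). (act z t, \<zero>\<^bsub>gns\<^esub>))"

lemmas corner_defs = diag_def first_def down_def up_def

lemma corner_apply:
  "diag z (s, t) = (act z s, act z t)" "down (s, t) = (\<zero>\<^bsub>gns\<^esub>, s)" "up z (s, t) = (act z t, \<zero>\<^bsub>gns\<^esub>)"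
  by (simp_all add: corner_defs)

lemmas cgns = bimoduleD(1)[OF bimodule_gns]

lemma zero_gns: "\<zero>\<^bsub>gns\<^esub> \<in> carrier gns"
  by (rule cmod_closed(2)[OF cgns])

lemma act_zero: "z \<in> carrier A \<Longrightarrow> act z \<zero>\<^bsub>gns\<^esub> = \<zero>\<^bsub>gns\<^esub>"
  by (rule lin_zero[OF cgns cgns act_lin])

lemmas Y_simps = bimod_prod_simps zero_gns act_zero act_simps cmod_simps[OF cgns] cmod_closed[OF cgns]

lemma corner_lin: "z \<in> carrier A \<Longrightarrow> lin Y Y (diag z)" "lin Y Y first" "lin Y Y down" "z \<in> carrier A \<Longrightarrow> lin Y Y (up z)"
  by (rule linI; auto simp: corner_defs Y_simps linD[OF act_lin] cmod_smult_zero[OF cgns])+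

lemma act_left_alg: "z \<in> left_alg B A \<epsilon> \<Longrightarrow> b \<in> carrier B \<Longrightarrow> s \<in> carrier gns \<Longrightarrow> act z (act (R b) s) = act (R b) (act z s)"
  and act_right_alg: "z \<in> right_alg B A \<epsilon> \<Longrightarrow> b \<in> carrier B \<Longrightarrow> s \<in> carrier gns \<Longrightarrow> act z (act (L b) s) = act (L b) (act z s)"
  by (auto simp: left_alg_def right_alg_def LR_closed simp flip: act_simps(1))

text \<open>The matrix units have scalar entries and respect both actions of \<open>B\<close>,
  whereas an entry \<open>z\<close> from \<open>left_alg\<close> is only known to commute with the
  right action. This is why \<open>z\<close> is placed in the corner that goes to the left
  face.\<close>

lemma corner_left:
  "z \<in> left_alg B A \<epsilon> \<Longrightarrow> pb.hat (diag z) \<in> carrier (left_ops B pb.W)" "pb.hat first \<in> carrier (left_ops B pb.W)"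
  "pb.hat down \<in> carrier (left_ops B pb.W)" "z \<in> left_alg B A \<epsilon> \<Longrightarrow> pb.hat (up z) \<in> carrier (left_ops B pb.W)"
  by (rule pb.hat_left[OF corner_lin(1)] pb.hat_left[OF corner_lin(2)] pb.hat_left[OF corner_lin(3)] pb.hat_left[OF corner_lin(4)];
      auto simp: corner_defs Y_simps gns_consts(3) act_left_alg LR_closed left_alg_def)+

lemma corner_right:
  "z \<in> right_alg B A \<epsilon> \<Longrightarrow> pb.hat (diag z) \<in> carrier (right_ops B pb.W)" "pb.hat first \<in> carrier (right_ops B pb.W)"
  "pb.hat down \<in> carrier (right_ops B pb.W)"
  by (rule pb.hat_right[OF corner_lin(1)] pb.hat_right[OF corner_lin(2)] pb.hat_right[OF corner_lin(3)];
      auto simp: corner_defs Y_simps gns_consts(2) act_right_alg LR_closed right_alg_def)+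

text \<open>The matrix identities that place the images in \<open>diag_l\<close>,
  \<open>diag_r\<close>, \<open>upper_l\<close> and \<open>lower_r\<close>.\<close>

lemma corner_hat:
  assumes z: "z \<in> carrier A"
  shows "pb.hat (diag z) \<otimes>\<^bsub>lin_ops pb.W\<^esub> pb.hat first = pb.hat first \<otimes>\<^bsub>lin_ops pb.W\<^esub> pb.hat (diag z)"
    "pb.hat first \<otimes>\<^bsub>lin_ops pb.W\<^esub> pb.hat (up z) = pb.hat (up z)"
    "pb.hat (up z) \<otimes>\<^bsub>lin_ops pb.W\<^esub> pb.hat first = \<zero>\<^bsub>lin_ops pb.W\<^esub>"
    "pb.hat down \<otimes>\<^bsub>lin_ops pb.W\<^esub> pb.hat first = pb.hat down"
    "pb.hat first \<otimes>\<^bsub>lin_ops pb.W\<^esub> pb.hat down = \<zero>\<^bsub>lin_ops pb.W\<^esub>"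
  using z unfolding pb.hat_zero[symmetric]
  by (simp_all add: pb.hat_mult corner_lin) (rule pb.hat_cong; auto simp: corner_defs Y_simps)+

text \<open>Multiplicativity of \<open>up\<close> against \<open>diag\<close> from either side is
  what later makes the Boolean embedding \<open>B\<close>-linear.\<close>

lemma diag_hat:
  assumes "z \<in> carrier A"
  shows "z' \<in> carrier A \<Longrightarrow> pb.hat (diag (z \<otimes>\<^bsub>A\<^esub> z')) = pb.hat (diag z) \<otimes>\<^bsub>lin_ops pb.W\<^esub> pb.hat (diag z')"
    "z' \<in> carrier A \<Longrightarrow> pb.hat (diag (z \<oplus>\<^bsub>A\<^esub> z')) = pb.hat (diag z) \<oplus>\<^bsub>lin_ops pb.W\<^esub> pb.hat (diag z')"
    "pb.hat (diag (c \<odot>\<^bsub>A\<^esub> z)) = c \<odot>\<^bsub>lin_ops pb.W\<^esub> pb.hat (diag z)"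
    "z' \<in> carrier A \<Longrightarrow> pb.hat (up (z \<otimes>\<^bsub>A\<^esub> z')) = pb.hat (diag z) \<otimes>\<^bsub>lin_ops pb.W\<^esub> pb.hat (up z')"
    "z' \<in> carrier A \<Longrightarrow> pb.hat (up (z \<otimes>\<^bsub>A\<^esub> z')) = pb.hat (up z) \<otimes>\<^bsub>lin_ops pb.W\<^esub> pb.hat (diag z')"
    "z' \<in> carrier A \<Longrightarrow> pb.hat (up (z \<oplus>\<^bsub>A\<^esub> z')) = pb.hat (up z) \<oplus>\<^bsub>lin_ops pb.W\<^esub> pb.hat (up z')"
    "pb.hat (up (c \<odot>\<^bsub>A\<^esub> z)) = c \<odot>\<^bsub>lin_ops pb.W\<^esub> pb.hat (up z)"
  using assms
  by (simp_all flip: pb.hat_add pb.hat_smult add: pb.hat_mult corner_lin)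
     (rule pb.hat_cong; auto simp: corner_defs Y_simps cmod_smult_zero[OF cgns])+

lemma diag_LR:
  assumes "b \<in> carrier B"
  shows "pb.hat (diag (L b)) = lact_op pb.W b" "pb.hat (diag (R b)) = ract_op pb.W b"
  unfolding pb.hat_lact[OF assms, symmetric] pb.hat_ract[OF assms, symmetric]
  by (rule pb.hat_cong; auto simp: corner_defs bimod_prod_simps gns_consts)+

lemma LR_algs: "b \<in> carrier B \<Longrightarrow> L b \<in> left_alg B A \<epsilon>" "b \<in> carrier B \<Longrightarrow> R b \<in> right_alg B A \<epsilon>"
  by (auto simp: left_alg_def right_alg_def LR_closed LR_mult)

end

lemma word_prod_simps: "word_prod A [] = \<one>\<^bsub>A\<^esub>" "word_prod A (x # xs) = x \<otimes>\<^bsub>A\<^esub> word_prod A xs"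
  by (simp_all add: word_prod_def)

section \<open>Operators on the free product that act as a given element of the space\<close>

locale bb_family = bb_space B A E \<epsilon> for B :: "(complex, 'b) module" and A :: "(complex, 'a) module" and E \<epsilon> +
  fixes K :: "'k set"
begin

sublocale bf: bimodule_family B K "\<lambda>_. pb.ker"
  by (rule bimodule_family.intro[OF B pb.bimodule_ker])

definition emb :: "'k \<Rightarrow> 'a set \<times> 'a \<Rightarrow> ('b, 'k, 'a doubled) fp" where
  "emb k s = bf.iota k (pb.split (s, \<zero>\<^bsub>gns\<^esub>))"

text \<open>The invariant linking the two spaces: \<open>S\<close> maps the embedded first copy of
  \<open>gns\<close> into itself and acts there as \<open>z\<close>. It is multiplicative, its value
  at the vacuum gives the moment, and it determines \<open>z\<close>.\<close>

definition implements :: "'k \<Rightarrow> ('b, 'k, 'a doubled) fp_ops \<Rightarrow> 'a \<Rightarrow> bool" where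
  "implements k S z \<longleftrightarrow> z \<in> carrier A \<and> (\<forall>s\<in>carrier gns. S (emb k s) = emb k (act z s))"

definition al :: "'k \<Rightarrow> 'a \<Rightarrow> ('b, 'k, 'a doubled) fp_ops" where
  "al k z = bf.lrep k (pb.hat (diag z))"

definition ar :: "'k \<Rightarrow> 'a \<Rightarrow> ('b, 'k, 'a doubled) fp_ops" where
  "ar k z = bf.rrep k (pb.hat (diag z))"

definition ab :: "'k \<Rightarrow> 'a \<Rightarrow> ('b, 'k, 'a doubled) fp_ops" where
  "ab k z = bf.lrep k (pb.hat (up z)) \<otimes>\<^bsub>bf.LO\<^esub> bf.rrep k (pb.hat down)"

lemma algs_closed: "z \<in> left_alg B A \<epsilon> \<Longrightarrow> z \<in> carrier A" "z \<in> right_alg B A \<epsilon> \<Longrightarrow> z \<in> carrier A"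
  by (simp_all add: left_alg_def right_alg_def)

text \<open>\<open>expect\<close> and \<open>vac\<close> involve only the first copy of
  \<open>gns\<close>, on which e_11 is the identity; this gives both conditions on \<open>q\<close>
  in \<open>corner_system\<close>.\<close>

lemma system:
  "bi_free_ffb_system TYPE('a doubled) B bf.LO (fp_exp B K (\<lambda>_. pb.ker)) bf.EPS K
    (\<lambda>k. bf.diag_l (pb.hat first) k) (\<lambda>k. bf.diag_r (pb.hat first) k)
    (\<lambda>k. bf.upper_l (pb.hat first) k) (\<lambda>k. bf.lower_r (pb.hat first) k)"
proof (rule bf.corner_system[OF corner_left(2) corner_right(2)])
  fix k :: 'k
  show "fst (pb.hat first v) = fst v" if "v \<in> carrier (bf.Y k)" for v
  proof -
    have "fst (first y) = fst y" for y by (simp add: first_def split_beta)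
    then have "expect (first (pb.join v)) = expect (pb.join v)" by (simp add: expect_def)
    then show ?thesis using that by (simp add: pb.hat_def pb.fst_split pb.p_join)
  qed
  have "first vac = vac" by (simp add: first_def vac_def)
  then show "pb.hat first (bf.unitY k) = bf.unitY k"
    using pb.hat_split[OF vac_closed, of first] by (simp only: pb.split_e)
qed

lemma dom: "s \<in> carrier gns \<Longrightarrow> (s, \<zero>\<^bsub>gns\<^esub>) \<in> carrier Y" "s \<in> carrier gns \<Longrightarrow> (\<zero>\<^bsub>gns\<^esub>, s) \<in> carrier Y"
  by (simp_all add: Y_simps)

lemma implements_one: "implements k \<one>\<^bsub>bf.LO\<^esub> \<one>\<^bsub>A\<^esub>" if "k \<in> K"
  unfolding implements_def emb_def
  by (simp add: A_closed act_simps(4)[OF A_closed(2)] bf.ev_FM[OF that] bf.iota_closed[OF that] pb.split_closed dom)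

lemma implements_mult:
  assumes "k \<in> K" "implements k S z" "implements k S' z'"
  shows "implements k (S \<otimes>\<^bsub>bf.LO\<^esub> S') (z \<otimes>\<^bsub>A\<^esub> z')"
  using assms unfolding implements_def emb_def
  by (simp add: A_closed act_simps bf.ev_FM[OF assms(1)] bf.iota_closed[OF assms(1)] pb.split_closed dom)

lemma implements_word:
  assumes "k \<in> K" "\<And>i. i \<in> set is \<Longrightarrow> implements k (S i) (z i)"
  shows "implements k (word_prod bf.LO (map S is)) (word_prod A (map z is))"
  using assms(2)
proof (induction "is")
  case Nil
  show ?case using implements_one[OF assms(1)] by (simp add: word_prod_simps list.map)
next
  case (Cons i "is")
  then show ?case using implements_mult[OF assms(1) Cons.prems[of i] Cons.IH] by (simp add: word_prod_simps list.map)
qed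

lemma implements_exp:
  assumes "implements k S z"
  shows "fp_exp B K (\<lambda>_. pb.ker) S = E z"
proof -
  have z: "z \<in> carrier A" using assms by (simp add: implements_def)
  \<comment> \<open>With 0 in the summand \<open>A\<close> this is the vacuum, whose image is the
    unit vector of the free product.\<close>
  have s: "(cls \<one>\<^bsub>A\<^esub>, \<zero>\<^bsub>A\<^esub>) \<in> carrier gns" by (simp add: gns_simps A_closed)
  have "emb k (cls \<one>\<^bsub>A\<^esub>, \<zero>\<^bsub>A\<^esub>) = bf.unit"
    unfolding emb_def vac_def[symmetric] pb.split_e by (rule bf.unitY_iota)
  then have "S bf.unit = emb k (act z (cls \<one>\<^bsub>A\<^esub>, \<zero>\<^bsub>A\<^esub>))"
    using assms s unfolding implements_def by metis
  then show ?thesis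
    using z by (simp add: fp_exp_def op_exp_def fp_part_def direct_sum_def emb_def bf.iota_def pb.fst_split gns_simps expect_simps A_closed A_simps)
qed

text \<open>Evaluated at the vector with \<open>\<one>\<close> in the summand \<open>A\<close>, the
  action returns \<open>z\<close> itself. The quotient summand alone could identify different
  elements.\<close>

lemma implements_inj:
  assumes "k \<in> K" "implements k S z" "implements k S z'"
  shows "z = z'"
proof -
  have z: "z \<in> carrier A" "z' \<in> carrier A" using assms by (simp_all add: implements_def)
  let ?s = "(cls \<one>\<^bsub>A\<^esub>, \<one>\<^bsub>A\<^esub>)"
  have s: "?s \<in> carrier gns" by (simp add: gns_simps A_closed)
  have "emb k (act z ?s) = emb k (act z' ?s)"
    using assms(2,3) s unfolding implements_def by metis
  then have "pb.split (act z ?s, \<zero>\<^bsub>gns\<^esub>) = pb.split (act z' ?s, \<zero>\<^bsub>gns\<^esub>)"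
    unfolding emb_def using bf.iota_inj[OF assms(1)] pb.split_closed[OF dom(1)] act_simps(5)[OF _ s] z by metis
  then have "(act z ?s, \<zero>\<^bsub>gns\<^esub>) = (act z' ?s, \<zero>\<^bsub>gns\<^esub>)"
    using pb.join_split[OF dom(1)] act_simps(5)[OF _ s] z by metis
  then show ?thesis using z by (simp add: gns_simps A_closed A_simps)
qed

context
  fixes k assumes k: "k \<in> K"
begin

lemma implements_al: "z \<in> left_alg B A \<epsilon> \<Longrightarrow> implements k (al k z) z"
  unfolding implements_def al_def emb_def
  by (simp add: algs_closed bf.left_rep_iota[OF k corner_left(1)] pb.hat_split pb.split_closed dom corner_apply act_zero)

lemma implements_ar: "z \<in> right_alg B A \<epsilon> \<Longrightarrow> implements k (ar k z) z"
  unfolding implements_def ar_def emb_def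
  by (simp add: algs_closed bf.right_rep_iota[OF k corner_right(1)] pb.hat_split pb.split_closed dom corner_apply act_zero)

text \<open>\<open>down\<close> moves a vector unchanged from the first copy to the second, and
  \<open>up z\<close> brings it back multiplied by \<open>z\<close>.\<close>

lemma implements_ab: "z \<in> left_alg B A \<epsilon> \<Longrightarrow> implements k (ab k z) z"
  unfolding implements_def ab_def emb_def
  by (simp add: algs_closed bf.ev_FM[OF k] bf.iota_closed[OF k] bf.right_rep_iota[OF k corner_right(3)] bf.left_rep_iota[OF k corner_left(4)]
      pb.hat_split pb.split_closed dom corner_apply act_zero)

lemma al_closed: "z \<in> left_alg B A \<epsilon> \<Longrightarrow> al k z \<in> bf.diag_l (pb.hat first) k"
  and ar_closed: "z \<in> right_alg B A \<epsilon> \<Longrightarrow> ar k z \<in> bf.diag_r (pb.hat first) k"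
  unfolding al_def ar_def bf.diag_l_def bf.diag_r_def
  by (intro imageI CollectI conjI corner_left corner_right corner_hat algs_closed; assumption)+

lemma ab_closed:
  "z \<in> left_alg B A \<epsilon> \<Longrightarrow> ab k z \<in> alg_gen bf.LO (bf.upper_l (pb.hat first) k <#>\<^bsub>bf.LO\<^esub> bf.lower_r (pb.hat first) k)"
  unfolding ab_def bf.upper_l_def bf.lower_r_def
  by (intro alg_gen_mult imageI CollectI conjI IntI corner_left corner_right corner_hat algs_closed) (auto simp: A_closed)

lemma al_B_linear:
  assumes "S \<subseteq> left_alg B A \<epsilon>"
  shows "B_linear_on B A L bf.LO (Lop B bf.EPS) S (al k)"
proof -
  note [simp] = corner_left(1) algs_closed diag_hat(1-3) LR_algs bf.lrep_simps[OF k] diag_LR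
    LR_closed bf.left_rep_lact[OF k, symmetric] Lop_bimod_eps[OF B bf.bFM] bf.lact_lops[OF k]
  show ?thesis
    using assms unfolding B_linear_on_def linear_on_def al_def by (auto simp: subset_iff)
qed

lemma ar_B_linear:
  assumes "S \<subseteq> right_alg B A \<epsilon>"
  shows "B_linear_on B A R bf.LO (Rop B bf.EPS) S (ar k)"
proof -
  note [simp] = corner_right(1) algs_closed diag_hat(1-3) LR_algs bf.rrep_simps[OF k] diag_LR
    LR_closed bf.right_rep_ract[OF k, symmetric] Rop_bimod_eps[OF B bf.bFM] bf.ract_rops[OF k]
  show ?thesis
    using assms unfolding B_linear_on_def linear_on_def ar_def by (auto simp: subset_iff)
qed

text \<open>On the left, \<open>L\<^sub>b\<close> is absorbed by the upper corner. On the right it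
  first has to pass the factor \<open>down\<close>, which is in a right face and therefore commutes
  with it.\<close>

lemma ab_B_linear:
  assumes "S \<subseteq> left_alg B A \<epsilon>"
  shows "B_linear_on B A L bf.LO (Lop B bf.EPS) S (ab k)"
proof -
  note LO = calg_closed[OF bf.LO_alg] complex_algebraD(9,10)[OF bf.LO_alg] complex_algebraD(3)[OF bf.LO_alg, symmetric]
  have down: "bf.rrep k (pb.hat down) \<in> carrier bf.LO" by (rule bf.rrep_simps(1)[OF k corner_right(3)])
  have L': "Lop B bf.EPS b \<in> carrier bf.LO" if "b \<in> carrier B" for b
    using bf.lrep_simps(1)[OF k bf.lact_lops[OF k that]] that by (simp add: Lop_bimod_eps[OF B bf.bFM] bf.left_rep_lact[OF k])
  have comm: "bf.rrep k (pb.hat down) \<otimes>\<^bsub>bf.LO\<^esub> Lop B bf.EPS b = Lop B bf.EPS b \<otimes>\<^bsub>bf.LO\<^esub> bf.rrep k (pb.hat down)" if "b \<in> carrier B" for b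
    using bf.right_rep_right_ops[OF k corner_right(3)] bf.right_ops_right_alg that by (auto simp: right_alg_def)
  have lact: "bf.lrep k (pb.hat (diag (L b))) = Lop B bf.EPS b" if "b \<in> carrier B" for b
    using that by (simp add: diag_LR Lop_bimod_eps[OF B bf.bFM] bf.left_rep_lact[OF k])
  show ?thesis
    unfolding B_linear_on_def linear_on_def
  proof (intro conjI ballI allI funcsetI)
    fix z assume "z \<in> S"
    then have z: "z \<in> left_alg B A \<epsilon>" "z \<in> carrier A" using assms algs_closed by auto
    note up = corner_left(4)[OF z(1)]
    note l = bf.lrep_simps(1)[OF k up]
    show "ab k z \<in> carrier bf.LO" using l down by (simp add: ab_def LO)
    show "ab k (c \<odot>\<^bsub>A\<^esub> z) = c \<odot>\<^bsub>bf.LO\<^esub> ab k z" for c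
      using z l down by (simp add: ab_def diag_hat(7)[OF z(2)] bf.lrep_simps(4)[OF k up] LO)
    show "ab k (z \<oplus>\<^bsub>A\<^esub> z') = ab k z \<oplus>\<^bsub>bf.LO\<^esub> ab k z'" if "z' \<in> S" for z'
    proof -
      have z': "z' \<in> left_alg B A \<epsilon>" "z' \<in> carrier A" using that assms algs_closed by auto
      show ?thesis
        using l down bf.lrep_simps(1)[OF k corner_left(4)[OF z'(1)]]
        by (simp add: ab_def diag_hat(6)[OF z(2) z'(2)] bf.lrep_simps(3)[OF k up corner_left(4)[OF z'(1)]] LO)
    qed
    fix b assume b: "b \<in> carrier B"
    note L = corner_left(1)[OF LR_algs(1)[OF b]]
    show "ab k (L b \<otimes>\<^bsub>A\<^esub> z) = Lop B bf.EPS b \<otimes>\<^bsub>bf.LO\<^esub> ab k z"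
      using l down L'[OF b]
      by (simp add: ab_def diag_hat(4)[OF LR_closed(1)[OF b] z(2)] bf.lrep_simps(2)[OF k L up] lact[OF b] LO)
    show "ab k (z \<otimes>\<^bsub>A\<^esub> L b) = ab k z \<otimes>\<^bsub>bf.LO\<^esub> Lop B bf.EPS b"
      using l down L'[OF b]
      by (simp add: ab_def diag_hat(5)[OF z(2) LR_closed(1)[OF b]] bf.lrep_simps(2)[OF k up L] lact[OF b] LO comm[OF b])
  qed
qed

end

end

text \<open>This is the moment formula for the empty word: the identity operator fixes the unit
  vector, provided that this vector is in the carrier. Membership is read off from
  \<open>cmodule_tensor_list\<close>, since the \<open>X k\<close> are known to be bimodules only
  for \<open>k \<in> K\<close>.\<close>

lemma ffb_independent_E_one:
  fixes B :: "(complex, 'b) module" and A :: "(complex, 'a) module" and K :: "'k set"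
  assumes B: "complex_algebra B" and "ffb_independent TYPE('x) B A E \<epsilon> K Al Ar Ab"
  shows "E \<one>\<^bsub>A\<^esub> = \<one>\<^bsub>B\<^esub>"
proof -
  obtain X :: "'k \<Rightarrow> ('b, 'x) bimod" and l r m where X: "\<forall>k\<in>K. bimodule B (X k)" and
    w: "\<And>w :: (face \<times> 'k \<times> 'a) list.
        (\<forall>(\<chi>, k, Z)\<in>set w. k \<in> K \<and> Z \<in> (case \<chi> of LeftFace \<Rightarrow> Al k | RightFace \<Rightarrow> Ar k | BoolFace \<Rightarrow> Ab k)) \<longrightarrow>
         E (word_prod A (map (\<lambda>(\<chi>, k, Z). Z) w)) = fp_exp B K X (word_prod (lin_ops (fp_mod B K X))
           (map (\<lambda>(\<chi>, k, Z). case \<chi> of LeftFace \<Rightarrow> left_rep B K X k (l k Z)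
              | RightFace \<Rightarrow> right_rep B K X k (r k Z)
              | BoolFace \<Rightarrow> word_prod (lin_ops (fp_mod B K X)) [bool_proj B K X k, left_rep B K X k (m k Z), bool_proj B K X k]) w))"
    using assms(2) unfolding ffb_independent_def by blast
  have "(\<one>\<^bsub>B\<^esub>, \<zero>\<^bsub>fp_part B X (alt_words K)\<^esub>) \<in> carrier (fp_mod B K X)"
    by (simp add: cmod_closed(2)[OF cmodule_tensor_list] complex_algebraD(6)[OF B] fp_mod_def with_proj_simps fp_part_def direct_sum_def)
  then show ?thesis
    using w[of "[]"] by (simp add: word_prod_def fp_exp_def op_exp_def lin_ops_simps)
qed

theorem proposition5p3:
  fixes B :: "(complex, 'b) module"
    and A :: "(complex, 'a) module"
    and E :: "'a \<Rightarrow> 'b"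
    and \<epsilon> :: "('b \<times> 'b \<Rightarrow>\<^sub>0 complex) set \<Rightarrow> 'a"
    and K :: "'k set"
    and Al Ar Ab :: "'k \<Rightarrow> 'a set"
  assumes "bb_ncps B A E \<epsilon>"
    and "ffb_independent TYPE('x) B A E \<epsilon> K Al Ar Ab"
  shows "\<exists>(A' :: (complex, ('b, 'k, 'a doubled) fp_ops) module) E' \<epsilon>' Al' Ar' C' D' \<alpha>l \<alpha>r \<alpha>b.
    bb_ncps B A' E' \<epsilon>' \<and>
    bi_free_ffb_system TYPE('a doubled) B A' E' \<epsilon>' K Al' Ar' C' D' \<and>
    (\<forall>k\<in>K.
      \<alpha>l k \<in> Al k \<rightarrow> Al' k \<and> inj_on (\<alpha>l k) (Al k) \<and>
      B_linear_on B A (Lop B \<epsilon>) A' (Lop B \<epsilon>') (Al k) (\<alpha>l k) \<and>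
      \<alpha>r k \<in> Ar k \<rightarrow> Ar' k \<and> inj_on (\<alpha>r k) (Ar k) \<and>
      B_linear_on B A (Rop B \<epsilon>) A' (Rop B \<epsilon>') (Ar k) (\<alpha>r k) \<and>
      \<alpha>b k \<in> Ab k \<rightarrow> alg_gen A' (C' k <#>\<^bsub>A'\<^esub> D' k) \<and> inj_on (\<alpha>b k) (Ab k) \<and>
      B_linear_on B A (Lop B \<epsilon>) A' (Lop B \<epsilon>') (Ab k) (\<alpha>b k) \<and>
      (\<forall>n (\<chi> :: nat \<Rightarrow> face) Z.
        (\<forall>i\<in>{1..n}. Z i \<in> (case \<chi> i of LeftFace \<Rightarrow> Al k | RightFace \<Rightarrow> Ar k | BoolFace \<Rightarrow> Ab k)) \<longrightarrow>
        E' (word_prod A' (map (\<lambda>i. case \<chi> i of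
              LeftFace \<Rightarrow> \<alpha>l k (Z i) | RightFace \<Rightarrow> \<alpha>r k (Z i) | BoolFace \<Rightarrow> \<alpha>b k (Z i)) [1..<Suc n])) =
        E (word_prod A (map Z [1..<Suc n]))))"
proof -
  have B: "complex_algebra B" using assms(1) by (simp add: bb_ncps_def)
  interpret bb_family B A E \<epsilon> K
    by (intro bb_family.intro bb_space.intro assms(1) ffb_independent_E_one[OF B assms(2)])
  have sub: "Al k \<subseteq> left_alg B A \<epsilon>" "Ar k \<subseteq> right_alg B A \<epsilon>" "Ab k \<subseteq> left_alg B A \<epsilon>" if "k \<in> K" for k
    using assms(2) that by (auto simp: ffb_independent_def triple_of_faces_def pair_of_faces_def)
  show ?thesis
  proof (intro exI conjI ballI allI impI)
    show "bb_ncps B bf.LO (fp_exp B K (\<lambda>_. pb.ker)) bf.EPS" by (rule bf.bb_ncps_FM)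
    show "bi_free_ffb_system TYPE('a doubled) B bf.LO (fp_exp B K (\<lambda>_. pb.ker)) bf.EPS K
      (\<lambda>k. bf.diag_l (pb.hat first) k) (\<lambda>k. bf.diag_r (pb.hat first) k)
      (\<lambda>k. bf.upper_l (pb.hat first) k) (\<lambda>k. bf.lower_r (pb.hat first) k)" by (rule system)
    fix k assume k: "k \<in> K"
    note s = sub[OF k]
    show "al k \<in> Al k \<rightarrow> bf.diag_l (pb.hat first) k" "ar k \<in> Ar k \<rightarrow> bf.diag_r (pb.hat first) k"
      "ab k \<in> Ab k \<rightarrow> alg_gen bf.LO (bf.upper_l (pb.hat first) k <#>\<^bsub>bf.LO\<^esub> bf.lower_r (pb.hat first) k)"
      using s al_closed[OF k] ar_closed[OF k] ab_closed[OF k] by auto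
    show "inj_on (al k) (Al k)" "inj_on (ar k) (Ar k)" "inj_on (ab k) (Ab k)"
      by (rule inj_onI; metis s implements_inj[OF k] implements_al[OF k] implements_ar[OF k] implements_ab[OF k] subsetD)+
    show "B_linear_on B A (Lop B \<epsilon>) bf.LO (Lop B bf.EPS) (Al k) (al k)"
      "B_linear_on B A (Rop B \<epsilon>) bf.LO (Rop B bf.EPS) (Ar k) (ar k)"
      "B_linear_on B A (Lop B \<epsilon>) bf.LO (Lop B bf.EPS) (Ab k) (ab k)"
      by (rule al_B_linear[OF k s(1)] ar_B_linear[OF k s(2)] ab_B_linear[OF k s(3)])+
    fix n :: nat and \<chi> Z
    assume Z: "\<forall>i\<in>{1..n}. Z i \<in> (case \<chi> i of LeftFace \<Rightarrow> Al k | RightFace \<Rightarrow> Ar k | BoolFace \<Rightarrow> Ab k)"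
    show "fp_exp B K (\<lambda>_. pb.ker) (word_prod bf.LO (map (\<lambda>i. case \<chi> i of
          LeftFace \<Rightarrow> al k (Z i) | RightFace \<Rightarrow> ar k (Z i) | BoolFace \<Rightarrow> ab k (Z i)) [1..<Suc n])) =
        E (word_prod A (map Z [1..<Suc n]))"
    \<comment> \<open>Each letter acts on the embedded copy of \<open>gns\<close> as the element it
      comes from, so the word acts as the product, whose expectation appears at the vacuum.\<close>
    proof (rule implements_exp[OF implements_word[OF k]])
      fix i assume "i \<in> set [1..<Suc n]"
      then have "Z i \<in> (case \<chi> i of LeftFace \<Rightarrow> Al k | RightFace \<Rightarrow> Ar k | BoolFace \<Rightarrow> Ab k)" using Z by auto
      then show "implements k (case \<chi> i of LeftFace \<Rightarrow> al k (Z i) | RightFace \<Rightarrow> ar k (Z i) | BoolFace \<Rightarrow> ab k (Z i)) (Z i)"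
        using s implements_al[OF k] implements_ar[OF k] implements_ab[OF k] by (auto split: face.splits)
    qed
  qed
qed

end
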